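(* Suppose the smoothness assumption stated in the context holds and $\lambda=\lambda_n>0$ satisfies $\sqrt{n}\lambda=o(1)$, $n^{-1}\lambda^{-1/m}(-\log\lambda)^{2|S_{\sup}|-2}=o(1)$ and $\sqrt{n}\alpha_n=o(1)$ as $n\to\infty$, where $$\alpha_n=\beta_n\Big(n^{-1/2}\lambda^{-1/(4m)}(-\log\lambda)^{(|S_{\sup}|-1)/2}+\lambda^{1/2}J^{1/2}(f^\ast)\Big),$$ $$\beta_n=n^{-1/2}\lambda^{-1/(2m)}\lambda^{-1/(4m-2\tau-2)}\lambda^{1/(8m^2-4m\tau-4m)}(-\log\lambda)^{(|S_{\sup}|-1)(1-1/(4m-2\tau-2))}\Big(\log\big(\lambda^{1/(4m)-1/2}(-\log\lambda)^{(1-|S_{\sup}|)/2}\big)\Big)^{1/2}(\log n)^{1/2},$$ with $\tau=0$ if $|S_{\sup}|=1$ and $\tau$ a fixed value in $(0,2m-2)$ if $|S_{\sup}|>1$. Let $S\in\mathbb{S}\setminus\{\emptyset\}$ and suppose there is a constant $\mathcal{C}^\ast_S\in(0,\infty)$ with $\sum_{v\in\mathbb{N}}\mu_{S,v}^{-2}V_S^2(f^\ast_S,\psi_{S,v})\le\mathcal{C}^\ast_S$. Then for any fixed $x_S\in[0,1]^{|S|}$ satisfying $$\sum_{v\in\mathbb{N}}\frac{\psi_{S,v}^2(x_S)}{(1+\lambda/\mu_{S,v})^2}\asymp\lambda^{-1/(2m)}(-\log\lambda)^{|S|-1},$$ we have, as $n\to\infty$, $$\frac{\sqrt{n\lambda^{1/(2m)}(-\log\lambda)^{1-|S|}}\,\big(\hat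 f_S(x_S)-f^\ast_S(x_S)\big)}{\sqrt{\sigma^2\lambda^{1/(2m)}(-\log\lambda)^{1-|S|}\sum_{v\in\mathbb{N}}\psi_{S,v}^2(x_S)/(1+\lambda/\mu_{S,v})^2}}\xrightarrow{\mathrm{d}}\mathrm{N}(0,1).$$ Moreover, for the intercept, $\sqrt{n}(\hat f_\emptyset-f^\ast_\emptyset)/\sigma\xrightarrow{\mathrm{d}}\mathrm{N}(0,1)$.
   Context: Fix integers $d\ge1$ and $m\ge2$. For $j=1,\dots,d$, let $\mathcal{H}_{[j]}$ be the Sobolev space of $f\in\mathcal{L}_2[0,1]$ with $f,\dots,f^{(m-1)}$ absolutely continuous and $f^{(m)}\in\mathcal{L}_2[0,1]$. Let $\mathcal{H}_{\{j\}}=\{f\in\mathcal{H}_{[j]}:\int_0^1 f=0\}$ with inner product $\langle f,g\rangle_{\{j\}}=\sum_{l=1}^{m-1}\big(\int_0^1 f^{(l)}\big)\big(\int_0^1 g^{(l)}\big)+\int_0^1 f^{(m)}g^{(m)}$. For nonempty $S\subseteq\{1,\dots,d\}$, $\mathcal{H}_S=\otimes_{j\in S}\mathcal{H}_{\{j\}}$ (Hilbert tensor product; functions of $x_S\in[0,1]^{|S|}$) with tensor-product inner product $\langle\cdot,\cdot\rangle_S$; $\mathcal{H}_\emptyset$ is the space of constants. Let $\mathbb{S}$ be a collection of subsets of $\{1,\dots,d\}$ with $\emptyset\in\mathbb{S}$, $\mathcal{H}=\oplus_{S\in\mathbb{S}}\mathcal{H}_S$ (each $f=\sum_S f_S$ uniquely),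 and $S_{\sup}$ an element of $\mathbb{S}$ of maximal cardinality. $V_S(f_S,g_S)=\int f_Sg_S\,dx_S$, $J_\emptyset=0$, $J_S=\langle\cdot,\cdot\rangle_S$ for $S\neq\emptyset$, $J(f,g)=\sum_S J_S(f_S,g_S)$, $J(f)=J(f,f)$. Eigensystem: for $S\in\mathbb{S}\setminus\{\emptyset\}$, $\{(\mu_{S,v},\psi_{S,v})\}_{v\in\mathbb{N}}$ is the eigensystem of $\mathcal{H}_S$ with respect to $(V_S,J_S)$: $\mu_{S,v}>0$ nonincreasing in $v$, $\psi_{S,v}\in\mathcal{H}_S$, $V_S(\psi_{S,v},\psi_{S,v'})=\delta_{v,v'}$, $J_S(\psi_{S,v},\psi_{S,v'})=\mu_{S,v}^{-1}\delta_{v,v'}$, every $f_S\in\mathcal{H}_S$ satisfies $f_S=\sum_vV_S(f_S,\psi_{S,v})\psi_{S,v}$, and $\sup_v\sup_{x_S}|\psi_{S,v}(x_S)|\le\mathcal{C}_\psi$ for a constant $\mathcal{C}_\psi\in(1,\infty)$. Data: $X$ has independent Uniform$[0,1]$ coordinates, $Y=f^\ast(X)+\epsilon$, $f^\ast=\sum_{S\in\mathbb{S}}f^\ast_S\in\mathcal{H}$, $\epsilon$ independent of $X$ with mean $0$, variance $\sigma^2$, $\mathbb{E}\epsilon^4<\infty$; $(X_i,Y_i)$, $i=1,\dots,n$, i.i.d. copies. Smoothness assumption: $J_S(f^\ast_S)\le\mathcal{C}_{J,S}<\infty$ for each $S\in\mathbb{S}\setminus\{\emptyset\}$. Estimator $\hat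 f=\arg\min_{f\in\mathcal{H}}\frac1{2n}\sum_i(Y_i-f(X_i))^2+\frac\lambda2J(f)=\sum_S\hat f_S$, $\hat f_S\in\mathcal{H}_S$; $\lambda=\lambda_n$ depends on $n$. $a_n\asymp b_n$ means $a_n=\mathcal{O}(b_n)$ and $b_n=\mathcal{O}(a_n)$. *)

theory Defs
  imports "HOL-Probability.Probability" "HOL-Library.Landau_Symbols"
begin

definition abs_cont_on :: "real \<Rightarrow> real \<Rightarrow> (real \<Rightarrow> real) \<Rightarrow> bool" where
  "abs_cont_on a b f \<longleftrightarrow>
     (\<forall>\<epsilon>>0. \<exists>\<delta>>0. \<forall>(n::nat) (l::nat \<Rightarrow> real) (r::nat \<Rightarrow> real).
        (\<forall>k<n. a \<le> l k \<and> l k \<le> r k \<and> r k \<le> b) \<and>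
        (\<forall>k<n. \<forall>k'<n. k \<noteq> k' \<longrightarrow> r k \<le> l k' \<or> r k' \<le> l k) \<and>
        (\<Sum>k<n. r k - l k) < \<delta>
        \<longrightarrow> (\<Sum>k<n. \<bar>f (r k) - f (l k)\<bar>) < \<epsilon>)"

definition sob_witness :: "nat \<Rightarrow> (real \<Rightarrow> real) \<Rightarrow> (nat \<Rightarrow> real \<Rightarrow> real) \<Rightarrow> bool" where
  "sob_witness m f D \<longleftrightarrow>
     (\<forall>x\<in>{0..1}. D 0 x = f x) \<and>
     (\<forall>k<m. abs_cont_on 0 1 (D k)) \<and>
     (\<forall>k<m. AE x in lborel. x \<in> {0..1} \<longrightarrow>
              (D k has_real_derivative D (Suc k) x) (at x within {0..1})) \<and>
     D m \<in> borel_measurable lborel \<and>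
     set_integrable lborel {0..1} (\<lambda>x. (D m x)\<^sup>2)"

definition sobolev :: "nat \<Rightarrow> (real \<Rightarrow> real) \<Rightarrow> bool" where
  "sobolev m f \<longleftrightarrow> (\<exists>D. sob_witness m f D)"

definition sobD :: "nat \<Rightarrow> (real \<Rightarrow> real) \<Rightarrow> nat \<Rightarrow> real \<Rightarrow> real" where
  "sobD m f = (SOME D. sob_witness m f D)"

definition H1 :: "nat \<Rightarrow> (real \<Rightarrow> real) set" where
  "H1 m = {f. sobolev m f \<and> (LINT x:{0..1}|lborel. f x) = 0}"

definition inner1 :: "nat \<Rightarrow> (real \<Rightarrow> real) \<Rightarrow> (real \<Rightarrow> real) \<Rightarrow> real" where
  "inner1 m f g =
     (\<Sum>l=1..m-1. (LINT x:{0..1}|lborel. sobD m f l x) * (LINT x:{0..1}|lborel. sobD m g l x))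
     + (LINT x:{0..1}|lborel. sobD m f m x * sobD m g m x)"

definition onb1 :: "nat \<Rightarrow> (nat \<Rightarrow> real \<Rightarrow> real) \<Rightarrow> bool" where
  "onb1 m e \<longleftrightarrow>
     (\<forall>k. e k \<in> H1 m) \<and>
     (\<forall>k k'. inner1 m (e k) (e k') = (if k = k' then 1 else 0)) \<and>
     (\<forall>f\<in>H1 m. (\<lambda>N. let r = (\<lambda>x. f x - (\<Sum>k<N. inner1 m f (e k) * e k x)) in inner1 m r r)
                   \<longlonglongrightarrow> 0)"

definition E1 :: "nat \<Rightarrow> nat \<Rightarrow> real \<Rightarrow> real" where
  "E1 m = (SOME e. onb1 m e)"

definition cube :: "nat set \<Rightarrow> (nat \<Rightarrow> real) set" where
  "cube S = PiE S (\<lambda>_. {0..1})"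

definition multi_idx :: "nat set \<Rightarrow> (nat \<Rightarrow> nat) set" where
  "multi_idx S = PiE S (\<lambda>_. UNIV)"

text \<open>c represents f in the Hilbert tensor product of |S| copies of H_{j},
  w.r.t. the orthonormal basis of products of basis functions.\<close>
definition tensor_rep :: "nat \<Rightarrow> nat set \<Rightarrow> ((nat \<Rightarrow> real) \<Rightarrow> real) \<Rightarrow> ((nat \<Rightarrow> nat) \<Rightarrow> real) \<Rightarrow> bool" where
  "tensor_rep m S f c \<longleftrightarrow>
     (\<lambda>\<alpha>. (c \<alpha>)\<^sup>2) summable_on multi_idx S \<and>
     (\<forall>x\<in>cube S. ((\<lambda>\<alpha>. c \<alpha> * (\<Prod>j\<in>S. E1 m (\<alpha> j) (x j))) has_sum f x) (multi_idx S))"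

definition HS :: "nat \<Rightarrow> nat set \<Rightarrow> ((nat \<Rightarrow> real) \<Rightarrow> real) set" where
  "HS m S = {f. \<exists>c. tensor_rep m S f c}"

definition coefS :: "nat \<Rightarrow> nat set \<Rightarrow> ((nat \<Rightarrow> real) \<Rightarrow> real) \<Rightarrow> (nat \<Rightarrow> nat) \<Rightarrow> real" where
  "coefS m S f = (SOME c. tensor_rep m S f c)"

definition JS :: "nat \<Rightarrow> nat set \<Rightarrow> ((nat \<Rightarrow> real) \<Rightarrow> real) \<Rightarrow> ((nat \<Rightarrow> real) \<Rightarrow> real) \<Rightarrow> real" where
  "JS m S f g = infsum (\<lambda>\<alpha>. coefS m S f \<alpha> * coefS m S g \<alpha>) (multi_idx S)"

definition U01 :: "real measure" where
  "U01 = restrict_space lborel {0..1}"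

definition VS :: "nat set \<Rightarrow> ((nat \<Rightarrow> real) \<Rightarrow> real) \<Rightarrow> ((nat \<Rightarrow> real) \<Rightarrow> real) \<Rightarrow> real" where
  "VS S f g = (LINT x|PiM S (\<lambda>_. U01). f x * g x)"

definition eigensystem ::
  "nat \<Rightarrow> nat set \<Rightarrow> (nat \<Rightarrow> real) \<Rightarrow> (nat \<Rightarrow> (nat \<Rightarrow> real) \<Rightarrow> real) \<Rightarrow> real \<Rightarrow> bool" where
  "eigensystem m S \<mu> \<psi> C\<psi> \<longleftrightarrow>
     (\<forall>v. \<mu> v > 0) \<and> (\<forall>v. \<mu> (Suc v) \<le> \<mu> v) \<and>
     (\<forall>v. \<psi> v \<in> HS m S) \<and>
     (\<forall>v v'. VS S (\<psi> v) (\<psi> v') = (if v = v' then 1 else 0)) \<and>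
     (\<forall>v v'. JS m S (\<psi> v) (\<psi> v') = (if v = v' then 1 / \<mu> v else 0)) \<and>
     (\<forall>f\<in>HS m S. (\<lambda>N. let r = (\<lambda>x. f x - (\<Sum>v<N. VS S f (\<psi> v) * \<psi> v x)) in JS m S r r)
                   \<longlonglongrightarrow> 0) \<and>
     (\<forall>v. \<forall>x\<in>cube S. \<bar>\<psi> v x\<bar> \<le> C\<psi>)"

text \<open>An element of H is represented by its family of components f_S (S in the collection);
  the intercept f_\<emptyset> is the value of the \<emptyset>-component (a function of the empty tuple).\<close>
definition Hfam :: "nat \<Rightarrow> nat set set \<Rightarrow> (nat set \<Rightarrow> (nat \<Rightarrow> real) \<Rightarrow> real) set" where
  "Hfam m SS = {fam. \<forall>S\<in>SS - {{}}. fam S \<in> HS m S}"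

definition evalfam :: "nat set set \<Rightarrow> (nat set \<Rightarrow> (nat \<Rightarrow> real) \<Rightarrow> real) \<Rightarrow> (nat \<Rightarrow> real) \<Rightarrow> real" where
  "evalfam SS fam x = (\<Sum>S\<in>SS. fam S (restrict x S))"

definition intercept :: "(nat set \<Rightarrow> (nat \<Rightarrow> real) \<Rightarrow> real) \<Rightarrow> real" where
  "intercept fam = fam {} (\<lambda>_. undefined)"

definition Jtot :: "nat \<Rightarrow> nat set set \<Rightarrow> (nat set \<Rightarrow> (nat \<Rightarrow> real) \<Rightarrow> real) \<Rightarrow> real" where
  "Jtot m SS fam = (\<Sum>S\<in>SS - {{}}. JS m S (fam S) (fam S))"

definition pls_obj :: "nat \<Rightarrow> nat set set \<Rightarrow> real \<Rightarrow> (nat \<Rightarrow> nat \<Rightarrow> real) \<Rightarrow> (nat \<Rightarrow> real) \<Rightarrow> nat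
     \<Rightarrow> (nat set \<Rightarrow> (nat \<Rightarrow> real) \<Rightarrow> real) \<Rightarrow> real" where
  "pls_obj m SS lam Xs Ys n fam =
     (\<Sum>i<n. (Ys i - evalfam SS fam (Xs i))\<^sup>2) / (2 * real n) + lam / 2 * Jtot m SS fam"

definition estimator :: "nat \<Rightarrow> nat set set \<Rightarrow> real \<Rightarrow> (nat \<Rightarrow> nat \<Rightarrow> real) \<Rightarrow> (nat \<Rightarrow> real) \<Rightarrow> nat
     \<Rightarrow> (nat set \<Rightarrow> (nat \<Rightarrow> real) \<Rightarrow> real)" where
  "estimator m SS lam Xs Ys n =
     (SOME fam. fam \<in> Hfam m SS \<and> (\<forall>g\<in>Hfam m SS. pls_obj m SS lam Xs Ys n fam \<le> pls_obj m SS lam Xs Ys n g))"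

definition beta_n :: "real \<Rightarrow> real \<Rightarrow> real \<Rightarrow> real \<Rightarrow> nat \<Rightarrow> real" where
  "beta_n m \<tau> s lam n =
     real n powr (-1/2) * lam powr (-1/(2*m)) * lam powr (-1/(4*m - 2*\<tau> - 2))
     * lam powr (1/(8*m\<^sup>2 - 4*m*\<tau> - 4*m))
     * (- ln lam) powr ((s - 1) * (1 - 1/(4*m - 2*\<tau> - 2)))
     * sqrt (ln (lam powr (1/(4*m) - 1/2) * (- ln lam) powr ((1 - s)/2)))
     * sqrt (ln (real n))"

definition alpha_n :: "real \<Rightarrow> real \<Rightarrow> real \<Rightarrow> real \<Rightarrow> real \<Rightarrow> nat \<Rightarrow> real" where
  "alpha_n m \<tau> s J lam n =
     beta_n m \<tau> s lam n *
     (real n powr (-1/2) * lam powr (-1/(4*m)) * (- ln lam) powr ((s - 1)/2) + sqrt lam * sqrt J)"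

end

(* Let g be the difference of the estimator and the truth, and expand it in the joint eigenbasis made of the
   constant 1 and all psi_{S,v}. With rho_i = 1/mu_i (0 for the constant) and w_i = 1/(1 + lambda rho_i), the
   normal equations of the penalized least squares problem become
     g_i = w_i (z_i - sum_k D_ik g_k - lambda rho_i f*_i),
   where z_i is the empirical score of the i-th basis function and D the empirical Gram matrix minus the
   identity. The w-weighted Hilbert-Schmidt norm of D has second moment O(W^2/n) with W = sum_i w_i, so g is a
   small perturbation of w_i (z_i - lambda rho_i f*_i). Point evaluation of a component and the intercept are
   functionals sum_i l_i g_i; their leading term is an average of independent variables, to which a Lyapunov
   central limit theorem for rows applies, and the source condition on f*_S with sqrt(n) lambda -> 0 removes
   the bias.

   The effective dimension W is bounded by a multiple of lambda^(-theta), for theta slightly above 1/(2m), without any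
   knowledge of the eigenvalues: W is the integral of the diagonal of the regularized kernel, which is controlled by
     f(x)^2 <= C lambda^(-theta) (V(f,f) + lambda J(f,f)).
   In one variable this comes from averaging kernels with vanishing moments at dyadic scales, whose differences
   telescope to point evaluation; products of such kernels give the tensor case. The condition on alpha_n
   implies n^(-1) lambda^(-2/m) -> 0, which absorbs the loss in theta. *)

theory Submission
  imports Defs "HOL-Computational_Algebra.Polynomial"
begin

section \<open>Absolute continuity and Sobolev derivatives\<close>

text \<open>Two obstacles shape the proof. The objects are given through choices:
  \<open>sobD\<close> picks derivatives, \<open>E1\<close> a basis, \<open>coefS\<close>
  coefficients, \<open>estimator\<close> a minimizer. Hence an orthonormal basis has to be
  constructed, derivatives and coefficients shown unique, and the chosen minimizer identified with a
  formula; before that no norm can be computed and no measurability asserted. Second, the empirical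
  Gram matrix has to be controlled jointly for all coordinates. The weighted Hilbert--Schmidt norm
  needs only second moments of single entries, so no supremum over a function class is estimated.
  The price is a square of the effective dimension: relative to a variance of order at least
  lambda^(-1/(2m)), the stochastic remainder is of order n^(-1) lambda^(-(4 theta - 1/(2m))). At
  theta = 1/(2m) the exponent is 3/(2m), strictly better than the available 2/m, and this gap is
  what permits a theta above the threshold. With theta = 9/(16m) it becomes 7/(4m).\<close>

lemma abs_cont_on_finite_family:
  assumes ac: "abs_cont_on a b f" and e: "0 < e"
  obtains \<delta> where "0 < \<delta>"
    "\<And>(I::'i set) l r. finite I \<Longrightarrow> (\<And>k. k \<in> I \<Longrightarrow> a \<le> l k \<and> l k \<le> r k \<and> r k \<le> b) \<Longrightarrow>
      (\<And>k k'. k \<in> I \<Longrightarrow> k' \<in> I \<Longrightarrow> k \<noteq> k' \<Longrightarrow> r k \<le> l k' \<or> r k' \<le> l k) \<Longrightarrow>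
      (\<Sum>k\<in>I. r k - l k) < \<delta> \<Longrightarrow> (\<Sum>k\<in>I. \<bar>f (r k) - f (l k)\<bar>) < e"
proof -
  from ac[unfolded abs_cont_on_def, THEN spec, THEN mp, OF e]
  obtain \<delta> where d0: "\<delta> > 0" and d1: "\<forall>(n::nat) (l::nat \<Rightarrow> real) (r::nat \<Rightarrow> real).
        (\<forall>k<n. a \<le> l k \<and> l k \<le> r k \<and> r k \<le> b) \<and>
        (\<forall>k<n. \<forall>k'<n. k \<noteq> k' \<longrightarrow> r k \<le> l k' \<or> r k' \<le> l k) \<and>
        (\<Sum>k<n. r k - l k) < \<delta> \<longrightarrow> (\<Sum>k<n. \<bar>f (r k) - f (l k)\<bar>) < e"
    by (elim exE conjE) (rule that)
  note d = d0 d1[THEN spec, THEN spec, THEN spec, THEN mp]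
  show thesis
  proof (rule that[OF d(1)])
    fix I :: "'i set" and l r :: "'i \<Rightarrow> real"
    assume I: "finite I" and 1: "\<And>k. k \<in> I \<Longrightarrow> a \<le> l k \<and> l k \<le> r k \<and> r k \<le> b"
      and 2: "\<And>k k'. k \<in> I \<Longrightarrow> k' \<in> I \<Longrightarrow> k \<noteq> k' \<Longrightarrow> r k \<le> l k' \<or> r k' \<le> l k"
      and 3: "(\<Sum>k\<in>I. r k - l k) < \<delta>"
    obtain h where h: "bij_betw h {0..<card I} I" using ex_bij_betw_nat_finite[OF I] by blast
    then have h': "bij_betw h {..<card I} I" by (simp add: atLeast0LessThan)
    have hI: "h k \<in> I" if "k < card I" for k using h' that by (auto simp: bij_betw_def)
    have hinj: "h k \<noteq> h k'" if "k < card I" "k' < card I" "k \<noteq> k'" for k k'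
      using h' that by (auto simp: bij_betw_def inj_on_def)
    have "(\<Sum>k<card I. \<bar>f (r (h k)) - f (l (h k))\<bar>) < e"
    proof (rule d(2), intro conjI allI impI)
      fix k assume "k < card I" then show "a \<le> l (h k)" "l (h k) \<le> r (h k)" "r (h k) \<le> b" using 1 hI by auto
    next
      fix k k' assume "k < card I" "k' < card I" "k \<noteq> k'"
      then show "r (h k) \<le> l (h k') \<or> r (h k') \<le> l (h k)" using 2 hI hinj by metis
    next
      show "(\<Sum>k<card I. r (h k) - l (h k)) < \<delta>"
        using 3 sum.reindex_bij_betw[OF h', of "\<lambda>k. r k - l k"] by simp
    qed
    then show "(\<Sum>k\<in>I. \<bar>f (r k) - f (l k)\<bar>) < e"
      using sum.reindex_bij_betw[OF h', of "\<lambda>k. \<bar>f (r k) - f (l k)\<bar>"] by simp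
  qed
qed

text \<open>Riemann sums over a fine tagged division are compared with the telescoping sum of increments:
  a straddle estimate handles the tags at which the derivative exists, and absolute continuity handles
  the others, whose intervals lie in an open set of small measure.\<close>

lemma abs_cont_on_fundamental_theorem:
  fixes f f' :: "real \<Rightarrow> real"
  assumes ac: "abs_cont_on a b f" and ab: "a \<le> b"
    and deriv: "AE x in lborel. x \<in> {a..b} \<longrightarrow> (f has_real_derivative f' x) (at x within {a..b})"
  shows "(f' has_integral (f b - f a)) {a..b}"
proof -
  obtain N where N: "N \<in> null_sets lborel"
    "{x \<in> space lborel. \<not> (x \<in> {a..b} \<longrightarrow> (f has_real_derivative f' x) (at x within {a..b}))} \<subseteq> N"
    using AE_E[OF deriv] by (metis (no_types, lifting) null_setsI)
  have der: "(f has_real_derivative f' x) (at x within {a..b})" if "x \<in> {a..b}" "x \<notin> N" for x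
    using N(2) that by auto
  \<comment> \<open>Setting the integrand to 0 on the exceptional null set makes the Riemann sum
    terms with tags in \<open>N\<close> vanish exactly, however large \<open>f'\<close> is there;
    its values are restored at the end because \<open>N\<close> is negligible.\<close>
  define g where "g x = (if x \<in> N then 0 else f' x)" for x
  have "(g has_integral (f b - f a)) {a..b}"
    unfolding has_integral_real
  proof (intro allI impI)
    fix e :: real assume e: "0 < e"
    \<comment> \<open>Half of \<open>e\<close> is spread over the interval; the \<open>+ 1\<close>
      keeps the quotient meaningful when \<open>a = b\<close>.\<close>
    define e1 where "e1 = e / 2 / (b - a + 1)"
    have e1: "0 < e1" using e ab by (simp add: e1_def)
    \<comment> \<open>The elements of the tagged division serve as indices, so that subfamilies can
      be selected by their tags without an enumeration.\<close>
    obtain \<delta> where d: "0 < \<delta>" "\<And>(I::(real \<times> real set) set) l r. finite I \<Longrightarrow> (\<And>k. k \<in> I \<Longrightarrow> a \<le> l k \<and> l k \<le> r k \<and> r k \<le> b) \<Longrightarrow>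
      (\<And>k k'. k \<in> I \<Longrightarrow> k' \<in> I \<Longrightarrow> k \<noteq> k' \<Longrightarrow> r k \<le> l k' \<or> r k' \<le> l k) \<Longrightarrow>
      (\<Sum>k\<in>I. r k - l k) < \<delta> \<Longrightarrow> (\<Sum>k\<in>I. \<bar>f (r k) - f (l k)\<bar>) < e / 2"
      apply (rule abs_cont_on_finite_family[OF ac half_gt_zero[OF e]]) apply (erule that) apply (assumption | blast)+ done
    have "N \<in> sets borel" using N(1) by auto
    then obtain U where U: "open U" "N \<subseteq> U" "emeasure lborel (U - N) < ennreal \<delta>"
      by (rule outer_regular_lborel[OF _ d(1)])
    have "emeasure lborel U \<le> emeasure lborel (U - N) + emeasure lborel N"
      by (rule order_trans[OF emeasure_mono emeasure_subadditive]) (use U N(1) in auto)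
    then have Um: "emeasure lborel U < ennreal \<delta>" using U(3) N(1) by (simp add: null_sets_def)
    have strad: "\<exists>d>0. \<forall>y\<in>{a..b}. \<bar>y - x\<bar> < d \<longrightarrow> \<bar>f y - f x - f' x * (y - x)\<bar> \<le> e1 * \<bar>y - x\<bar>"
      if "x \<in> {a..b}" "x \<notin> N" for x
      using der[OF that] e1 unfolding has_field_derivative_def has_derivative_within_alt
      by simp
    then obtain dd where dd: "\<And>x. x \<in> {a..b} \<Longrightarrow> x \<notin> N \<Longrightarrow> 0 < dd x"
      "\<And>x y. x \<in> {a..b} \<Longrightarrow> x \<notin> N \<Longrightarrow> y\<in>{a..b} \<Longrightarrow> \<bar>y - x\<bar> < dd x \<Longrightarrow> \<bar>f y - f x - f' x * (y - x)\<bar> \<le> e1 * \<bar>y - x\<bar>"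
      by metis
    \<comment> \<open>At tags in \<open>N\<close> the gauge is the open set itself, so intervals
      tagged there lie in \<open>U\<close>, whose measure is below \<open>\<delta>\<close>; at the
      other tags of the interval it is the ball of the straddle estimate.\<close>
    define \<gamma> where "\<gamma> x = (if x \<in> N then U else if x \<in> {a..b} then ball x (dd x) else ball x 1)" for x
    have gauge: "gauge \<gamma>"
      unfolding gauge_def \<gamma>_def using U(1,2) dd(1) by auto
    show "\<exists>\<gamma>. gauge \<gamma> \<and> (\<forall>D. D tagged_division_of {a..b} \<and> \<gamma> fine D \<longrightarrow>
        norm ((\<Sum>(x, k)\<in>D. measure lborel k *\<^sub>R g x) - (f b - f a)) < e)"
    proof (intro exI conjI allI impI, rule gauge)
      fix D assume D: "D tagged_division_of {a..b} \<and> \<gamma> fine D"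
      then have tD: "D tagged_division_of {a..b}" and fin: "finite D" and fine: "\<gamma> fine D"
        using tagged_division_of_finite by auto
      define l where "l z = Inf (snd z)" for z :: "real \<times> real set"
      define r where "r z = Sup (snd z)" for z :: "real \<times> real set"
      have lr: "snd z = {l z..r z} \<and> l z \<le> fst z \<and> fst z \<le> r z \<and> a \<le> l z \<and> r z \<le> b" if "z \<in> D" for z
      proof -
        obtain x k where z: "z = (x,k)" by (cases z)
        from tD that z have k: "x \<in> k" "k \<subseteq> {a..b}" "\<exists>u v. k = cbox u v"
          using tagged_division_ofD[OF tD] by blast+
        then obtain u v where uv: "k = {u..v}" by auto
        then have "u \<le> v" using k by auto
        then show ?thesis using k uv z by (auto simp: l_def r_def)
      qed
      have con: "measure lborel (snd z) = r z - l z" if "z \<in> D" for z using lr[OF that] by simp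
      have tel: "f b - f a = (\<Sum>z\<in>D. f (r z) - f (l z))"
        using additive_tagged_division_1[OF ab tD, of f] by (simp add: case_prod_unfold l_def r_def)
      have tot: "b - a = (\<Sum>z\<in>D. r z - l z)"
        using additive_tagged_division_1[OF ab tD, of "\<lambda>x. x"] by (simp add: case_prod_unfold l_def r_def)
      define G where "G = {z\<in>D. fst z \<notin> N}"
      define B where "B = {z\<in>D. fst z \<in> N}"
      have DGB: "D = G \<union> B" "G \<inter> B = {}" "finite G" "finite B" using fin by (auto simp: G_def B_def)
      have G1: "\<bar>measure lborel (snd z) * g (fst z) - (f (r z) - f (l z))\<bar> \<le> e1 * (r z - l z)" if z: "z \<in> G" for z
      proof -
        let ?x = "fst z"
        have zD: "z \<in> D" "?x \<notin> N" using z by (auto simp: G_def)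
        note h = lr[OF zD(1)]
        have xab: "?x \<in> {a..b}" using h by auto
        have "snd z \<subseteq> \<gamma> ?x" using fine zD(1) by (metis fineD prod.collapse)
        then have "l z \<in> ball ?x (dd ?x)" "r z \<in> ball ?x (dd ?x)" using zD xab h
          by (auto simp: \<gamma>_def simp del: mem_ball)
        then have "\<bar>f (l z) - f ?x - f' ?x * (l z - ?x)\<bar> \<le> e1 * \<bar>l z - ?x\<bar>"
           "\<bar>f (r z) - f ?x - f' ?x * (r z - ?x)\<bar> \<le> e1 * \<bar>r z - ?x\<bar>"
          using dd(2)[OF xab zD(2), of "l z"] dd(2)[OF xab zD(2), of "r z"] h
          by (simp_all add: dist_real_def abs_minus_commute)
        then have "\<bar>f (l z) - f ?x - f' ?x * (l z - ?x)\<bar> \<le> e1 * (?x - l z)"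
           "\<bar>f (r z) - f ?x - f' ?x * (r z - ?x)\<bar> \<le> e1 * (r z - ?x)" using h by auto
        then have "\<bar>f' ?x * (r z - l z) - (f (r z) - f (l z))\<bar> \<le> e1 * (r z - l z)"
          by (simp add: algebra_simps abs_le_iff)
        then show ?thesis using con[OF zD(1)] zD(2) by (simp add: g_def mult.commute)
      qed
      have S1: "\<bar>\<Sum>z\<in>G. measure lborel (snd z) * g (fst z) - (f (r z) - f (l z))\<bar> \<le> e1 * (b - a)"
      proof -
        have "\<bar>\<Sum>z\<in>G. measure lborel (snd z) * g (fst z) - (f (r z) - f (l z))\<bar> \<le> (\<Sum>z\<in>G. e1 * (r z - l z))"
          by (rule order_trans[OF sum_abs sum_mono[OF G1]])
        also have "\<dots> \<le> (\<Sum>z\<in>D. e1 * (r z - l z))"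
          by (rule sum_mono2) (use fin e1 lr in \<open>auto simp: G_def intro!: mult_nonneg_nonneg\<close>, force)
        finally show ?thesis by (simp add: tot sum_distrib_left)
      qed
      \<comment> \<open>Degenerate intervals carry no increment, but such a point may lie inside
        another interval of the division and would violate the non-overlap condition of absolute
        continuity. They are dropped here.\<close>
      define B' where "B' = {z\<in>B. l z < r z}"
      have fB': "finite B'" using DGB by (simp add: B'_def)
      have disj: "{l z<..<r z} \<inter> {l z'<..<r z'} = {}" if "z \<in> B'" "z' \<in> B'" "z \<noteq> z'" for z z'
      proof -
        have "z \<in> D" "z' \<in> D" using that by (auto simp: B'_def B_def)
        then have "interior (snd z) \<inter> interior (snd z') = {}"
          using tagged_division_ofD(5)[OF tD, of "fst z" "snd z" "fst z'" "snd z'"] that(3) by (metis prod.collapse)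
        then show ?thesis using lr[OF \<open>z \<in> D\<close>] lr[OF \<open>z' \<in> D\<close>] by simp
      qed
      have "(\<Sum>z\<in>B'. r z - l z) = (\<Sum>z\<in>B'. measure lborel {l z<..<r z})"
        by (rule sum.cong) (auto simp: B'_def)
      also have "\<dots> = measure lborel (\<Union>z\<in>B'. {l z<..<r z})"
        by (rule measure_finite_Union[symmetric])
          (use fB' disj in \<open>auto simp: disjoint_family_on_def B'_def\<close>)
      also have "\<dots> < \<delta>"
      proof -
        have "(\<Union>z\<in>B'. {l z<..<r z}) \<subseteq> U"
        proof
          fix t assume "t \<in> (\<Union>z\<in>B'. {l z<..<r z})"
          then obtain z where z: "z \<in> B'" "t \<in> {l z<..<r z}" by auto
          then have "z \<in> D" "fst z \<in> N" by (auto simp: B'_def B_def)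
          then have "snd z \<subseteq> U" using fine by (metis fineD prod.collapse \<gamma>_def)
          then show "t \<in> U" using lr[OF \<open>z \<in> D\<close>] z by auto
        qed
        then have "emeasure lborel (\<Union>z\<in>B'. {l z<..<r z}) \<le> emeasure lborel U"
          using U(1) by (intro emeasure_mono) auto
        then have "emeasure lborel (\<Union>z\<in>B'. {l z<..<r z}) < ennreal \<delta>" using Um by simp
        then show ?thesis by (simp add: measure_def enn2real_less_iff d(1) less_top[symmetric])
          (use d(1) in \<open>metis enn2real_ennreal enn2real_less_iff ennreal_less_top less_le_trans less_imp_le top.not_eq_extremum\<close>)
      qed
      finally have "(\<Sum>z\<in>B'. r z - l z) < \<delta>" .
      have "(\<Sum>z\<in>B'. \<bar>f (r z) - f (l z)\<bar>) < e / 2"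
      proof (rule d(2)[OF fB'])
        fix k assume "k \<in> B'" then show "a \<le> l k \<and> l k \<le> r k \<and> r k \<le> b" using lr[of k] by (auto simp: B'_def B_def)
      next
        fix k k' assume k: "k \<in> B'" "k' \<in> B'" "k \<noteq> k'"
        show "r k \<le> l k' \<or> r k' \<le> l k"
        proof (rule ccontr)
          assume "\<not> ?thesis"
          then have "(max (l k) (l k') + min (r k) (r k')) / 2 \<in> {l k<..<r k} \<inter> {l k'<..<r k'}"
            using k by (auto simp: B'_def max_def min_def)
          then show False using disj[OF k] by auto
        qed
      qed fact
      moreover have "(\<Sum>z\<in>B'. \<bar>f (r z) - f (l z)\<bar>) = (\<Sum>z\<in>B. \<bar>f (r z) - f (l z)\<bar>)"
      proof (rule sum.mono_neutral_left)
        show "\<forall>z\<in>B - B'. \<bar>f (r z) - f (l z)\<bar> = 0"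
        proof
          fix z assume "z \<in> B - B'"
          then have "z \<in> D" "\<not> l z < r z" by (auto simp: B'_def B_def)
          then have "l z = r z" using lr[of z] by linarith
          then show "\<bar>f (r z) - f (l z)\<bar> = 0" by simp
        qed
      qed (use DGB in \<open>auto simp: B'_def\<close>)
      moreover have "\<bar>\<Sum>z\<in>B. f (r z) - f (l z)\<bar> \<le> (\<Sum>z\<in>B. \<bar>f (r z) - f (l z)\<bar>)" by (rule sum_abs)
      ultimately have S2: "\<bar>\<Sum>z\<in>B. f (r z) - f (l z)\<bar> < e / 2" by linarith
      have S3: "(\<Sum>z\<in>B. measure lborel (snd z) * g (fst z)) = 0" by (rule sum.neutral) (auto simp: B_def g_def)
      have "(\<Sum>(x, k)\<in>D. measure lborel k *\<^sub>R g x) - (f b - f a) =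
         (\<Sum>z\<in>G. measure lborel (snd z) * g (fst z) - (f (r z) - f (l z))) + (\<Sum>z\<in>B. measure lborel (snd z) * g (fst z)) - (\<Sum>z\<in>B. f (r z) - f (l z))"
        unfolding tel using DGB by (simp add: case_prod_unfold sum.union_disjoint sum_subtractf)
      moreover have "e1 * (b - a) \<le> e / 2" using ab e by (simp add: e1_def field_simps)
      ultimately show "norm ((\<Sum>(x, k)\<in>D. measure lborel k *\<^sub>R g x) - (f b - f a)) < e"
        using S1 S2 S3 unfolding real_norm_def by linarith
    qed
  qed
  then show ?thesis
  proof (rule has_integral_spike[rotated 2])
    show "negligible N" using N(1) by (simp add: negligible_iff_null_sets null_sets_completionI)
  qed (auto simp: g_def)
qed

lemma abs_cont_on_subset:
  assumes "abs_cont_on a b f" "a \<le> a'" "b' \<le> b"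
  shows "abs_cont_on a' b' f"
  unfolding abs_cont_on_def
proof (intro allI impI)
  fix e :: real assume "0 < e"
  from assms(1)[unfolded abs_cont_on_def, THEN spec, THEN mp, OF this]
  obtain \<delta> where "\<delta>>0" and *: "\<forall>(n::nat) (l::nat \<Rightarrow> real) (r::nat \<Rightarrow> real).
        (\<forall>k<n. a \<le> l k \<and> l k \<le> r k \<and> r k \<le> b) \<and>
        (\<forall>k<n. \<forall>k'<n. k \<noteq> k' \<longrightarrow> r k \<le> l k' \<or> r k' \<le> l k) \<and>
        (\<Sum>k<n. r k - l k) < \<delta> \<longrightarrow> (\<Sum>k<n. \<bar>f (r k) - f (l k)\<bar>) < e"
    by (elim exE conjE) (rule that)
  show "\<exists>\<delta>>0. \<forall>(n::nat) (l::nat \<Rightarrow> real) (r::nat \<Rightarrow> real).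
        (\<forall>k<n. a' \<le> l k \<and> l k \<le> r k \<and> r k \<le> b') \<and>
        (\<forall>k<n. \<forall>k'<n. k \<noteq> k' \<longrightarrow> r k \<le> l k' \<or> r k' \<le> l k) \<and>
        (\<Sum>k<n. r k - l k) < \<delta> \<longrightarrow> (\<Sum>k<n. \<bar>f (r k) - f (l k)\<bar>) < e"
  proof (intro exI[of _ \<delta>] conjI allI impI \<open>\<delta>>0\<close>)
    fix n :: nat and l r :: "nat \<Rightarrow> real"
    assume A: "(\<forall>k<n. a' \<le> l k \<and> l k \<le> r k \<and> r k \<le> b') \<and>
        (\<forall>k<n. \<forall>k'<n. k \<noteq> k' \<longrightarrow> r k \<le> l k' \<or> r k' \<le> l k) \<and> (\<Sum>k<n. r k - l k) < \<delta>"
    have "\<forall>k<n. a \<le> l k \<and> l k \<le> r k \<and> r k \<le> b" using A assms(2,3) by force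
    then show "(\<Sum>k<n. \<bar>f (r k) - f (l k)\<bar>) < e" using A by (intro *[rule_format]) auto
  qed
qed

lemma abs_cont_on_continuous:
  assumes "abs_cont_on a b f"
  shows "continuous_on {a..b} f"
  unfolding continuous_on_iff
proof (intro ballI allI impI)
  fix x e :: real assume x: "x \<in> {a..b}" and e: "0 < e"
  obtain \<delta> where d: "0 < \<delta>" "\<And>(I::unit set) l r. finite I \<Longrightarrow> (\<And>k. k \<in> I \<Longrightarrow> a \<le> l k \<and> l k \<le> r k \<and> r k \<le> b) \<Longrightarrow>
      (\<And>k k'. k \<in> I \<Longrightarrow> k' \<in> I \<Longrightarrow> k \<noteq> k' \<Longrightarrow> r k \<le> l k' \<or> r k' \<le> l k) \<Longrightarrow>
      (\<Sum>k\<in>I. r k - l k) < \<delta> \<Longrightarrow> (\<Sum>k\<in>I. \<bar>f (r k) - f (l k)\<bar>) < e"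
    apply (rule abs_cont_on_finite_family[OF assms e]) apply (erule that) apply (assumption | blast)+ done
  show "\<exists>d>0. \<forall>x'\<in>{a..b}. dist x' x < d \<longrightarrow> dist (f x') (f x) < e"
  proof (intro exI[of _ \<delta>] conjI d(1) ballI impI)
    fix y assume y: "y \<in> {a..b}" "dist y x < \<delta>"
    show "dist (f y) (f x) < e"
      using d(2)[of "{()}" "\<lambda>_. min x y" "\<lambda>_. max x y"] x y
      by (cases "x \<le> y") (auto simp: dist_real_def min_def max_def abs_minus_commute)
  qed
qed

lemma abs_cont_on_lipschitz:
  assumes "\<And>x y. x \<in> {a..b} \<Longrightarrow> y \<in> {a..b} \<Longrightarrow> \<bar>f x - f y\<bar> \<le> C * \<bar>x - y\<bar>"
  shows "abs_cont_on a b f"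
  unfolding abs_cont_on_def
proof (intro allI impI)
  fix e :: real assume e: "0 < e"
  show "\<exists>\<delta>>0. \<forall>(n::nat) (l::nat \<Rightarrow> real) (r::nat \<Rightarrow> real).
        (\<forall>k<n. a \<le> l k \<and> l k \<le> r k \<and> r k \<le> b) \<and>
        (\<forall>k<n. \<forall>k'<n. k \<noteq> k' \<longrightarrow> r k \<le> l k' \<or> r k' \<le> l k) \<and>
        (\<Sum>k<n. r k - l k) < \<delta> \<longrightarrow> (\<Sum>k<n. \<bar>f (r k) - f (l k)\<bar>) < e"
  proof (intro exI[of _ "e / (\<bar>C\<bar> + 1)"] conjI allI impI)
    fix n :: nat and l r :: "nat \<Rightarrow> real"
    assume A: "(\<forall>k<n. a \<le> l k \<and> l k \<le> r k \<and> r k \<le> b) \<and>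
        (\<forall>k<n. \<forall>k'<n. k \<noteq> k' \<longrightarrow> r k \<le> l k' \<or> r k' \<le> l k) \<and> (\<Sum>k<n. r k - l k) < e / (\<bar>C\<bar> + 1)"
    have "(\<Sum>k<n. \<bar>f (r k) - f (l k)\<bar>) \<le> (\<Sum>k<n. (\<bar>C\<bar> + 1) * (r k - l k))"
    proof (rule sum_mono)
      fix k assume "k \<in> {..<n}"
      then have k: "a \<le> l k" "l k \<le> r k" "r k \<le> b" using A by auto
      then have "\<bar>f (r k) - f (l k)\<bar> \<le> C * \<bar>r k - l k\<bar>" by (intro assms) auto
      also have "\<dots> \<le> (\<bar>C\<bar> + 1) * \<bar>r k - l k\<bar>" by (rule mult_right_mono) auto
      finally show "\<bar>f (r k) - f (l k)\<bar> \<le> (\<bar>C\<bar> + 1) * (r k - l k)" using k by simp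
    qed
    also have "\<dots> = (\<bar>C\<bar> + 1) * (\<Sum>k<n. r k - l k)" by (simp add: sum_distrib_left)
    also have "\<dots> < (\<bar>C\<bar> + 1) * (e / (\<bar>C\<bar> + 1))" using A by (intro mult_strict_left_mono) auto
    finally show "(\<Sum>k<n. \<bar>f (r k) - f (l k)\<bar>) < e" by simp
  qed (use e in auto)
qed

lemma abs_cont_on_lincomb:
  assumes f: "abs_cont_on a b f" and g: "abs_cont_on a b g"
  shows "abs_cont_on a b (\<lambda>x. c * f x + d * g x)"
  unfolding abs_cont_on_def
proof (intro allI impI)
  fix e :: real assume e: "0 < e"
  let ?ef = "e / 2 / (\<bar>c\<bar> + 1)" and ?eg = "e / 2 / (\<bar>d\<bar> + 1)"
  have "0 < ?ef" "0 < ?eg" using e by auto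
  from f[unfolded abs_cont_on_def, THEN spec, THEN mp, OF this(1)]
  obtain d1 where "d1>0" and *: "\<forall>(n::nat) (l::nat \<Rightarrow> real) (r::nat \<Rightarrow> real).
        (\<forall>k<n. a \<le> l k \<and> l k \<le> r k \<and> r k \<le> b) \<and>
        (\<forall>k<n. \<forall>k'<n. k \<noteq> k' \<longrightarrow> r k \<le> l k' \<or> r k' \<le> l k) \<and>
        (\<Sum>k<n. r k - l k) < d1 \<longrightarrow> (\<Sum>k<n. \<bar>f (r k) - f (l k)\<bar>) < ?ef"
    by (elim exE conjE) (rule that)
  from g[unfolded abs_cont_on_def, THEN spec, THEN mp, OF \<open>0 < ?eg\<close>]
  obtain d2 where "d2>0" and **: "\<forall>(n::nat) (l::nat \<Rightarrow> real) (r::nat \<Rightarrow> real).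
        (\<forall>k<n. a \<le> l k \<and> l k \<le> r k \<and> r k \<le> b) \<and>
        (\<forall>k<n. \<forall>k'<n. k \<noteq> k' \<longrightarrow> r k \<le> l k' \<or> r k' \<le> l k) \<and>
        (\<Sum>k<n. r k - l k) < d2 \<longrightarrow> (\<Sum>k<n. \<bar>g (r k) - g (l k)\<bar>) < ?eg"
    by (elim exE conjE) (rule that)
  show "\<exists>\<delta>>0. \<forall>(n::nat) (l::nat \<Rightarrow> real) (r::nat \<Rightarrow> real).
        (\<forall>k<n. a \<le> l k \<and> l k \<le> r k \<and> r k \<le> b) \<and>
        (\<forall>k<n. \<forall>k'<n. k \<noteq> k' \<longrightarrow> r k \<le> l k' \<or> r k' \<le> l k) \<and>
        (\<Sum>k<n. r k - l k) < \<delta> \<longrightarrow> (\<Sum>k<n. \<bar>(c * f (r k) + d * g (r k)) - (c * f (l k) + d * g (l k))\<bar>) < e"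
  proof (intro exI[of _ "min d1 d2"] conjI allI impI)
    fix n :: nat and l r :: "nat \<Rightarrow> real"
    assume A: "(\<forall>k<n. a \<le> l k \<and> l k \<le> r k \<and> r k \<le> b) \<and>
        (\<forall>k<n. \<forall>k'<n. k \<noteq> k' \<longrightarrow> r k \<le> l k' \<or> r k' \<le> l k) \<and> (\<Sum>k<n. r k - l k) < min d1 d2"
    have F: "(\<Sum>k<n. \<bar>f (r k) - f (l k)\<bar>) < ?ef" using A by (intro *[rule_format]) auto
    have G: "(\<Sum>k<n. \<bar>g (r k) - g (l k)\<bar>) < ?eg" using A by (intro **[rule_format]) auto
    have "(\<Sum>k<n. \<bar>(c * f (r k) + d * g (r k)) - (c * f (l k) + d * g (l k))\<bar>)
       \<le> (\<Sum>k<n. (\<bar>c\<bar> + 1) * \<bar>f (r k) - f (l k)\<bar> + (\<bar>d\<bar> + 1) * \<bar>g (r k) - g (l k)\<bar>)"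
    proof (rule sum_mono)
      fix k
      have "\<bar>(c * f (r k) + d * g (r k)) - (c * f (l k) + d * g (l k))\<bar> = \<bar>c * (f (r k) - f (l k)) + d * (g (r k) - g (l k))\<bar>"
        by (simp add: algebra_simps)
      also have "\<dots> \<le> \<bar>c\<bar> * \<bar>f (r k) - f (l k)\<bar> + \<bar>d\<bar> * \<bar>g (r k) - g (l k)\<bar>"
        by (rule order_trans[OF abs_triangle_ineq]) (simp add: abs_mult)
      finally show "\<bar>(c * f (r k) + d * g (r k)) - (c * f (l k) + d * g (l k))\<bar> \<le> (\<bar>c\<bar> + 1) * \<bar>f (r k) - f (l k)\<bar> + (\<bar>d\<bar> + 1) * \<bar>g (r k) - g (l k)\<bar>"
        by (rule order_trans) (simp add: distrib_right add_mono)
    qed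
    also have "\<dots> = (\<bar>c\<bar> + 1) * (\<Sum>k<n. \<bar>f (r k) - f (l k)\<bar>) + (\<bar>d\<bar> + 1) * (\<Sum>k<n. \<bar>g (r k) - g (l k)\<bar>)"
      by (simp add: sum.distrib sum_distrib_left)
    also have "\<dots> < (\<bar>c\<bar> + 1) * ?ef + (\<bar>d\<bar> + 1) * ?eg"
      using F G by (intro add_strict_mono mult_strict_left_mono) auto
    also have "\<dots> = e"
    proof -
      have "(\<bar>A\<bar> + 1) * (e / 2 / (\<bar>A\<bar> + 1)) = e / 2" for A :: real
        using abs_ge_zero[of A] by (intro nonzero_mult_div_cancel_left[of "\<bar>A\<bar> + 1" "e/2", unfolded times_divide_eq_right[symmetric]]) linarith
      then show ?thesis by (metis field_sum_of_halves)
    qed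
    finally show "(\<Sum>k<n. \<bar>(c * f (r k) + d * g (r k)) - (c * f (l k) + d * g (l k))\<bar>) < e" .
  qed (use \<open>d1>0\<close> \<open>d2>0\<close> in auto)
qed

section \<open>Square integrable functions\<close>

lemma integrable_mult_of_squares:
  fixes f g :: "'a \<Rightarrow> real"
  assumes [measurable]: "f \<in> borel_measurable M" "g \<in> borel_measurable M"
    and i: "integrable M (\<lambda>x. (f x)\<^sup>2)" "integrable M (\<lambda>x. (g x)\<^sup>2)"
  shows "integrable M (\<lambda>x. f x * g x)"
proof (rule Bochner_Integration.integrable_bound)
  show "integrable M (\<lambda>x. (f x)\<^sup>2 + (g x)\<^sup>2)" using i by simp
  have "\<bar>a * b\<bar> \<le> a\<^sup>2 + b\<^sup>2" for a b :: real
  proof -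
    have "0 \<le> (\<bar>a\<bar> - \<bar>b\<bar>)\<^sup>2" by simp
    then have "2 * (\<bar>a\<bar> * \<bar>b\<bar>) \<le> a\<^sup>2 + b\<^sup>2" by (simp add: power2_eq_square algebra_simps)
    moreover have "0 \<le> \<bar>a\<bar> * \<bar>b\<bar>" by simp
    ultimately show ?thesis unfolding abs_mult by linarith
  qed
  then show "AE x in M. norm (f x * g x) \<le> norm ((f x)\<^sup>2 + (g x)\<^sup>2)" by simp
qed simp

lemma integral_Cauchy_Schwarz:
  fixes f g :: "'a \<Rightarrow> real"
  assumes [measurable]: "f \<in> borel_measurable M" "g \<in> borel_measurable M"
    and i: "integrable M (\<lambda>x. (f x)\<^sup>2)" "integrable M (\<lambda>x. (g x)\<^sup>2)"
  shows "(LINT x|M. f x * g x)\<^sup>2 \<le> (LINT x|M. (f x)\<^sup>2) * (LINT x|M. (g x)\<^sup>2)"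
proof -
  define A where "A = (LINT x|M. (f x)\<^sup>2)"
  define B where "B = (LINT x|M. (g x)\<^sup>2)"
  define C where "C = (LINT x|M. f x * g x)"
  have fg: "integrable M (\<lambda>x. f x * g x)" by (rule integrable_mult_of_squares) (use i in auto)
  have q: "0 \<le> s\<^sup>2 * A - 2 * s * t * C + t\<^sup>2 * B" for s t
  proof -
    have "(LINT x|M. (s * f x - t * g x)\<^sup>2) = (LINT x|M. s\<^sup>2 * (f x)\<^sup>2 - 2 * s * t * (f x * g x) + t\<^sup>2 * (g x)\<^sup>2)"
      by (simp add: power2_eq_square algebra_simps)
    also have "\<dots> = s\<^sup>2 * A - 2 * s * t * C + t\<^sup>2 * B"
      using i fg by (simp add: A_def B_def C_def)
    finally have "(LINT x|M. (s * f x - t * g x)\<^sup>2) = s\<^sup>2 * A - 2 * s * t * C + t\<^sup>2 * B" .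
    moreover have "0 \<le> (LINT x|M. (s * f x - t * g x)\<^sup>2)" by simp
    ultimately show ?thesis by simp
  qed
  have AB: "0 \<le> A" "0 \<le> B" by (simp_all add: A_def B_def)
  show ?thesis
  proof (cases "B = 0")
    case True
    have "C = 0"
    proof (rule ccontr)
      assume "C \<noteq> 0"
      \<comment> \<open>With \<open>B = 0\<close> the form is linear in \<open>t\<close>; this
        \<open>t\<close> makes its value -1.\<close>
      have "0 \<le> 1\<^sup>2 * A - 2 * 1 * ((A + 1) / (2 * C)) * C + ((A + 1) / (2 * C))\<^sup>2 * B" by (rule q)
      then show False using \<open>C \<noteq> 0\<close> True by (simp add: field_simps)
    qed
    then show ?thesis using True AB by (simp add: A_def[symmetric] B_def[symmetric] C_def[symmetric])
  next
    case False
    then have B: "0 < B" using AB by simp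
    have "0 \<le> B * (B * A - C\<^sup>2)" using q[of B C] by (simp add: power2_eq_square algebra_simps)
    then have "C\<^sup>2 \<le> A * B" using B by (simp add: zero_le_mult_iff mult.commute)
    then show ?thesis by (simp add: A_def B_def C_def)
  qed
qed

lemma space_U01: "space U01 = {0..1}" by (simp add: U01_def)

lemma prob_space_U01: "prob_space U01"
  by (rule prob_spaceI) (simp add: U01_def emeasure_restrict_space)

interpretation U01: prob_space U01 by (rule prob_space_U01)

lemma set_integral_U01: "(LINT x:{0..1}|lborel. (f x::real)) = (LINT x|U01. f x)"
  by (simp add: U01_def integral_restrict_space set_lebesgue_integral_def)

lemma set_integrable_U01: "set_integrable lborel {0..1} (f::real\<Rightarrow>real) \<longleftrightarrow> integrable U01 f"
  by (simp add: U01_def integrable_restrict_space set_integrable_def)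

lemma borel_measurable_U01: "f \<in> borel_measurable borel \<Longrightarrow> f \<in> borel_measurable U01"
  unfolding U01_def by (rule measurable_restrict_space1) simp

lemma continuous_measurable_U01:
  assumes "continuous_on {0..1} (f::real\<Rightarrow>real)" shows "f \<in> borel_measurable U01"
proof -
  have "sets U01 = sets (restrict_space borel {0..1::real})" unfolding U01_def by (rule sets_restrict_space_cong) simp
  then have "borel_measurable U01 = borel_measurable (restrict_space borel {0..1::real})" by (rule measurable_cong_sets) simp
  then show ?thesis using borel_measurable_continuous_on_restrict[OF assms] by blast
qed

lemma AE_U01: "(AE x in U01. P x) \<longleftrightarrow> (AE x in lborel. x \<in> {0..1} \<longrightarrow> P x)"
  unfolding U01_def by (rule AE_restrict_space_iff) simp

lemma U01_integral_cong:
  assumes "\<And>x. x \<in> {0..1} \<Longrightarrow> f x = (g x :: real)"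
  shows "(LINT x|U01. f x) = (LINT x|U01. g x)"
  by (rule Bochner_Integration.integral_cong) (use assms in \<open>auto simp: space_U01\<close>)

lemma U01_integrable_bounded:
  assumes "f \<in> borel_measurable U01" "\<And>x. x \<in> {0..1} \<Longrightarrow> \<bar>f x\<bar> \<le> B"
  shows "integrable U01 (f::real\<Rightarrow>real)"
  by (rule U01.integrable_const_bound[of _ B]) (use assms in \<open>auto simp: space_U01\<close>)

lemma continuous_integrable_U01:
  assumes "continuous_on {0..1} (f::real\<Rightarrow>real)" shows "integrable U01 f"
proof -
  obtain B where "\<forall>x\<in>{0..1}. norm (f x) \<le> B"
    using compact_imp_bounded[OF compact_continuous_image[OF assms compact_Icc]] by (auto simp: bounded_iff)
  then show ?thesis by (intro U01_integrable_bounded[of _ B] continuous_measurable_U01 assms) auto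
qed

lemma (in prob_space) integrable_of_square:
  assumes [measurable]: "f \<in> borel_measurable M" and "integrable M (\<lambda>x. (f x)\<^sup>2)"
  shows "integrable M (f::'a\<Rightarrow>real)"
  using integrable_mult_of_squares[of f M "\<lambda>_. 1"] assms by simp

section \<open>Sobolev derivatives on the unit interval\<close>

locale sobolev_witness =
  fixes m :: nat and f :: "real \<Rightarrow> real" and D :: "nat \<Rightarrow> real \<Rightarrow> real"
  assumes wit: "sob_witness m f D" and m_pos: "0 < m"
begin

lemma D0: "x \<in> {0..1} \<Longrightarrow> D 0 x = f x" using wit by (auto simp: sob_witness_def)
lemma ac: "k < m \<Longrightarrow> abs_cont_on 0 1 (D k)" using wit by (auto simp: sob_witness_def)
lemma cont: "k < m \<Longrightarrow> continuous_on {0..1} (D k)" using ac abs_cont_on_continuous by blast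
lemma Dm_meas: "D m \<in> borel_measurable borel" using wit by (auto simp: sob_witness_def)
lemma meas: "k \<le> m \<Longrightarrow> D k \<in> borel_measurable U01"
  using cont[THEN continuous_measurable_U01, of k] borel_measurable_U01[OF Dm_meas] by (cases "k = m") auto
lemma int2: "k \<le> m \<Longrightarrow> integrable U01 (\<lambda>x. (D k x)\<^sup>2)"
proof (cases "k = m")
  case True then show ?thesis using wit by (auto simp: sob_witness_def set_integrable_U01)
next
  case False assume "k \<le> m"
  then have "continuous_on {0..1} (\<lambda>x. (D k x)\<^sup>2)" using False by (intro continuous_on_power cont) simp
  then show ?thesis by (rule continuous_integrable_U01)
qed
lemma int1: "k \<le> m \<Longrightarrow> integrable U01 (D k)"
  by (rule U01.integrable_of_square[OF meas int2])

lemma AE_deriv: "k < m \<Longrightarrow> AE x in lborel. x \<in> {0..1} \<longrightarrow> (D k has_real_derivative D (Suc k) x) (at x within {0..1})"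
  using wit by (auto simp: sob_witness_def)

lemma has_integral_deriv:
  assumes k: "k < m" and xy: "0 \<le> x" "x \<le> y" "y \<le> 1"
  shows "(D (Suc k) has_integral (D k y - D k x)) {x..y}"
proof (rule abs_cont_on_fundamental_theorem)
  show "abs_cont_on x y (D k)" by (rule abs_cont_on_subset[OF ac[OF k]]) (use xy in auto)
  show "AE t in lborel. t \<in> {x..y} \<longrightarrow> (D k has_real_derivative D (Suc k) t) (at t within {x..y})"
    using AE_deriv[OF k]
  proof eventually_elim
    case (elim t)
    have "{x..y} \<subseteq> {0..1}" using xy by auto
    then show ?case using elim has_field_derivative_subset[of "D k" _ t "{0..1}" "{x..y}"] by auto
  qed
qed (use xy in auto)

lemma set_integrable_sub:
  assumes "k \<le> m" "0 \<le> x" "y \<le> 1"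
  shows "set_integrable lborel {x..y} (D k)"
proof (rule set_integrable_subset)
  show "set_integrable lborel {0..1} (D k)" using int1[OF assms(1)] by (simp add: set_integrable_U01)
qed (use assms in auto)

lemma increment_eq:
  assumes k: "k < m" and xy: "0 \<le> x" "x \<le> y" "y \<le> 1"
  shows "D k y - D k x = (LINT t:{x..y}|lborel. D (Suc k) t)"
  using has_integral_deriv[OF assms] set_borel_integral_eq_integral(2)[OF set_integrable_sub[of "Suc k" x y]] k xy
  by (simp add: integral_unique)

text \<open>Below the top order the next derivative is itself continuous, so the integral
  representation upgrades the almost everywhere derivative of the definition to one at every point.
  Uniqueness, mean value bounds and Taylor expansion rest on this.\<close>

lemma deriv_everywhere:
  assumes k: "Suc k < m" and x: "x \<in> {0..1}"
  shows "(D k has_real_derivative D (Suc k) x) (at x within {0..1})"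
proof -
  have "((\<lambda>u. integral {0..u} (D (Suc k))) has_real_derivative D (Suc k) x) (at x within {0..1})"
    by (rule integral_has_real_derivative[OF cont[OF k] x])
  then have "((\<lambda>u. D k 0 + integral {0..u} (D (Suc k))) has_real_derivative D (Suc k) x) (at x within {0..1})"
    by (auto intro!: derivative_eq_intros)
  then show ?thesis
  proof (rule has_field_derivative_transform_within[of _ _ _ _ 1])
    fix u assume "u \<in> {0..1::real}"
    then have "integral {0..u} (D (Suc k)) = D k u - D k 0"
      using has_integral_deriv[of k 0 u] k by (intro integral_unique) auto
    then show "D k 0 + integral {0..u} (D (Suc k)) = D k u" by simp
  qed (use x in auto)
qed

lemma integral_eq_increment:
  assumes "k < m" shows "(LINT t|U01. D (Suc k) t) = D k 1 - D k 0"
  using increment_eq[OF assms, of 0 1] by (simp add: set_integral_U01)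

end

lemma derivative_unique_01:
  assumes "(f has_real_derivative a) (at x within {0..1})" "(f has_real_derivative b) (at x within {0..1})" "x \<in> {0..1}"
  shows "a = b"
  using vector_derivative_unique_within_closed_interval[of 0 1 x f a b] assms
  by (simp add: has_real_derivative_iff_has_vector_derivative)

text \<open>Orders below \<open>m\<close> agree everywhere by induction, each being the genuine
  derivative of the previous one; order \<open>m\<close> is determined only almost everywhere, which
  suffices under the integral. This frees \<open>inner1\<close> from the choice made by
  \<open>sobD\<close>.\<close>

lemma sob_witness_unique:
  assumes "sob_witness m f D" "sob_witness m f E" "0 < m"
  shows "k < m \<Longrightarrow> x \<in> {0..1} \<Longrightarrow> D k x = E k x"
    and "AE x in U01. D m x = E m x"
proof -
  interpret D: sobolev_witness m f D by unfold_locales (use assms in auto)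
  interpret E: sobolev_witness m f E by unfold_locales (use assms in auto)
  have 1: "\<forall>x\<in>{0..1}. D k x = E k x" if "k < m" for k
    using that
  proof (induction k)
    case 0 then show ?case using D.D0 E.D0 by auto
  next
    case (Suc k)
    show ?case
    proof
      fix x :: real assume x: "x \<in> {0..1}"
      have "(D k has_real_derivative E (Suc k) x) (at x within {0..1})"
        using E.deriv_everywhere[OF Suc.prems x]
        by (rule has_field_derivative_transform_within[of _ _ _ _ 1]) (use Suc x in auto)
      with D.deriv_everywhere[OF Suc.prems x] show "D (Suc k) x = E (Suc k) x"
        using derivative_unique_01 x by blast
    qed
  qed
  then show "k < m \<Longrightarrow> x \<in> {0..1} \<Longrightarrow> D k x = E k x" by auto
  obtain k where k: "m = Suc k" using assms(3) by (cases m) auto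
  have km: "k < m" using k by simp
  from D.AE_deriv[OF km] E.AE_deriv[OF km]
  have "AE x in lborel. x \<in> {0..1} \<longrightarrow> D (Suc k) x = E (Suc k) x"
  proof eventually_elim
    case (elim x)
    show ?case
    proof
      assume x: "x \<in> {0..1}"
      have "(D k has_real_derivative E (Suc k) x) (at x within {0..1})"
        by (rule has_field_derivative_transform_within[of "E k" _ _ _ 1]) (use elim 1 km x in auto)
      with elim x show "D (Suc k) x = E (Suc k) x" using derivative_unique_01[of "D k" _ x] by auto
    qed
  qed
  then show "AE x in U01. D m x = E m x" unfolding AE_U01 k .
qed

lemma sobD_witness: "sobolev m f \<Longrightarrow> sob_witness m f (sobD m f)"
  using someI_ex[of "\<lambda>D. sob_witness m f D"] unfolding sobolev_def sobD_def by simp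

lemma inner1_eq:
  assumes D: "sob_witness m f D" and E: "sob_witness m g E" and m: "0 < m"
  shows "inner1 m f g = (\<Sum>l=1..m-1. (LINT x|U01. D l x) * (LINT x|U01. E l x)) + (LINT x|U01. D m x * E m x)"
proof -
  have fD: "sob_witness m f (sobD m f)" "sob_witness m g (sobD m g)"
    using D E by (auto intro!: sobD_witness simp: sobolev_def)
  interpret D: sobolev_witness m f D by unfold_locales (use assms in auto)
  interpret E: sobolev_witness m g E by unfold_locales (use assms in auto)
  interpret D': sobolev_witness m f "sobD m f" by unfold_locales (use assms fD in auto)
  interpret E': sobolev_witness m g "sobD m g" by unfold_locales (use assms fD in auto)
  have "(LINT x|U01. sobD m f m x * sobD m g m x) = (LINT x|U01. D m x * E m x)"
  proof (rule integral_cong_AE)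
    show "AE x in U01. sobD m f m x * sobD m g m x = D m x * E m x"
      using sob_witness_unique(2)[OF fD(1) D m] sob_witness_unique(2)[OF fD(2) E m] by eventually_elim simp
  qed (use D.meas E.meas D'.meas E'.meas in auto)
  moreover have "(LINT x|U01. sobD m f l x) = (LINT x|U01. D l x)" "(LINT x|U01. sobD m g l x) = (LINT x|U01. E l x)"
    if "l \<in> {1..m-1}" for l
    by (intro U01_integral_cong sob_witness_unique(1)[OF fD(1) D m] sob_witness_unique(1)[OF fD(2) E m]; use that m in auto)+
  ultimately show ?thesis unfolding inner1_def set_integral_U01 by simp
qed

lemma sob_witness_lincomb:
  assumes D: "sob_witness m f D" and E: "sob_witness m g E" and m: "0 < m"
  shows "sob_witness m (\<lambda>x. c * f x + d * g x) (\<lambda>k x. c * D k x + d * E k x)"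
proof -
  interpret D: sobolev_witness m f D by unfold_locales (use assms in auto)
  interpret E: sobolev_witness m g E by unfold_locales (use assms in auto)
  have "AE x in lborel. x \<in> {0..1} \<longrightarrow>
      ((\<lambda>x. c * D k x + d * E k x) has_real_derivative c * D (Suc k) x + d * E (Suc k) x) (at x within {0..1})"
    if "k < m" for k
    using D.AE_deriv[OF that] E.AE_deriv[OF that] by eventually_elim (auto intro!: derivative_eq_intros)
  moreover have "integrable U01 (\<lambda>x. (c * D m x + d * E m x)\<^sup>2)"
  proof -
    have "integrable U01 (\<lambda>x. c\<^sup>2 * (D m x)\<^sup>2 + 2 * c * d * (D m x * E m x) + d\<^sup>2 * (E m x)\<^sup>2)"
      using D.int2[of m] E.int2[of m] integrable_mult_of_squares[of "D m" U01 "E m"] D.meas[of m] E.meas[of m] by simp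
    then show ?thesis by (simp add: power2_eq_square algebra_simps)
  qed
  ultimately show ?thesis using D.D0 E.D0 D.ac E.ac D.Dm_meas E.Dm_meas
    by (auto simp: sob_witness_def set_integrable_U01 intro!: abs_cont_on_lincomb)
qed

lemma H1_witness:
  assumes "f \<in> H1 m" "0 < m"
  obtains D where "sob_witness m f D" "(LINT x|U01. D 0 x) = 0"
proof -
  obtain D where D: "sob_witness m f D" using assms by (auto simp: H1_def sobolev_def)
  interpret D: sobolev_witness m f D by unfold_locales (use assms D in auto)
  have "(LINT x|U01. D 0 x) = (LINT x|U01. f x)" by (rule U01_integral_cong) (rule D.D0)
  also have "\<dots> = 0" using assms by (simp add: H1_def set_integral_U01)
  finally show thesis using that D by blast
qed

lemma H1_I:
  assumes "sob_witness m f D" "(LINT x|U01. D 0 x) = 0" "0 < m"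
  shows "f \<in> H1 m"
proof -
  interpret D: sobolev_witness m f D by unfold_locales (use assms in auto)
  have "(LINT x|U01. D 0 x) = (LINT x|U01. f x)" by (rule U01_integral_cong) (rule D.D0)
  then show ?thesis using assms by (auto simp: H1_def sobolev_def set_integral_U01)
qed

lemma H1_lincomb:
  assumes "f \<in> H1 m" "g \<in> H1 m" "0 < m"
  shows "(\<lambda>x. c * f x + d * g x) \<in> H1 m"
proof -
  obtain D where D: "sob_witness m f D" "(LINT x|U01. D 0 x) = 0" using H1_witness assms by metis
  obtain E where E: "sob_witness m g E" "(LINT x|U01. E 0 x) = 0" using H1_witness assms by metis
  interpret D: sobolev_witness m f D by unfold_locales (use assms D in auto)
  interpret E: sobolev_witness m g E by unfold_locales (use assms E in auto)
  show ?thesis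
    by (rule H1_I[OF sob_witness_lincomb[OF D(1) E(1) assms(3)]]) (use D E D.int1 E.int1 assms in auto)
qed

lemma inner1_commute: "inner1 m f g = inner1 m g f"
  by (simp add: inner1_def mult.commute)

lemma inner1_lincomb:
  assumes "f \<in> H1 m" "g \<in> H1 m" "h \<in> H1 m" "0 < m"
  shows "inner1 m (\<lambda>x. c * f x + d * g x) h = c * inner1 m f h + d * inner1 m g h"
proof -
  obtain D where D: "sob_witness m f D" using H1_witness assms by metis
  obtain E where E: "sob_witness m g E" using H1_witness assms by metis
  obtain F where F: "sob_witness m h F" using H1_witness assms by metis
  interpret D: sobolev_witness m f D by unfold_locales (use assms D in auto)
  interpret E: sobolev_witness m g E by unfold_locales (use assms E in auto)
  interpret F: sobolev_witness m h F by unfold_locales (use assms F in auto)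
  have DF: "integrable U01 (\<lambda>x. D m x * F m x)" "integrable U01 (\<lambda>x. E m x * F m x)"
    by (rule integrable_mult_of_squares; simp add: D.meas E.meas F.meas D.int2 E.int2 F.int2)+
  have 1: "(LINT x|U01. (c * D m x + d * E m x) * F m x) = c * (LINT x|U01. D m x * F m x) + d * (LINT x|U01. E m x * F m x)"
    using DF by (simp add: distrib_right mult.assoc)
  have 2: "(LINT x|U01. c * D l x + d * E l x) = c * (LINT x|U01. D l x) + d * (LINT x|U01. E l x)" if "l \<in> {1..m-1}" for l
    using D.int1[of l] E.int1[of l] that by auto
  show ?thesis
    unfolding inner1_eq[OF sob_witness_lincomb[OF D E assms(4)] F assms(4)] inner1_eq[OF D F assms(4)] inner1_eq[OF E F assms(4)] 1
    by (simp add: 2 distrib_right sum.distrib sum_distrib_left algebra_simps)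
qed

lemma inner1_nonneg: "0 \<le> inner1 m f f"
  unfolding inner1_def set_integral_U01 by (intro add_nonneg_nonneg sum_nonneg integral_nonneg_AE) auto

lemma H1_zero: "0 < m \<Longrightarrow> (\<lambda>x. 0) \<in> H1 m"
  by (rule H1_I[of _ _ "\<lambda>_ _. 0"]) (auto simp: sob_witness_def set_integrable_U01 intro!: abs_cont_on_lipschitz[of _ _ _ 0])

lemma H1_sum:
  assumes "\<And>i. i \<in> I \<Longrightarrow> f i \<in> H1 m" "0 < m"
  shows "(\<lambda>x. \<Sum>i\<in>I. c i * f i x) \<in> H1 m"
  using assms(1)
proof (induction I rule: infinite_finite_induct)
  case (insert i I)
  then show ?case using H1_lincomb[of "f i" m "\<lambda>x. \<Sum>i\<in>I. c i * f i x" "c i" 1] assms(2) by simp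
qed (use H1_zero[OF assms(2)] in auto)

lemma inner1_sum:
  assumes "\<And>i. i \<in> I \<Longrightarrow> f i \<in> H1 m" "0 < m" "h \<in> H1 m"
  shows "inner1 m (\<lambda>x. \<Sum>i\<in>I. c i * f i x) h = (\<Sum>i\<in>I. c i * inner1 m (f i) h)"
  using assms(1)
proof (induction I rule: infinite_finite_induct)
  case (insert i I)
  then show ?case
    using inner1_lincomb[of "f i" m "\<lambda>x. \<Sum>i\<in>I. c i * f i x" h "c i" 1] H1_sum[of I f m c] assms(2,3) by simp
next
  case (infinite I)
  then show ?case using inner1_lincomb[of "\<lambda>x. 0" m "\<lambda>x. 0" h 0 0] H1_zero assms by simp
next
  case empty
  then show ?case using inner1_lincomb[of "\<lambda>x. 0" m "\<lambda>x. 0" h 0 0] H1_zero assms by simp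
qed

section \<open>Norm bounds and Taylor expansion\<close>

lemma integral_indicator_square_U01:
  assumes "0 \<le> x" "x \<le> y" "y \<le> 1"
  shows "(LINT t|U01. (indicator {x..y} t)\<^sup>2) = (y - x :: real)" "integrable U01 (\<lambda>t. (indicator {x..y} t :: real)\<^sup>2)"
proof -
  have m: "{x..y} \<in> sets U01" using assms by (auto simp: U01_def sets_restrict_space_iff)
  have e: "emeasure U01 {x..y} = ennreal (y - x)"
    unfolding U01_def using assms by (subst emeasure_restrict_space) auto
  have *: "(\<lambda>t. (indicator {x..y} t :: real)\<^sup>2) = indicator {x..y}" by (auto simp: indicator_def)
  show "(LINT t|U01. (indicator {x..y} t)\<^sup>2) = (y - x :: real)"
    unfolding * using m e assms by (simp add: measure_def)
  show "integrable U01 (\<lambda>t. (indicator {x..y} t :: real)\<^sup>2)"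
    unfolding * using m e by (simp add: integrable_real_indicator)
qed

context sobolev_witness
begin

text \<open>Cauchy--Schwarz against the indicator of the interval: an L^2 bound on the top
  derivative makes the one below it Hoelder continuous with exponent 1/2.\<close>

lemma increment_last:
  assumes x: "x \<in> {0..1}" and y: "y \<in> {0..1}"
  shows "\<bar>D (m - 1) y - D (m - 1) x\<bar> \<le> sqrt \<bar>y - x\<bar> * sqrt (LINT t|U01. (D m t)\<^sup>2)"
proof -
  have *: "\<bar>D (m - 1) y - D (m - 1) x\<bar> \<le> sqrt \<bar>y - x\<bar> * sqrt (LINT t|U01. (D m t)\<^sup>2)"
    if xy: "0 \<le> x" "x \<le> y" "y \<le> 1" for x y
  proof -
    have "D (m - 1) y - D (m - 1) x = (LINT t:{x..y}|lborel. D m t)"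
      using increment_eq[of "m - 1" x y] xy m_pos by simp
    also have "\<dots> = (LINT t:{0..1}|lborel. indicator {x..y} t * D m t)"
      unfolding set_lebesgue_integral_def
      by (rule Bochner_Integration.integral_cong) (use xy in \<open>auto simp: indicator_def\<close>)
    finally have e: "D (m - 1) y - D (m - 1) x = (LINT t|U01. indicator {x..y} t * D m t)"
      by (simp add: set_integral_U01)
    have "(indicator {x..y} :: real \<Rightarrow> real) \<in> borel_measurable U01" by (rule borel_measurable_U01) simp
    then have "(D (m - 1) y - D (m - 1) x)\<^sup>2 \<le> (y - x) * (LINT t|U01. (D m t)\<^sup>2)"
      unfolding e using integral_Cauchy_Schwarz[of "indicator {x..y}" U01 "D m"] meas[of m] int2[of m]
        integral_indicator_square_U01[OF xy] by simp
    then have "\<bar>D (m - 1) y - D (m - 1) x\<bar> \<le> sqrt ((y - x) * (LINT t|U01. (D m t)\<^sup>2))"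
      by (metis real_sqrt_abs real_sqrt_le_iff)
    then show ?thesis using xy by (simp add: real_sqrt_mult)
  qed
  show ?thesis
  proof (cases "x \<le> y")
    case True then show ?thesis using * x y by auto
  next
    case False then show ?thesis using *[of y x] x y by (simp add: abs_minus_commute)
  qed
qed

text \<open>The norm has no term for the mean of the function itself; for \<open>l = 0\<close> the
  mean-zero condition takes its place.\<close>

lemma norm_parts_le:
  shows "(LINT t|U01. (D m t)\<^sup>2) \<le> inner1 m f f"
    and "l < m \<Longrightarrow> (LINT x|U01. D 0 x) = 0 \<Longrightarrow> \<bar>LINT x|U01. D l x\<bar> \<le> sqrt (inner1 m f f)"
proof -
  have eq: "inner1 m f f = (\<Sum>l=1..m-1. (LINT x|U01. D l x)\<^sup>2) + (LINT x|U01. (D m x)\<^sup>2)"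
    using inner1_eq[OF wit wit m_pos] by (simp add: power2_eq_square)
  have a: "0 \<le> (\<Sum>l=1..m-1. (LINT x|U01. D l x)\<^sup>2)" by (intro sum_nonneg) auto
  have b: "0 \<le> (LINT x|U01. (D m x)\<^sup>2)" by simp
  show "(LINT t|U01. (D m t)\<^sup>2) \<le> inner1 m f f" using eq a by simp
  show "\<bar>LINT x|U01. D l x\<bar> \<le> sqrt (inner1 m f f)" if "l < m" "(LINT x|U01. D 0 x) = 0"
  proof (cases "l = 0")
    case False
    then have "(LINT x|U01. D l x)\<^sup>2 \<le> (\<Sum>l=1..m-1. (LINT x|U01. D l x)\<^sup>2)"
      using that by (intro member_le_sum) auto
    then have "(LINT x|U01. D l x)\<^sup>2 \<le> inner1 m f f" using eq b by linarith
    then show ?thesis by (metis real_sqrt_abs real_sqrt_le_iff)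
  qed (use that inner1_nonneg in simp)
qed

lemma increment_lower:
  assumes k: "Suc k < m" and x: "x \<in> {0..1}" and y: "y \<in> {0..1}" and B: "\<And>t. t \<in> {0..1} \<Longrightarrow> \<bar>D (Suc k) t\<bar> \<le> B"
  shows "\<bar>D k y - D k x\<bar> \<le> B * \<bar>y - x\<bar>"
  using field_differentiable_bound[OF convex_closed_interval[of 0 "1::real"], of "D k" "D (Suc k)" B y x]
    deriv_everywhere[OF k] B x y by (simp add: cbox_interval)

text \<open>Descends from order \<open>m - 1\<close>: a derivative differs from its mean by at most
  its oscillation, the mean is bounded by the norm, and the oscillation by the supremum of the next
  derivative. Each descent adds one norm, hence the factor \<open>j + 2\<close>.\<close>

lemma sup_bound_aux:
  assumes z: "(LINT x|U01. D 0 x) = 0" and j: "j < m" and x: "x \<in> {0..1}"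
  shows "\<bar>D (m - 1 - j) x\<bar> \<le> (real j + 2) * sqrt (inner1 m f f)"
  using j x
proof (induction j arbitrary: x)
  let ?N = "sqrt (inner1 m f f)"
  have step: "\<bar>D l x\<bar> \<le> B + ?N" if l: "l < m" and x: "x \<in> {0..1}" and B: "\<And>y. y \<in> {0..1} \<Longrightarrow> \<bar>D l y - D l x\<bar> \<le> B" for l x B
  proof -
    have "\<bar>LINT y|U01. D l y - D l x\<bar> \<le> B"
    proof (rule order_trans[OF integral_abs_bound])
      have "(LINT y|U01. \<bar>D l y - D l x\<bar>) \<le> (LINT y|U01. B)"
        by (rule integral_mono) (use int1[of l] l B in \<open>auto simp: space_U01\<close>)
      then show "(LINT y|U01. \<bar>D l y - D l x\<bar>) \<le> B" by (simp add: U01.prob_space)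
    qed
    moreover have "(LINT y|U01. D l y - D l x) = (LINT y|U01. D l y) - D l x"
      using int1[of l] l by (simp add: U01.prob_space)
    ultimately show ?thesis using norm_parts_le(2)[OF l z] by linarith
  qed
  case 0
  have "\<bar>D (m - 1) y - D (m - 1) x\<bar> \<le> ?N" if "y \<in> {0..1}" for y
  proof -
    have "\<bar>D (m - 1) y - D (m - 1) x\<bar> \<le> sqrt \<bar>y - x\<bar> * sqrt (LINT t|U01. (D m t)\<^sup>2)"
      using increment_last 0 that by auto
    also have "\<dots> \<le> 1 * ?N"
      by (intro mult_mono) (use that 0 norm_parts_le(1) in \<open>auto simp: abs_if\<close>)
    finally show ?thesis by simp
  qed
  from step[of "m - 1" x, OF _ _ this] show ?case using 0 m_pos by simp
next
  let ?N = "sqrt (inner1 m f f)"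
  have step: "\<bar>D l x\<bar> \<le> B + ?N" if l: "l < m" and x: "x \<in> {0..1}" and B: "\<And>y. y \<in> {0..1} \<Longrightarrow> \<bar>D l y - D l x\<bar> \<le> B" for l x B
  proof -
    have "\<bar>LINT y|U01. D l y - D l x\<bar> \<le> B"
    proof (rule order_trans[OF integral_abs_bound])
      have "(LINT y|U01. \<bar>D l y - D l x\<bar>) \<le> (LINT y|U01. B)"
        by (rule integral_mono) (use int1[of l] l B in \<open>auto simp: space_U01\<close>)
      then show "(LINT y|U01. \<bar>D l y - D l x\<bar>) \<le> B" by (simp add: U01.prob_space)
    qed
    moreover have "(LINT y|U01. D l y - D l x) = (LINT y|U01. D l y) - D l x"
      using int1[of l] l by (simp add: U01.prob_space)
    ultimately show ?thesis using norm_parts_le(2)[OF l z] by linarith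
  qed
  case (Suc j)
  let ?l = "m - 1 - Suc j"
  have l: "Suc ?l = m - 1 - j" "Suc ?l < m" using Suc.prems by auto
  have "\<bar>D ?l y - D ?l x\<bar> \<le> (real j + 2) * ?N" if "y \<in> {0..1}" for y
  proof -
    have "\<bar>D ?l y - D ?l x\<bar> \<le> ((real j + 2) * ?N) * \<bar>y - x\<bar>"
      by (rule increment_lower[OF l(2) Suc.prems(2) that]) (use Suc l in auto)
    also have "\<dots> \<le> ((real j + 2) * ?N) * 1"
      by (rule mult_left_mono) (use that Suc.prems inner1_nonneg in \<open>auto simp: abs_if\<close>)
    finally show ?thesis by simp
  qed
  from step[of ?l x, OF _ _ this] show ?case using Suc.prems l by (simp add: algebra_simps)
qed

lemma sup_bound:
  assumes z: "(LINT x|U01. D 0 x) = 0" and l: "l < m" and x: "x \<in> {0..1}"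
  shows "\<bar>D l x\<bar> \<le> (real m + 1) * sqrt (inner1 m f f)"
proof -
  have "\<bar>D l x\<bar> \<le> (real (m - 1 - l) + 2) * sqrt (inner1 m f f)"
    using sup_bound_aux[OF z _ x, of "m - 1 - l"] l by simp
  also have "\<dots> \<le> (real m + 1) * sqrt (inner1 m f f)"
    by (rule mult_right_mono) (use l inner1_nonneg in auto)
  finally show ?thesis .
qed

text \<open>A single modulus of continuity for all orders below \<open>m\<close>: on the unit
  interval a distance is at most its square root, which weakens the Lipschitz bound of the lower
  orders to the exponent 1/2 available at order \<open>m - 1\<close>.\<close>

lemma holder_bound:
  assumes z: "(LINT x|U01. D 0 x) = 0" and l: "l < m" and x: "x \<in> {0..1}" and y: "y \<in> {0..1}"
  shows "\<bar>D l y - D l x\<bar> \<le> (real m + 1) * sqrt (inner1 m f f) * sqrt \<bar>y - x\<bar>"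
proof (cases "Suc l < m")
  case True
  have "\<bar>D l y - D l x\<bar> \<le> ((real m + 1) * sqrt (inner1 m f f)) * \<bar>y - x\<bar>"
    by (rule increment_lower[OF True x y]) (use sup_bound[OF z True] in auto)
  also have "\<dots> \<le> ((real m + 1) * sqrt (inner1 m f f)) * sqrt \<bar>y - x\<bar>"
  proof (rule mult_left_mono)
    have "\<bar>y - x\<bar> \<le> 1" using x y by (auto simp: abs_if)
    then have "sqrt \<bar>y - x\<bar> * sqrt \<bar>y - x\<bar> \<le> 1 * sqrt \<bar>y - x\<bar>" by (intro mult_right_mono) auto
    then show "\<bar>y - x\<bar> \<le> sqrt \<bar>y - x\<bar>" by simp
  qed (use inner1_nonneg in auto)
  finally show ?thesis .
next
  case False
  then have "l = m - 1" using l by auto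
  then have "\<bar>D l y - D l x\<bar> \<le> sqrt \<bar>y - x\<bar> * sqrt (LINT t|U01. (D m t)\<^sup>2)" using increment_last[OF x y] by simp
  also have "\<dots> \<le> sqrt \<bar>y - x\<bar> * ((real m + 1) * sqrt (inner1 m f f))"
  proof (rule mult_left_mono)
    have "sqrt (LINT t|U01. (D m t)\<^sup>2) \<le> 1 * sqrt (inner1 m f f)" using norm_parts_le(1) by simp
    also have "\<dots> \<le> (real m + 1) * sqrt (inner1 m f f)" by (rule mult_right_mono) (use inner1_nonneg in auto)
    finally show "sqrt (LINT t|U01. (D m t)\<^sup>2) \<le> (real m + 1) * sqrt (inner1 m f f)" .
  qed simp
  finally show ?thesis by (simp add: mult.commute)
qed

text \<open>The derivative of the remainder at one order is the remainder at the next. Starting from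
  the Hoelder estimate at order \<open>m - 1\<close>, each integration gains a factor
  \<open>h\<close>, so the function itself gets the exponent m - 1/2.\<close>

lemma taylor_remainder_aux:
  assumes j: "j < m" and t: "t \<in> {0..1}" and y: "y \<in> {0..1}" "\<bar>y - t\<bar> \<le> h"
  shows "\<bar>D (m - 1 - j) y - (\<Sum>i\<le>j. D (m - 1 - j + i) t * (y - t) ^ i / fact i)\<bar>
      \<le> h ^ j * sqrt h * sqrt (LINT t|U01. (D m t)\<^sup>2)"
  using j y
proof (induction j arbitrary: y)
  case 0
  have "\<bar>D (m - 1) y - D (m - 1) t\<bar> \<le> sqrt \<bar>y - t\<bar> * sqrt (LINT t|U01. (D m t)\<^sup>2)"
    by (rule increment_last) (use 0 t in auto)
  also have "\<dots> \<le> sqrt h * sqrt (LINT t|U01. (D m t)\<^sup>2)" by (rule mult_right_mono) (use 0 in auto)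
  finally show ?case by simp
next
  case (Suc j)
  let ?l = "m - 1 - Suc j" and ?K = "sqrt (LINT t|U01. (D m t)\<^sup>2)"
  have l: "Suc ?l = m - 1 - j" "Suc ?l < m" using Suc.prems by auto
  define R where "R y = D ?l y - (\<Sum>i\<le>Suc j. D (?l + i) t * (y - t) ^ i / fact i)" for y
  define R' where "R' y = D (Suc ?l) y - (\<Sum>i\<le>j. D (Suc ?l + i) t * (y - t) ^ i / fact i)" for y
  have h: "0 \<le> h" using Suc.prems by auto
  let ?S = "closed_segment t y"
  have seg: "?S \<subseteq> {0..1}" "\<And>u. u \<in> ?S \<Longrightarrow> \<bar>u - t\<bar> \<le> h"
    using Suc.prems t by (auto simp: closed_segment_eq_real_ivl split: if_splits)
  have der: "(R has_field_derivative R' u) (at u within ?S)" if u: "u \<in> ?S" for u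
  proof -
    have "(D ?l has_real_derivative D (Suc ?l) u) (at u within ?S)"
      using deriv_everywhere[OF l(2)] u seg by (meson has_field_derivative_subset subsetD)
    moreover have "((\<lambda>y. \<Sum>i\<le>Suc j. D (?l + i) t * (y - t) ^ i / fact i) has_real_derivative
        (\<Sum>i\<le>j. D (Suc ?l + i) t * (u - t) ^ i / fact i)) (at u within ?S)"
    proof -
      have "((\<lambda>y. \<Sum>i\<le>Suc j. D (?l + i) t * (y - t) ^ i / fact i) has_real_derivative
        (\<Sum>i\<le>Suc j. D (?l + i) t * (real i * (u - t) ^ (i - 1)) / fact i)) (at u within ?S)"
        by (rule DERIV_sum) (auto intro!: derivative_eq_intros)
      also have "(\<Sum>i\<le>Suc j. D (?l + i) t * (real i * (u - t) ^ (i - 1)) / fact i) =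
          (\<Sum>i\<le>j. D (?l + Suc i) t * (real (Suc i) * (u - t) ^ i) / fact (Suc i))"
        by (subst sum.atMost_Suc_shift) simp
      also have "\<dots> = (\<Sum>i\<le>j. D (Suc ?l + i) t * (u - t) ^ i / fact i)"
        by (rule sum.cong) (simp_all add: fact_Suc field_simps del: of_nat_Suc)
      finally show ?thesis .
    qed
    ultimately show ?thesis unfolding R_def R'_def by (rule DERIV_diff)
  qed
  have bd: "norm (R' u) \<le> h ^ j * sqrt h * ?K" if "u \<in> ?S" for u
    using Suc.IH[of u] Suc.prems seg that l unfolding R'_def by auto
  have "norm (R y - R t) \<le> (h ^ j * sqrt h * ?K) * norm (y - t)"
    by (rule field_differentiable_bound[OF _ der bd]) auto
  also have "\<dots> \<le> (h ^ j * sqrt h * ?K) * h"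
    by (rule mult_left_mono) (use Suc.prems h in auto)
  finally have "\<bar>R y - R t\<bar> \<le> h ^ Suc j * sqrt h * ?K" by (simp add: mult_ac)
  moreover have "R t = 0" unfolding R_def by (simp add: sum.atMost_Suc_shift)
  ultimately show ?case by (simp add: R_def)
qed

lemma taylor_remainder:
  assumes t: "t \<in> {0..1}" and y: "y \<in> {0..1}" "\<bar>y - t\<bar> \<le> h"
  shows "\<bar>f y - (\<Sum>i<m. D i t * (y - t) ^ i / fact i)\<bar> \<le> h ^ (m - 1) * sqrt h * sqrt (inner1 m f f)"
proof -
  have "0 \<le> h" using y by auto
  have "\<bar>f y - (\<Sum>i<m. D i t * (y - t) ^ i / fact i)\<bar> \<le> h ^ (m - 1) * sqrt h * sqrt (LINT t|U01. (D m t)\<^sup>2)"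
    using taylor_remainder_aux[of "m - 1", OF _ t y] m_pos D0[OF y(1)]
    by (simp add: lessThan_Suc_atMost[symmetric])
  also have "\<dots> \<le> h ^ (m - 1) * sqrt h * sqrt (inner1 m f f)"
    by (rule mult_left_mono) (use norm_parts_le(1) \<open>0 \<le> h\<close> in auto)
  finally show ?thesis .
qed

end

section \<open>Multiscale averaging kernels\<close>

lemma lborel_rescale_unit:
  fixes f p :: "real \<Rightarrow> real"
  assumes s: "s \<noteq> 0" and t: "t \<in> {0..1}" "t + s \<in> {0..1}"
  defines "Q \<equiv> \<lambda>y. (1 / \<bar>s\<bar>) * (indicator {0..1} ((y - t) / s) * p ((y - t) / s))"
  shows "(LINT y|U01. Q y * f y) = (LINT u|U01. p u * f (t + s * u))"
proof -
  have in01: "t + s * u \<in> {0..1}" if u: "u \<in> {0..1}" for u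
  proof -
    have "t + s * u = (1 - u) * t + u * (t + s)" by (simp add: algebra_simps)
    moreover have "0 \<le> (1 - u) * t + u * (t + s)" using t u by simp
    moreover have "(1 - u) * t + u * (t + s) \<le> (1 - u) * 1 + u * 1"
      by (intro add_mono mult_left_mono) (use t u in auto)
    ultimately show ?thesis by simp
  qed
  have "(LINT y|U01. Q y * f y) = (LINT y|lborel. indicator {0..1} y * (Q y * f y))"
    by (simp add: set_integral_U01[symmetric] set_lebesgue_integral_def)
  also have "\<dots> = \<bar>s\<bar> * (LINT u|lborel. indicator {0..1} (t + s * u) * (Q (t + s * u) * f (t + s * u)))"
    using lborel_integral_real_affine[OF s, of "\<lambda>y. indicator {0..1} y * (Q y * f y)" t] by simp
  also have "\<dots> = (LINT u|lborel. \<bar>s\<bar> * (indicator {0..1} (t + s * u) * (Q (t + s * u) * f (t + s * u))))"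
    by simp
  also have "\<dots> = (LINT u|lborel. indicator {0..1} u * (p u * f (t + s * u)))"
  proof (rule Bochner_Integration.integral_cong[OF refl])
    fix u :: real
    have "(t + s * u - t) / s = u" using s by simp
    then have "Q (t + s * u) = (1 / \<bar>s\<bar>) * (indicator {0..1} u * p u)" by (simp add: Q_def)
    then show "\<bar>s\<bar> * (indicator {0..1} (t + s * u) * (Q (t + s * u) * f (t + s * u))) = indicator {0..1} u * (p u * f (t + s * u))"
      using s in01[of u] by (cases "u \<in> {0..1}") (auto simp: indicator_def)
  qed
  also have "\<dots> = (LINT u|U01. p u * f (t + s * u))"
    by (simp add: set_integral_U01[symmetric] set_lebesgue_integral_def)
  finally show ?thesis .
qed

text \<open>Richardson extrapolation: combining a weight with its dilation by two removes the next moment.\<close>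

lemma vanishing_moment_weight_exists:
  "\<exists>p B. p \<in> borel_measurable borel \<and> (\<forall>u. \<bar>p u\<bar> \<le> (B::real)) \<and> (LINT u|U01. p u) = 1 \<and>
     (\<forall>i. 1 \<le> i \<longrightarrow> i \<le> (j::nat) \<longrightarrow> (LINT u|U01. p u * u ^ i) = 0)"
proof (induction j)
  case 0
  show ?case by (rule exI[of _ "\<lambda>_. 1"], rule exI[of _ 1]) (auto simp: U01.prob_space)
next
  case (Suc j)
  then obtain p B where p[measurable]: "p \<in> borel_measurable borel" and B: "\<forall>u. \<bar>p u\<bar> \<le> (B::real)"
    and one: "(LINT u|U01. p u) = 1" and mom: "\<And>i. 1 \<le> i \<Longrightarrow> i \<le> j \<Longrightarrow> (LINT u|U01. p u * u ^ i) = 0" by blast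
  have B0: "0 \<le> B" using B[rule_format, of 0] by (simp add: abs_le_iff)
  \<comment> \<open>Dilation by two divides the i-th moment by \<open>2 ^ i\<close>, so this factor
    cancels moment \<open>Suc j\<close> in \<open>c * P u - p u\<close>. Moments that already vanish
    stay zero, and dividing by \<open>c - 1\<close> restores total mass one.\<close>
  define c :: real where "c = 2 ^ Suc j"
  have c: "c > 1" by (simp add: c_def del: power_Suc)
  define P where "P y = 1 / \<bar>1/2\<bar> * (indicator {0..1} ((y - 0) / (1/2)) * p ((y - 0) / (1/2)))" for y :: real
  have Pm[measurable]: "P \<in> borel_measurable borel" unfolding P_def by measurable
  have PB: "\<bar>P y\<bar> \<le> 2 * B" for y using B B0 by (auto simp: P_def indicator_def abs_mult)
  define q where "q u = (c * P u - p u) / (c - 1)" for u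
  have int: "integrable U01 (\<lambda>u. p u * u ^ i)" "integrable U01 (\<lambda>u. P u * u ^ i)" for i
  proof -
    have *: "\<bar>u ^ i\<bar> \<le> 1" if "u \<in> {0..1::real}" for u using that by (simp add: power_le_one)
    show "integrable U01 (\<lambda>u. p u * u ^ i)"
    proof (rule U01_integrable_bounded[of _ "B * 1"])
      show "\<bar>p u * u ^ i\<bar> \<le> B * 1" if "u \<in> {0..1}" for u
        unfolding abs_mult by (intro mult_mono) (use B *[OF that] B0 in auto)
    qed (rule borel_measurable_U01, measurable)
    show "integrable U01 (\<lambda>u. P u * u ^ i)"
    proof (rule U01_integrable_bounded[of _ "(2 * B) * 1"])
      show "\<bar>P u * u ^ i\<bar> \<le> (2 * B) * 1" if "u \<in> {0..1}" for u
        unfolding abs_mult by (intro mult_mono) (use PB *[OF that] B0 in auto)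
    qed (rule borel_measurable_U01, measurable)
  qed
  have sc: "(LINT u|U01. P u * u ^ i) = (LINT u|U01. p u * u ^ i) / 2 ^ i" for i
  proof -
    have "(LINT u|U01. P u * u ^ i) = (LINT u|U01. p u * (0 + 1/2 * u) ^ i)"
      unfolding P_def by (rule lborel_rescale_unit) auto
    also have "\<dots> = (LINT u|U01. (p u * u ^ i) / 2 ^ i)" by (simp add: power_divide)
    finally show ?thesis by simp
  qed
  have Q: "(LINT u|U01. q u * u ^ i) = (c / 2 ^ i - 1) / (c - 1) * (LINT u|U01. p u * u ^ i)" for i
  proof -
    have "(LINT u|U01. q u * u ^ i) = (LINT u|U01. (c * (P u * u ^ i) - p u * u ^ i) / (c - 1))"
      by (rule Bochner_Integration.integral_cong) (auto simp: q_def diff_divide_distrib algebra_simps)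
    also have "\<dots> = (c * (LINT u|U01. P u * u ^ i) - (LINT u|U01. p u * u ^ i)) / (c - 1)"
      using int[of i] by simp
    finally show ?thesis by (simp add: sc diff_divide_distrib algebra_simps)
  qed
  show ?case
  proof (intro exI conjI allI impI)
    show "q \<in> borel_measurable borel" unfolding q_def by measurable
    show "\<bar>q u\<bar> \<le> (c * (2 * B) + B) / (c - 1)" for u
    proof -
      have "\<bar>c * P u - p u\<bar> \<le> \<bar>c * P u\<bar> + \<bar>p u\<bar>" by simp
      also have "\<dots> \<le> c * (2 * B) + B" using PB[of u] B c by (intro add_mono) (auto simp: abs_mult)
      finally show ?thesis using c by (auto simp: q_def abs_divide intro: divide_right_mono)
    qed
    show "(LINT u|U01. q u) = 1" using Q[of 0] one c by simp
    show "(LINT u|U01. q u * u ^ i) = 0" if "1 \<le> i" "i \<le> Suc j" for i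
    proof (cases "i = Suc j")
      case True then show ?thesis using Q[of i] by (simp add: c_def del: power_Suc)
    next
      case False then show ?thesis using Q[of i] mom[of i] that by simp
    qed
  qed
qed

text \<open>The kernels are increments of averages over windows of width 2^(-k-1) at
  \<open>t\<close>. Vanishing moments reduce the Taylor polynomial to its value at \<open>t\<close>,
  so the k-th increment of \<open>f\<close> is of order 2^(-k(m-1/2)) times the norm, while the
  squared L^2 norm of the kernel grows like the inverse width. These are the two rates that the
  interpolation inequality balances.\<close>

lemma multiscale_kernels_exist:
  assumes m: "0 < m"
  obtains C :: real where "0 < C"
    "\<And>t. t \<in> {0..1} \<Longrightarrow> \<exists>q::nat \<Rightarrow> real \<Rightarrow> real.
      (\<forall>k. q k \<in> borel_measurable borel \<and> (\<exists>B. \<forall>y. \<bar>q k y\<bar> \<le> B) \<and> (LINT y|U01. (q k y)\<^sup>2) \<le> C * 2 ^ k) \<and>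
      (\<forall>k. \<forall>f\<in>H1 m. (LINT y|U01. q k y * f y)\<^sup>2 \<le> C * (1/2) ^ (k * (2*m-1)) * inner1 m f f) \<and>
      (\<forall>f\<in>H1 m. (\<lambda>K. \<Sum>k<K. LINT y|U01. q k y * f y) \<longlonglongrightarrow> f t)"
proof -
  obtain p B where p[measurable]: "p \<in> borel_measurable borel" and B: "\<And>u. \<bar>p u\<bar> \<le> (B::real)"
    and one: "(LINT u|U01. p u) = 1" and mom: "\<And>i. 1 \<le> i \<Longrightarrow> i \<le> m \<Longrightarrow> (LINT u|U01. p u * u ^ i) = 0"
    using vanishing_moment_weight_exists[of m] by blast
  have B0: "0 \<le> B" using B[of 0] by (simp add: abs_le_iff)
  \<comment> \<open>The summands serve, in turn, the squared L^2 norms, the increments with positive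
    index (where \<open>2 ^ (2*m-1)\<close> pays for the coarser of the two scales) and the average
    of index 0, which has no predecessor to be subtracted and uses the sup bound. The last 1 gives
    positivity.\<close>
  define C where "C = 8 * B\<^sup>2 + (2 * B)\<^sup>2 * 2 ^ (2*m-1) + (B * (real m + 1))\<^sup>2 + 1"
  have C: "8 * B\<^sup>2 \<le> C" "(2 * B)\<^sup>2 * 2 ^ (2*m-1) \<le> C" "(B * (real m + 1))\<^sup>2 \<le> C" "0 < C"
    unfolding C_def by (auto simp: add_nonneg_pos)
  show thesis
  proof (rule that[OF C(4)])
    fix t :: real assume t: "t \<in> {0..1}"
    \<comment> \<open>The window points towards the farther endpoint, so its length of at most 1/2
      fits inside [0,1].\<close>
    define \<sigma> :: real where "\<sigma> = (if t \<le> 1/2 then 1 else -1)"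
    define s where "s k = \<sigma> * (1/2) ^ Suc k" for k
    have abs_s: "\<bar>s k\<bar> = (1/2) ^ Suc k" for k by (simp add: s_def \<sigma>_def abs_mult)
    have s0: "s k \<noteq> 0" for k by (simp add: s_def \<sigma>_def)
    have ts: "t + s k \<in> {0..1}" for k
    proof -
      have "(1/2::real) ^ Suc k \<le> 1/2" using power_decreasing[of 1 "Suc k" "1/2::real"] by simp
      moreover have "0 \<le> (1/2::real) ^ Suc k" by simp
      ultimately show ?thesis using t unfolding s_def \<sigma>_def atLeastAtMost_iff
        by (cases "t \<le> 1/2") (simp_all only: if_True if_False mult_1 mult_minus1, linarith+)
    qed
    have in01: "t + s k * u \<in> {0..1}" if u: "u \<in> {0..1}" for u k
    proof -
      have "t + s k * u = (1 - u) * t + u * (t + s k)" by (simp add: algebra_simps)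
      moreover have "0 \<le> (1 - u) * t + u * (t + s k)" using t u ts[of k] by simp
      moreover have "(1 - u) * t + u * (t + s k) \<le> (1 - u) * 1 + u * 1"
        by (intro add_mono mult_left_mono) (use t u ts[of k] in auto)
      ultimately show ?thesis by simp
    qed
    define Q where "Q k y = (1 / \<bar>s k\<bar>) * (indicator {0..1} ((y - t) / s k) * p ((y - t) / s k))" for k y
    have QI: "(LINT y|U01. Q k y * f y) = (LINT u|U01. p u * f (t + s k * u))" for k f
      unfolding Q_def by (rule lborel_rescale_unit[OF s0 t ts])
    have Qm[measurable]: "Q k \<in> borel_measurable borel" for k unfolding Q_def by measurable
    have QB: "\<bar>Q k y\<bar> \<le> (1 / \<bar>s k\<bar>) * B" for k y
      unfolding Q_def abs_mult using B B0 by (intro mult_mono) (auto simp: indicator_def)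
    have Q2: "(LINT y|U01. (Q k y)\<^sup>2) \<le> 2 * B\<^sup>2 * 2 ^ k" for k
    proof -
      have "(LINT y|U01. (Q k y)\<^sup>2) = (LINT u|U01. p u * Q k (t + s k * u))"
        using QI[of k "Q k"] by (simp add: power2_eq_square)
      also have "\<dots> \<le> (LINT u|U01. B * (1 / \<bar>s k\<bar> * B))"
      proof (rule integral_mono)
        have *: "\<bar>p u * Q k (t + s k * u)\<bar> \<le> B * (1 / \<bar>s k\<bar> * B)" for u
          unfolding abs_mult by (rule mult_mono) (use B QB B0 in auto)
        show "integrable U01 (\<lambda>u. p u * Q k (t + s k * u))"
          by (rule U01_integrable_bounded[OF borel_measurable_U01 *]) measurable
        show "p u * Q k (t + s k * u) \<le> B * (1 / \<bar>s k\<bar> * B)" for u using * abs_le_D1 by blast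
      qed simp
      also have "\<dots> = 2 * B\<^sup>2 * 2 ^ k"
        by (simp add: U01.prob_space abs_s power2_eq_square power_one_over)
      finally show ?thesis .
    qed
    have Qint2: "integrable U01 (\<lambda>y. (Q k y)\<^sup>2)" for k
    proof (rule U01_integrable_bounded[of _ "((1 / \<bar>s k\<bar>) * B)\<^sup>2"])
      show "(\<lambda>y. (Q k y)\<^sup>2) \<in> borel_measurable U01" by (rule borel_measurable_U01) measurable
      show "\<bar>(Q k y)\<^sup>2\<bar> \<le> ((1 / \<bar>s k\<bar>) * B)\<^sup>2" for y using power_mono[OF QB[of k y], of 2] by simp
    qed
    define q where "q k = (case k of 0 \<Rightarrow> Q 0 | Suc j \<Rightarrow> (\<lambda>y. Q (Suc j) y - Q j y))" for k
    have q0: "q 0 = Q 0" and qS: "q (Suc j) = (\<lambda>y. Q (Suc j) y - Q j y)" for j by (simp_all add: q_def)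
    have qm: "q k \<in> borel_measurable borel" for k by (cases k) (simp_all add: q0 qS)
    have fm: "f \<in> borel_measurable U01 \<and> (\<exists>Bf. \<forall>x\<in>{0..1}. \<bar>f x\<bar> \<le> Bf)" if f: "f \<in> H1 m" for f
    proof -
      obtain D where D: "sob_witness m f D" "(LINT x|U01. D 0 x) = 0" using H1_witness[OF f m] by blast
      interpret D: sobolev_witness m f D by unfold_locales (use D m in auto)
      have "f \<in> borel_measurable U01 \<longleftrightarrow> D 0 \<in> borel_measurable U01"
        by (rule measurable_cong) (simp add: space_U01 D.D0)
      moreover have "\<bar>f x\<bar> \<le> (real m + 1) * sqrt (inner1 m f f)" if "x \<in> {0..1}" for x
        using D.sup_bound[OF D(2) m that] D.D0[OF that] by simp
      ultimately show ?thesis using D.meas[of 0] by (metis le0)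
    qed
    have Qf: "integrable U01 (\<lambda>y. Q k y * f y)" if f: "f \<in> H1 m" for f k
    proof -
      obtain Bf where Bf: "\<And>x. x \<in> {0..1} \<Longrightarrow> \<bar>f x\<bar> \<le> Bf" and [measurable]: "f \<in> borel_measurable U01" using fm[OF f] by blast
      have [measurable]: "Q k \<in> borel_measurable U01" by (rule borel_measurable_U01) measurable
      show ?thesis
      proof (rule U01_integrable_bounded)
        show "\<bar>Q k x * f x\<bar> \<le> (1 / \<bar>s k\<bar>) * B * Bf" if "x \<in> {0..1}" for x
          unfolding abs_mult using QB Bf[OF that] B0 by (intro mult_mono) auto
      qed measurable
    qed
    have Sbound: "\<bar>(LINT y|U01. Q k y * f y) - f t\<bar> \<le> B * ((1/2) ^ k) ^ (m - 1) * sqrt ((1/2) ^ k) * sqrt (inner1 m f f)"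
      if f: "f \<in> H1 m" for f k
    proof -
      obtain D where D: "sob_witness m f D" "(LINT x|U01. D 0 x) = 0" using H1_witness[OF f m] by blast
      interpret D: sobolev_witness m f D by unfold_locales (use D m in auto)
      let ?T = "\<lambda>u. \<Sum>i<m. D i t * (s k * u) ^ i / fact i"
      let ?E = "((1/2) ^ k) ^ (m - 1) * sqrt ((1/2) ^ k) * sqrt (inner1 m f f)"
      have pi: "integrable U01 (\<lambda>u. p u * u ^ i)" for i
      proof (rule U01_integrable_bounded[of _ "B * 1"])
        have *: "\<bar>u ^ i\<bar> \<le> 1" if "u \<in> {0..1::real}" for u using that by (simp add: power_le_one)
        show "\<bar>p u * u ^ i\<bar> \<le> B * 1" if "u \<in> {0..1}" for u
          unfolding abs_mult by (intro mult_mono) (use B *[OF that] B0 in auto)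
      qed (rule borel_measurable_U01, measurable)
      have pT_eq: "p u * ?T u = (\<Sum>i<m. (D i t * s k ^ i / fact i) * (p u * u ^ i))" for u
        by (simp add: sum_distrib_left power_mult_distrib mult_ac)
      have iT: "integrable U01 (\<lambda>u. p u * ?T u)" unfolding pT_eq using pi by auto
      have "(LINT u|U01. p u * ?T u) = (\<Sum>i<m. (D i t * s k ^ i / fact i) * (LINT u|U01. p u * u ^ i))"
        unfolding pT_eq using pi by simp
      \<comment> \<open>Moments of orders 1 to m - 1 vanish and the total mass is one, so only the
        value at \<open>t\<close> survives from the Taylor polynomial.\<close>
      also have "\<dots> = (\<Sum>i<m. if i = 0 then D 0 t else 0)"
      proof (rule sum.cong)
        fix i assume "i \<in> {..<m}"
        then show "(D i t * s k ^ i / fact i) * (LINT u|U01. p u * u ^ i) = (if i = 0 then D 0 t else 0)"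
          using mom[of i] one by (cases "i = 0") auto
      qed simp
      also have "\<dots> = f t" using m D.D0[OF t] by simp
      finally have T: "(LINT u|U01. p u * ?T u) = f t" .
      have fu: "(\<lambda>u. f (t + s k * u)) \<in> borel_measurable U01"
      proof -
        have "continuous_on {0..1} (\<lambda>u. D 0 (t + s k * u))"
          by (rule continuous_on_compose2[OF D.cont[OF m]]) (use in01[of _ k] in \<open>auto intro!: continuous_intros\<close>)
        then have "(\<lambda>u. D 0 (t + s k * u)) \<in> borel_measurable U01" by (rule continuous_measurable_U01)
        then show ?thesis using in01[of _ k] D.D0
          by (subst measurable_cong[of _ _ "\<lambda>u. D 0 (t + s k * u)"]) (auto simp: space_U01)
      qed
      obtain Bf where Bf: "\<And>x. x \<in> {0..1} \<Longrightarrow> \<bar>f x\<bar> \<le> Bf" using fm[OF f] by blast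
      have pm: "p \<in> borel_measurable U01" by (rule borel_measurable_U01) measurable
      have iF: "integrable U01 (\<lambda>u. p u * f (t + s k * u))"
      proof (rule U01_integrable_bounded)
        show "\<bar>p x * f (t + s k * x)\<bar> \<le> B * Bf" if "x \<in> {0..1}" for x
          unfolding abs_mult using B Bf[OF in01[OF that]] B0 by (intro mult_mono) auto
      qed (use fu pm in measurable)
      have E0: "0 \<le> ?E" using inner1_nonneg by simp
      have pw: "\<bar>p u * f (t + s k * u) - p u * ?T u\<bar> \<le> B * ?E" if u: "u \<in> {0..1}" for u
      proof -
        have "\<bar>s k * u\<bar> \<le> (1/2) ^ k"
        proof -
          have "\<bar>s k * u\<bar> \<le> (1/2) ^ Suc k * 1" unfolding abs_mult abs_s using u by (intro mult_left_mono) auto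
          then show ?thesis by simp
        qed
        then have "\<bar>f (t + s k * u) - ?T u\<bar> \<le> ?E"
          using D.taylor_remainder[OF t in01[OF u, of k], of "(1/2) ^ k"] by simp
        then have "\<bar>p u\<bar> * \<bar>f (t + s k * u) - ?T u\<bar> \<le> B * ?E" using B B0 by (intro mult_mono) auto
        then show ?thesis by (simp add: abs_mult[symmetric] right_diff_distrib)
      qed
      have eq: "(LINT y|U01. Q k y * f y) - f t = (LINT u|U01. p u * f (t + s k * u) - p u * ?T u)"
        unfolding QI T[symmetric] using iF iT by simp
      have "\<bar>LINT u|U01. p u * f (t + s k * u) - p u * ?T u\<bar> \<le> (LINT u|U01. B * ?E)"
      proof (rule order_trans[OF integral_abs_bound])
        show "(LINT u|U01. \<bar>p u * f (t + s k * u) - p u * ?T u\<bar>) \<le> (LINT u|U01. B * ?E)"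
          by (rule integral_mono) (use iF iT pw in \<open>auto simp: space_U01\<close>)
      qed
      then show ?thesis unfolding eq by (simp add: U01.prob_space mult.assoc)
    qed
    have half: "(((1/2::real) ^ k) ^ (m - 1) * sqrt ((1/2) ^ k))\<^sup>2 = (1/2) ^ (k * (2 * m - 1))" for k
    proof -
      have "(((1/2::real) ^ k) ^ (m - 1) * sqrt ((1/2) ^ k))\<^sup>2 = ((1/2) ^ k) ^ (2 * (m - 1)) * (1/2) ^ k"
        by (simp add: power_mult_distrib power_mult[symmetric] mult_ac)
      also have "\<dots> = (1/2) ^ (k * (2 * (m - 1)) + k)" by (simp add: power_add power_mult)
      also have "k * (2 * (m - 1)) + k = k * (2 * m - 1)" using m by (cases m) (auto simp: algebra_simps)
      finally show ?thesis .
    qed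
    have lin: "(LINT y|U01. q (Suc k) y * f y) = (LINT y|U01. Q (Suc k) y * f y) - (LINT y|U01. Q k y * f y)"
      if "f \<in> H1 m" for f k using Qf[OF that] by (simp add: qS left_diff_distrib)
    have tele: "(\<Sum>k<Suc K. LINT y|U01. q k y * f y) = (LINT y|U01. Q K y * f y)" if "f \<in> H1 m" for f K
      by (induction K) (use lin[OF that] in \<open>simp_all add: q0\<close>)
    show "\<exists>q::nat \<Rightarrow> real \<Rightarrow> real.
      (\<forall>k. q k \<in> borel_measurable borel \<and> (\<exists>B. \<forall>y. \<bar>q k y\<bar> \<le> B) \<and> (LINT y|U01. (q k y)\<^sup>2) \<le> C * 2 ^ k) \<and>
      (\<forall>k. \<forall>f\<in>H1 m. (LINT y|U01. q k y * f y)\<^sup>2 \<le> C * (1/2) ^ (k * (2*m-1)) * inner1 m f f) \<and>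
      (\<forall>f\<in>H1 m. (\<lambda>K. \<Sum>k<K. LINT y|U01. q k y * f y) \<longlonglongrightarrow> f t)"
    proof (intro exI[of _ q] conjI allI ballI)
      fix k show "q k \<in> borel_measurable borel" by (rule qm)
    next
      fix k show "\<exists>B. \<forall>y. \<bar>q k y\<bar> \<le> B"
      proof (cases k)
        case 0 then show ?thesis using QB[of 0] by (auto simp: q0)
      next
        case (Suc j)
        have "\<bar>q k y\<bar> \<le> (1 / \<bar>s (Suc j)\<bar>) * B + (1 / \<bar>s j\<bar>) * B" for y
          using QB[of "Suc j" y] QB[of j y] unfolding Suc qS by linarith
        then show ?thesis by blast
      qed
    next
      fix k
      have "(LINT y|U01. (q k y)\<^sup>2) \<le> 8 * B\<^sup>2 * 2 ^ k"
      proof (cases k)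
        case 0
        have "2 * B\<^sup>2 * 2 ^ 0 \<le> 8 * B\<^sup>2 * 2 ^ 0" by simp
        then show ?thesis unfolding 0 q0 by (rule order_trans[OF Q2[of 0]])
      next
        case (Suc j)
        have "(LINT y|U01. (q k y)\<^sup>2) \<le> (LINT y|U01. 2 * (Q (Suc j) y)\<^sup>2 + 2 * (Q j y)\<^sup>2)"
        proof (rule integral_mono)
          have pw: "(q k y)\<^sup>2 \<le> 2 * (Q (Suc j) y)\<^sup>2 + 2 * (Q j y)\<^sup>2" for y
            using zero_le_power2[of "Q (Suc j) y + Q j y"] by (simp add: Suc qS power2_eq_square algebra_simps)
          show "(q k y)\<^sup>2 \<le> 2 * (Q (Suc j) y)\<^sup>2 + 2 * (Q j y)\<^sup>2" for y by (rule pw)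
          show i: "integrable U01 (\<lambda>y. 2 * (Q (Suc j) y)\<^sup>2 + 2 * (Q j y)\<^sup>2)" using Qint2 by simp
          show "integrable U01 (\<lambda>y. (q k y)\<^sup>2)"
          proof (rule Bochner_Integration.integrable_bound[OF i])
            show "(\<lambda>y. (q k y)\<^sup>2) \<in> borel_measurable U01" by (rule borel_measurable_U01) (use qm[of k] in measurable)
          qed (use pw in auto)
        qed
        also have "\<dots> = 2 * (LINT y|U01. (Q (Suc j) y)\<^sup>2) + 2 * (LINT y|U01. (Q j y)\<^sup>2)" using Qint2 by simp
        also have "\<dots> \<le> 2 * (2 * B\<^sup>2 * 2 ^ Suc j) + 2 * (2 * B\<^sup>2 * 2 ^ j)" using Q2[of "Suc j"] Q2[of j] by linarith
        also have "\<dots> \<le> 8 * B\<^sup>2 * 2 ^ k" using zero_le_power2[of B] by (simp add: Suc)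
        finally show ?thesis .
      qed
      also have "\<dots> \<le> C * 2 ^ k" using C(1) by (intro mult_right_mono) auto
      finally show "(LINT y|U01. (q k y)\<^sup>2) \<le> C * 2 ^ k" .
    next
      fix k f assume f: "f \<in> H1 m"
      let ?N = "inner1 m f f"
      have N: "0 \<le> ?N" by (rule inner1_nonneg)
      show "(LINT y|U01. q k y * f y)\<^sup>2 \<le> C * (1/2) ^ (k * (2*m-1)) * ?N"
      proof (cases k)
        case 0
        obtain D where D: "sob_witness m f D" "(LINT x|U01. D 0 x) = 0" using H1_witness[OF f m] by blast
        interpret D: sobolev_witness m f D by unfold_locales (use D m in auto)
        have b: "\<bar>p u * f (t + s 0 * u)\<bar> \<le> B * ((real m + 1) * sqrt ?N)" if "u \<in> {0..1}" for u
          unfolding abs_mult using B B0 D.sup_bound[OF D(2) m in01[OF that, of 0]] D.D0[OF in01[OF that, of 0]]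
          by (intro mult_mono) auto
        have "\<bar>LINT u|U01. p u * f (t + s 0 * u)\<bar> \<le> (LINT u|U01. B * ((real m + 1) * sqrt ?N))"
        proof (cases "integrable U01 (\<lambda>u. p u * f (t + s 0 * u))")
          case True
          show ?thesis by (rule order_trans[OF integral_abs_bound integral_mono]) (use True b in \<open>auto simp: space_U01\<close>)
        next
          case False then show ?thesis using B0 N by (simp add: not_integrable_integral_eq U01.prob_space)
        qed
        then have "\<bar>LINT y|U01. q k y * f y\<bar> \<le> B * (real m + 1) * sqrt ?N" using 0 by (simp add: q0 QI U01.prob_space)
        then have "\<bar>LINT y|U01. q k y * f y\<bar>\<^sup>2 \<le> (B * (real m + 1) * sqrt ?N)\<^sup>2" by (rule power_mono) simp
        also have "\<dots> = (B * (real m + 1))\<^sup>2 * ?N" using N by (simp add: power_mult_distrib)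
        also have "\<dots> \<le> C * ?N" using C(3) N by (rule mult_right_mono)
        finally show ?thesis using 0 by simp
      next
        case (Suc j)
        let ?e = "\<lambda>k. ((1/2) ^ k) ^ (m - 1) * sqrt ((1/2) ^ k)"
        have "\<bar>LINT y|U01. q k y * f y\<bar> \<le> B * ?e (Suc j) * sqrt ?N + B * ?e j * sqrt ?N"
          using Sbound[OF f, of "Suc j"] Sbound[OF f, of j] unfolding Suc lin[OF f] by (simp only: mult.assoc)
        also have "\<dots> \<le> B * ?e j * sqrt ?N + B * ?e j * sqrt ?N"
        proof -
          have "?e (Suc j) \<le> ?e j" by (intro mult_mono power_mono real_sqrt_le_mono) auto
          then show ?thesis using B0 N by (intro add_mono mult_right_mono mult_left_mono) auto
        qed
        finally have *: "\<bar>LINT y|U01. q k y * f y\<bar> \<le> 2 * B * ?e j * sqrt ?N" by (simp add: mult_ac)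
        then have "\<bar>LINT y|U01. q k y * f y\<bar>\<^sup>2 \<le> (2 * B * ?e j * sqrt ?N)\<^sup>2" by (rule power_mono) simp
        also have "\<dots> = (2 * B)\<^sup>2 * (?e j)\<^sup>2 * ?N" using N by (simp add: power_mult_distrib)
        also have "\<dots> = ((2 * B)\<^sup>2 * 2 ^ (2*m-1)) * (1/2) ^ (k * (2*m-1)) * ?N"
        proof -
          have "(1/2::real) ^ (k * (2*m-1)) = (1/2) ^ (2*m-1) * (1/2) ^ (j * (2*m-1))"
            by (simp add: Suc power_add)
          moreover have "(2::real) ^ (2*m-1) * (1/2) ^ (2*m-1) = 1" by (simp add: power_one_over)
          ultimately show ?thesis unfolding half by (simp add: mult.assoc mult.left_commute[of _ "2 ^ (2*m-1)"])
        qed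
        also have "\<dots> \<le> C * (1/2) ^ (k * (2*m-1)) * ?N" using C(2) N by (intro mult_right_mono) auto
        finally show ?thesis by simp
      qed
    next
      fix f assume f: "f \<in> H1 m"
      show "(\<lambda>K. \<Sum>k<K. LINT y|U01. q k y * f y) \<longlonglongrightarrow> f t"
      proof (rule LIMSEQ_offset[of _ 1])
        have "(\<lambda>K. (LINT y|U01. Q K y * f y) - f t) \<longlonglongrightarrow> 0"
        proof (rule Lim_null_comparison)
          show "\<forall>\<^sub>F k in sequentially. norm ((LINT y|U01. Q k y * f y) - f t) \<le> (B * sqrt (inner1 m f f)) * sqrt ((1/2) ^ k)"
          proof (intro always_eventually allI)
            fix k
            have "((1/2::real) ^ k) ^ (m - 1) \<le> 1" by (intro power_le_one) auto
            then have "B * ((1/2) ^ k) ^ (m - 1) * sqrt ((1/2) ^ k) * sqrt (inner1 m f f) \<le> B * 1 * sqrt ((1/2) ^ k) * sqrt (inner1 m f f)"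
              using B0 inner1_nonneg[of m f] by (intro mult_right_mono mult_left_mono) auto
            then show "norm ((LINT y|U01. Q k y * f y) - f t) \<le> (B * sqrt (inner1 m f f)) * sqrt ((1/2) ^ k)"
              using Sbound[OF f, of k] by (simp add: mult_ac)
          qed
          have "(\<lambda>k. sqrt ((1/2::real) ^ k)) \<longlonglongrightarrow> sqrt 0" by (intro tendsto_real_sqrt LIMSEQ_power_zero) simp
          then show "(\<lambda>k. (B * sqrt (inner1 m f f)) * sqrt ((1/2) ^ k)) \<longlonglongrightarrow> 0" using tendsto_mult_right_zero by fastforce
        qed
        then show "(\<lambda>K. \<Sum>k<K + 1. LINT y|U01. q k y * f y) \<longlonglongrightarrow> f t"
          using tele[OF f] by (simp add: LIM_zero_iff del: sum.lessThan_Suc)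
      qed
    qed
  qed
qed

section \<open>Orthonormal bases\<close>

abbreviation L2U :: "(real \<Rightarrow> real) \<Rightarrow> bool" where
  "L2U f \<equiv> f \<in> borel_measurable U01 \<and> integrable U01 (\<lambda>x. (f x)\<^sup>2)"

lemma L2U_mult: "L2U f \<Longrightarrow> L2U g \<Longrightarrow> integrable U01 (\<lambda>x. f x * g x)"
  by (rule integrable_mult_of_squares) auto

lemma L2U_lincomb:
  assumes f: "L2U f" and g: "L2U g" shows "L2U (\<lambda>x. a * f x + b * g x)"
proof
  show "(\<lambda>x. a * f x + b * g x) \<in> borel_measurable U01" using f g by (intro borel_measurable_add borel_measurable_times) auto
  have "integrable U01 (\<lambda>x. a\<^sup>2 * (f x)\<^sup>2 + 2 * a * b * (f x * g x) + b\<^sup>2 * (g x)\<^sup>2)"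
    using f g L2U_mult[OF f g] by simp
  then show "integrable U01 (\<lambda>x. (a * f x + b * g x)\<^sup>2)" by (simp add: power2_eq_square algebra_simps)
qed

lemma L2U_diff: "L2U f \<Longrightarrow> L2U g \<Longrightarrow> L2U (\<lambda>x. f x - g x)"
  using L2U_lincomb[of f g 1 "-1"] by simp

lemma L2U_bounded:
  assumes [measurable]: "f \<in> borel_measurable U01" and "\<And>x. x \<in> {0..1} \<Longrightarrow> \<bar>f x\<bar> \<le> B"
  shows "L2U f"
proof
  show "integrable U01 (\<lambda>x. (f x)\<^sup>2)"
  proof (rule U01_integrable_bounded[of _ "B\<^sup>2"])
    show "\<bar>(f x)\<^sup>2\<bar> \<le> B\<^sup>2" if "x \<in> {0..1}" for x using power_mono[OF assms(2)[OF that], of 2] by simp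
  qed measurable
qed fact

lemma L2U_continuous: "continuous_on {0..1} f \<Longrightarrow> L2U f"
  by (auto intro!: continuous_measurable_U01 continuous_integrable_U01 continuous_on_power)

lemma L2U_sum: "(\<And>i. i \<in> I \<Longrightarrow> L2U (f i)) \<Longrightarrow> L2U (\<lambda>x. \<Sum>i\<in>I. c i * f i x)"
proof (induction I rule: infinite_finite_induct)
  case (insert i I)
  then show ?case using L2U_lincomb[of "f i" "\<lambda>x. \<Sum>i\<in>I. c i * f i x" "c i" 1] by simp
qed (auto intro: L2U_bounded[of _ 0])

lemma L2U_borel_bounded:
  assumes "f \<in> borel_measurable borel" "\<And>x. x \<in> {0..1} \<Longrightarrow> \<bar>f x\<bar> \<le> B"
  shows "L2U f"
  by (rule L2U_bounded[of _ B]) (use assms borel_measurable_U01 in auto)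

lemma L2U_dominated_limit:
  assumes f: "L2U f" and s: "\<And>i. s i \<in> borel_measurable U01" and w: "L2U w"
    and lim: "\<And>x. x \<in> {0..1} \<Longrightarrow> (\<lambda>i. s i x) \<longlonglongrightarrow> f x"
    and bd: "\<And>i x. x \<in> {0..1} \<Longrightarrow> \<bar>f x - s i x\<bar> \<le> w x"
  shows "(\<lambda>i. LINT x|U01. (f x - s i x)\<^sup>2) \<longlonglongrightarrow> 0"
proof -
  have "(\<lambda>i. LINT x|U01. (f x - s i x)\<^sup>2) \<longlonglongrightarrow> (LINT x|U01. 0)"
  proof (rule integral_dominated_convergence[where w="\<lambda>x. (w x)\<^sup>2"])
    show "AE x in U01. (\<lambda>i. (f x - s i x)\<^sup>2) \<longlonglongrightarrow> 0"
    proof (rule AE_I2)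
      fix x assume "x \<in> space U01"
      then have "(\<lambda>i. (f x - s i x)\<^sup>2) \<longlonglongrightarrow> (f x - f x)\<^sup>2" by (intro tendsto_intros lim) (simp add: space_U01)
      then show "(\<lambda>i. (f x - s i x)\<^sup>2) \<longlonglongrightarrow> 0" by simp
    qed
    show "AE x in U01. norm ((f x - s i x)\<^sup>2) \<le> (w x)\<^sup>2" for i
    proof (rule AE_I2)
      fix x assume "x \<in> space U01"
      then have "\<bar>f x - s i x\<bar>\<^sup>2 \<le> (w x)\<^sup>2" using bd[of x i] by (intro power_mono) (auto simp: space_U01)
      then show "norm ((f x - s i x)\<^sup>2) \<le> (w x)\<^sup>2" by simp
    qed
  qed (use f s w in auto)
  then show ?thesis by simp
qed

text \<open>A monotone-class argument: half lines form an intersection-stable generator of the Borel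
  sets, linear combinations lead to simple functions, L^2 limits to the rest. It reduces both the
  density of polynomials and the weak convergence of top derivatives to half lines, where the
  integral of a derivative is an increment.\<close>

lemma L2U_induct:
  fixes P :: "(real \<Rightarrow> real) \<Rightarrow> bool"
  assumes ind: "\<And>a. P (indicator {..a})"
    and lin: "\<And>f g a b. L2U f \<Longrightarrow> L2U g \<Longrightarrow> P f \<Longrightarrow> P g \<Longrightarrow> P (\<lambda>x. a * f x + b * g x)"
    and lim: "\<And>f s. L2U f \<Longrightarrow> (\<And>i::nat. L2U (s i)) \<Longrightarrow> (\<And>i. P (s i)) \<Longrightarrow> (\<lambda>i. LINT x|U01. (f x - s i x)\<^sup>2) \<longlonglongrightarrow> 0 \<Longrightarrow> P f"
    and f: "L2U f"
  shows "P f"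
proof -
  \<comment> \<open>\<open>P\<close> is a predicate on functions of the whole line. Applying closure
    under L^2 limits to a constant sequence shows that it depends only on the values in
    [0,1].\<close>
  have cong: "P g" if "P f" "L2U f" "L2U g" "\<And>x. x \<in> {0..1} \<Longrightarrow> f x = g x" for f g
  proof (rule lim[of g "\<lambda>_. f"])
    have "(LINT x|U01. (g x - f x)\<^sup>2) = (LINT x|U01. 0)" by (rule U01_integral_cong) (use that in auto)
    then show "(\<lambda>i::nat. LINT x|U01. (g x - f x)\<^sup>2) \<longlonglongrightarrow> 0" by simp
  qed (use that in auto)
  have Li: "L2U (indicator A)" if "A \<in> sets borel" for A :: "real set"
    by (rule L2U_borel_bounded[of _ 1]) (use that in \<open>auto simp: indicator_def\<close>)
  have one: "P (\<lambda>_. 1)"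
    by (rule cong[OF ind[of 1] Li]) (auto intro: L2U_bounded[of _ 1])
  have zero: "P (\<lambda>_. 0)" using lin[of "\<lambda>_. 1" "\<lambda>_. 1" 0 0] one by (auto intro: L2U_bounded[of _ 1])
  have sums: "P (\<lambda>x. \<Sum>i\<in>I. c i * g i x)" if "\<And>i. i \<in> I \<Longrightarrow> L2U (g i) \<and> P (g i)" "finite I" for I :: "'i set" and c g
    using that(2,1)
  proof (induction I)
    case (insert i I)
    have "P (\<lambda>x. c i * g i x + 1 * (\<Sum>i\<in>I. c i * g i x))"
      by (rule lin) (use insert L2U_sum[of I g c] in auto)
    then show ?case using insert by simp
  qed (use zero in simp)
  have borel: "P (indicator A)" if "A \<in> sets borel" for A :: "real set"
  proof -
    have "A \<in> sigma_sets UNIV (range (\<lambda>a::real. {..a}))"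
      using that by (simp add: borel_eq_atMost)
    then show ?thesis
    proof (rule sigma_sets_induct_disjoint[rotated 2, where P="\<lambda>A. P (indicator A)"])
      show "Int_stable (range (\<lambda>a::real. {..a}))" unfolding Int_stable_def
      proof (intro ballI)
        fix A B :: "real set" assume "A \<in> range (\<lambda>a. {..a})" "B \<in> range (\<lambda>a. {..a})"
        then obtain a b where "A = {..a}" "B = {..b}" by auto
        then have "A \<inter> B = {..min a b}" by auto
        then show "A \<inter> B \<in> range (\<lambda>a. {..a})" by auto
      qed
    next
      show "range (\<lambda>a::real. {..a}) \<subseteq> Pow UNIV" by auto
    next
      fix A :: "real set" assume "A \<in> range (\<lambda>a. {..a})" then show "P (indicator A)" using ind by auto
    next
      have "(indicator {} :: real \<Rightarrow> real) = (\<lambda>_. 0)" by (simp add: fun_eq_iff)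
      then show "P (indicator {})" using zero by simp
    next
      fix A :: "real set" assume compl: "A \<in> sigma_sets UNIV (range (\<lambda>a. {..a}))" "P (indicator A)"
      then have A: "A \<in> sets borel" by (simp add: borel_eq_atMost)
      have "P (\<lambda>x. 1 * 1 + (-1) * indicator A x)"
        by (rule lin) (use Li[OF A] one compl in \<open>auto intro: L2U_bounded[of _ 1]\<close>)
      moreover have "(\<lambda>x. 1 * 1 + (-1) * indicator A x) = (indicator (UNIV - A) :: real \<Rightarrow> real)"
        by (auto simp: indicator_def)
      ultimately show "P (indicator (UNIV - A))" by simp
    next
      fix A :: "nat \<Rightarrow> real set" assume union: "disjoint_family A" "range A \<subseteq> sigma_sets UNIV (range (\<lambda>a. {..a}))"
        "\<And>i. P (indicator (A i))"
      then have A: "A i \<in> sets borel" for i by (auto simp: borel_eq_atMost)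
      show "P (indicator (\<Union>i. A i))"
      proof (rule lim[of _ "\<lambda>n x. \<Sum>i<n. 1 * indicator (A i) x"])
        have U: "(\<Union>i. A i) \<in> sets borel" using A by blast
        show Lu: "L2U (indicator (\<Union>i. A i))" by (rule Li[OF U])
        show Ln: "L2U (\<lambda>x. \<Sum>i<n. 1 * indicator (A i) x)" for n by (rule L2U_sum) (use Li[OF A] in auto)
        show "P (\<lambda>x. \<Sum>i<n. 1 * indicator (A i) x)" for n by (rule sums) (use Li[OF A] union in auto)
        have le: "(\<Sum>i<n. indicator (A i) x) = (indicator (\<Union>i<n. A i) x :: real)" for n x
          by (rule indicator_UN_disjoint[symmetric]) (use union(1) in \<open>auto simp: disjoint_family_on_def\<close>)
        show "(\<lambda>n. LINT x|U01. (indicator (\<Union>i. A i) x - (\<Sum>i<n. 1 * indicator (A i) x) :: real)\<^sup>2) \<longlonglongrightarrow> 0"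
        proof (rule L2U_dominated_limit[where w="\<lambda>_. 1", OF Lu])
          show "(\<lambda>n. \<Sum>i<n. 1 * indicator (A i) x) \<longlonglongrightarrow> (indicator (\<Union>i. A i) x :: real)" for x
            using LIMSEQ_indicator_UN[of A x] by (simp add: le)
          show "\<bar>indicator (\<Union>i. A i) x - (\<Sum>i<n. 1 * indicator (A i) x)\<bar> \<le> (1::real)" for n x
            by (simp add: le) (auto simp: indicator_def)
        qed (use Ln in \<open>auto intro: L2U_bounded[of _ 1]\<close>)
      qed
    qed
  qed
  obtain F where F: "\<And>i. simple_function U01 (F i)" "\<And>x. x \<in> space U01 \<Longrightarrow> (\<lambda>i. F i x) \<longlonglongrightarrow> f x"
    "\<And>i x. x \<in> space U01 \<Longrightarrow> dist (F i x) 0 \<le> 2 * dist (f x) 0"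
    using borel_measurable_implies_sequence_metric[of f U01 0] f by blast
  have Fm: "F i \<in> borel_measurable U01" for i using F(1) by (rule borel_measurable_simple_function)
  have fw: "L2U (\<lambda>x. 3 * \<bar>f x\<bar>)"
  proof
    show "integrable U01 (\<lambda>x. (3 * \<bar>f x\<bar>)\<^sup>2)" using f by (simp add: power_mult_distrib)
  qed (use f in auto)
  have FL: "L2U (F i)" for i
  proof
    show "integrable U01 (\<lambda>x. (F i x)\<^sup>2)"
    proof (rule Bochner_Integration.integrable_bound)
      show "integrable U01 (\<lambda>x. (3 * \<bar>f x\<bar>)\<^sup>2)" using fw by simp
      show "AE x in U01. norm ((F i x)\<^sup>2) \<le> norm ((3 * \<bar>f x\<bar>)\<^sup>2)"
      proof (rule AE_I2)
        fix x assume "x \<in> space U01"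
        then have "\<bar>F i x\<bar> \<le> 3 * \<bar>f x\<bar>" using F(3)[of x i] by (simp add: dist_real_def)
        then have "\<bar>F i x\<bar>\<^sup>2 \<le> (3 * \<bar>f x\<bar>)\<^sup>2" by (intro power_mono) auto
        then show "norm ((F i x)\<^sup>2) \<le> norm ((3 * \<bar>f x\<bar>)\<^sup>2)" by simp
      qed
    qed (use Fm in measurable)
  qed (rule Fm)
  show "P f"
  proof (rule lim[OF f FL])
    fix i
    let ?A = "\<lambda>y. F i -` {y} \<inter> space U01"
    have fin: "finite (F i ` space U01)" using F(1) by (auto simp: simple_function_def)
    have A: "?A y \<in> sets borel" for y
    proof -
      have "?A y \<in> sets U01" using Fm[of i] by (rule measurable_sets) simp
      then show ?thesis by (auto simp: U01_def sets_restrict_space)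
    qed
    have "P (\<lambda>x. \<Sum>y\<in>F i ` space U01. y * indicator (?A y) x)"
      by (rule sums) (use Li[OF A] borel[OF A] fin in auto)
    then show "P (F i)"
    proof (rule cong)
      show "L2U (\<lambda>x. \<Sum>y\<in>F i ` space U01. y * indicator (?A y) x)" by (rule L2U_sum) (use Li[OF A] in auto)
      show "(\<Sum>y\<in>F i ` space U01. y * indicator (?A y) x) = F i x" if "x \<in> {0..1}" for x
      proof -
        have "x \<in> space U01" using that by (simp add: space_U01)
        then have "F i x = (\<Sum>y\<in>F i ` space U01. indicator (?A y) x *\<^sub>R y)"
          by (rule simple_function_indicator_representation_banach[OF F(1)])
        also have "\<dots> = (\<Sum>y\<in>F i ` space U01. y * indicator (?A y) x)"
          by (rule sum.cong) (simp_all only: real_scaleR_def mult.commute)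
        finally show ?thesis by (rule sym)
      qed
    qed (rule FL)
  next
    show "(\<lambda>i. LINT x|U01. (f x - F i x)\<^sup>2) \<longlonglongrightarrow> 0"
    proof (rule L2U_dominated_limit[OF f Fm fw])
      show "\<bar>f x - F i x\<bar> \<le> 3 * \<bar>f x\<bar>" if "x \<in> {0..1}" for i x
        using F(3)[of x i] that by (simp add: dist_real_def space_U01)
      show "(\<lambda>i. F i x) \<longlonglongrightarrow> f x" if "x \<in> {0..1}" for x using F(2)[of x] that by (simp add: space_U01)
    qed
  qed
qed

lemma L2U_poly: "L2U (poly p)"
  by (rule L2U_continuous) (intro continuous_intros)

lemma integral_sq_add_le:
  assumes f: "L2U f" and g: "L2U g"
  shows "(LINT x|U01. (f x + g x)\<^sup>2) \<le> 2 * (LINT x|U01. (f x)\<^sup>2) + 2 * (LINT x|U01. (g x)\<^sup>2)"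
proof -
  have "(LINT x|U01. (f x + g x)\<^sup>2) \<le> (LINT x|U01. 2 * (f x)\<^sup>2 + 2 * (g x)\<^sup>2)"
  proof (rule integral_mono)
    show "integrable U01 (\<lambda>x. (f x + g x)\<^sup>2)" using L2U_lincomb[OF f g, of 1 1] by simp
    show "integrable U01 (\<lambda>x. 2 * (f x)\<^sup>2 + 2 * (g x)\<^sup>2)" using f g by simp
    fix x
    show "(f x + g x)\<^sup>2 \<le> 2 * (f x)\<^sup>2 + 2 * (g x)\<^sup>2"
      using zero_le_power2[of "f x - g x"] by (simp add: power2_eq_square algebra_simps)
  qed
  then show ?thesis using f g by simp
qed

text \<open>By \<open>L2U_induct\<close> only half lines need approximation: they are L^2 limits of
  continuous ramps of increasing slope, and Stone--Weierstrass treats continuous functions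
  uniformly.\<close>

lemma poly_dense_L2U:
  assumes f: "L2U f" and e: "0 < e"
  shows "\<exists>p. (LINT x|U01. (f x - poly p x)\<^sup>2) < e"
proof -
  let ?P = "\<lambda>f. \<forall>e>0. \<exists>p. (LINT x|U01. (f x - poly p x)\<^sup>2) < e"
  have lim: "?P f" if f: "L2U f" and s: "\<And>i::nat. L2U (s i)" "\<And>i. ?P (s i)" "(\<lambda>i. LINT x|U01. (f x - s i x)\<^sup>2) \<longlonglongrightarrow> 0" for f s
  proof (intro allI impI)
    fix e :: real assume e: "0 < e"
    have "\<forall>\<^sub>F i in sequentially. (LINT x|U01. (f x - s i x)\<^sup>2) < e / 4"
      using s(3) e by (intro order_tendstoD(2)) auto
    then obtain i where i: "(LINT x|U01. (f x - s i x)\<^sup>2) < e / 4" by (auto simp: eventually_sequentially)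
    obtain p where p: "(LINT x|U01. (s i x - poly p x)\<^sup>2) < e / 4" using s(2)[of i] e by (meson divide_pos_pos zero_less_numeral)
    have "(LINT x|U01. ((f x - s i x) + (s i x - poly p x))\<^sup>2) \<le> 2 * (LINT x|U01. (f x - s i x)\<^sup>2) + 2 * (LINT x|U01. (s i x - poly p x)\<^sup>2)"
      by (rule integral_sq_add_le) (intro L2U_diff f s(1) L2U_poly)+
    then show "\<exists>p. (LINT x|U01. (f x - poly p x)\<^sup>2) < e" using i p by (intro exI[of _ p]) simp
  qed
  have cont: "?P g" if g: "continuous_on {0..1} g" for g
  proof (intro allI impI)
    fix e :: real assume e: "0 < e"
    define d where "d = sqrt (e / 2)"
    have d: "0 < d" "d\<^sup>2 = e / 2" using e by (auto simp: d_def)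
    obtain h where h: "real_polynomial_function h" "\<And>x. x \<in> {0..1} \<Longrightarrow> \<bar>g x - h x\<bar> < d"
      using Stone_Weierstrass_real_polynomial_function[of "{0..1::real}" g d] g d by auto
    obtain a n where an: "h = (\<lambda>x. \<Sum>i\<le>n. a i * x ^ i)" using h(1) real_polynomial_function_iff_sum by blast
    define p where "p = (\<Sum>i\<le>n. monom (a i) i)"
    have p: "poly p x = h x" for x by (simp add: p_def an poly_sum poly_monom)
    have "(LINT x|U01. (g x - poly p x)\<^sup>2) \<le> (LINT x|U01. d\<^sup>2)"
    proof (rule integral_mono)
      show "integrable U01 (\<lambda>x. (g x - poly p x)\<^sup>2)" using L2U_diff[OF L2U_continuous[OF g] L2U_poly] by simp
      fix x assume "x \<in> space U01"
      then have "\<bar>g x - poly p x\<bar>\<^sup>2 \<le> d\<^sup>2" using h(2)[of x] by (intro power_mono) (auto simp: p space_U01)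
      then show "(g x - poly p x)\<^sup>2 \<le> d\<^sup>2" by simp
    qed simp
    then show "\<exists>p. (LINT x|U01. (g x - poly p x)\<^sup>2) < e" using d e by (intro exI[of _ p]) (simp add: U01.prob_space)
  qed
  have "?P f"
  proof (rule L2U_induct[where P="?P", OF _ _ lim f])
    fix a :: real
    define g where "g n x = max 0 (1 - real n * max 0 (x - a))" for n x
    have gc: "continuous_on {0..1} (g n)" for n unfolding g_def by (intro continuous_intros)
    show "?P (indicator {..a})"
    proof (rule lim[of _ g])
      show Li: "L2U (indicator {..a})" by (rule L2U_borel_bounded[of _ 1]) (auto simp: indicator_def)
      show "L2U (g n)" for n by (rule L2U_continuous[OF gc])
      show "?P (g n)" for n by (rule cont[OF gc])
      show "(\<lambda>n. LINT x|U01. (indicator {..a} x - g n x :: real)\<^sup>2) \<longlonglongrightarrow> 0"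
      proof (rule L2U_dominated_limit[where w="\<lambda>_. 1", OF Li])
        show "g n \<in> borel_measurable U01" for n by (rule continuous_measurable_U01[OF gc])
        show "L2U (\<lambda>_. 1)" by (rule L2U_bounded[of _ 1]) auto
        show "(\<lambda>n. g n x) \<longlonglongrightarrow> indicator {..a} x" for x
        proof (cases "x \<le> a")
          case True then show ?thesis by (simp add: g_def max_def)
        next
          case False
          then obtain N where N: "1 < real N * (x - a)" using reals_Archimedean3[of "x - a"] by auto
          have "g n x = 0" if "n \<ge> N" for n
          proof -
            have "real N * (x - a) \<le> real n * (x - a)" using that False by (intro mult_right_mono) auto
            then have "1 - real n * (x - a) \<le> 0" using N by linarith
            then show ?thesis using False by (simp add: g_def max_def)
          qed
          then have "\<forall>\<^sub>F n in sequentially. 0 = g n x" by (auto simp: eventually_sequentially)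
          then have "(\<lambda>n. g n x) \<longlonglongrightarrow> 0" by (rule Lim_transform_eventually[OF tendsto_const])
          then show ?thesis using False by simp
        qed
        show "\<bar>indicator {..a} x - g n x\<bar> \<le> 1" for n x
          by (auto simp: g_def indicator_def max_def abs_if)
      qed
    qed
  next
    fix f g a b assume f: "L2U f" and g: "L2U g" and Pf: "?P f" and Pg: "?P g"
    show "?P (\<lambda>x. a * f x + b * g x)"
    proof (intro allI impI)
      fix e :: real assume e: "0 < e"
      have A: "0 < e / (4 * (a\<^sup>2 + 1))" "0 < e / (4 * (b\<^sup>2 + 1))" using e by (auto intro!: divide_pos_pos add_nonneg_pos)
      obtain p where p: "(LINT x|U01. (f x - poly p x)\<^sup>2) < e / (4 * (a\<^sup>2 + 1))" using Pf A by blast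
      obtain q where q: "(LINT x|U01. (g x - poly q x)\<^sup>2) < e / (4 * (b\<^sup>2 + 1))" using Pg A by blast
      have sm: "2 * (c\<^sup>2 * I) < e / 2" if I: "0 \<le> I" "I < e / (4 * (c\<^sup>2 + 1))" for c I
      proof -
        have "4 * (c\<^sup>2 + 1) * I < e" using I(2) by (simp add: pos_less_divide_eq add_nonneg_pos mult.commute)
        moreover have "4 * (c\<^sup>2 * I) \<le> 4 * (c\<^sup>2 + 1) * I" using I(1) by (simp add: algebra_simps)
        ultimately show ?thesis by simp
      qed
      have fp: "L2U (\<lambda>x. f x - poly p x)" "L2U (\<lambda>x. g x - poly q x)" by (intro L2U_diff f g L2U_poly)+
      have s: "L2U (\<lambda>x. a * (f x - poly p x))" "L2U (\<lambda>x. b * (g x - poly q x))"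
        using L2U_lincomb[OF fp(1) fp(1), of a 0] L2U_lincomb[OF fp(2) fp(2), of b 0] by simp_all
      have "(LINT x|U01. (a * (f x - poly p x) + b * (g x - poly q x))\<^sup>2)
          \<le> 2 * (LINT x|U01. (a * (f x - poly p x))\<^sup>2) + 2 * (LINT x|U01. (b * (g x - poly q x))\<^sup>2)"
        by (rule integral_sq_add_le[OF s])
      also have "\<dots> = 2 * (a\<^sup>2 * (LINT x|U01. (f x - poly p x)\<^sup>2)) + 2 * (b\<^sup>2 * (LINT x|U01. (g x - poly q x)\<^sup>2))"
        using fp by (simp add: power_mult_distrib)
      also have "\<dots> < e / 2 + e / 2" using sm p q by (intro add_strict_mono) auto
      finally show "\<exists>p. (LINT x|U01. (a * f x + b * g x - poly p x)\<^sup>2) < e"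
        by (intro exI[of _ "smult a p + smult b q"]) (simp add: algebra_simps)
    qed
  qed
  then show ?thesis using e by blast
qed

section \<open>Orthonormal polynomials\<close>

lemma poly_integral_square_pos:
  assumes "p \<noteq> 0" shows "0 < (LINT x|U01. (poly p x)\<^sup>2)"
proof -
  have "(LINT x|U01. (poly p x)\<^sup>2) \<noteq> 0"
  proof
    assume "(LINT x|U01. (poly p x)\<^sup>2) = 0"
    then have "AE x in U01. (poly p x)\<^sup>2 = 0"
      using integral_nonneg_eq_0_iff_AE[of U01 "\<lambda>x. (poly p x)\<^sup>2"] L2U_poly[of p] by auto
    moreover have "AE x in U01. poly p x \<noteq> 0"
      unfolding AE_U01
    proof -
      have "{x. poly p x = 0} \<in> null_sets lborel"
        using poly_roots_finite[OF assms] by (intro finite_imp_null_set_lborel)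
      then have "AE x in lborel. x \<notin> {x. poly p x = 0}" by (rule AE_not_in)
      then show "AE x in lborel. x \<in> {0..1} \<longrightarrow> poly p x \<noteq> 0" by eventually_elim auto
    qed
    ultimately have "AE x in U01. False" by eventually_elim auto
    then show False by (simp add: U01.AE_False)
  qed
  then show ?thesis by (simp add: order_less_le)
qed

lemma graded_poly_span:
  assumes deg: "\<And>i. i < n \<Longrightarrow> degree (P i) = i \<and> P i \<noteq> (0::real poly)"
  shows "degree q < n \<Longrightarrow> \<exists>c. q = (\<Sum>i<n. smult (c i) (P i))"
  using deg
proof (induction n arbitrary: q)
  case (Suc n)
  define a where "a = coeff q n / coeff (P n) n"
  have Pn: "degree (P n) = n" "coeff (P n) n \<noteq> 0" using Suc.prems(2)[of n] by (auto simp: leading_coeff_0_iff[symmetric] simp del: leading_coeff_0_iff)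
  define r where "r = q - smult a (P n)"
  have cr: "coeff r n = 0" using Pn by (simp add: r_def a_def)
  have dr: "degree r \<le> n" unfolding r_def
    by (rule degree_diff_le) (use Suc.prems(1) Pn degree_smult_le[of a "P n"] in auto)
  have "\<exists>c. r = (\<Sum>i<n. smult (c i) (P i))"
  proof (cases "n = 0")
    case True
    then have "r = 0" using dr cr by (metis le_0_eq leading_coeff_0_iff)
    then show ?thesis using True by simp
  next
    case False
    have "degree r < n"
    proof (cases "r = 0")
      case True then show ?thesis using False by simp
    next
      case rn: False
      then have "degree r \<noteq> n" using cr by (metis leading_coeff_0_iff)
      then show ?thesis using dr by simp
    qed
    then show ?thesis using Suc.IH Suc.prems by simp
  qed
  then obtain c where c: "r = (\<Sum>i<n. smult (c i) (P i))" by blast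
  have "q = (\<Sum>i<Suc n. smult ((c(n := a)) i) (P i))"
    using c by (simp add: r_def algebra_simps)
  then show ?case by blast
qed simp

text \<open>These are, up to sign, the normalized shifted Legendre polynomials. The inductive claim
  demands orthogonality to every polynomial of lower degree; it therefore determines each degree
  independently of the choices made at the others, and one choice per degree can be made at the
  end.\<close>

lemma orthonormal_polynomials_exist:
  obtains P :: "nat \<Rightarrow> real poly" where "\<And>n. degree (P n) = n" "\<And>n. P n \<noteq> 0"
    "\<And>i j. (LINT x|U01. poly (P i) x * poly (P j) x) = (if i = j then 1 else 0)"
proof -
  let ?B = "\<lambda>p q. LINT x|U01. poly p x * poly q x"
  have int: "integrable U01 (\<lambda>x. poly p x * poly q x)" for p q by (rule L2U_mult) (rule L2U_poly)+
  have ex: "\<exists>p. degree p = n \<and> p \<noteq> 0 \<and> ?B p p = 1 \<and> (\<forall>q. degree q < n \<longrightarrow> ?B p q = 0)" for n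
  proof (induction n rule: less_induct)
    case (less n)
    then have "\<forall>i\<in>{..<n}. \<exists>p. degree p = i \<and> p \<noteq> 0 \<and> ?B p p = 1 \<and> (\<forall>q. degree q < i \<longrightarrow> ?B p q = 0)" by auto
    from bchoice[OF this] obtain P where P: "\<And>i. i < n \<Longrightarrow> degree (P i) = i \<and> P i \<noteq> 0 \<and> ?B (P i) (P i) = 1 \<and> (\<forall>q. degree q < i \<longrightarrow> ?B (P i) q = 0)"
      by blast
    have orth: "?B (P i) (P j) = (if i = j then 1 else 0)" if "i < n" "j < n" for i j
    proof (cases i j rule: linorder_cases)
      case less then show ?thesis using P[OF that(2)] P[OF that(1)] by (simp add: mult.commute)
    next
      case greater then show ?thesis using P[OF that(2)] P[OF that(1)] by simp
    qed (use P that in simp)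
    define r where "r = monom 1 n - (\<Sum>i<n. smult (?B (monom 1 n) (P i)) (P i))"
    have rn: "coeff r n = 1"
    proof -
      have "coeff (P i) n = 0" if "i < n" for i using P[OF that] that by (simp add: coeff_eq_0)
      then show ?thesis by (simp add: r_def coeff_sum)
    qed
    have "degree r \<le> n" unfolding r_def
    proof (rule degree_diff_le)
      show "degree (\<Sum>i<n. smult (?B (monom 1 n) (P i)) (P i)) \<le> n"
        by (rule degree_sum_le) (use P in \<open>auto intro: order_trans[OF degree_smult_le]\<close>)
    qed (simp add: degree_monom_le)
    then have dr: "degree r = n" using rn le_degree[of r n] by simp
    have r0: "r \<noteq> 0" using rn by auto
    have rP: "?B r (P j) = 0" if j: "j < n" for j
    proof -
      let ?c = "\<lambda>i. ?B (monom 1 n) (P i)"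
      have "?B r (P j) = (LINT x|U01. poly (monom 1 n) x * poly (P j) x - (\<Sum>i<n. ?c i * (poly (P i) x * poly (P j) x)))"
        by (simp add: r_def poly_sum left_diff_distrib sum_distrib_right mult.assoc)
      also have "\<dots> = ?c j - (\<Sum>i<n. ?c i * ?B (P i) (P j))" using int by simp
      also have "(\<Sum>i<n. ?c i * ?B (P i) (P j)) = (\<Sum>i<n. if i = j then ?c i else 0)"
        by (rule sum.cong) (use orth j in auto)
      also have "\<dots> = ?c j" using j by simp
      finally show ?thesis by simp
    qed
    have rq: "?B r q = 0" if "degree q < n" for q
    proof -
      have "\<exists>c. q = (\<Sum>i<n. smult (c i) (P i))" by (rule graded_poly_span[OF _ that]) (use P in auto)
      then obtain c where c: "q = (\<Sum>i<n. smult (c i) (P i))" by blast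
      have "?B r q = (LINT x|U01. (\<Sum>i<n. c i * (poly r x * poly (P i) x)))"
        by (simp add: c poly_sum sum_distrib_left mult.left_commute)
      also have "\<dots> = (\<Sum>i<n. c i * ?B r (P i))" using int by simp
      finally show ?thesis using rP by simp
    qed
    define N where "N = sqrt (?B r r)"
    have N: "0 < ?B r r" using poly_integral_square_pos[OF r0] by (simp add: power2_eq_square)
    have N2: "0 < N" "N * N = ?B r r" using N by (simp_all add: N_def)
    show ?case
    proof (intro exI[of _ "smult (1 / N) r"] conjI allI impI)
      show "degree (smult (1 / N) r) = n" using dr N2 by simp
      show "smult (1 / N) r \<noteq> 0" using r0 N2 by simp
      have "?B (smult (1 / N) r) (smult (1 / N) r) = (LINT x|U01. (1 / (N * N)) * (poly r x * poly r x))"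
        by (rule Bochner_Integration.integral_cong) (simp_all add: field_simps)
      also have "\<dots> = (1 / (N * N)) * ?B r r" by (rule integral_mult_right_zero)
      finally show "?B (smult (1 / N) r) (smult (1 / N) r) = 1" using N N2(2) by simp
      fix q :: "real poly" assume "degree q < n"
      have "?B (smult (1 / N) r) q = (LINT x|U01. (1 / N) * (poly r x * poly q x))" by (simp add: mult.assoc)
      also have "\<dots> = (1 / N) * ?B r q" by (rule integral_mult_right_zero)
      finally show "?B (smult (1 / N) r) q = 0" using rq[OF \<open>degree q < n\<close>] by simp
    qed
  qed
  then obtain P where P: "\<And>n. degree (P n) = n \<and> P n \<noteq> 0 \<and> ?B (P n) (P n) = 1 \<and> (\<forall>q. degree q < n \<longrightarrow> ?B (P n) q = 0)"
    by metis
  show thesis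
  proof (rule that[of P])
    show "?B (P i) (P j) = (if i = j then 1 else 0)" for i j
    proof (cases i j rule: linorder_cases)
      case less then show ?thesis using P[of j] P[of i] by (simp add: mult.commute)
    next
      case greater then show ?thesis using P[of j] P[of i] by simp
    qed (use P in simp)
  qed (use P in auto)
qed

section \<open>An orthonormal basis of the one-variable space\<close>

lemma pderiv_sum_fun: "pderiv (\<Sum>i\<in>A. f i) = (\<Sum>i\<in>A. pderiv (f i))"
  by (induction A rule: infinite_finite_induct) (auto simp: pderiv_add)

lemma poly_antiderivative_exists: "\<exists>p. pderiv p = (q :: real poly)"
proof -
  have "pderiv (\<Sum>i\<le>degree q. monom (coeff q i / real (Suc i)) (Suc i)) = (\<Sum>i\<le>degree q. monom (coeff q i) i)"
    by (simp add: pderiv_sum_fun pderiv_monom del: of_nat_Suc)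
  then show ?thesis using poly_as_sum_of_monoms[of q] by metis
qed

text \<open>The space \<open>H1 m\<close> and its norm see a function only through the means of its
  derivatives below order \<open>m\<close> and through its derivative of order \<open>m\<close>.
  Integrating and fixing the constant at each stage realizes any such data with polynomial top
  derivative.\<close>

lemma poly_with_derivative_and_moments_exists:
  "\<exists>p::real poly. (pderiv ^^ m) p = q \<and> (\<forall>l<m. (LINT x|U01. poly ((pderiv ^^ l) p) x) = a l)"
proof (induction m arbitrary: a)
  case (Suc m)
  obtain p' where p': "(pderiv ^^ m) p' = q" "\<forall>l<m. (LINT x|U01. poly ((pderiv ^^ l) p') x) = a (Suc l)"
    using Suc[of "\<lambda>l. a (Suc l)"] by blast
  obtain p1 where p1: "pderiv p1 = p'" using poly_antiderivative_exists by blast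
  define p where "p = p1 + [:a 0 - (LINT x|U01. poly p1 x):]"
  have d: "pderiv p = p'" by (simp add: p_def pderiv_add p1 pderiv_pCons)
  have i: "integrable U01 (poly p1)" by (rule continuous_integrable_U01) (intro continuous_intros)
  have "(LINT x|U01. poly p x) = a 0" using i by (simp add: p_def U01.prob_space)
  then have "(LINT x|U01. poly ((pderiv ^^ l) p) x) = a l" if "l < Suc m" for l
    using p'(2) that d by (cases l) (simp_all add: funpow_Suc_right del: funpow.simps(2))
  moreover have "(pderiv ^^ Suc m) p = q" using p'(1) d by (simp add: funpow_Suc_right del: funpow.simps(2))
  ultimately show ?case by blast
qed simp

lemma poly_sob_witness: "sob_witness m (poly p) (\<lambda>k. poly ((pderiv ^^ k) p))"
proof -
  have ac: "abs_cont_on 0 1 (poly q)" for q :: "real poly"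
  proof -
    have "compact (poly (pderiv q) ` {0..1})" by (intro compact_continuous_image continuous_intros) simp
    then obtain C where "\<forall>y\<in>poly (pderiv q) ` {0..1}. norm y \<le> C"
      using compact_imp_bounded bounded_iff by blast
    then have C: "\<And>x. x \<in> {0..1} \<Longrightarrow> norm (poly (pderiv q) x) \<le> C" by blast
    show ?thesis
    proof (rule abs_cont_on_lipschitz)
      fix x y :: real assume "x \<in> {0..1}" "y \<in> {0..1}"
      then show "\<bar>poly q x - poly q y\<bar> \<le> C * \<bar>x - y\<bar>"
        using field_differentiable_bound[of "{0..1::real}" "poly q" "poly (pderiv q)" C x y] C
        by (auto intro: DERIV_subset[OF poly_DERIV])
    qed
  qed
  show ?thesis unfolding sob_witness_def
  proof (intro conjI allI impI ballI)
    show "set_integrable lborel {0..1} (\<lambda>x. (poly ((pderiv ^^ m) p) x)\<^sup>2)" using L2U_poly by (simp add: set_integrable_U01)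
    show "AE x in lborel. x \<in> {0..1} \<longrightarrow> (poly ((pderiv ^^ k) p) has_real_derivative poly ((pderiv ^^ Suc k) p) x) (at x within {0..1})" for k
      by (rule AE_I2) (auto intro: DERIV_subset[OF poly_DERIV])
    show "poly ((pderiv ^^ m) p) \<in> borel_measurable lborel"
      by (simp add: borel_measurable_continuous_onI continuous_on_poly)
  qed (simp_all add: ac)
qed

lemma sob_witness_zero: "0 < m \<Longrightarrow> sob_witness m (\<lambda>x. 0) (\<lambda>_ _. 0)"
  by (auto simp: sob_witness_def set_integrable_U01 intro!: abs_cont_on_lipschitz[of _ _ _ 0])

lemma sob_witness_sum:
  assumes "\<And>i. i \<in> I \<Longrightarrow> sob_witness m (f i) (D i)" "0 < m"
  shows "sob_witness m (\<lambda>x. \<Sum>i\<in>I. c i * f i x) (\<lambda>k x. \<Sum>i\<in>I. c i * D i k x)"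
  using assms(1)
proof (induction I rule: infinite_finite_induct)
  case (insert i I)
  then show ?case using sob_witness_lincomb[of m "f i" "D i" "\<lambda>x. \<Sum>i\<in>I. c i * f i x" "\<lambda>k x. \<Sum>i\<in>I. c i * D i k x" "c i" 1] assms(2)
    by simp
qed (use sob_witness_zero[OF assms(2)] in auto)

text \<open>By completing squares: the Fourier coefficients remove the nonnegative term in
  \<open>c j - b j\<close>. This converts density of polynomials into convergence of the
  expansion.\<close>

lemma orthonormal_expansion_le:
  fixes n :: nat
  assumes g: "L2U g" and P: "\<And>i. i < n \<Longrightarrow> L2U (P i)"
    and orth: "\<And>i j. i < n \<Longrightarrow> j < n \<Longrightarrow> (LINT x|U01. P i x * P j x) = (if i = j then 1 else 0)"
  shows "(LINT x|U01. (g x - (\<Sum>j<n. (LINT x|U01. g x * P j x) * P j x))\<^sup>2) \<le> (LINT x|U01. (g x - (\<Sum>j<n. c j * P j x))\<^sup>2)"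
proof -
  define b where "b j = (LINT x|U01. g x * P j x)" for j
  have ex: "(LINT x|U01. (g x - (\<Sum>j<n. c j * P j x))\<^sup>2) = (LINT x|U01. (g x)\<^sup>2) + (\<Sum>j<n. (c j - b j)\<^sup>2) - (\<Sum>j<n. (b j)\<^sup>2)" for c
  proof -
    have PP: "integrable U01 (\<lambda>x. P i x * P j x)" if "i < n" "j < n" for i j using P that by (intro L2U_mult) auto
    have gP: "integrable U01 (\<lambda>x. g x * P j x)" if "j < n" for j using P that g by (intro L2U_mult) auto
    have gs: "g x * (\<Sum>j<n. c j * P j x) = (\<Sum>j<n. c j * (g x * P j x))" for x
      by (simp add: sum_distrib_left mult_ac)
    have ss: "(\<Sum>j<n. c j * P j x)\<^sup>2 = (\<Sum>i<n. \<Sum>j<n. c i * c j * (P i x * P j x))" for x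
      by (simp add: power2_eq_square sum_product mult_ac)
    have "(LINT x|U01. (g x - (\<Sum>j<n. c j * P j x))\<^sup>2) =
      (LINT x|U01. (g x)\<^sup>2 - 2 * (\<Sum>j<n. c j * (g x * P j x)) + (\<Sum>i<n. \<Sum>j<n. c i * c j * (P i x * P j x)))"
      by (simp add: power2_diff ss gs[symmetric] algebra_simps)
    also have "\<dots> = (LINT x|U01. (g x)\<^sup>2) - 2 * (\<Sum>j<n. c j * b j) + (\<Sum>i<n. \<Sum>j<n. c i * c j * (LINT x|U01. P i x * P j x))"
    proof -
      have i1: "integrable U01 (\<lambda>x. \<Sum>j<n. c j * (g x * P j x))" using gP by (intro Bochner_Integration.integrable_sum integrable_mult_right) auto
      have i2: "integrable U01 (\<lambda>x. \<Sum>i<n. \<Sum>j<n. c i * c j * (P i x * P j x))"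
        using PP by (intro Bochner_Integration.integrable_sum integrable_mult_right) auto
      have I1: "(LINT x|U01. (\<Sum>j<n. c j * (g x * P j x))) = (\<Sum>j<n. c j * b j)"
        using gP by (subst Bochner_Integration.integral_sum) (auto simp: b_def)
      have I2: "(LINT x|U01. (\<Sum>i<n. \<Sum>j<n. c i * c j * (P i x * P j x))) = (\<Sum>i<n. \<Sum>j<n. c i * c j * (LINT x|U01. P i x * P j x))"
      proof (subst Bochner_Integration.integral_sum)
        show "integrable U01 (\<lambda>x. \<Sum>j<n. c i * c j * (P i x * P j x))" if "i \<in> {..<n}" for i
          using PP that by (intro Bochner_Integration.integrable_sum integrable_mult_right) auto
        show "(\<Sum>i<n. LINT x|U01. (\<Sum>j<n. c i * c j * (P i x * P j x))) = (\<Sum>i<n. \<Sum>j<n. c i * c j * (LINT x|U01. P i x * P j x))"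
        proof (rule sum.cong[OF refl])
          fix i assume "i \<in> {..<n}"
          then show "(LINT x|U01. (\<Sum>j<n. c i * c j * (P i x * P j x))) = (\<Sum>j<n. c i * c j * (LINT x|U01. P i x * P j x))"
            using PP by (subst Bochner_Integration.integral_sum) auto
        qed
      qed
      show ?thesis using g i1 i2 I1 I2 by simp
    qed
    also have "(\<Sum>i<n. \<Sum>j<n. c i * c j * (LINT x|U01. P i x * P j x)) = (\<Sum>i<n. \<Sum>j<n. if j = i then c i * c j else 0)"
      by (intro sum.cong refl) (use orth in auto)
    also have "\<dots> = (\<Sum>i<n. (c i)\<^sup>2)"
    proof (rule sum.cong[OF refl])
      fix i assume "i \<in> {..<n}"
      then show "(\<Sum>j<n. if j = i then c i * c j else 0) = (c i)\<^sup>2"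
        by (subst sum.delta) (auto simp: power2_eq_square)
    qed
    finally show ?thesis by (simp add: power2_diff sum.distrib sum_subtractf sum_distrib_left algebra_simps)
  qed
  have "0 \<le> (\<Sum>j<n. (c j - b j)\<^sup>2)" by (intro sum_nonneg) auto
  then show ?thesis using ex[of c] ex[of b] unfolding b_def[symmetric] by simp
qed

text \<open>\<open>inner1\<close> makes the space a sum of m - 1 coordinates, the means of the
  derivatives of orders 1 to m - 1, and of L^2, through the top derivative. The first m - 1 basis
  elements are scaled Bernoulli polynomials, with one mean equal to 1 and zero top derivative; the
  others have zero means and an orthonormal polynomial as top derivative. Without this existence the
  choice in \<open>E1\<close> would carry no information.\<close>

lemma onb1_exists:
  assumes m: "0 < m" shows "\<exists>e. onb1 m e"
proof -
  obtain P :: "nat \<Rightarrow> real poly" where P: "\<And>n. degree (P n) = n" "\<And>n. P n \<noteq> 0"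
    and PO: "\<And>i j. (LINT x|U01. poly (P i) x * poly (P j) x) = (if i = j then 1 else 0)"
    using orthonormal_polynomials_exist by blast
  define M where "M = m - 1"
  define q where "q k = (if k < M then 0 else P (k - M))" for k
  define a where "a k l = (if k < M \<and> l = Suc k then 1 else 0 :: real)" for k l
  have "\<forall>k. \<exists>p. (pderiv ^^ m) p = q k \<and> (\<forall>l<m. (LINT x|U01. poly ((pderiv ^^ l) p) x) = a k l)"
    using poly_with_derivative_and_moments_exists by blast
  then obtain p where p: "\<And>k. (pderiv ^^ m) (p k) = q k" "\<And>k l. l < m \<Longrightarrow> (LINT x|U01. poly ((pderiv ^^ l) (p k)) x) = a k l"
    by metis
  define e where "e k = poly (p k)" for k
  define E where "E k l = poly ((pderiv ^^ l) (p k))" for k l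
  have wE: "sob_witness m (e k) (E k)" for k unfolding e_def E_def by (rule poly_sob_witness)
  have Em: "E k m = poly (q k)" for k by (simp add: E_def p)
  have El: "(LINT x|U01. E k l x) = a k l" if "l < m" for k l using p(2)[OF that] by (simp add: E_def)
  have eH: "e k \<in> H1 m" for k by (rule H1_I[OF wE _ m]) (use El[of 0] m in \<open>simp add: a_def\<close>)
  have inn: "inner1 m f (e k) = (if k < M then LINT x|U01. D (Suc k) x else LINT x|U01. D m x * poly (P (k - M)) x)"
    if D: "sob_witness m f D" for f D k
  proof -
    have "(\<Sum>l=1..m-1. (LINT x|U01. D l x) * (LINT x|U01. E k l x)) = (\<Sum>l=1..m-1. if l = Suc k then if k < M then LINT x|U01. D l x else 0 else 0)"
      by (intro sum.cong refl) (use El m in \<open>auto simp: a_def\<close>)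
    also have "\<dots> = (if k < M then LINT x|U01. D (Suc k) x else 0)" by (auto simp: M_def)
    finally show ?thesis unfolding inner1_eq[OF D wE m] Em by (simp add: q_def)
  qed
  have orth: "inner1 m (e k) (e k') = (if k = k' then 1 else 0)" for k k'
  proof (cases "k' < M")
    case True
    then show ?thesis unfolding inn[OF wE] using El[of "Suc k'" k] by (auto simp: a_def M_def)
  next
    case False
    then show ?thesis unfolding inn[OF wE] Em using PO[of "k - M" "k' - M"] by (auto simp: q_def)
  qed
  have compl: "(\<lambda>N. inner1 m (\<lambda>x. f x - (\<Sum>k<N. inner1 m f (e k) * e k x)) (\<lambda>x. f x - (\<Sum>k<N. inner1 m f (e k) * e k x))) \<longlonglongrightarrow> 0"
    if f: "f \<in> H1 m" for f
  proof -
    obtain D where D: "sob_witness m f D" using H1_witness[OF f m] by blast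
    interpret D: sobolev_witness m f D by unfold_locales (use D m in auto)
    have DL: "L2U (D m)" using D.meas[of m] D.int2[of m] by simp
    define c where "c k = inner1 m f (e k)" for k
    define r where "r N x = f x - (\<Sum>k<N. c k * e k x)" for N x
    define R where "R N l x = D l x - (\<Sum>k<N. c k * E k l x)" for N l x
    have wr: "sob_witness m (r N) (R N)" for N
      using sob_witness_lincomb[OF D sob_witness_sum[of "{..<N}" m e E c] m, of 1 "-1"] wE m
      by (simp add: r_def[abs_def] R_def[abs_def])
    have Rl: "(LINT x|U01. R (M + n) l x) = 0" if l: "l \<in> {1..m-1}" for n l
    proof -
      have "integrable U01 (E k l)" for k unfolding E_def by (rule continuous_integrable_U01) (intro continuous_intros)
      then have "(LINT x|U01. R (M + n) l x) = (LINT x|U01. D l x) - (\<Sum>k<M+n. c k * a k l)"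
        unfolding R_def using D.int1[of l] El[of l] l
        by (subst Bochner_Integration.integral_diff)
          (auto intro!: Bochner_Integration.integrable_sum integrable_mult_right simp: Bochner_Integration.integral_sum)
      also have "(\<Sum>k<M+n. c k * a k l) = (\<Sum>k<M+n. if k = l - 1 then c k else 0)"
        by (intro sum.cong refl) (use l in \<open>auto simp: a_def M_def\<close>)
      also have "\<dots> = c (l - 1)" using l by (auto simp: M_def)
      also have "\<dots> = (LINT x|U01. D l x)" unfolding c_def inn[OF D] using l by (auto simp: M_def)
      finally show ?thesis by simp
    qed
    have Rm: "R (M + n) m x = D m x - (\<Sum>j<n. (LINT x|U01. D m x * poly (P j) x) * poly (P j) x)" for n x
    proof -
      have "(\<Sum>k<M+n. c k * E k m x) = (\<Sum>k\<in>{M..<M+n}. c k * E k m x)"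
        by (rule sum.mono_neutral_right) (auto simp: Em q_def)
      also have "\<dots> = (\<Sum>j<n. c (M + j) * E (M + j) m x)"
        using sum.shift_bounds_nat_ivl[of "\<lambda>k. c k * E k m x" 0 M n] by (simp add: atLeast0LessThan add.commute)
      also have "\<dots> = (\<Sum>j<n. (LINT x|U01. D m x * poly (P j) x) * poly (P j) x)"
        by (intro sum.cong refl) (simp add: c_def inn[OF D] Em q_def)
      finally show ?thesis by (simp add: R_def)
    qed
    have key: "inner1 m (r (M + n)) (r (M + n)) = (LINT x|U01. (D m x - (\<Sum>j<n. (LINT x|U01. D m x * poly (P j) x) * poly (P j) x))\<^sup>2)" for n
      unfolding inner1_eq[OF wr wr m] using Rl by (simp add: Rm power2_eq_square)
    have "(\<lambda>n. inner1 m (r (M + n)) (r (M + n))) \<longlonglongrightarrow> 0"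
    proof (rule LIMSEQ_I)
      fix \<epsilon> :: real assume e: "0 < \<epsilon>"
      obtain q where q: "(LINT x|U01. (D m x - poly q x)\<^sup>2) < \<epsilon>" using poly_dense_L2U[OF DL e] by blast
      \<comment> \<open>Once \<open>n\<close> exceeds the degree of the approximating polynomial,
        that polynomial lies in the span, and the orthonormal expansion is at least as
        close.\<close>
      have "norm (inner1 m (r (M + n)) (r (M + n)) - 0) < \<epsilon>" if n: "n \<ge> Suc (degree q)" for n
      proof -
        obtain d where d: "q = (\<Sum>i<n. smult (d i) (P i))" using graded_poly_span[of n P q] P n by auto
        have "inner1 m (r (M + n)) (r (M + n)) \<le> (LINT x|U01. (D m x - (\<Sum>j<n. d j * poly (P j) x))\<^sup>2)"
          unfolding key by (rule orthonormal_expansion_le[OF DL]) (auto simp: PO L2U_poly)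
        also have "\<dots> = (LINT x|U01. (D m x - poly q x)\<^sup>2)" by (simp add: d poly_sum)
        finally show ?thesis using q inner1_nonneg[of m "r (M + n)"] by simp
      qed
      then show "\<exists>no. \<forall>n\<ge>no. norm (inner1 m (r (M + n)) (r (M + n)) - 0) < \<epsilon>" by blast
    qed
    then have "(\<lambda>N. inner1 m (r N) (r N)) \<longlonglongrightarrow> 0"
      using LIMSEQ_offset[of "\<lambda>N. inner1 m (r N) (r N)" M] by (simp add: add.commute)
    then show ?thesis by (simp add: r_def[abs_def] c_def)
  qed
  show ?thesis
    by (rule exI[of _ e]) (use eH orth compl in \<open>auto simp: onb1_def Let_def\<close>)
qed

lemma E1_onb: "0 < m \<Longrightarrow> onb1 m (E1 m)"
  unfolding E1_def by (rule someI_ex[OF onb1_exists])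

section \<open>Kernel bounds and uniqueness of expansions in the one-variable basis\<close>

context
  fixes m :: nat
  assumes m: "0 < m"
begin

lemma E1_H1: "E1 m k \<in> H1 m"
  and E1_orth: "inner1 m (E1 m k) (E1 m k') = (if k = k' then 1 else 0)"
  using E1_onb[OF m] by (auto simp: onb1_def)

lemma H1_regular:
  assumes f: "f \<in> H1 m"
  shows "continuous_on {0..1} f" "(LINT x|U01. f x) = 0"
    "\<And>x. x \<in> {0..1} \<Longrightarrow> (f x)\<^sup>2 \<le> (real m + 1)\<^sup>2 * inner1 m f f"
proof -
  obtain D where D: "sob_witness m f D" "(LINT x|U01. D 0 x) = 0" using H1_witness[OF f m] by blast
  interpret D: sobolev_witness m f D by unfold_locales (use D m in auto)
  show "continuous_on {0..1} f" by (rule continuous_on_eq[OF D.cont[OF m] D.D0])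
  show "(LINT x|U01. f x) = 0" using f by (simp add: H1_def set_integral_U01)
  fix x :: real assume x: "x \<in> {0..1}"
  have "\<bar>f x\<bar>\<^sup>2 \<le> ((real m + 1) * sqrt (inner1 m f f))\<^sup>2"
    by (rule power_mono) (use D.sup_bound[OF D(2) m x] D.D0[OF x] in auto)
  then show "(f x)\<^sup>2 \<le> (real m + 1)\<^sup>2 * inner1 m f f" using inner1_nonneg by (simp add: power_mult_distrib)
qed

text \<open>Duality: the functional is tested on the combination whose coefficients are its own values.\<close>

lemma sum_squares_functional_le:
  assumes lin: "\<And>c. L (\<lambda>x. \<Sum>k<N. c k * E1 m k x) = (\<Sum>k<N. c k * L (E1 m k))"
    and bd: "\<And>f. f \<in> H1 m \<Longrightarrow> (L f)\<^sup>2 \<le> C * inner1 m f f"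
  shows "(\<Sum>k<N. (L (E1 m k))\<^sup>2) \<le> C"
proof -
  define c where "c k = L (E1 m k)" for k
  define S where "S = (\<Sum>k<N. (c k)\<^sup>2)"
  let ?f = "\<lambda>x. \<Sum>k<N. c k * E1 m k x"
  have fH: "?f \<in> H1 m" by (rule H1_sum[OF E1_H1 m])
  have "inner1 m ?f ?f = (\<Sum>k<N. c k * inner1 m (E1 m k) ?f)" by (rule inner1_sum[OF E1_H1 m fH])
  also have "\<dots> = (\<Sum>k<N. c k * c k)"
  proof (rule sum.cong[OF refl])
    fix k assume k: "k \<in> {..<N}"
    have "inner1 m (E1 m k) ?f = (\<Sum>j<N. c j * inner1 m (E1 m j) (E1 m k))"
      by (subst inner1_commute) (rule inner1_sum[OF E1_H1 m E1_H1])
    also have "\<dots> = (\<Sum>j<N. if j = k then c j else 0)" by (intro sum.cong refl) (simp add: E1_orth)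
    finally show "c k * inner1 m (E1 m k) ?f = c k * c k" using k by simp
  qed
  finally have i: "inner1 m ?f ?f = S" by (simp add: S_def power2_eq_square)
  have "L ?f = S" using lin[of c] by (simp add: S_def c_def power2_eq_square)
  then have *: "S * S \<le> C * S" using bd[OF fH] i by (simp add: power2_eq_square)
  have S0: "0 \<le> S" unfolding S_def by (intro sum_nonneg) auto
  show ?thesis
  proof (cases "S = 0")
    case True
    have "0 \<le> (L (E1 m 0))\<^sup>2" by simp
    also have "\<dots> \<le> C * 1" using bd[OF E1_H1[of 0]] by (simp add: E1_orth)
    finally show ?thesis using True by (simp add: S_def c_def)
  next
    case False
    then have "S \<le> C" using * S0 by (metis mult_le_cancel_right order_less_le not_less)
    then show ?thesis by (simp add: S_def c_def)
  qed
qed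

text \<open>The diagonal of the reproducing kernel is the squared norm of point evaluation, which
  the sup bound on \<open>H1 m\<close> controls.\<close>

lemma E1_kernel_bound:
  assumes "t \<in> {0..1}" shows "(\<Sum>k<N. (E1 m k t)\<^sup>2) \<le> (real m + 1)\<^sup>2"
  using sum_squares_functional_le[of "\<lambda>f. f t" N "(real m + 1)\<^sup>2"] H1_regular(3)[OF _ assms] by simp

text \<open>Turns the bound of each functional on the unit ball into a bound on the square sum of
  its basis coefficients. In this form one-variable estimates multiply over the factors of a tensor
  product.\<close>

lemma E1_multiscale_kernels:
  obtains C :: real where "0 < C"
    "\<And>t. t \<in> {0..1} \<Longrightarrow> \<exists>q::nat \<Rightarrow> real \<Rightarrow> real.
      (\<forall>k. q k \<in> borel_measurable borel \<and> (\<exists>B. \<forall>y. \<bar>q k y\<bar> \<le> B) \<and> (LINT y|U01. (q k y)\<^sup>2) \<le> C * 2 ^ k) \<and>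
      (\<forall>k N. (\<Sum>a<N. (LINT y|U01. q k y * E1 m a y)\<^sup>2) \<le> C * (1/2) ^ (k * (2*m-1))) \<and>
      (\<forall>a. (\<lambda>K. \<Sum>k<K. LINT y|U01. q k y * E1 m a y) \<longlonglongrightarrow> E1 m a t)"
proof (rule multiscale_kernels_exist[OF m])
  fix C :: real
  assume C: "0 < C" and q: "\<And>t. t \<in> {0..1} \<Longrightarrow> \<exists>q::nat \<Rightarrow> real \<Rightarrow> real.
      (\<forall>k. q k \<in> borel_measurable borel \<and> (\<exists>B. \<forall>y. \<bar>q k y\<bar> \<le> B) \<and> (LINT y|U01. (q k y)\<^sup>2) \<le> C * 2 ^ k) \<and>
      (\<forall>k. \<forall>f\<in>H1 m. (LINT y|U01. q k y * f y)\<^sup>2 \<le> C * (1/2) ^ (k * (2*m-1)) * inner1 m f f) \<and>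
      (\<forall>f\<in>H1 m. (\<lambda>K. \<Sum>k<K. LINT y|U01. q k y * f y) \<longlonglongrightarrow> f t)"
  show thesis
  proof (rule that[OF C])
    fix t :: real assume "t \<in> {0..1}"
    from q[OF this] obtain q :: "nat \<Rightarrow> real \<Rightarrow> real" where
      q1: "\<And>k. q k \<in> borel_measurable borel \<and> (\<exists>B. \<forall>y. \<bar>q k y\<bar> \<le> B) \<and> (LINT y|U01. (q k y)\<^sup>2) \<le> C * 2 ^ k"
      and q2: "\<And>k f. f \<in> H1 m \<Longrightarrow> (LINT y|U01. q k y * f y)\<^sup>2 \<le> C * (1/2) ^ (k * (2*m-1)) * inner1 m f f"
      and q3: "\<And>f. f \<in> H1 m \<Longrightarrow> (\<lambda>K. \<Sum>k<K. LINT y|U01. q k y * f y) \<longlonglongrightarrow> f t" by blast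
    have qL: "L2U (q k)" for k
    proof -
      obtain B where "\<And>y. \<bar>q k y\<bar> \<le> B" using q1[of k] by blast
      then show ?thesis using q1[of k] by (intro L2U_borel_bounded[of _ B]) auto
    qed
    have qe: "integrable U01 (\<lambda>y. q k y * E1 m a y)" for k a
      by (intro L2U_mult qL L2U_continuous H1_regular(1) E1_H1)
    have "(\<Sum>a<N. (LINT y|U01. q k y * E1 m a y)\<^sup>2) \<le> C * (1/2) ^ (k * (2*m-1))" for k N
    proof (rule sum_squares_functional_le[of "\<lambda>f. LINT y|U01. q k y * f y"])
      fix c
      have "(LINT y|U01. q k y * (\<Sum>a<N. c a * E1 m a y)) = (LINT y|U01. (\<Sum>a<N. c a * (q k y * E1 m a y)))"
        by (simp add: sum_distrib_left mult.left_commute)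
      also have "\<dots> = (\<Sum>a<N. c a * (LINT y|U01. q k y * E1 m a y))"
        using qe by (subst Bochner_Integration.integral_sum) auto
      finally show "(LINT y|U01. q k y * (\<Sum>a<N. c a * E1 m a y)) = (\<Sum>a<N. c a * (LINT y|U01. q k y * E1 m a y))" .
    qed (rule q2)
    then show "\<exists>q::nat \<Rightarrow> real \<Rightarrow> real.
      (\<forall>k. q k \<in> borel_measurable borel \<and> (\<exists>B. \<forall>y. \<bar>q k y\<bar> \<le> B) \<and> (LINT y|U01. (q k y)\<^sup>2) \<le> C * 2 ^ k) \<and>
      (\<forall>k N. (\<Sum>a<N. (LINT y|U01. q k y * E1 m a y)\<^sup>2) \<le> C * (1/2) ^ (k * (2*m-1))) \<and>
      (\<forall>a. (\<lambda>K. \<Sum>k<K. LINT y|U01. q k y * E1 m a y) \<longlonglongrightarrow> E1 m a t)"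
      using q1 q3[OF E1_H1] by blast
  qed
qed

text \<open>If an $\ell^2$ combination of the basis vanishes pointwise, then so do the limits of all the
  derivatives below order $m$ (by difference quotients, uniformly controlled by the Hoelder bound), and the
  derivatives of order $m$ tend weakly to zero in $L^2$.\<close>

lemma E1_expansion_unique:
  assumes c: "summable (\<lambda>k. (c k)\<^sup>2)" and z: "\<And>t. t \<in> {0..1} \<Longrightarrow> (\<lambda>N. \<Sum>k<N. c k * E1 m k t) \<longlonglongrightarrow> 0"
  shows "c j = 0"
proof -
  have "\<forall>k. \<exists>D. sob_witness m (E1 m k) D \<and> (LINT x|U01. D 0 x) = 0" using H1_witness[OF E1_H1 m] by metis
  then obtain E where E: "\<And>k. sob_witness m (E1 m k) (E k)" "\<And>k. (LINT x|U01. E k 0 x) = 0" by metis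
  define F where "F N t = (\<Sum>k<N. c k * E1 m k t)" for N t
  define D where "D N l t = (\<Sum>k<N. c k * E k l t)" for N l t
  have wD: "sob_witness m (F N) (D N)" for N unfolding F_def[abs_def] D_def[abs_def]
    by (rule sob_witness_sum) (use E m in auto)
  interpret Ek: sobolev_witness m "E1 m k" "E k" for k by unfold_locales (use E m in auto)
  interpret D: sobolev_witness m "F N" "D N" for N by unfold_locales (use wD m in auto)
  have D0: "(LINT x|U01. D N 0 x) = 0" for N
    unfolding D_def using Ek.int1[of 0] E(2) by (subst Bochner_Integration.integral_sum) auto
  have FH: "F N \<in> H1 m" for N by (rule H1_I[OF wD D0 m])
  have Fe: "inner1 m (F N) (E1 m k) = (if k < N then c k else 0)" for N k
  proof -
    have "inner1 m (F N) (E1 m k) = (\<Sum>j<N. c j * inner1 m (E1 m j) (E1 m k))"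
      unfolding F_def[abs_def] by (rule inner1_sum[OF E1_H1 m E1_H1])
    also have "\<dots> = (\<Sum>j<N. if j = k then c j else 0)" by (intro sum.cong refl) (simp add: E1_orth)
    finally show ?thesis by simp
  qed
  define B where "B = sqrt (\<Sum>k. (c k)\<^sup>2) + 1"
  have B: "0 < B" using suminf_nonneg[OF c] by (simp add: B_def add_nonneg_pos)
  have FN: "inner1 m (F N) (F N) \<le> B\<^sup>2" for N
  proof -
    have "inner1 m (F N) (F N) = (\<Sum>k<N. c k * inner1 m (E1 m k) (F N))"
      using inner1_sum[of "{..<N}" "E1 m" m "F N" c, OF E1_H1 m FH] by (simp add: F_def[abs_def])
    also have "\<dots> = (\<Sum>k<N. (c k)\<^sup>2)" using Fe by (simp add: inner1_commute[of m "E1 m _"] power2_eq_square)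
    also have "\<dots> \<le> (\<Sum>k. (c k)\<^sup>2)" by (rule sum_le_suminf[OF c]) auto
    also have "\<dots> = (sqrt (\<Sum>k. (c k)\<^sup>2))\<^sup>2" using suminf_nonneg[OF c] by simp
    also have "\<dots> \<le> B\<^sup>2" unfolding B_def by (rule power_mono) (use suminf_nonneg[OF c] in auto)
    finally show ?thesis .
  qed
  have FNs: "sqrt (inner1 m (F N) (F N)) \<le> B" for N using FN[of N] B by (simp add: real_le_lsqrt inner1_nonneg)
  define H where "H = (real m + 1) * B"
  have H: "0 < H" using B by (simp add: H_def)
  have hold: "\<bar>D N l y - D N l x\<bar> \<le> H * sqrt \<bar>y - x\<bar>" if "l < m" "x \<in> {0..1}" "y \<in> {0..1}" for N l x y
  proof -
    have "\<bar>D N l y - D N l x\<bar> \<le> (real m + 1) * sqrt (inner1 m (F N) (F N)) * sqrt \<bar>y - x\<bar>"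
      by (rule D.holder_bound[OF D0 that])
    also have "\<dots> \<le> (real m + 1) * B * sqrt \<bar>y - x\<bar>" using FNs by (intro mult_right_mono mult_left_mono) auto
    finally show ?thesis by (simp add: H_def)
  qed
  have lim: "(\<lambda>N. D N l t) \<longlonglongrightarrow> 0" if "l < m" "t \<in> {0..1}" for l t
    using that
  proof (induction l arbitrary: t)
    case 0
    then have "D N 0 t = (\<Sum>k<N. c k * E1 m k t)" for N using D.D0[of t N] by (simp add: F_def)
    then show ?case using z[OF 0(2)] by simp
  next
    case (Suc l)
    show ?case
    proof (rule LIMSEQ_I)
      fix \<epsilon> :: real assume e: "0 < \<epsilon>"
      \<comment> \<open>At distance \<open>h0\<close> the Hoelder modulus costs at most half of
        \<epsilon>; the cap 1/2 leaves room for a point \<open>s\<close> at that distance on one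
        side of \<open>t\<close>.\<close>
      define h0 where "h0 = min (1/2) ((\<epsilon> / (2 * H))\<^sup>2)"
      have h0: "0 < h0" "h0 \<le> 1/2" "sqrt h0 \<le> \<epsilon> / (2 * H)"
        using e H by (auto simp: h0_def intro!: real_le_lsqrt)
      define s where "s = (if t \<le> 1/2 then t + h0 else t - h0)"
      have s: "s \<in> {0..1}" "\<bar>s - t\<bar> = h0" using Suc.prems h0 by (auto simp: s_def)
      have l: "l < m" using Suc.prems by simp
      have "(\<lambda>N. D N l s - D N l t) \<longlonglongrightarrow> 0 - 0" by (intro tendsto_diff Suc.IH l s Suc.prems)
      then have "\<forall>\<^sub>F N in sequentially. norm (D N l s - D N l t - 0) < h0 * (\<epsilon> / 2)"
        using tendstoD[of "\<lambda>N. D N l s - D N l t" 0 sequentially "h0 * (\<epsilon> / 2)"] h0 e by (simp add: dist_real_def)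
      then obtain N0 where N0: "\<And>N. N \<ge> N0 \<Longrightarrow> \<bar>D N l s - D N l t\<bar> < h0 * (\<epsilon> / 2)" by (auto simp: eventually_sequentially)
      show "\<exists>no. \<forall>N\<ge>no. norm (D N (Suc l) t - 0) < \<epsilon>"
      proof (intro exI[of _ N0] allI impI)
        fix N assume N: "N \<ge> N0"
        let ?S = "closed_segment t s"
        have seg: "?S \<subseteq> {0..1}" "\<And>u. u \<in> ?S \<Longrightarrow> \<bar>u - t\<bar> \<le> h0"
          using s Suc.prems by (auto simp: closed_segment_eq_real_ivl split: if_splits)
        \<comment> \<open>The increment of \<open>?g\<close> measures how far the difference
          quotient over \<open>h0\<close> is from the derivative at \<open>t\<close>; its derivative
          is controlled by the Hoelder modulus uniformly in \<open>N\<close>.\<close>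
        let ?g = "\<lambda>u. D N l u - D N (Suc l) t * u"
        have "norm (?g s - ?g t) \<le> (H * sqrt h0) * norm (s - t)"
        proof (rule field_differentiable_bound[where f'="\<lambda>u. D N (Suc l) u - D N (Suc l) t" and S="?S"])
          fix u assume u: "u \<in> ?S"
          have "(D N l has_real_derivative D N (Suc l) u) (at u within ?S)"
            using D.deriv_everywhere[of l u N] u seg Suc.prems by (meson has_field_derivative_subset subsetD)
          then show "(?g has_field_derivative D N (Suc l) u - D N (Suc l) t) (at u within ?S)"
            by (auto intro!: derivative_eq_intros)
          have "\<bar>D N (Suc l) u - D N (Suc l) t\<bar> \<le> H * sqrt \<bar>u - t\<bar>" using hold Suc.prems seg u by auto
          also have "\<dots> \<le> H * sqrt h0" using H seg(2)[OF u] by (intro mult_left_mono) auto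
          finally show "norm (D N (Suc l) u - D N (Suc l) t) \<le> H * sqrt h0" by simp
        qed auto
        also have "\<dots> \<le> (\<epsilon> / 2) * h0"
        proof -
          have "H * sqrt h0 \<le> H * (\<epsilon> / (2 * H))" using h0 H by (intro mult_left_mono) auto
          then have "H * sqrt h0 \<le> \<epsilon> / 2" using H by simp
          then show ?thesis using s(2) h0 by (simp add: mult_right_mono)
        qed
        finally have g: "\<bar>(D N l s - D N l t) - D N (Suc l) t * (s - t)\<bar> \<le> h0 * (\<epsilon> / 2)" by (simp add: algebra_simps)
        have "\<bar>D N (Suc l) t * (s - t)\<bar> < h0 * (\<epsilon> / 2) + h0 * (\<epsilon> / 2)" using g N0[OF N] by linarith
        then have "h0 * \<bar>D N (Suc l) t\<bar> < h0 * \<epsilon>" using s(2) by (simp add: abs_mult mult.commute)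
        then show "norm (D N (Suc l) t - 0) < \<epsilon>" using h0 by simp
      qed
    qed
  qed
  have DmL: "L2U (D N m)" for N using D.meas[of m N] D.int2[of m N] by simp
  have Dm2: "(LINT x|U01. (D N m x)\<^sup>2) \<le> B\<^sup>2" for N using D.norm_parts_le(1)[of N] FN[of N] by simp
  have CS: "\<bar>LINT x|U01. D N m x * g x\<bar> \<le> B * sqrt (LINT x|U01. (g x)\<^sup>2)" if g: "L2U g" for N g
  proof -
    have "(LINT x|U01. D N m x * g x)\<^sup>2 \<le> (LINT x|U01. (D N m x)\<^sup>2) * (LINT x|U01. (g x)\<^sup>2)"
      by (rule integral_Cauchy_Schwarz) (use DmL g in auto)
    also have "\<dots> \<le> B\<^sup>2 * (LINT x|U01. (g x)\<^sup>2)" using Dm2 by (intro mult_right_mono) auto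
    finally have "\<bar>LINT x|U01. D N m x * g x\<bar> \<le> sqrt (B\<^sup>2 * (LINT x|U01. (g x)\<^sup>2))"
      by (metis real_sqrt_abs real_sqrt_le_iff)
    then show ?thesis using B by (simp add: real_sqrt_mult)
  qed
  have weak: "(\<lambda>N. LINT x|U01. D N m x * g x) \<longlonglongrightarrow> 0" if g: "L2U g" for g
  proof (rule L2U_induct[where P="\<lambda>g. (\<lambda>N. LINT x|U01. D N m x * g x) \<longlonglongrightarrow> 0", OF _ _ _ g])
    fix a :: real
    define b where "b = max 0 (min 1 a)"
    have b: "b \<in> {0..1}" by (auto simp: b_def)
    \<comment> \<open>Against a half line the top derivative integrates to an increment of the
      derivative of order \<open>m - 1\<close>, already known to tend to zero pointwise.\<close>
    have "(LINT x|U01. D N m x * indicator {..a} x) = (if a < 0 then 0 else D N (m - 1) b - D N (m - 1) 0)" for N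
    proof (cases "a < 0")
      case True
      have "(LINT x|U01. D N m x * indicator {..a} x) = (LINT x|U01. 0)"
        by (rule U01_integral_cong) (use True in auto)
      then show ?thesis using True by simp
    next
      case False
      have "(LINT x|U01. D N m x * indicator {..a} x) = (LINT x:{0..b}|lborel. D N m x)"
        unfolding set_integral_U01[symmetric] set_lebesgue_integral_def
        by (rule Bochner_Integration.integral_cong) (use False in \<open>auto simp: indicator_def b_def\<close>)
      also have "\<dots> = D N (m - 1) b - D N (m - 1) 0" using D.increment_eq[of "m - 1" 0 b N] b m by simp
      finally show ?thesis using False by simp
    qed
    moreover have "(\<lambda>N. D N (m - 1) b - D N (m - 1) 0) \<longlonglongrightarrow> 0 - 0"
      by (intro tendsto_diff lim) (use m b in auto)
    ultimately show "(\<lambda>N. LINT x|U01. D N m x * indicator {..a} x) \<longlonglongrightarrow> 0" by (cases "a < 0") auto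
  next
    fix f g a b assume fg: "L2U f" "L2U g" "(\<lambda>N. LINT x|U01. D N m x * f x) \<longlonglongrightarrow> 0" "(\<lambda>N. LINT x|U01. D N m x * g x) \<longlonglongrightarrow> 0"
    have "(LINT x|U01. D N m x * (a * f x + b * g x)) = a * (LINT x|U01. D N m x * f x) + b * (LINT x|U01. D N m x * g x)" for N
    proof -
      have "(LINT x|U01. D N m x * (a * f x + b * g x)) = (LINT x|U01. a * (D N m x * f x) + b * (D N m x * g x))"
        by (simp add: algebra_simps)
      then show ?thesis using L2U_mult[OF DmL fg(1)] L2U_mult[OF DmL fg(2)] by simp
    qed
    moreover have "(\<lambda>N. a * (LINT x|U01. D N m x * f x) + b * (LINT x|U01. D N m x * g x)) \<longlonglongrightarrow> a * 0 + b * 0"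
      by (intro tendsto_intros fg)
    ultimately show "(\<lambda>N. LINT x|U01. D N m x * (a * f x + b * g x)) \<longlonglongrightarrow> 0" by simp
  next
    fix f s assume f: "L2U f" and s: "\<And>i::nat. L2U (s i)" "\<And>i. (\<lambda>N. LINT x|U01. D N m x * s i x) \<longlonglongrightarrow> 0"
      "(\<lambda>i. LINT x|U01. (f x - s i x)\<^sup>2) \<longlonglongrightarrow> 0"
    show "(\<lambda>N. LINT x|U01. D N m x * f x) \<longlonglongrightarrow> 0"
    proof (rule LIMSEQ_I)
      fix \<epsilon> :: real assume e: "0 < \<epsilon>"
      have "\<forall>\<^sub>F i in sequentially. (LINT x|U01. (f x - s i x)\<^sup>2) < (\<epsilon> / (2 * B))\<^sup>2"
        using s(3) e B by (intro order_tendstoD(2)) auto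
      then obtain i where i: "(LINT x|U01. (f x - s i x)\<^sup>2) < (\<epsilon> / (2 * B))\<^sup>2" by (auto simp: eventually_sequentially)
      then have "sqrt (LINT x|U01. (f x - s i x)\<^sup>2) < sqrt ((\<epsilon> / (2 * B))\<^sup>2)" by (rule real_sqrt_less_mono)
      then have sq: "B * sqrt (LINT x|U01. (f x - s i x)\<^sup>2) < \<epsilon> / 2" using e B by (simp add: pos_less_divide_eq mult.commute mult.left_commute)
      obtain N0 where N0: "\<And>N. N \<ge> N0 \<Longrightarrow> \<bar>LINT x|U01. D N m x * s i x\<bar> < \<epsilon> / 2"
        using LIMSEQ_D[OF s(2)[of i], of "\<epsilon>/2"] e by auto
      show "\<exists>no. \<forall>N\<ge>no. norm ((LINT x|U01. D N m x * f x) - 0) < \<epsilon>"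
      proof (intro exI[of _ N0] allI impI)
        fix N assume "N \<ge> N0"
        have "(LINT x|U01. D N m x * f x) = (LINT x|U01. D N m x * (f x - s i x)) + (LINT x|U01. D N m x * s i x)"
          using L2U_mult[OF DmL f, of N] L2U_mult[OF DmL s(1), of N i] by (simp add: right_diff_distrib)
        then show "norm ((LINT x|U01. D N m x * f x) - 0) < \<epsilon>"
          using CS[OF L2U_diff[OF f s(1)], of N i] sq N0[OF \<open>N \<ge> N0\<close>] by simp
      qed
    qed
  qed
  \<comment> \<open>The same inner product equals \<open>c j\<close> as soon as \<open>N\<close>
    exceeds \<open>j\<close>, so the limit zero obtained here forces the coefficient to
    vanish.\<close>
  have "(\<lambda>N. inner1 m (F N) (E1 m j)) \<longlonglongrightarrow> (\<Sum>l=1..m-1. 0 * (LINT x|U01. E j l x)) + 0"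
    unfolding inner1_eq[OF wD E(1) m]
  proof (intro tendsto_add tendsto_sum tendsto_mult tendsto_const)
    show "(\<lambda>N. LINT x|U01. D N m x * E j m x) \<longlonglongrightarrow> 0" by (rule weak) (use Ek.meas Ek.int2 in auto)
    fix l assume l: "l \<in> {1..m-1}"
    have "(LINT x|U01. D N l x) = D N (l - 1) 1 - D N (l - 1) 0" for N
      using D.integral_eq_increment[of "l - 1" N] l by auto
    moreover have "(\<lambda>N. D N (l - 1) 1 - D N (l - 1) 0) \<longlonglongrightarrow> 0 - 0" by (intro tendsto_diff lim) (use l in auto)
    ultimately show "(\<lambda>N. LINT x|U01. D N l x) \<longlonglongrightarrow> 0" by simp
  qed
  then have "(\<lambda>N. inner1 m (F N) (E1 m j)) \<longlonglongrightarrow> 0" by simp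
  moreover have "(\<lambda>N. inner1 m (F N) (E1 m j)) \<longlonglongrightarrow> c j"
    by (rule Lim_transform_eventually[OF tendsto_const]) (auto simp: Fe eventually_sequentially intro!: exI[of _ "Suc j"])
  ultimately show ?thesis by (metis LIMSEQ_unique)
qed

end

section \<open>Square summable families\<close>

abbreviation l2_on :: "'a set \<Rightarrow> ('a \<Rightarrow> real) \<Rightarrow> bool" where
  "l2_on A c \<equiv> (\<lambda>\<alpha>. (c \<alpha>)\<^sup>2) summable_on A"

lemma l2_mult_summable:
  assumes "l2_on A c" "l2_on A d" shows "(\<lambda>\<alpha>. c \<alpha> * d \<alpha>) summable_on A"
proof -
  have s: "(\<lambda>\<alpha>. (c \<alpha>)\<^sup>2 + (d \<alpha>)\<^sup>2) summable_on A" using assms by (rule summable_on_add)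
  have "(\<lambda>\<alpha>. norm (c \<alpha> * d \<alpha>)) summable_on A"
  proof (rule summable_on_comparison_test[OF s])
    fix x
    have "\<bar>a * b\<bar> \<le> a\<^sup>2 + b\<^sup>2" for a b :: real
    proof -
      have "0 \<le> (\<bar>a\<bar> - \<bar>b\<bar>)\<^sup>2" by simp
      then have "2 * (\<bar>a\<bar> * \<bar>b\<bar>) \<le> a\<^sup>2 + b\<^sup>2" by (simp add: power2_eq_square algebra_simps)
      moreover have "0 \<le> \<bar>a\<bar> * \<bar>b\<bar>" by simp
      ultimately show ?thesis unfolding abs_mult by linarith
    qed
    then show "norm (c x * d x) \<le> (c x)\<^sup>2 + (d x)\<^sup>2" by simp
  qed simp
  then show ?thesis by (rule abs_summable_summable)
qed

lemma l2_lincomb: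
  assumes "l2_on A c" "l2_on A d" shows "l2_on A (\<lambda>\<alpha>. a * c \<alpha> + b * d \<alpha>)"
proof -
  have "(\<lambda>\<alpha>. a\<^sup>2 * (c \<alpha>)\<^sup>2 + 2 * a * b * (c \<alpha> * d \<alpha>) + b\<^sup>2 * (d \<alpha>)\<^sup>2) summable_on A"
    using assms l2_mult_summable[OF assms] by (intro summable_on_add summable_on_cmult_right)
  then show ?thesis by (simp add: power2_eq_square algebra_simps)
qed

lemma l2_bounded_partial:
  assumes "\<And>F. finite F \<Longrightarrow> F \<subseteq> A \<Longrightarrow> (\<Sum>\<alpha>\<in>F. (c \<alpha>)\<^sup>2) \<le> (K::real)" shows "l2_on A c" "infsum (\<lambda>\<alpha>. (c \<alpha>)\<^sup>2) A \<le> K"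
proof -
  show s: "l2_on A c"
    by (rule nonneg_bdd_above_summable_on) (use assms in \<open>auto intro!: bdd_aboveI2[of _ _ K]\<close>)
  show "infsum (\<lambda>\<alpha>. (c \<alpha>)\<^sup>2) A \<le> K" by (rule infsum_le_finite_sums[OF s assms])
qed

section \<open>The tensor product spaces\<close>

definition tensor_basis :: "nat \<Rightarrow> nat set \<Rightarrow> (nat \<Rightarrow> nat) \<Rightarrow> (nat \<Rightarrow> real) \<Rightarrow> real" where
  "tensor_basis m S \<alpha> x = (\<Prod>j\<in>S. E1 m (\<alpha> j) (x j))"

definition idx_box :: "nat set \<Rightarrow> nat \<Rightarrow> (nat \<Rightarrow> nat) set" where
  "idx_box S N = PiE S (\<lambda>_. {..<N})"

lemma finite_idx_box: "finite S \<Longrightarrow> finite (idx_box S N)"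
  unfolding idx_box_def by (intro finite_PiE) auto

lemma idx_box_subset: "idx_box S N \<subseteq> multi_idx S"
  by (auto simp: idx_box_def multi_idx_def PiE_iff)

lemma finite_subset_idx_box:
  assumes "finite S" "finite F" "F \<subseteq> multi_idx S"
  obtains N where "\<And>n. N \<le> n \<Longrightarrow> F \<subseteq> idx_box S n"
proof -
  define N where "N = Suc (\<Sum>\<alpha>\<in>F. \<Sum>j\<in>S. \<alpha> j)"
  show thesis
  proof (rule that[of N], rule subsetI)
    fix n \<alpha> assume n: "N \<le> n" and a: "\<alpha> \<in> F"
    have "\<alpha> j < n" if "j \<in> S" for j
    proof -
      have "\<alpha> j \<le> (\<Sum>j\<in>S. \<alpha> j)" using assms that by (intro member_le_sum) auto
      also have "\<dots> \<le> (\<Sum>\<alpha>\<in>F. \<Sum>j\<in>S. \<alpha> j)" by (rule member_le_sum[of \<alpha> F "\<lambda>\<alpha>. \<Sum>j\<in>S. \<alpha> j"]) (use a assms in auto)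
      finally show ?thesis using n by (simp add: N_def)
    qed
    then show "\<alpha> \<in> idx_box S n" using a assms(3) by (auto simp: idx_box_def multi_idx_def PiE_iff)
  qed
qed

text \<open>The boxes eventually contain every finite set of indices, so unordered sums become
  sequential limits, the form in which dominated convergence and measurability of limits
  apply.\<close>

lemma has_sum_idx_box_limit:
  assumes S: "finite S" and h: "(f has_sum (L::real)) (multi_idx S)"
  shows "(\<lambda>N. \<Sum>\<alpha>\<in>idx_box S N. f \<alpha>) \<longlonglongrightarrow> L"
proof -
  have "filterlim (idx_box S) (finite_subsets_at_top (multi_idx S)) sequentially"
    unfolding filterlim_finite_subsets_at_top
  proof (intro allI impI)
    fix F :: "(nat \<Rightarrow> nat) set" assume "finite F \<and> F \<subseteq> multi_idx S"
    then obtain N where "\<And>n. N \<le> n \<Longrightarrow> F \<subseteq> idx_box S n" using finite_subset_idx_box[OF S] by metis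
    then show "\<forall>\<^sub>F n in sequentially. finite (idx_box S n) \<and> F \<subseteq> idx_box S n \<and> idx_box S n \<subseteq> multi_idx S"
      using finite_idx_box[OF S] idx_box_subset by (auto simp: eventually_sequentially)
  qed
  with h show ?thesis unfolding has_sum_def by (rule filterlim_compose)
qed

lemma cube_memD: "x \<in> cube S \<Longrightarrow> j \<in> S \<Longrightarrow> x j \<in> {0..1}"
  by (auto simp: cube_def PiE_iff)

lemma space_PiM_U01: "space (PiM S (\<lambda>_. U01)) = cube S"
  by (simp add: space_PiM cube_def space_U01)

context
  fixes m :: nat
  assumes m: "0 < m"
begin

abbreviation (input) "KB S \<equiv> ((real m + 1)\<^sup>2) ^ card S"

text \<open>Sums of products over a box factorize; every passage from one variable to the tensor
  product goes through this identity.\<close>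

lemma sum_tensor_basis_box:
  assumes "finite S"
  shows "(\<Sum>\<alpha>\<in>idx_box S N. \<Prod>j\<in>S. g j (\<alpha> j)) = (\<Prod>j\<in>S. \<Sum>a<N. (g j a :: real))"
  unfolding idx_box_def using assms by (subst prod_sum_PiE) auto

lemma sum_tensor_basis_square_le:
  assumes S: "finite S" and x: "x \<in> cube S" and F: "finite F" "F \<subseteq> multi_idx S"
  shows "(\<Sum>\<alpha>\<in>F. (tensor_basis m S \<alpha> x)\<^sup>2) \<le> KB S"
proof -
  obtain N where N: "\<And>n. N \<le> n \<Longrightarrow> F \<subseteq> idx_box S n" using finite_subset_idx_box[OF S F] by metis
  have "(\<Sum>\<alpha>\<in>F. (tensor_basis m S \<alpha> x)\<^sup>2) \<le> (\<Sum>\<alpha>\<in>idx_box S N. (tensor_basis m S \<alpha> x)\<^sup>2)"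
    by (rule sum_mono2) (use N finite_idx_box[OF S] in auto)
  also have "\<dots> = (\<Prod>j\<in>S. \<Sum>a<N. (E1 m a (x j))\<^sup>2)"
    unfolding tensor_basis_def prod_power_distrib by (rule sum_tensor_basis_box[OF S])
  also have "\<dots> \<le> (\<Prod>j\<in>S. (real m + 1)\<^sup>2)"
    by (rule prod_mono) (use E1_kernel_bound[OF m] cube_memD[OF x] in \<open>auto intro: sum_nonneg\<close>)
  finally show ?thesis by simp
qed

lemma tensor_basis_l2:
  assumes "finite S" "x \<in> cube S"
  shows "l2_on (multi_idx S) (\<lambda>\<alpha>. tensor_basis m S \<alpha> x)" "infsum (\<lambda>\<alpha>. (tensor_basis m S \<alpha> x)\<^sup>2) (multi_idx S) \<le> KB S"
  using l2_bounded_partial[OF sum_tensor_basis_square_le[OF assms]] by auto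

lemma partial_tensor_sum_le:
  assumes S: "finite S" and x: "x \<in> cube S" and F: "finite F" "F \<subseteq> multi_idx S" and c: "l2_on (multi_idx S) c"
  shows "(\<Sum>\<alpha>\<in>F. c \<alpha> * tensor_basis m S \<alpha> x)\<^sup>2 \<le> infsum (\<lambda>\<alpha>. (c \<alpha>)\<^sup>2) (multi_idx S) * KB S"
proof -
  have "(\<Sum>\<alpha>\<in>F. c \<alpha> * tensor_basis m S \<alpha> x)\<^sup>2 \<le> (\<Sum>\<alpha>\<in>F. (c \<alpha>)\<^sup>2) * (\<Sum>\<alpha>\<in>F. (tensor_basis m S \<alpha> x)\<^sup>2)"
    by (rule Cauchy_Schwarz_ineq_sum)
  also have "\<dots> \<le> infsum (\<lambda>\<alpha>. (c \<alpha>)\<^sup>2) (multi_idx S) * KB S"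
    by (intro mult_mono sum_tensor_basis_square_le[OF S x F] finite_sum_le_infsum[OF c F] infsum_nonneg sum_nonneg) auto
  finally show ?thesis .
qed

lemma tensor_repI:
  assumes S: "finite S" and c: "l2_on (multi_idx S) c"
    and f: "\<And>x. x \<in> cube S \<Longrightarrow> f x = infsum (\<lambda>\<alpha>. c \<alpha> * tensor_basis m S \<alpha> x) (multi_idx S)"
  shows "tensor_rep m S f c"
  unfolding tensor_rep_def tensor_basis_def[symmetric]
  using c f l2_mult_summable[OF c tensor_basis_l2(1)[OF S]] by (auto intro: has_sum_infsum)

lemma tensor_repD:
  assumes "tensor_rep m S f c"
  shows "l2_on (multi_idx S) c" "x \<in> cube S \<Longrightarrow> ((\<lambda>\<alpha>. c \<alpha> * tensor_basis m S \<alpha> x) has_sum f x) (multi_idx S)"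
  using assms by (auto simp: tensor_rep_def tensor_basis_def)

lemma tensor_rep_box_limit:
  assumes "finite S" "tensor_rep m S f c" "x \<in> cube S"
  shows "(\<lambda>N. \<Sum>\<alpha>\<in>idx_box S N. c \<alpha> * tensor_basis m S \<alpha> x) \<longlonglongrightarrow> f x"
  by (rule has_sum_idx_box_limit[OF assms(1) tensor_repD(2)[OF assms(2,3)]])

lemma tensor_rep_bound:
  assumes S: "finite S" and f: "tensor_rep m S f c" and x: "x \<in> cube S"
  shows "(f x)\<^sup>2 \<le> infsum (\<lambda>\<alpha>. (c \<alpha>)\<^sup>2) (multi_idx S) * KB S"
proof (rule LIMSEQ_le_const2)
  show "(\<lambda>N. (\<Sum>\<alpha>\<in>idx_box S N. c \<alpha> * tensor_basis m S \<alpha> x)\<^sup>2) \<longlonglongrightarrow> (f x)\<^sup>2"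
    by (intro tendsto_power tensor_rep_box_limit[OF assms])
  show "\<exists>N. \<forall>n\<ge>N. (\<Sum>\<alpha>\<in>idx_box S n. c \<alpha> * tensor_basis m S \<alpha> x)\<^sup>2 \<le> infsum (\<lambda>\<alpha>. (c \<alpha>)\<^sup>2) (multi_idx S) * KB S"
    using partial_tensor_sum_le[OF S x finite_idx_box[OF S] idx_box_subset tensor_repD(1)[OF f]] by blast
qed

lemma tensor_rep_lincomb:
  assumes "tensor_rep m S f c" "tensor_rep m S g d"
  shows "tensor_rep m S (\<lambda>x. a * f x + b * g x) (\<lambda>\<alpha>. a * c \<alpha> + b * d \<alpha>)"
  unfolding tensor_rep_def tensor_basis_def[symmetric]
proof (intro conjI ballI)
  show "l2_on (multi_idx S) (\<lambda>\<alpha>. a * c \<alpha> + b * d \<alpha>)" by (rule l2_lincomb[OF tensor_repD(1)[OF assms(1)] tensor_repD(1)[OF assms(2)]])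
  fix x assume x: "x \<in> cube S"
  have "((\<lambda>\<alpha>. a * (c \<alpha> * tensor_basis m S \<alpha> x) + b * (d \<alpha> * tensor_basis m S \<alpha> x)) has_sum a * f x + b * g x) (multi_idx S)"
    by (intro has_sum_add has_sum_cmult_right tensor_repD(2)[OF assms(1) x] tensor_repD(2)[OF assms(2) x])
  then show "((\<lambda>\<alpha>. (a * c \<alpha> + b * d \<alpha>) * tensor_basis m S \<alpha> x) has_sum a * f x + b * g x) (multi_idx S)"
    by (simp add: algebra_simps)
qed

lemma multi_idx_insert: "multi_idx (insert j S) = (\<lambda>(k, \<alpha>). \<alpha>(j := k)) ` (UNIV \<times> multi_idx S)"
  unfolding multi_idx_def by (rule PiE_insert_eq)

lemma tensor_basis_insert:
  assumes "finite S" "j \<notin> S"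
  shows "tensor_basis m (insert j S) (\<alpha>(j := k)) (x(j := t)) = E1 m k t * tensor_basis m S \<alpha> x"
proof -
  have "(\<Prod>i\<in>S. E1 m ((\<alpha>(j := k)) i) ((x(j := t)) i)) = (\<Prod>i\<in>S. E1 m (\<alpha> i) (x i))"
    by (rule prod.cong) (use assms in auto)
  then show ?thesis using assms by (simp add: tensor_basis_def)
qed

text \<open>Injectivity of the coefficient map, by induction on the number of factors: a vanishing expansion in
  the new variable has vanishing coefficients, and these are expansions in the remaining variables.\<close>

lemma tensor_rep_zero:
  assumes "finite S"
  shows "tensor_rep m S (\<lambda>_. 0) c \<Longrightarrow> \<alpha> \<in> multi_idx S \<Longrightarrow> c \<alpha> = 0"
  using assms
proof (induction S arbitrary: c \<alpha> rule: finite_induct)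
  case empty
  have s: "multi_idx {} = {\<lambda>_. undefined}" "cube {} = {\<lambda>_. undefined}" by (auto simp: multi_idx_def cube_def)
  have "((\<lambda>\<alpha>. c \<alpha> * tensor_basis m {} \<alpha> (\<lambda>_. undefined)) has_sum 0) (multi_idx {})"
    by (rule tensor_repD(2)[OF empty(1)]) (simp add: s)
  then have "((\<lambda>\<alpha>. c \<alpha>) has_sum 0) {\<lambda>_. undefined}" by (simp add: s tensor_basis_def)
  then have "c (\<lambda>_. undefined) = 0" using has_sum_finite[of "{\<lambda>_. undefined}" c] has_sum_unique by fastforce
  then show ?case using empty(2) by (simp add: s)
next
  case (insert j S)
  let ?h = "\<lambda>(k, \<alpha>). \<alpha>(j := k)"
  have inj: "inj_on ?h (UNIV \<times> multi_idx S)" unfolding multi_idx_def by (rule inj_combinator[OF insert(2)])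
  define d where "d k \<alpha> = c (\<alpha>(j := k))" for k \<alpha>
  have "((\<lambda>\<alpha>. (c \<alpha>)\<^sup>2) \<circ> ?h) summable_on (UNIV \<times> multi_idx S)"
    using tensor_repD(1)[OF insert(4)] unfolding multi_idx_insert by (subst summable_on_reindex[OF inj, symmetric])
  then have l2: "(\<lambda>(k,\<alpha>). (d k \<alpha>)\<^sup>2) summable_on (UNIV \<times> multi_idx S)"
    by (simp add: d_def o_def case_prod_unfold)
  have l2k: "l2_on (multi_idx S) (d k)" for k
    using summable_on_SigmaD1[OF l2, of k] by simp
  have l2s: "(\<lambda>k. infsum (\<lambda>\<alpha>. (d k \<alpha>)\<^sup>2) (multi_idx S)) summable_on UNIV"
    using summable_on_Sigma_banach[OF l2] by simp
  have zero: "infsum (\<lambda>\<alpha>. d k \<alpha> * tensor_basis m S \<alpha> x) (multi_idx S) = 0" if x: "x \<in> cube S" for k x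
  proof -
    \<comment> \<open>The coefficient of the k-th basis function in the new coordinate, the other
      coordinates being frozen at \<open>x\<close>. Its square is bounded by the square sum of the
      k-th slice, so these coefficients are again square summable.\<close>
    define g where "g k = infsum (\<lambda>\<alpha>. d k \<alpha> * tensor_basis m S \<alpha> x) (multi_idx S)" for k
    have hg: "((\<lambda>\<alpha>. d k \<alpha> * tensor_basis m S \<alpha> x) has_sum g k) (multi_idx S)" for k
      unfolding g_def by (rule has_sum_infsum[OF l2_mult_summable[OF l2k tensor_basis_l2(1)[OF insert(1) x]]])
    have gb: "(g k)\<^sup>2 \<le> infsum (\<lambda>\<alpha>. (d k \<alpha>)\<^sup>2) (multi_idx S) * KB S" for k
      by (rule tensor_rep_bound[OF insert(1) _ x, where f="\<lambda>x. infsum (\<lambda>\<alpha>. d k \<alpha> * tensor_basis m S \<alpha> x) (multi_idx S)" , folded g_def])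
         (rule tensor_repI[OF insert(1) l2k], simp)
    have "g k = 0" for k
    proof (rule E1_expansion_unique[OF m])
      have "(\<lambda>k. infsum (\<lambda>\<alpha>. (d k \<alpha>)\<^sup>2) (multi_idx S) * KB S) summable_on UNIV"
        by (rule summable_on_cmult_left[OF l2s])
      then have "summable (\<lambda>k. infsum (\<lambda>\<alpha>. (d k \<alpha>)\<^sup>2) (multi_idx S) * KB S)" by (rule summable_on_imp_summable)
      then show "summable (\<lambda>k. (g k)\<^sup>2)" by (rule summable_comparison_test') (use gb in auto)
      fix t :: real assume t: "t \<in> {0..1}"
      have xc: "x(j := t) \<in> cube (insert j S)" using x t by (auto simp: cube_def PiE_iff extensional_def)
      have "((\<lambda>\<alpha>. c \<alpha> * tensor_basis m (insert j S) \<alpha> (x(j := t))) has_sum 0) (?h ` (UNIV \<times> multi_idx S))"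
        using tensor_repD(2)[OF insert(4) xc] unfolding multi_idx_insert .
      then have "((\<lambda>\<alpha>. c \<alpha> * tensor_basis m (insert j S) \<alpha> (x(j := t))) \<circ> ?h has_sum 0) (UNIV \<times> multi_idx S)"
        by (simp only: has_sum_reindex[OF inj])
      moreover have "(\<lambda>\<alpha>. c \<alpha> * tensor_basis m (insert j S) \<alpha> (x(j := t))) \<circ> ?h = (\<lambda>(k,\<alpha>). E1 m k t * (d k \<alpha> * tensor_basis m S \<alpha> x))"
        by (auto simp: fun_eq_iff d_def tensor_basis_insert[OF insert(1,2)])
      ultimately have hs: "((\<lambda>(k,\<alpha>). E1 m k t * (d k \<alpha> * tensor_basis m S \<alpha> x)) has_sum 0) (UNIV \<times> multi_idx S)" by simp
      have "((\<lambda>k. E1 m k t * g k) has_sum 0) UNIV"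
        by (rule has_sum_SigmaD[OF hs]) (simp add: has_sum_cmult_right[OF hg])
      then have "(\<lambda>k. E1 m k t * g k) sums 0" by (rule has_sum_imp_sums)
      then show "(\<lambda>N. \<Sum>k<N. g k * E1 m k t) \<longlonglongrightarrow> 0" by (simp add: sums_def mult.commute)
    qed
    then show ?thesis by (simp add: g_def)
  qed
  obtain k \<beta> where kb: "\<beta> \<in> multi_idx S" "\<alpha> = \<beta>(j := k)" using insert(5) unfolding multi_idx_insert by auto
  have "tensor_rep m S (\<lambda>_. 0) (d k)" by (rule tensor_repI[OF insert(1) l2k]) (use zero in simp)
  then have "d k \<beta> = 0" using insert.IH kb(1) by blast
  then show ?case unfolding d_def kb(2) .
qed

lemma tensor_rep_unique:
  assumes "finite S" "tensor_rep m S f c" "tensor_rep m S f d" "\<alpha> \<in> multi_idx S"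
  shows "c \<alpha> = d \<alpha>"
  using tensor_rep_zero[OF assms(1) _ assms(4)] tensor_rep_lincomb[OF assms(2,3), of 1 "-1"] by force

lemma coefS_rep: "f \<in> HS m S \<Longrightarrow> tensor_rep m S f (coefS m S f)"
  using someI_ex[of "\<lambda>c. tensor_rep m S f c"] unfolding HS_def coefS_def by simp

text \<open>Injectivity of the coefficient map makes \<open>JS\<close>, defined through chosen
  coefficients, computable from any representation.\<close>

lemma JS_eq:
  assumes "finite S" "tensor_rep m S f c" "tensor_rep m S g d"
  shows "JS m S f g = infsum (\<lambda>\<alpha>. c \<alpha> * d \<alpha>) (multi_idx S)"
proof -
  have fg: "f \<in> HS m S" "g \<in> HS m S" using assms by (auto simp: HS_def)
  show ?thesis unfolding JS_def
    by (rule infsum_cong) (simp add: tensor_rep_unique[OF assms(1) coefS_rep[OF fg(1)] assms(2)]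
        tensor_rep_unique[OF assms(1) coefS_rep[OF fg(2)] assms(3)])
qed

lemma HS_lincomb: "f \<in> HS m S \<Longrightarrow> g \<in> HS m S \<Longrightarrow> (\<lambda>x. a * f x + b * g x) \<in> HS m S"
  unfolding HS_def using tensor_rep_lincomb by blast

lemma JS_commute: "JS m S f g = JS m S g f"
  by (simp add: JS_def mult.commute)

lemma JS_lincomb:
  assumes S: "finite S" and f: "f \<in> HS m S" and g: "g \<in> HS m S" and h: "h \<in> HS m S"
  shows "JS m S (\<lambda>x. a * f x + b * g x) h = a * JS m S f h + b * JS m S g h"
proof -
  note r = coefS_rep[OF f] coefS_rep[OF g] coefS_rep[OF h]
  have s: "(\<lambda>\<alpha>. coefS m S f \<alpha> * coefS m S h \<alpha>) summable_on multi_idx S" "(\<lambda>\<alpha>. coefS m S g \<alpha> * coefS m S h \<alpha>) summable_on multi_idx S"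
    by (rule l2_mult_summable[OF tensor_repD(1) tensor_repD(1)]; rule r)+
  have "JS m S (\<lambda>x. a * f x + b * g x) h = infsum (\<lambda>\<alpha>. a * (coefS m S f \<alpha> * coefS m S h \<alpha>) + b * (coefS m S g \<alpha> * coefS m S h \<alpha>)) (multi_idx S)"
    unfolding JS_eq[OF S tensor_rep_lincomb[OF r(1,2)] r(3)] by (simp add: algebra_simps)
  also have "\<dots> = a * JS m S f h + b * JS m S g h"
    unfolding JS_def using s by (subst infsum_add) (auto intro: summable_on_cmult_right simp: infsum_cmult_right)
  finally show ?thesis .
qed

lemma JS_nonneg: "0 \<le> JS m S f f"
  unfolding JS_def by (rule infsum_nonneg) simp

lemma HS_bound:
  assumes "finite S" "f \<in> HS m S" "x \<in> cube S"
  shows "(f x)\<^sup>2 \<le> JS m S f f * KB S"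
  using tensor_rep_bound[OF assms(1) coefS_rep[OF assms(2)] assms(3)] by (simp add: JS_def power2_eq_square)

lemma HS_zero: "(\<lambda>_. 0) \<in> HS m S"
proof -
  have "tensor_rep m S (\<lambda>_. 0) (\<lambda>_. 0)" by (auto simp: tensor_rep_def)
  then show ?thesis by (auto simp: HS_def)
qed

lemma HS_sum: "(\<And>i. i \<in> I \<Longrightarrow> f i \<in> HS m S) \<Longrightarrow> (\<lambda>x. \<Sum>i\<in>I. c i * f i x) \<in> HS m S"
proof (induction I rule: infinite_finite_induct)
  case (insert i I)
  then show ?case using HS_lincomb[of "f i" S "\<lambda>x. \<Sum>i\<in>I. c i * f i x" "c i" 1] by simp
qed (auto simp: HS_zero)

lemma JS_sum:
  assumes S: "finite S" and f: "\<And>i. i \<in> I \<Longrightarrow> f i \<in> HS m S" and h: "h \<in> HS m S"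
  shows "JS m S (\<lambda>x. \<Sum>i\<in>I. c i * f i x) h = (\<Sum>i\<in>I. c i * JS m S (f i) h)"
  using f
proof (induction I rule: infinite_finite_induct)
  case (insert i I)
  then show ?case using JS_lincomb[OF S, of "f i" "\<lambda>x. \<Sum>i\<in>I. c i * f i x" h "c i" 1] HS_sum[of I f S c] h by simp
next
  case (infinite I)
  then show ?case using JS_lincomb[OF S HS_zero HS_zero h, of 0 0] by simp
next
  case empty
  then show ?case using JS_lincomb[OF S HS_zero HS_zero h, of 0 0] by simp
qed

lemma E1_measurable: "E1 m k \<in> borel_measurable U01"
  by (rule continuous_measurable_U01[OF H1_regular(1)[OF m E1_H1[OF m]]])

lemma tensor_basis_measurable:
  assumes S: "finite S" and X: "X \<in> measurable M (PiM S (\<lambda>_. U01))"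
  shows "(\<lambda>\<omega>. tensor_basis m S \<alpha> (X \<omega>)) \<in> borel_measurable M"
  unfolding tensor_basis_def
proof (rule borel_measurable_prod)
  fix j assume j: "j \<in> S"
  have "(\<lambda>\<omega>. X \<omega> j) \<in> measurable M U01"
    using measurable_compose[OF X measurable_component_singleton[OF j, of "\<lambda>_. U01"]] .
  then show "(\<lambda>\<omega>. E1 m (\<alpha> j) (X \<omega> j)) \<in> borel_measurable M" by (rule measurable_compose[OF _ E1_measurable])
qed

lemma HS_measurable:
  assumes S: "finite S" and f: "f \<in> HS m S"
  shows "f \<in> borel_measurable (PiM S (\<lambda>_. U01))"
proof (rule borel_measurable_LIMSEQ_real)
  show "(\<lambda>N. \<Sum>\<alpha>\<in>idx_box S N. coefS m S f \<alpha> * tensor_basis m S \<alpha> x) \<longlonglongrightarrow> f x" if "x \<in> space (PiM S (\<lambda>_. U01))" for x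
    using tensor_rep_box_limit[OF S coefS_rep[OF f]] that by (simp add: space_PiM_U01)
  show "(\<lambda>x. \<Sum>\<alpha>\<in>idx_box S N. coefS m S f \<alpha> * tensor_basis m S \<alpha> x) \<in> borel_measurable (PiM S (\<lambda>_. U01))" for N
    by (intro borel_measurable_sum borel_measurable_times borel_measurable_const tensor_basis_measurable[OF S] measurable_ident_sets refl)
qed

text \<open>Every basis function has mean zero in each coordinate, and dominated convergence along
  the boxes passes this to the expansion. It is the source of the orthogonality between
  components.\<close>

lemma HS_integral_coordinate:
  assumes S: "finite S" and f: "f \<in> HS m S" and j: "j \<in> S" and x: "x \<in> cube (S - {j})"
  shows "(LINT t|U01. f (x(j := t))) = 0"
proof -
  let ?c = "coefS m S f"
  have rep: "tensor_rep m S f ?c" by (rule coefS_rep[OF f])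
  have xc: "x(j := t) \<in> cube S" if "t \<in> {0..1}" for t
    using x that j by (auto simp: cube_def PiE_iff extensional_def)
  have tb: "tensor_basis m S \<alpha> (x(j := t)) = E1 m (\<alpha> j) t * tensor_basis m (S - {j}) \<alpha> x" for \<alpha> t
    using tensor_basis_insert[of "S - {j}" j \<alpha> "\<alpha> j" x t] S j by (simp add: insert_absorb)
  let ?K = "infsum (\<lambda>\<alpha>. (?c \<alpha>)\<^sup>2) (multi_idx S) * KB S"
  have "(\<lambda>N. LINT t|U01. (\<Sum>\<alpha>\<in>idx_box S N. ?c \<alpha> * tensor_basis m S \<alpha> (x(j := t)))) \<longlonglongrightarrow> (LINT t|U01. f (x(j := t)))"
  proof (rule integral_dominated_convergence[where w="\<lambda>_. sqrt ?K"])
    show me: "(\<lambda>t. \<Sum>\<alpha>\<in>idx_box S N. ?c \<alpha> * tensor_basis m S \<alpha> (x(j := t))) \<in> borel_measurable U01" for N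
      unfolding tb using E1_measurable by measurable
    show lim: "AE t in U01. (\<lambda>N. \<Sum>\<alpha>\<in>idx_box S N. ?c \<alpha> * tensor_basis m S \<alpha> (x(j := t))) \<longlonglongrightarrow> f (x(j := t))"
      by (rule AE_I2) (use tensor_rep_box_limit[OF S rep] xc in \<open>auto simp: space_U01\<close>)
    show "(\<lambda>t. f (x(j := t))) \<in> borel_measurable U01"
    proof (rule borel_measurable_LIMSEQ_real)
      show "(\<lambda>N. \<Sum>\<alpha>\<in>idx_box S N. ?c \<alpha> * tensor_basis m S \<alpha> (x(j := t))) \<longlonglongrightarrow> f (x(j := t))" if "t \<in> space U01" for t
        using tensor_rep_box_limit[OF S rep xc] that by (simp add: space_U01)
    qed (rule me)
    show "AE t in U01. norm (\<Sum>\<alpha>\<in>idx_box S N. ?c \<alpha> * tensor_basis m S \<alpha> (x(j := t))) \<le> sqrt ?K" for N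
    proof (rule AE_I2)
      fix t assume "t \<in> space U01"
      then have "(\<Sum>\<alpha>\<in>idx_box S N. ?c \<alpha> * tensor_basis m S \<alpha> (x(j := t)))\<^sup>2 \<le> ?K"
        using partial_tensor_sum_le[OF S xc finite_idx_box[OF S] idx_box_subset tensor_repD(1)[OF rep]] by (simp add: space_U01)
      then show "norm (\<Sum>\<alpha>\<in>idx_box S N. ?c \<alpha> * tensor_basis m S \<alpha> (x(j := t))) \<le> sqrt ?K"
        by (simp only: real_norm_def real_sqrt_abs[symmetric] real_sqrt_le_iff)
    qed
  qed simp
  moreover have "(LINT t|U01. (\<Sum>\<alpha>\<in>idx_box S N. ?c \<alpha> * tensor_basis m S \<alpha> (x(j := t)))) = 0" for N
  proof -
    have ei: "integrable U01 (E1 m k)" "(LINT t|U01. E1 m k t) = 0" for k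
      using H1_regular[OF m E1_H1[OF m, of k]] continuous_integrable_U01 by auto
    have "(LINT t|U01. (\<Sum>\<alpha>\<in>idx_box S N. ?c \<alpha> * tensor_basis m S \<alpha> (x(j := t))))
        = (LINT t|U01. (\<Sum>\<alpha>\<in>idx_box S N. (?c \<alpha> * tensor_basis m (S - {j}) \<alpha> x) * E1 m (\<alpha> j) t))"
      unfolding tb by (simp add: mult_ac)
    also have "\<dots> = 0" using ei by (subst Bochner_Integration.integral_sum) auto
    finally show ?thesis .
  qed
  ultimately show ?thesis by (simp add: LIMSEQ_const_iff)
qed

text \<open>The reproducing kernel of the tensor space; it supplies the representers in the explicit
  solution of the penalized problem.\<close>

definition rkern :: "nat set \<Rightarrow> (nat \<Rightarrow> real) \<Rightarrow> (nat \<Rightarrow> real) \<Rightarrow> real" where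
  "rkern S x y = infsum (\<lambda>\<alpha>. tensor_basis m S \<alpha> x * tensor_basis m S \<alpha> y) (multi_idx S)"

lemma rkern_rep:
  assumes "finite S" "x \<in> cube S"
  shows "tensor_rep m S (rkern S x) (\<lambda>\<alpha>. tensor_basis m S \<alpha> x)"
  by (rule tensor_repI[OF assms(1) tensor_basis_l2(1)[OF assms]]) (simp add: rkern_def)

lemma rkern_HS: "finite S \<Longrightarrow> x \<in> cube S \<Longrightarrow> rkern S x \<in> HS m S"
  using rkern_rep by (auto simp: HS_def)

lemma JS_rkern:
  assumes S: "finite S" and x: "x \<in> cube S" and f: "f \<in> HS m S"
  shows "JS m S f (rkern S x) = f x"
  unfolding JS_eq[OF S coefS_rep[OF f] rkern_rep[OF S x]]
  using tensor_repD(2)[OF coefS_rep[OF f] x] by (rule infsumI)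

lemma rkern_measurable:
  assumes S: "finite S" and X: "X \<in> measurable M (PiM S (\<lambda>_. U01))" and Y: "Y \<in> measurable M (PiM S (\<lambda>_. U01))"
  shows "(\<lambda>\<omega>. rkern S (X \<omega>) (Y \<omega>)) \<in> borel_measurable M"
proof (rule borel_measurable_LIMSEQ_real)
  show "(\<lambda>N. \<Sum>\<alpha>\<in>idx_box S N. tensor_basis m S \<alpha> (X \<omega>) * tensor_basis m S \<alpha> (Y \<omega>)) \<longlonglongrightarrow> rkern S (X \<omega>) (Y \<omega>)"
    if "\<omega> \<in> space M" for \<omega>
    by (rule tensor_rep_box_limit[OF S rkern_rep[OF S]])
      (use measurable_space[OF X that] measurable_space[OF Y that] in \<open>auto simp: space_PiM_U01\<close>)
qed (intro borel_measurable_sum borel_measurable_times tensor_basis_measurable[OF S] X Y)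

end

section \<open>Interpolation inequality and effective dimension\<close>

interpretation PU: product_prob_space "\<lambda>_::nat. U01" UNIV
  by (rule product_prob_spaceI) (rule prob_space_U01)

lemma prob_space_PiM_U01: "prob_space (PiM S (\<lambda>_::nat. U01))"
  by (rule prob_space_PiM) (rule prob_space_U01)

lemma min_le_powr_mult:
  assumes "0 < a" "0 < b" "0 \<le> \<theta>" "\<theta> \<le> 1"
  shows "min a b \<le> a powr (1 - \<theta>) * b powr (\<theta>::real)"
proof -
  have "min a b = min a b powr (1 - \<theta>) * min a b powr \<theta>"
    using assms by (simp add: powr_add[symmetric])
  also have "\<dots> \<le> a powr (1 - \<theta>) * b powr \<theta>"
    using assms by (intro mult_mono powr_mono2) auto
  finally show ?thesis .
qed

lemma discriminant_le:
  assumes "\<And>t::real. 0 \<le> a + 2 * t * b + t\<^sup>2 * c" "0 \<le> c"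
  shows "b\<^sup>2 \<le> a * c"
proof (cases "c = 0")
  case True
  have "b = 0"
  proof (rule ccontr)
    assume "b \<noteq> 0"
    then show False using assms(1)[of "- (a + 1) / (2 * b)"] True by (simp add: field_simps)
  qed
  then show ?thesis using True by simp
next
  case False
  then have "0 < c" using assms(2) by simp
  have "0 \<le> (a + 2 * (- b / c) * b + (- b / c)\<^sup>2 * c) * c" using assms(1)[of "- b / c"] \<open>0 < c\<close> by simp
  also have "\<dots> = a * c - b\<^sup>2" using \<open>0 < c\<close> by (simp add: field_simps power2_eq_square)
  finally show ?thesis by simp
qed

lemma L2U_PiM_prod:
  fixes S :: "nat set"
  assumes S: "finite S" and L: "\<And>j. j \<in> S \<Longrightarrow> L2U (g j)"
  shows "(\<lambda>x. \<Prod>j\<in>S. g j (x j)) \<in> borel_measurable (PiM S (\<lambda>_. U01))"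
    and "integrable (PiM S (\<lambda>_. U01)) (\<lambda>x. (\<Prod>j\<in>S. g j (x j))\<^sup>2)"
    and "(LINT x|PiM S (\<lambda>_. U01). (\<Prod>j\<in>S. g j (x j))\<^sup>2) = (\<Prod>j\<in>S. LINT y|U01. (g j y)\<^sup>2)"
proof -
  show "(\<lambda>x. \<Prod>j\<in>S. g j (x j)) \<in> borel_measurable (PiM S (\<lambda>_. U01))"
  proof (rule borel_measurable_prod)
    fix j assume j: "j \<in> S"
    show "(\<lambda>x. g j (x j)) \<in> borel_measurable (PiM S (\<lambda>_. U01))"
      by (rule measurable_compose[OF measurable_component_singleton[OF j]]) (use L[OF j] in auto)
  qed
  show "integrable (PiM S (\<lambda>_. U01)) (\<lambda>x. (\<Prod>j\<in>S. g j (x j))\<^sup>2)"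
    unfolding prod_power_distrib by (rule PU.product_integrable_prod[OF S]) (use L in auto)
  show "(LINT x|PiM S (\<lambda>_. U01). (\<Prod>j\<in>S. g j (x j))\<^sup>2) = (\<Prod>j\<in>S. LINT y|U01. (g j y)\<^sup>2)"
    unfolding prod_power_distrib by (rule PU.product_integral_prod[OF S]) (use L in auto)
qed

lemma prod_C_power: "finite S \<Longrightarrow> (\<Prod>j\<in>S. C * a ^ \<kappa> j) = C ^ card S * (a::real) ^ (\<Sum>j\<in>S. \<kappa> j)"
  by (simp add: prod.distrib power_sum)

context
  fixes m :: nat
  assumes m: "0 < m"
begin

lemma E1_L2U: "L2U (E1 m k)"
  by (rule L2U_continuous[OF H1_regular(1)[OF m E1_H1[OF m]]])

text \<open>Point evaluation is a sum over vectors of scales of functionals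
  \<open>L \<kappa>\<close>. The L^2 norm of the kernel bounds such a functional by \<open>V\<close>
  with growth 2 per unit of total scale, its coefficients by \<open>J\<close> with decay
  2^(-(2m-1)). Interpolating between the two with exponent \<theta> gives a geometric series in each
  coordinate, and its constant does not depend on \<open>lam\<close>. Finite combinations keep all
  interchanges of sum and integral elementary.\<close>

lemma interpolation_finite:
  assumes S: "finite S" and th: "0 < \<theta>" "\<theta> < 1" "1 < 2 * real m * \<theta>"
  obtains C where "0 < C" "\<And>c N x lam. x \<in> cube S \<Longrightarrow> 0 < lam \<Longrightarrow>
    (\<Sum>\<alpha>\<in>idx_box S N. c \<alpha> * tensor_basis m S \<alpha> x)\<^sup>2 \<le> C * lam powr (-\<theta>) *
      ((LINT y|PiM S (\<lambda>_. U01). (\<Sum>\<alpha>\<in>idx_box S N. c \<alpha> * tensor_basis m S \<alpha> y)\<^sup>2) + lam * (\<Sum>\<alpha>\<in>idx_box S N. (c \<alpha>)\<^sup>2))"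
proof -
  obtain C1 :: real where C1: "0 < C1"
    "\<And>t. t \<in> {0..1} \<Longrightarrow> \<exists>q::nat \<Rightarrow> real \<Rightarrow> real.
      (\<forall>k. q k \<in> borel_measurable borel \<and> (\<exists>B. \<forall>y. \<bar>q k y\<bar> \<le> B) \<and> (LINT y|U01. (q k y)\<^sup>2) \<le> C1 * 2 ^ k) \<and>
      (\<forall>k N. (\<Sum>a<N. (LINT y|U01. q k y * E1 m a y)\<^sup>2) \<le> C1 * (1/2) ^ (k * (2*m-1))) \<and>
      (\<forall>a. (\<lambda>K. \<Sum>k<K. LINT y|U01. q k y * E1 m a y) \<longlonglongrightarrow> E1 m a t)"
    using E1_multiscale_kernels[OF m] by blast
  let ?P = "PiM S (\<lambda>_::nat. U01)"
  interpret P: prob_space ?P by (rule prob_space_PiM_U01)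
  \<comment> \<open>Weight 1 - \<theta> on the growth exponent 1 and \<theta> on the decay exponent
    2m - 1 leave 1 - 2m\<theta> for the square of a functional; hence the division by 2. The ratio
    is below 1 because \<theta> exceeds 1/(2m).\<close>
  define \<rho> where "\<rho> = (2::real) powr ((1 - 2 * real m * \<theta>) / 2)"
  have rho: "0 < \<rho>" "\<rho> < 1" using th by (simp_all add: \<rho>_def powr_less_one)
  define G where "G = (1 / (1 - \<rho>)) ^ card S"
  have G: "0 < G" using rho by (simp add: G_def)
  show thesis
  proof (rule that[of "C1 ^ card S * G\<^sup>2"])
    show "0 < C1 ^ card S * G\<^sup>2" using C1(1) G by simp
    fix c :: "(nat \<Rightarrow> nat) \<Rightarrow> real" and N :: nat and x :: "nat \<Rightarrow> real" and lam :: real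
    assume x: "x \<in> cube S" and lam: "0 < lam"
    define f where "f y = (\<Sum>\<alpha>\<in>idx_box S N. c \<alpha> * tensor_basis m S \<alpha> y)" for y
    define V where "V = (LINT y|?P. (f y)\<^sup>2)"
    define J where "J = (\<Sum>\<alpha>\<in>idx_box S N. (c \<alpha>)\<^sup>2)"
    define D where "D = V + lam * J"
    have V0: "0 \<le> V" by (simp add: V_def)
    have J0: "0 \<le> J" unfolding J_def by (intro sum_nonneg) auto
    have D0: "0 \<le> D" using V0 J0 lam by (simp add: D_def)
    have "\<forall>j\<in>S. \<exists>q::nat \<Rightarrow> real \<Rightarrow> real.
      (\<forall>k. q k \<in> borel_measurable borel \<and> (\<exists>B. \<forall>y. \<bar>q k y\<bar> \<le> B) \<and> (LINT y|U01. (q k y)\<^sup>2) \<le> C1 * 2 ^ k) \<and>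
      (\<forall>k N. (\<Sum>a<N. (LINT y|U01. q k y * E1 m a y)\<^sup>2) \<le> C1 * (1/2) ^ (k * (2*m-1))) \<and>
      (\<forall>a. (\<lambda>K. \<Sum>k<K. LINT y|U01. q k y * E1 m a y) \<longlonglongrightarrow> E1 m a (x j))"
      using C1(2) cube_memD[OF x] by blast
    from bchoice[OF this] obtain q :: "nat \<Rightarrow> nat \<Rightarrow> real \<Rightarrow> real" where
      q: "\<forall>j\<in>S. (\<forall>k. q j k \<in> borel_measurable borel \<and> (\<exists>B. \<forall>y. \<bar>q j k y\<bar> \<le> B) \<and> (LINT y|U01. (q j k y)\<^sup>2) \<le> C1 * 2 ^ k) \<and>
      (\<forall>k N. (\<Sum>a<N. (LINT y|U01. q j k y * E1 m a y)\<^sup>2) \<le> C1 * (1/2) ^ (k * (2*m-1))) \<and>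
      (\<forall>a. (\<lambda>K. \<Sum>k<K. LINT y|U01. q j k y * E1 m a y) \<longlonglongrightarrow> E1 m a (x j))" ..
    have qL: "L2U (q j k)" if "j \<in> S" for j k
    proof -
      have "q j k \<in> borel_measurable borel" "\<exists>B. \<forall>y. \<bar>q j k y\<bar> \<le> B" using q that by blast+
      then show ?thesis using L2U_borel_bounded by blast
    qed
    define b where "b j k a = (LINT y|U01. q j k y * E1 m a y)" for j k a
    define g where "g \<kappa> y = (\<Prod>j\<in>S. q j (\<kappa> j) (y j))" for \<kappa> y
    define L where "L \<kappa> = (LINT y|?P. f y * g \<kappa> y)" for \<kappa>
    have gm: "g \<kappa> \<in> borel_measurable ?P" and gi: "integrable ?P (\<lambda>y. (g \<kappa> y)\<^sup>2)"
      and g2: "(LINT y|?P. (g \<kappa> y)\<^sup>2) \<le> C1 ^ card S * 2 ^ (\<Sum>j\<in>S. \<kappa> j)" for \<kappa>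
    proof -
      show "g \<kappa> \<in> borel_measurable ?P" "integrable ?P (\<lambda>y. (g \<kappa> y)\<^sup>2)"
        unfolding g_def[abs_def] by (rule L2U_PiM_prod[OF S qL], assumption)+
      have "(LINT y|?P. (g \<kappa> y)\<^sup>2) = (\<Prod>j\<in>S. LINT y|U01. (q j (\<kappa> j) y)\<^sup>2)"
        unfolding g_def by (rule L2U_PiM_prod(3)[OF S qL])
      also have "\<dots> \<le> (\<Prod>j\<in>S. C1 * 2 ^ \<kappa> j)" by (rule prod_mono) (use q in auto)
      also have "\<dots> = C1 ^ card S * 2 ^ (\<Sum>j\<in>S. \<kappa> j)" by (rule prod_C_power[OF S])
      finally show "(LINT y|?P. (g \<kappa> y)\<^sup>2) \<le> C1 ^ card S * 2 ^ (\<Sum>j\<in>S. \<kappa> j)" .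
    qed
    have tm: "tensor_basis m S \<alpha> \<in> borel_measurable ?P" for \<alpha>
      unfolding tensor_basis_def[abs_def] by (rule L2U_PiM_prod(1)[OF S E1_L2U])
    have tt: "integrable ?P (\<lambda>y. tensor_basis m S \<alpha> y * tensor_basis m S \<beta> y)" for \<alpha> \<beta>
      unfolding tensor_basis_def prod.distrib[symmetric]
      by (rule PU.product_integrable_prod[OF S]) (rule L2U_mult[OF E1_L2U E1_L2U])
    have tg: "integrable ?P (\<lambda>y. tensor_basis m S \<alpha> y * g \<kappa> y)"
      "(LINT y|?P. tensor_basis m S \<alpha> y * g \<kappa> y) = (\<Prod>j\<in>S. b j (\<kappa> j) (\<alpha> j))" for \<alpha> \<kappa>
    proof -
      show "integrable ?P (\<lambda>y. tensor_basis m S \<alpha> y * g \<kappa> y)"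
        unfolding tensor_basis_def g_def prod.distrib[symmetric]
        by (rule PU.product_integrable_prod[OF S]) (rule L2U_mult[OF E1_L2U qL])
      have "(LINT y|?P. tensor_basis m S \<alpha> y * g \<kappa> y) = (\<Prod>j\<in>S. LINT y|U01. E1 m (\<alpha> j) y * q j (\<kappa> j) y)"
        unfolding tensor_basis_def g_def prod.distrib[symmetric]
        by (rule PU.product_integral_prod[OF S]) (rule L2U_mult[OF E1_L2U qL])
      then show "(LINT y|?P. tensor_basis m S \<alpha> y * g \<kappa> y) = (\<Prod>j\<in>S. b j (\<kappa> j) (\<alpha> j))"
        by (simp add: b_def mult.commute)
    qed
    have fm: "f \<in> borel_measurable ?P" unfolding f_def[abs_def] using tm by measurable
    have fi: "integrable ?P (\<lambda>y. (f y)\<^sup>2)"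
    proof -
      have "(f y)\<^sup>2 = (\<Sum>\<alpha>\<in>idx_box S N. \<Sum>\<beta>\<in>idx_box S N. (c \<alpha> * c \<beta>) * (tensor_basis m S \<alpha> y * tensor_basis m S \<beta> y))" for y
        by (simp add: f_def power2_eq_square sum_product mult_ac)
      then show ?thesis using tt by simp
    qed
    have La: "L \<kappa> = (\<Sum>\<alpha>\<in>idx_box S N. c \<alpha> * (\<Prod>j\<in>S. b j (\<kappa> j) (\<alpha> j)))" for \<kappa>
    proof -
      have "L \<kappa> = (LINT y|?P. (\<Sum>\<alpha>\<in>idx_box S N. c \<alpha> * (tensor_basis m S \<alpha> y * g \<kappa> y)))"
        by (simp add: L_def f_def sum_distrib_right mult.assoc)
      also have "\<dots> = (\<Sum>\<alpha>\<in>idx_box S N. c \<alpha> * (LINT y|?P. tensor_basis m S \<alpha> y * g \<kappa> y))"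
        using tg(1) by (subst Bochner_Integration.integral_sum) auto
      finally show ?thesis by (simp add: tg(2))
    qed
    have Lb: "(L \<kappa>)\<^sup>2 \<le> D * (C1 ^ card S * 2 ^ (\<Sum>j\<in>S. \<kappa> j))" for \<kappa>
    proof -
      have "(L \<kappa>)\<^sup>2 \<le> V * (LINT y|?P. (g \<kappa> y)\<^sup>2)"
        unfolding L_def V_def by (rule integral_Cauchy_Schwarz[OF fm gm fi gi])
      also have "\<dots> \<le> D * (C1 ^ card S * 2 ^ (\<Sum>j\<in>S. \<kappa> j))"
        by (rule mult_mono) (use g2 D0 J0 lam in \<open>auto simp: D_def\<close>)
      finally show ?thesis .
    qed
    \<comment> \<open>Here Cauchy--Schwarz is applied to the coefficients instead of the L^2
      product: it pays with \<open>J\<close> and gains the decay of the kernels. Dividing by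
      \<open>lam\<close> expresses \<open>J\<close> through the same energy \<open>D\<close> as in
      \<open>Lb\<close>.\<close>
    have Lc: "(L \<kappa>)\<^sup>2 \<le> D * (C1 ^ card S * ((1/2) ^ (2*m-1)) ^ (\<Sum>j\<in>S. \<kappa> j) / lam)" for \<kappa>
    proof -
      have "(L \<kappa>)\<^sup>2 \<le> J * (\<Sum>\<alpha>\<in>idx_box S N. (\<Prod>j\<in>S. b j (\<kappa> j) (\<alpha> j))\<^sup>2)"
        unfolding La J_def by (rule Cauchy_Schwarz_ineq_sum)
      also have "(\<Sum>\<alpha>\<in>idx_box S N. (\<Prod>j\<in>S. b j (\<kappa> j) (\<alpha> j))\<^sup>2) = (\<Prod>j\<in>S. \<Sum>a<N. (b j (\<kappa> j) a)\<^sup>2)"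
        unfolding prod_power_distrib by (rule sum_tensor_basis_box[OF m S])
      also have "J * \<dots> \<le> (D / lam) * (\<Prod>j\<in>S. C1 * ((1/2) ^ (2*m-1)) ^ \<kappa> j)"
      proof (rule mult_mono)
        show "J \<le> D / lam" using V0 lam by (simp add: D_def field_simps)
        show "(\<Prod>j\<in>S. \<Sum>a<N. (b j (\<kappa> j) a)\<^sup>2) \<le> (\<Prod>j\<in>S. C1 * ((1/2) ^ (2*m-1)) ^ \<kappa> j)"
          by (rule prod_mono) (use q in \<open>auto simp: b_def power_mult[symmetric] mult.commute intro: sum_nonneg\<close>)
        show "0 \<le> (\<Prod>j\<in>S. \<Sum>a<N. (b j (\<kappa> j) a)\<^sup>2)" by (intro prod_nonneg sum_nonneg ballI) auto
      qed (use D0 lam in auto)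
      finally show ?thesis unfolding prod_C_power[OF S] by simp
    qed
    define A where "A = sqrt (C1 ^ card S * D * lam powr (-\<theta>))"
    have A0: "0 \<le> A" using C1 D0 by (simp add: A_def)
    have Ld: "\<bar>L \<kappa>\<bar> \<le> A * \<rho> ^ (\<Sum>j\<in>S. \<kappa> j)" for \<kappa>
    proof -
      let ?n = "\<Sum>j\<in>S. \<kappa> j"
      let ?a = "(2::real) ^ ?n" and ?b = "((1/2::real) ^ (2*m-1)) ^ ?n / lam"
      have "(L \<kappa>)\<^sup>2 \<le> (D * C1 ^ card S) * min ?a ?b"
        using Lb[of \<kappa>] Lc[of \<kappa>] D0 C1(1) by (auto simp: min_def mult.assoc)
      also have "\<dots> \<le> (D * C1 ^ card S) * (?a powr (1 - \<theta>) * ?b powr \<theta>)"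
        by (intro mult_left_mono min_le_powr_mult) (use lam th D0 C1 in auto)
      also have "?a powr (1 - \<theta>) * ?b powr \<theta> = lam powr (-\<theta>) * (\<rho> ^ ?n)\<^sup>2"
      proof -
        have 1: "?a powr (1 - \<theta>) = 2 powr (real ?n * (1 - \<theta>))" by (simp add: powr_realpow[symmetric] powr_powr)
        have 2: "((1/2::real) ^ (2*m-1)) ^ ?n = 2 powr (- real (2*m-1) * real ?n)"
          by (simp add: powr_minus powr_mult[symmetric] powr_realpow[symmetric] power_mult[symmetric] power_one_over inverse_eq_divide powr_powr)
        have 3: "?b powr \<theta> = 2 powr (- real (2*m-1) * real ?n * \<theta>) * lam powr (-\<theta>)"
          unfolding 2 using lam by (simp add: powr_divide powr_mult powr_powr powr_minus_divide)
        have 4: "(\<rho> ^ ?n)\<^sup>2 = 2 powr ((1 - 2 * real m * \<theta>) * real ?n)"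
          unfolding \<rho>_def by (simp add: powr_realpow[symmetric] powr_powr power_mult[symmetric] mult.commute powr_power)
        have "real ?n * (1 - \<theta>) + - real (2*m-1) * real ?n * \<theta> = (1 - 2 * real m * \<theta>) * real ?n"
          using m by (simp add: of_nat_diff algebra_simps)
        then show ?thesis unfolding 1 3 4 by (simp add: powr_add[symmetric] mult_ac)
      qed
      finally have "(L \<kappa>)\<^sup>2 \<le> (A * \<rho> ^ ?n)\<^sup>2" using C1 D0 by (simp add: A_def power_mult_distrib mult_ac)
      then show ?thesis using A0 rho by (simp add: abs_le_square_iff[symmetric])
    qed
    \<comment> \<open>Summed over a box of scales, the product functionals factorize, and each
      factor converges to the basis function at the corresponding coordinate of
      \<open>x\<close>.\<close>
    have lim: "(\<lambda>K. \<Sum>\<kappa>\<in>idx_box S K. L \<kappa>) \<longlonglongrightarrow> f x"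
    proof -
      have "(\<Sum>\<kappa>\<in>idx_box S K. L \<kappa>) = (\<Sum>\<alpha>\<in>idx_box S N. c \<alpha> * (\<Prod>j\<in>S. \<Sum>k<K. b j k (\<alpha> j)))" for K
      proof -
        have "(\<Sum>\<kappa>\<in>idx_box S K. L \<kappa>) = (\<Sum>\<alpha>\<in>idx_box S N. c \<alpha> * (\<Sum>\<kappa>\<in>idx_box S K. \<Prod>j\<in>S. b j (\<kappa> j) (\<alpha> j)))"
          unfolding La by (subst sum.swap) (simp add: sum_distrib_left)
        then show ?thesis using sum_tensor_basis_box[OF m S, of "\<lambda>j k. b j k (_ j)"]
          by (simp add: sum_tensor_basis_box[OF m S, where g="\<lambda>j k. b j k (\<alpha> j)" for \<alpha>])
      qed
      moreover have "(\<lambda>K. \<Sum>\<alpha>\<in>idx_box S N. c \<alpha> * (\<Prod>j\<in>S. \<Sum>k<K. b j k (\<alpha> j))) \<longlonglongrightarrow> f x"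
        unfolding f_def tensor_basis_def by (intro tendsto_intros) (use q in \<open>auto simp: b_def\<close>)
      ultimately show ?thesis by simp
    qed
    have "\<bar>f x\<bar> \<le> A * G"
    proof (rule LIMSEQ_le_const2)
      show "(\<lambda>K. \<bar>\<Sum>\<kappa>\<in>idx_box S K. L \<kappa>\<bar>) \<longlonglongrightarrow> \<bar>f x\<bar>" by (intro tendsto_rabs lim)
      have "\<bar>\<Sum>\<kappa>\<in>idx_box S K. L \<kappa>\<bar> \<le> A * G" for K
      proof -
        have "\<bar>\<Sum>\<kappa>\<in>idx_box S K. L \<kappa>\<bar> \<le> (\<Sum>\<kappa>\<in>idx_box S K. A * (\<Prod>j\<in>S. \<rho> ^ \<kappa> j))"
          by (rule order_trans[OF sum_abs sum_mono]) (use Ld in \<open>simp add: power_sum\<close>)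
        also have "\<dots> = A * (\<Prod>j\<in>S. \<Sum>k<K. \<rho> ^ k)"
          unfolding sum_distrib_left[symmetric] using sum_tensor_basis_box[OF m S, of "\<lambda>j k. \<rho> ^ k"] by simp
        also have "\<dots> \<le> A * (\<Prod>j\<in>S. 1 / (1 - \<rho>))"
        proof (intro mult_left_mono prod_mono conjI A0)
          show "(\<Sum>k<K. \<rho> ^ k) \<le> 1 / (1 - \<rho>)"
          proof -
            have "(\<Sum>k<K. \<rho> ^ k) = (1 - \<rho> ^ K) / (1 - \<rho>)" using rho by (simp add: sum_gp_strict)
            also have "\<dots> \<le> 1 / (1 - \<rho>)" using rho by (intro divide_right_mono) auto
            finally show ?thesis .
          qed
          show "0 \<le> (\<Sum>k<K. \<rho> ^ k)" using rho by (intro sum_nonneg) auto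
        qed
        finally show ?thesis by (simp add: G_def)
      qed
      then show "\<exists>N. \<forall>n\<ge>N. \<bar>\<Sum>\<kappa>\<in>idx_box S n. L \<kappa>\<bar> \<le> A * G" by blast
    qed
    then have "\<bar>f x\<bar>\<^sup>2 \<le> (A * G)\<^sup>2" by (rule power_mono) simp
    also have "\<dots> = C1 ^ card S * G\<^sup>2 * lam powr (-\<theta>) * D" using C1 D0 by (simp add: A_def power_mult_distrib mult_ac)
    finally show "(\<Sum>\<alpha>\<in>idx_box S N. c \<alpha> * tensor_basis m S \<alpha> x)\<^sup>2 \<le> C1 ^ card S * G\<^sup>2 * lam powr (-\<theta>) *
      ((LINT y|?P. (\<Sum>\<alpha>\<in>idx_box S N. c \<alpha> * tensor_basis m S \<alpha> y)\<^sup>2) + lam * (\<Sum>\<alpha>\<in>idx_box S N. (c \<alpha>)\<^sup>2))"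
      by (simp add: D_def V_def J_def f_def)
  qed
qed

end

context
  fixes m :: nat
  assumes m: "0 < m"
begin

lemma HS_abs_bound:
  assumes "finite S" "f \<in> HS m S"
  obtains B where "\<And>x. x \<in> cube S \<Longrightarrow> \<bar>f x\<bar> \<le> B"
proof -
  have "\<bar>f x\<bar> \<le> sqrt (JS m S f f * ((real m + 1)\<^sup>2) ^ card S)" if "x \<in> cube S" for x
    using HS_bound[OF m assms that] by (metis real_sqrt_abs real_sqrt_le_iff)
  then show thesis using that by blast
qed

lemma bounded_integrable_PiM:
  assumes "f \<in> borel_measurable (PiM S (\<lambda>_. U01))" "\<And>x. x \<in> cube S \<Longrightarrow> \<bar>f x\<bar> \<le> B"
  shows "integrable (PiM S (\<lambda>_::nat. U01)) (f :: _ \<Rightarrow> real)"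
proof -
  interpret P: prob_space "PiM S (\<lambda>_::nat. U01)" by (rule prob_space_PiM_U01)
  show ?thesis by (rule P.integrable_const_bound[of _ B]) (use assms in \<open>auto simp: space_PiM_U01\<close>)
qed

lemma HS_mult_integrable:
  assumes S: "finite S" and f: "f \<in> HS m S" and g: "g \<in> HS m S"
  shows "integrable (PiM S (\<lambda>_. U01)) (\<lambda>x. f x * g x)"
proof -
  obtain B where B: "\<And>x. x \<in> cube S \<Longrightarrow> \<bar>f x\<bar> \<le> B" using HS_abs_bound[OF S f] by blast
  obtain C where C: "\<And>x. x \<in> cube S \<Longrightarrow> \<bar>g x\<bar> \<le> C" using HS_abs_bound[OF S g] by blast
  show ?thesis
  proof (rule bounded_integrable_PiM)
    show "(\<lambda>x. f x * g x) \<in> borel_measurable (PiM S (\<lambda>_. U01))"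
      by (intro borel_measurable_times HS_measurable[OF m S] f g)
    show "\<bar>f x * g x\<bar> \<le> B * C" if "x \<in> cube S" for x
      unfolding abs_mult using B[OF that] C[OF that] by (intro mult_mono) auto
  qed
qed

lemma VS_commute: "VS S f g = VS S g f" by (simp add: VS_def mult.commute)

lemma VS_lincomb:
  assumes S: "finite S" and f: "f \<in> HS m S" and g: "g \<in> HS m S" and h: "h \<in> HS m S"
  shows "VS S (\<lambda>x. a * f x + b * g x) h = a * VS S f h + b * VS S g h"
proof -
  have "VS S (\<lambda>x. a * f x + b * g x) h = (LINT x|PiM S (\<lambda>_. U01). a * (f x * h x) + b * (g x * h x))"
    unfolding VS_def by (simp add: algebra_simps)
  then show ?thesis unfolding VS_def using HS_mult_integrable[OF S f h] HS_mult_integrable[OF S g h] by simp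
qed

lemma VS_sum:
  assumes S: "finite S" and f: "\<And>i. i \<in> I \<Longrightarrow> f i \<in> HS m S" and h: "h \<in> HS m S"
  shows "VS S (\<lambda>x. \<Sum>i\<in>I. c i * f i x) h = (\<Sum>i\<in>I. c i * VS S (f i) h)"
  using f
proof (induction I rule: infinite_finite_induct)
  case (insert i I)
  then show ?case using VS_lincomb[OF S, of "f i" "\<lambda>x. \<Sum>i\<in>I. c i * f i x" h "c i" 1] HS_sum[OF m, of I f S c] h by simp
qed (simp_all add: VS_def)

text \<open>The limit along the boxes: the penalty of a partial sum is at most that of
  \<open>f\<close>, and the L^2 part converges by dominated convergence since partial sums are
  uniformly bounded.\<close>

theorem interpolation_inequality:
  assumes S: "finite S" and th: "0 < \<theta>" "\<theta> < 1" "1 < 2 * real m * \<theta>"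
  obtains C where "0 < C" "\<And>f x lam. f \<in> HS m S \<Longrightarrow> x \<in> cube S \<Longrightarrow> 0 < lam \<Longrightarrow>
    (f x)\<^sup>2 \<le> C * lam powr (-\<theta>) * (VS S f f + lam * JS m S f f)"
proof -
  obtain C where C: "0 < C" "\<And>c N x lam. x \<in> cube S \<Longrightarrow> 0 < lam \<Longrightarrow>
    (\<Sum>\<alpha>\<in>idx_box S N. c \<alpha> * tensor_basis m S \<alpha> x)\<^sup>2 \<le> C * lam powr (-\<theta>) *
      ((LINT y|PiM S (\<lambda>_. U01). (\<Sum>\<alpha>\<in>idx_box S N. c \<alpha> * tensor_basis m S \<alpha> y)\<^sup>2) + lam * (\<Sum>\<alpha>\<in>idx_box S N. (c \<alpha>)\<^sup>2))"
    using interpolation_finite[OF m S th] by blast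
  show thesis
  proof (rule that[OF C(1)])
    fix f x and lam :: real assume f: "f \<in> HS m S" and x: "x \<in> cube S" and lam: "0 < lam"
    let ?c = "coefS m S f" and ?P = "PiM S (\<lambda>_::nat. U01)"
    interpret P: prob_space ?P by (rule prob_space_PiM_U01)
    have rep: "tensor_rep m S f ?c" by (rule coefS_rep[OF m f])
    define fN where "fN N y = (\<Sum>\<alpha>\<in>idx_box S N. ?c \<alpha> * tensor_basis m S \<alpha> y)" for N y
    have lim: "(\<lambda>N. fN N y) \<longlonglongrightarrow> f y" if "y \<in> cube S" for y
      unfolding fN_def by (rule tensor_rep_box_limit[OF m S rep that])
    have fNm: "fN N \<in> borel_measurable ?P" for N unfolding fN_def[abs_def]
      by (intro borel_measurable_sum borel_measurable_times borel_measurable_const tensor_basis_measurable[OF m S] measurable_ident_sets refl)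
    let ?K = "infsum (\<lambda>\<alpha>. (?c \<alpha>)\<^sup>2) (multi_idx S) * ((real m + 1)\<^sup>2) ^ card S"
    have V: "(\<lambda>N. LINT y|?P. (fN N y)\<^sup>2) \<longlonglongrightarrow> (LINT y|?P. (f y)\<^sup>2)"
    proof (rule integral_dominated_convergence[where w="\<lambda>_. ?K"])
      show "AE y in ?P. (\<lambda>N. (fN N y)\<^sup>2) \<longlonglongrightarrow> (f y)\<^sup>2"
        by (rule AE_I2) (use lim in \<open>auto simp: space_PiM_U01 intro: tendsto_power\<close>)
      show "AE y in ?P. norm ((fN N y)\<^sup>2) \<le> ?K" for N
        by (rule AE_I2) (use partial_tensor_sum_le[OF m S _ finite_idx_box[OF S] idx_box_subset tensor_repD(1)[OF m rep]] in
          \<open>simp add: space_PiM_U01 fN_def\<close>)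
      show "(\<lambda>y. (f y)\<^sup>2) \<in> borel_measurable ?P" using HS_measurable[OF m S f] by measurable
      show "(\<lambda>y. (fN N y)\<^sup>2) \<in> borel_measurable ?P" for N using fNm by measurable
    qed simp
    have "(f x)\<^sup>2 \<le> C * lam powr (-\<theta>) * ((LINT y|?P. (f y)\<^sup>2) + lam * JS m S f f)"
    proof (rule LIMSEQ_le)
      show "(\<lambda>N. (fN N x)\<^sup>2) \<longlonglongrightarrow> (f x)\<^sup>2" by (intro tendsto_power lim x)
      show "(\<lambda>N. C * lam powr (-\<theta>) * ((LINT y|?P. (fN N y)\<^sup>2) + lam * JS m S f f)) \<longlonglongrightarrow>
          C * lam powr (-\<theta>) * ((LINT y|?P. (f y)\<^sup>2) + lam * JS m S f f)"
        by (intro tendsto_intros V)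
      have "(fN N x)\<^sup>2 \<le> C * lam powr (-\<theta>) * ((LINT y|?P. (fN N y)\<^sup>2) + lam * JS m S f f)" for N
      proof -
        have "(\<Sum>\<alpha>\<in>idx_box S N. (?c \<alpha>)\<^sup>2) \<le> JS m S f f"
          unfolding JS_def power2_eq_square[symmetric]
          by (rule finite_sum_le_infsum[OF tensor_repD(1)[OF m rep] finite_idx_box[OF S] idx_box_subset]) simp
        then have "C * lam powr (-\<theta>) * ((LINT y|?P. (fN N y)\<^sup>2) + lam * (\<Sum>\<alpha>\<in>idx_box S N. (?c \<alpha>)\<^sup>2))
            \<le> C * lam powr (-\<theta>) * ((LINT y|?P. (fN N y)\<^sup>2) + lam * JS m S f f)"
          using C(1) lam by (intro mult_left_mono add_left_mono) auto
        then show ?thesis using C(2)[OF x lam, of ?c N] unfolding fN_def by (rule order_trans[rotated])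
      qed
      then show "\<exists>N. \<forall>n\<ge>N. (fN n x)\<^sup>2 \<le> C * lam powr (-\<theta>) * ((LINT y|?P. (fN n y)\<^sup>2) + lam * JS m S f f)" by blast
    qed
    then show "(f x)\<^sup>2 \<le> C * lam powr (-\<theta>) * (VS S f f + lam * JS m S f f)"
      by (simp add: VS_def power2_eq_square)
  qed
qed

lemma JS_Cauchy_Schwarz:
  assumes S: "finite S" and f: "f \<in> HS m S" and g: "g \<in> HS m S"
  shows "(JS m S f g)\<^sup>2 \<le> JS m S f f * JS m S g g"
proof (rule discriminant_le)
  fix t :: real
  have h: "(\<lambda>x. 1 * f x + t * g x) \<in> HS m S" by (rule HS_lincomb[OF m f g])
  have "JS m S (\<lambda>x. 1 * f x + t * g x) (\<lambda>x. 1 * f x + t * g x) = JS m S f f + 2 * t * JS m S f g + t\<^sup>2 * JS m S g g"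
    unfolding JS_lincomb[OF m S f g h] JS_commute[OF m, of S f "\<lambda>x. 1 * f x + t * g x"] JS_commute[OF m, of S g "\<lambda>x. 1 * f x + t * g x"]
      JS_lincomb[OF m S f g f] JS_lincomb[OF m S f g g]
    by (simp add: JS_commute[OF m, of S g f] power2_eq_square algebra_simps)
  then show "0 \<le> JS m S f f + 2 * t * JS m S f g + t\<^sup>2 * JS m S g g" by (metis JS_nonneg[OF m])
qed (rule JS_nonneg[OF m])

section \<open>Consequences of the eigensystem\<close>

context
  fixes S :: "nat set" and \<mu> :: "nat \<Rightarrow> real" and \<psi> :: "nat \<Rightarrow> (nat \<Rightarrow> real) \<Rightarrow> real" and C\<psi> :: real
  assumes S: "finite S" and eig: "eigensystem m S \<mu> \<psi> C\<psi>"
begin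

lemma eig_mu_pos: "0 < \<mu> v" and eig_HS: "\<psi> v \<in> HS m S"
  and eig_V: "VS S (\<psi> v) (\<psi> v') = (if v = v' then 1 else 0)"
  and eig_J: "JS m S (\<psi> v) (\<psi> v') = (if v = v' then 1 / \<mu> v else 0)"
  and eig_bound: "x \<in> cube S \<Longrightarrow> \<bar>\<psi> v x\<bar> \<le> C\<psi>"
  using eig unfolding eigensystem_def by blast+

lemma eig_mu_le: "\<mu> v \<le> \<mu> 0"
proof (induction v)
  case (Suc v)
  have "\<mu> (Suc v) \<le> \<mu> v" using eig unfolding eigensystem_def by blast
  then show ?case using Suc by simp
qed simp

definition "eig_rem f N = (\<lambda>x. f x - (\<Sum>v<N. VS S f (\<psi> v) * \<psi> v x))"

lemma eig_rem_HS: "f \<in> HS m S \<Longrightarrow> eig_rem f N \<in> HS m S"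
  using HS_lincomb[OF m, of f S "\<lambda>x. \<Sum>v<N. VS S f (\<psi> v) * \<psi> v x" 1 "-1"] HS_sum[OF m, of "{..<N}" \<psi> S "\<lambda>v. VS S f (\<psi> v)"] eig_HS
  by (simp add: eig_rem_def[abs_def])

lemma eig_rem_limit: "f \<in> HS m S \<Longrightarrow> (\<lambda>N. JS m S (eig_rem f N) (eig_rem f N)) \<longlonglongrightarrow> 0"
  using eig by (simp add: eigensystem_def eig_rem_def[abs_def] Let_def)

lemma eig_JS_split:
  assumes f: "f \<in> HS m S" and g: "g \<in> HS m S"
  shows "JS m S f g = JS m S (eig_rem f N) g + (\<Sum>v<N. VS S f (\<psi> v) * JS m S (\<psi> v) g)"
proof -
  have H: "(\<lambda>x. \<Sum>v<N. VS S f (\<psi> v) * \<psi> v x) \<in> HS m S" by (rule HS_sum[OF m eig_HS])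
  have "f = (\<lambda>x. 1 * eig_rem f N x + 1 * (\<Sum>v<N. VS S f (\<psi> v) * \<psi> v x))" by (simp add: eig_rem_def fun_eq_iff)
  then have "JS m S f g = JS m S (\<lambda>x. 1 * eig_rem f N x + 1 * (\<Sum>v<N. VS S f (\<psi> v) * \<psi> v x)) g" by simp
  also have "\<dots> = 1 * JS m S (eig_rem f N) g + 1 * JS m S (\<lambda>x. \<Sum>v<N. VS S f (\<psi> v) * \<psi> v x) g"
    by (rule JS_lincomb[OF m S eig_rem_HS[OF f] H g])
  also have "JS m S (\<lambda>x. \<Sum>v<N. VS S f (\<psi> v) * \<psi> v x) g = (\<Sum>v<N. VS S f (\<psi> v) * JS m S (\<psi> v) g)"
    by (rule JS_sum[OF m S eig_HS g])
  finally show ?thesis by simp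
qed

lemma eig_rem_JS_limit:
  assumes f: "f \<in> HS m S" and g: "g \<in> HS m S"
  shows "(\<lambda>N. JS m S (eig_rem f N) g) \<longlonglongrightarrow> 0"
proof -
  have "(\<lambda>N. sqrt (JS m S (eig_rem f N) (eig_rem f N) * JS m S g g)) \<longlonglongrightarrow> sqrt (0 * JS m S g g)"
    by (intro tendsto_intros eig_rem_limit[OF f])
  then have l: "(\<lambda>N. sqrt (JS m S (eig_rem f N) (eig_rem f N) * JS m S g g)) \<longlonglongrightarrow> 0" by simp
  show ?thesis
  proof (rule Lim_null_comparison[OF _ l])
    have "norm (JS m S (eig_rem f N) g) \<le> sqrt (JS m S (eig_rem f N) (eig_rem f N) * JS m S g g)" for N
      using JS_Cauchy_Schwarz[OF S eig_rem_HS[OF f] g, of N]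
      by (simp only: real_norm_def real_sqrt_abs[symmetric] real_sqrt_le_iff)
    then show "\<forall>\<^sub>F N in sequentially. norm (JS m S (eig_rem f N) g) \<le> sqrt (JS m S (eig_rem f N) (eig_rem f N) * JS m S g g)" by simp
  qed
qed

lemma eig_JS_sums:
  assumes f: "f \<in> HS m S" and g: "g \<in> HS m S"
  shows "(\<lambda>v. VS S f (\<psi> v) * JS m S (\<psi> v) g) sums JS m S f g"
proof -
  have "(\<lambda>N. JS m S f g - JS m S (eig_rem f N) g) \<longlonglongrightarrow> JS m S f g - 0"
    by (intro tendsto_intros eig_rem_JS_limit[OF f g])
  moreover have "JS m S f g - JS m S (eig_rem f N) g = (\<Sum>v<N. VS S f (\<psi> v) * JS m S (\<psi> v) g)" for N
    using eig_JS_split[OF f g, of N] by simp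
  ultimately show ?thesis by (simp add: sums_def)
qed

text \<open>The eigensystem fixes only products among eigenfunctions; expanding \<open>f\<close> in
  the norm of \<open>JS\<close> extends the relation to all of the space. In the normal equations it
  turns the penalty into multiplication by \<open>1 / \<mu> v\<close>.\<close>

lemma eig_JS_psi:
  assumes f: "f \<in> HS m S" shows "JS m S f (\<psi> v) = VS S f (\<psi> v) / \<mu> v"
proof -
  have "(\<lambda>w. VS S f (\<psi> w) * JS m S (\<psi> w) (\<psi> v)) sums (VS S f (\<psi> v) / \<mu> v)"
    using sums_finite[of "{v}" "\<lambda>w. VS S f (\<psi> w) * JS m S (\<psi> w) (\<psi> v)"] by (simp add: eig_J)
  then show ?thesis using eig_JS_sums[OF f eig_HS[of v]] by (metis sums_unique2)
qed

lemma eig_JS_energy: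
  assumes f: "f \<in> HS m S" shows "(\<lambda>v. (VS S f (\<psi> v))\<^sup>2 / \<mu> v) sums JS m S f f"
proof -
  have "JS m S (\<psi> v) f = VS S f (\<psi> v) / \<mu> v" for v
    using JS_commute[OF m, of S "\<psi> v" f] eig_JS_psi[OF f, of v] by simp
  then show ?thesis using eig_JS_sums[OF f f] by (simp add: power2_eq_square)
qed

text \<open>Convergence in the norm of \<open>JS\<close> implies convergence at every point, since
  point evaluation is bounded in that norm.\<close>

lemma eig_pointwise:
  assumes f: "f \<in> HS m S" and x: "x \<in> cube S"
  shows "(\<lambda>v. VS S f (\<psi> v) * \<psi> v x) sums f x"
proof -
  have "(\<lambda>N. sqrt (JS m S (eig_rem f N) (eig_rem f N) * ((real m + 1)\<^sup>2) ^ card S)) \<longlonglongrightarrow> sqrt (0 * ((real m + 1)\<^sup>2) ^ card S)"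
    by (intro tendsto_intros eig_rem_limit[OF f])
  then have l: "(\<lambda>N. sqrt (JS m S (eig_rem f N) (eig_rem f N) * ((real m + 1)\<^sup>2) ^ card S)) \<longlonglongrightarrow> 0" by simp
  have "(\<lambda>N. eig_rem f N x) \<longlonglongrightarrow> 0"
  proof (rule Lim_null_comparison[OF _ l])
    have "norm (eig_rem f N x) \<le> sqrt (JS m S (eig_rem f N) (eig_rem f N) * ((real m + 1)\<^sup>2) ^ card S)" for N
      using HS_bound[OF m S eig_rem_HS[OF f] x, of N]
      by (simp only: real_norm_def real_sqrt_abs[symmetric] real_sqrt_le_iff)
    then show "\<forall>\<^sub>F N in sequentially. norm (eig_rem f N x) \<le> sqrt (JS m S (eig_rem f N) (eig_rem f N) * ((real m + 1)\<^sup>2) ^ card S)" by simp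
  qed
  then have "(\<lambda>N. f x - eig_rem f N x) \<longlonglongrightarrow> f x - 0" by (intro tendsto_intros)
  then show ?thesis by (simp add: sums_def eig_rem_def)
qed

text \<open>The interpolation inequality applied to the truncated regularized kernel section at $x$.\<close>

lemma effective_dimension_pointwise:
  assumes C: "\<And>f x lam. f \<in> HS m S \<Longrightarrow> x \<in> cube S \<Longrightarrow> 0 < lam \<Longrightarrow>
      (f x)\<^sup>2 \<le> C * lam powr (-\<theta>) * (VS S f f + lam * JS m S f f)" "0 < C"
    and x: "x \<in> cube S" and lam: "0 < lam"
  shows "(\<Sum>v<N. (\<psi> v x)\<^sup>2 / (1 + lam / \<mu> v)) \<le> C * lam powr (-\<theta>)"
proof -
  define w where "w v = 1 / (1 + lam / \<mu> v)" for v
  have pos: "0 < 1 + lam / \<mu> v" for v using eig_mu_pos[of v] lam by (simp add: add_pos_pos)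
  define A where "A = (\<Sum>v<N. (\<psi> v x)\<^sup>2 * w v)"
  define c where "c v = w v * \<psi> v x" for v
  define f where "f y = (\<Sum>v<N. c v * \<psi> v y)" for y
  have f: "f \<in> HS m S" unfolding f_def[abs_def] by (rule HS_sum[OF m eig_HS])
  have fx: "f x = A" by (simp add: f_def A_def c_def power2_eq_square mult_ac)
  have V: "VS S f f = (\<Sum>v<N. (c v)\<^sup>2)"
  proof -
    have vf: "VS S (\<psi> v) f = c v" if "v < N" for v
    proof -
      have "VS S f (\<psi> v) = (\<Sum>w<N. c w * VS S (\<psi> w) (\<psi> v))" unfolding f_def[abs_def] by (rule VS_sum[OF S eig_HS eig_HS])
      also have "\<dots> = (\<Sum>w<N. if w = v then c w else 0)" by (intro sum.cong refl) (simp add: eig_V)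
      finally show ?thesis using that by (simp add: VS_commute)
    qed
    have "VS S f f = (\<Sum>v<N. c v * VS S (\<psi> v) f)" by (subst f_def[abs_def]) (rule VS_sum[OF S eig_HS f])
    then show ?thesis using vf by (simp add: power2_eq_square)
  qed
  have J: "JS m S f f = (\<Sum>v<N. (c v)\<^sup>2 / \<mu> v)"
  proof -
    have vf: "JS m S (\<psi> v) f = c v / \<mu> v" if "v < N" for v
    proof -
      have "JS m S f (\<psi> v) = (\<Sum>w<N. c w * JS m S (\<psi> w) (\<psi> v))" unfolding f_def[abs_def] by (rule JS_sum[OF m S eig_HS eig_HS])
      also have "\<dots> = (\<Sum>w<N. if w = v then c w / \<mu> w else 0)" by (intro sum.cong refl) (simp add: eig_J)
      finally show ?thesis using that by (simp add: JS_commute[OF m, of S "\<psi> v" f])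
    qed
    have "JS m S f f = (\<Sum>v<N. c v * JS m S (\<psi> v) f)" by (subst f_def[abs_def]) (rule JS_sum[OF m S eig_HS f])
    then show ?thesis using vf by (simp add: power2_eq_square)
  qed
  have "VS S f f + lam * JS m S f f = (\<Sum>v<N. (c v)\<^sup>2 * (1 + lam / \<mu> v))"
    unfolding V J by (simp add: sum_distrib_left sum.distrib[symmetric] algebra_simps)
  also have "\<dots> = A" unfolding A_def
  proof (rule sum.cong[OF refl])
    fix v show "(c v)\<^sup>2 * (1 + lam / \<mu> v) = (\<psi> v x)\<^sup>2 * w v"
      using pos[of v] by (simp add: c_def w_def power2_eq_square)
  qed
  \<comment> \<open>The kernel section has value \<open>A\<close> at \<open>x\<close> and also
    energy \<open>A\<close>; this coincidence lets the inequality be divided by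
    \<open>A\<close>.\<close>
  finally have "A\<^sup>2 \<le> C * lam powr (-\<theta>) * A" using C(1)[OF f x lam] by (simp add: fx)
  moreover have "0 \<le> A" unfolding A_def w_def using pos by (intro sum_nonneg mult_nonneg_nonneg) (auto intro: less_imp_le)
  ultimately have "A \<le> C * lam powr (-\<theta>)"
    using C(2) by (cases "A = 0") (auto simp: power2_eq_square)
  then show ?thesis by (simp add: A_def w_def)
qed

text \<open>Integrating the pointwise bound over the cube replaces every squared eigenfunction by
  1.\<close>

lemma effective_dimension:
  assumes C: "\<And>f x lam. f \<in> HS m S \<Longrightarrow> x \<in> cube S \<Longrightarrow> 0 < lam \<Longrightarrow>
      (f x)\<^sup>2 \<le> C * lam powr (-\<theta>) * (VS S f f + lam * JS m S f f)" "0 < C"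
    and lam: "0 < lam"
  shows "(\<Sum>v<N. 1 / (1 + lam / \<mu> v)) \<le> C * lam powr (-\<theta>)"
proof -
  let ?P = "PiM S (\<lambda>_::nat. U01)"
  interpret P: prob_space ?P by (rule prob_space_PiM_U01)
  have i: "integrable ?P (\<lambda>x. (\<psi> v x)\<^sup>2)" for v
    using HS_mult_integrable[OF S eig_HS eig_HS] by (simp add: power2_eq_square)
  have one: "(LINT x|?P. (\<psi> v x)\<^sup>2) = 1" for v using eig_V[of v v] by (simp add: VS_def power2_eq_square)
  have "(\<Sum>v<N. 1 / (1 + lam / \<mu> v)) = (LINT x|?P. (\<Sum>v<N. (\<psi> v x)\<^sup>2 / (1 + lam / \<mu> v)))"
    using i by (subst Bochner_Integration.integral_sum) (auto simp: one)
  also have "\<dots> \<le> (LINT x|?P. C * lam powr (-\<theta>))"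
    by (rule integral_mono) (use i effective_dimension_pointwise[OF C _ lam] in \<open>auto simp: space_PiM_U01\<close>)
  finally show ?thesis by (simp add: P.prob_space)
qed

end

section \<open>Orthogonality between different components\<close>

lemma restrict_cube: "x \<in> cube D \<Longrightarrow> T \<subseteq> D \<Longrightarrow> restrict x T \<in> cube T"
  by (auto simp: cube_def PiE_iff)

lemma restrict_measurable: "T \<subseteq> D \<Longrightarrow> (\<lambda>x. restrict x T) \<in> measurable (PiM D (\<lambda>_. U01)) (PiM T (\<lambda>_. U01))"
  by (rule measurable_restrict_subset)

text \<open>Integrating first over coordinate \<open>j\<close>, on which \<open>h\<close> does not
  depend, leaves the zero coordinate mean of \<open>f\<close>.\<close>

lemma HS_integral_against_independent:
  assumes D: "finite D" and T: "T \<subseteq> D" "j \<in> T" and f: "f \<in> HS m T"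
    and h: "h \<in> borel_measurable (PiM D (\<lambda>_. U01))" "\<And>x. x \<in> cube D \<Longrightarrow> \<bar>h x\<bar> \<le> B"
    and ind: "\<And>x t. h (x(j := t)) = (h x :: real)"
  shows "(LINT x|PiM D (\<lambda>_. U01). f (restrict x T) * h x) = 0"
proof -
  have fT: "finite T" using D T finite_subset by blast
  let ?D = "D - {j}"
  have jD: "insert j ?D = D" using T by auto
  obtain Bf where Bf: "\<And>x. x \<in> cube T \<Longrightarrow> \<bar>f x\<bar> \<le> Bf" using HS_abs_bound[OF fT f] by blast
  have int: "integrable (PiM D (\<lambda>_. U01)) (\<lambda>x. f (restrict x T) * h x)"
  proof (rule bounded_integrable_PiM)
    show "(\<lambda>x. f (restrict x T) * h x) \<in> borel_measurable (PiM D (\<lambda>_. U01))"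
      by (intro borel_measurable_times h(1) measurable_compose[OF restrict_measurable[OF T(1)] HS_measurable[OF m fT f]])
    show "\<bar>f (restrict x T) * h x\<bar> \<le> Bf * B" if "x \<in> cube D" for x
      unfolding abs_mult using Bf[OF restrict_cube[OF that T(1)]] h(2)[OF that] by (intro mult_mono) auto
  qed
  have "(LINT x|PiM D (\<lambda>_. U01). f (restrict x T) * h x) =
      (LINT x|PiM ?D (\<lambda>_. U01). LINT t|U01. f (restrict (x(j := t)) T) * h (x(j := t)))"
    using PU.product_integral_insert[of ?D j "\<lambda>x. f (restrict x T) * h x"] int D unfolding jD by simp
  also have "\<dots> = (LINT x|PiM ?D (\<lambda>_. U01). 0)"
  proof (rule Bochner_Integration.integral_cong[OF refl])
    fix x assume "x \<in> space (PiM ?D (\<lambda>_. U01))"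
    then have x: "x \<in> cube ?D" by (simp add: space_PiM_U01)
    have xr: "restrict x (T - {j}) \<in> cube (T - {j})" by (rule restrict_cube[OF x]) (use T in auto)
    have e: "restrict (x(j := t)) T = (restrict x (T - {j}))(j := t)" for t using T by (auto simp: fun_eq_iff)
    have "(LINT t|U01. f (restrict (x(j := t)) T) * h (x(j := t))) = (LINT t|U01. f ((restrict x (T - {j}))(j := t)) * h x)"
      by (simp add: ind e)
    also have "\<dots> = (LINT t|U01. f ((restrict x (T - {j}))(j := t))) * h x" by simp
    also have "\<dots> = 0" using HS_integral_coordinate[OF m fT f T(2) xr] by simp
    finally show "(LINT t|U01. f (restrict (x(j := t)) T) * h (x(j := t))) = 0" .
  qed
  finally show ?thesis by simp
qed

lemma integral_restrict_PiM:
  assumes D: "finite D" and T: "T \<subseteq> D" and f: "f \<in> borel_measurable (PiM T (\<lambda>_. U01))"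
  shows "(LINT x|PiM D (\<lambda>_::nat. U01). f (restrict x T)) = (LINT x|PiM T (\<lambda>_. U01). (f x :: real))"
  by (subst PU.distr_restrict[OF T D]) (simp add: integral_distr[OF restrict_measurable[OF T] f])

text \<open>Distinct index sets differ in a coordinate belonging to only one of them; the factor of
  the other set is constant in that coordinate.\<close>

lemma HS_cross_integral:
  assumes D: "finite D" and T: "T \<subseteq> D" "T' \<subseteq> D" "T \<noteq> T'" and f: "f \<in> HS m T" and g: "g \<in> HS m T'"
  shows "(LINT x|PiM D (\<lambda>_. U01). f (restrict x T) * g (restrict x T')) = 0"
proof -
  have *: "(LINT x|PiM D (\<lambda>_. U01). f (restrict x T) * g (restrict x T')) = 0"
    if T: "T \<subseteq> D" "T' \<subseteq> D" "j \<in> T" "j \<notin> T'" and f: "f \<in> HS m T" and g: "g \<in> HS m T'" for T T' j f g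
  proof -
    have fT: "finite T'" using D T finite_subset by blast
    obtain B where B: "\<And>x. x \<in> cube T' \<Longrightarrow> \<bar>g x\<bar> \<le> B" using HS_abs_bound[OF fT g] by blast
    show ?thesis
    proof (rule HS_integral_against_independent[OF D T(1,3) f])
      show "(\<lambda>x. g (restrict x T')) \<in> borel_measurable (PiM D (\<lambda>_. U01))"
        by (rule measurable_compose[OF restrict_measurable[OF T(2)] HS_measurable[OF m fT g]])
      show "\<bar>g (restrict x T')\<bar> \<le> B" if "x \<in> cube D" for x using B[OF restrict_cube[OF that T(2)]] .
      have "restrict (x(j := t)) T' = restrict x T'" for x :: "nat \<Rightarrow> real" and t using T(4) by (auto simp: restrict_def fun_eq_iff)
      then show "g (restrict (x(j := t)) T') = g (restrict x T')" for x t by simp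
    qed
  qed
  show ?thesis
  proof (cases "\<exists>j. j \<in> T \<and> j \<notin> T'")
    case True then show ?thesis using * T f g by blast
  next
    case False
    then obtain j where "j \<in> T'" "j \<notin> T" using T(3) by auto
    then show ?thesis using *[OF T(2,1) _ _ g f] by (simp add: mult.commute)
  qed
qed

end

section \<open>The penalized least squares estimator\<close>

type_synonym family = "nat set \<Rightarrow> (nat \<Rightarrow> real) \<Rightarrow> real"

definition famJ :: "nat \<Rightarrow> nat set set \<Rightarrow> family \<Rightarrow> family \<Rightarrow> real" where
  "famJ m SS f g = (\<Sum>S\<in>SS - {{}}. JS m S (f S) (g S))"

lemma Jtot_famJ: "Jtot m SS f = famJ m SS f f" by (simp add: Jtot_def famJ_def)

text \<open>Functional 0 is the intercept, functional $l+1$ is evaluation at the design point $l$.\<close>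

definition efun :: "nat set set \<Rightarrow> (nat \<Rightarrow> nat \<Rightarrow> real) \<Rightarrow> nat \<Rightarrow> family \<Rightarrow> real" where
  "efun SS Xs k f = (case k of 0 \<Rightarrow> intercept f | Suc l \<Rightarrow> evalfam SS f (Xs l))"

primrec rep0 :: "nat \<Rightarrow> real \<Rightarrow> (nat \<Rightarrow> nat \<Rightarrow> real) \<Rightarrow> nat \<Rightarrow> family" where
  "rep0 m a Xs 0 = (\<lambda>S x. if S = {} then 1 else 0)"
| "rep0 m a Xs (Suc l) = (\<lambda>S x. if S = {} then 1 else rkern m S (restrict (Xs l) S) x / a)"

text \<open>Representers of the functionals for the form
  $a J(f,g) + f_\emptyset g_\emptyset + \sum_{l<i} f(X_l) g(X_l)$, by rank one updates (Sherman--Morrison); the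
  final representers remove the auxiliary term $f_\emptyset g_\emptyset$ by a rank one downdate. The estimator
  is a \<open>SOME\<close> choice; comparing it with this explicit formula makes its values measurable.\<close>

primrec ridge_rep :: "nat \<Rightarrow> nat set set \<Rightarrow> real \<Rightarrow> (nat \<Rightarrow> nat \<Rightarrow> real) \<Rightarrow> nat \<Rightarrow> nat \<Rightarrow> family" where
  "ridge_rep m SS a Xs 0 = rep0 m a Xs"
| "ridge_rep m SS a Xs (Suc i) = (\<lambda>k S x. ridge_rep m SS a Xs i k S x -
     efun SS Xs k (ridge_rep m SS a Xs i (Suc i)) / (1 + efun SS Xs (Suc i) (ridge_rep m SS a Xs i (Suc i)))
       * ridge_rep m SS a Xs i (Suc i) S x)"

definition final_rep :: "nat \<Rightarrow> nat set set \<Rightarrow> real \<Rightarrow> (nat \<Rightarrow> nat \<Rightarrow> real) \<Rightarrow> nat \<Rightarrow> nat \<Rightarrow> family" where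
  "final_rep m SS a Xs n k = (\<lambda>S x. ridge_rep m SS a Xs n k S x +
     efun SS Xs k (ridge_rep m SS a Xs n 0) / (1 - efun SS Xs 0 (ridge_rep m SS a Xs n 0))
       * ridge_rep m SS a Xs n 0 S x)"

definition ridge_fit :: "nat \<Rightarrow> nat set set \<Rightarrow> real \<Rightarrow> (nat \<Rightarrow> nat \<Rightarrow> real) \<Rightarrow> (nat \<Rightarrow> real) \<Rightarrow> nat \<Rightarrow> family" where
  "ridge_fit m SS lam Xs Ys n = (\<lambda>S x. \<Sum>i<n. Ys i * final_rep m SS (lam * real n) Xs n (Suc i) S x)"

lemma evalfam_lincomb: "evalfam SS (\<lambda>S x. a * f S x + b * g S x) x = a * evalfam SS f x + b * evalfam SS g x"
  by (simp add: evalfam_def sum.distrib sum_distrib_left)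

lemma efun_lincomb: "efun SS Xs k (\<lambda>S x. a * f S x + b * g S x) = a * efun SS Xs k f + b * efun SS Xs k g"
  by (cases k) (simp_all add: efun_def intercept_def evalfam_lincomb)

lemma efun_sum: "efun SS Xs k (\<lambda>S x. \<Sum>i\<in>I. c i * f i S x) = (\<Sum>i\<in>I. c i * efun SS Xs k (f i))"
  by (cases k) (simp_all add: efun_def intercept_def evalfam_def sum_distrib_left sum.swap[of _ I])

locale family_space =
  fixes m :: nat and SS :: "nat set set" and D :: "nat set"
  assumes m: "0 < m" and D: "finite D" and SS: "SS \<subseteq> Pow D" "{} \<in> SS"
begin

lemma finite_SS: "finite SS" using D SS finite_subset by blast
lemma finite_comp: "S \<in> SS \<Longrightarrow> finite S" using D SS finite_subset by blast

lemma Hfam_lincomb: "f \<in> Hfam m SS \<Longrightarrow> g \<in> Hfam m SS \<Longrightarrow> (\<lambda>S x. a * f S x + b * g S x) \<in> Hfam m SS"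
  by (auto simp: Hfam_def intro: HS_lincomb[OF m])

lemma Hfam_sum: "(\<And>i. i \<in> I \<Longrightarrow> f i \<in> Hfam m SS) \<Longrightarrow> (\<lambda>S x. \<Sum>i\<in>I. c i * f i S x) \<in> Hfam m SS"
  by (auto simp: Hfam_def intro!: HS_sum[OF m])

lemma famJ_commute: "famJ m SS f g = famJ m SS g f"
  by (simp add: famJ_def JS_commute[OF m])

lemma famJ_lincomb:
  assumes "f \<in> Hfam m SS" "g \<in> Hfam m SS" "h \<in> Hfam m SS"
  shows "famJ m SS (\<lambda>S x. a * f S x + b * g S x) h = a * famJ m SS f h + b * famJ m SS g h"
proof -
  have "JS m S (\<lambda>x. a * f S x + b * g S x) (h S) = a * JS m S (f S) (h S) + b * JS m S (g S) (h S)" if "S \<in> SS - {{}}" for S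
    by (rule JS_lincomb[OF m finite_comp]) (use assms that in \<open>auto simp: Hfam_def\<close>)
  then show ?thesis by (simp add: famJ_def sum.distrib sum_distrib_left)
qed

lemma famJ_sum:
  assumes "\<And>i. i \<in> I \<Longrightarrow> f i \<in> Hfam m SS" "h \<in> Hfam m SS"
  shows "famJ m SS (\<lambda>S x. \<Sum>i\<in>I. c i * f i S x) h = (\<Sum>i\<in>I. c i * famJ m SS (f i) h)"
proof -
  have "JS m S (\<lambda>x. \<Sum>i\<in>I. c i * f i S x) (h S) = (\<Sum>i\<in>I. c i * JS m S (f i S) (h S))" if "S \<in> SS - {{}}" for S
    by (rule JS_sum[OF m finite_comp]) (use assms that in \<open>auto simp: Hfam_def\<close>)
  then show ?thesis by (simp add: famJ_def sum_distrib_left sum.swap[of _ I])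
qed

lemma famJ_nonneg: "0 \<le> famJ m SS f f"
  unfolding famJ_def by (intro sum_nonneg JS_nonneg[OF m])

text \<open>The penalty is definite on the non-constant components: applied to a difference of two
  families with zero penalty, it gives equality there at every point, so only the intercept has to
  be compared through the data.\<close>

lemma famJ_zero_vanishes:
  assumes f: "f \<in> Hfam m SS" and z: "famJ m SS f f \<le> 0" and S: "S \<in> SS - {{}}" and x: "x \<in> cube S"
  shows "JS m S (f S) (f S) = 0" "f S x = 0"
proof -
  have "JS m S (f S) (f S) \<le> famJ m SS f f"
    unfolding famJ_def by (rule member_le_sum[OF S]) (use finite_SS JS_nonneg[OF m] in auto)
  then show J: "JS m S (f S) (f S) = 0" using z JS_nonneg[OF m, of S "f S"] by simp
  have "(f S x)\<^sup>2 \<le> JS m S (f S) (f S) * ((real m + 1)\<^sup>2) ^ card S"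
    using HS_bound[OF m _ _ x] f S finite_comp by (auto simp: Hfam_def)
  then show "f S x = 0" using J by simp
qed

lemma rep0_Hfam:
  assumes X: "\<And>l. Xs l \<in> cube D" shows "rep0 m a Xs k \<in> Hfam m SS"
proof (cases k)
  case 0 then show ?thesis by (auto simp: Hfam_def HS_zero[OF m])
next
  case (Suc l)
  have "(\<lambda>x. rkern m S (restrict (Xs l) S) x / a) \<in> HS m S" if "S \<in> SS" for S
  proof -
    have "rkern m S (restrict (Xs l) S) \<in> HS m S"
      by (rule rkern_HS[OF m finite_comp[OF that] restrict_cube[OF m X]]) (use SS that in auto)
    from HS_lincomb[OF m this this, of "1/a" 0] show ?thesis by simp
  qed
  then show ?thesis by (auto simp: Suc Hfam_def)
qed

text \<open>The auxiliary product of intercepts represents the unpenalized component; on the others,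
  dividing the reproducing kernel by \<open>a\<close> compensates the factor of the penalty.\<close>

lemma rep0_represents:
  assumes X: "\<And>l. Xs l \<in> cube D" and a: "0 < a" and g: "g \<in> Hfam m SS"
  shows "a * famJ m SS (rep0 m a Xs k) g + intercept (rep0 m a Xs k) * intercept g = efun SS Xs k g"
proof (cases k)
  case 0
  have "JS m S (\<lambda>x. 0) (g S) = 0" if "S \<in> SS - {{}}" for S
    using JS_lincomb[OF m finite_comp HS_zero[OF m] HS_zero[OF m], of S "g S" 0 0] that g by (auto simp: Hfam_def)
  then have "famJ m SS (rep0 m a Xs 0) g = 0" by (simp add: famJ_def)
  then show ?thesis by (simp add: 0 efun_def intercept_def)
next
  case (Suc l)
  have c: "restrict (Xs l) S \<in> cube S" if "S \<in> SS" for S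
    by (rule restrict_cube[OF m X]) (use SS that in auto)
  have "a * JS m S (\<lambda>x. rkern m S (restrict (Xs l) S) x / a) (g S) = g S (restrict (Xs l) S)" if S: "S \<in> SS - {{}}" for S
  proof -
    have S': "S \<in> SS" "finite S" "g S \<in> HS m S" using S g finite_comp by (auto simp: Hfam_def)
    define y where "y = restrict (Xs l) S"
    have y: "y \<in> cube S" unfolding y_def by (rule c[OF S'(1)])
    have "JS m S (\<lambda>x. (1/a) * rkern m S y x + 0 * rkern m S y x) (g S)
      = (1/a) * JS m S (rkern m S y) (g S) + 0 * JS m S (rkern m S y) (g S)"
      by (rule JS_lincomb[OF m S'(2) rkern_HS[OF m S'(2) y] rkern_HS[OF m S'(2) y] S'(3)])
    also have "JS m S (rkern m S y) (g S) = g S y"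
      using JS_rkern[OF m S'(2) y S'(3)] JS_commute[OF m, of S "g S"] by simp
    finally have "JS m S (\<lambda>x. rkern m S y x / a) (g S) = g S y / a" by simp
    then show ?thesis unfolding y_def[symmetric] using a by simp
  qed
  then have "a * famJ m SS (rep0 m a Xs (Suc l)) g = (\<Sum>S\<in>SS - {{}}. g S (restrict (Xs l) S))"
    by (simp add: famJ_def sum_distrib_left)
  moreover have "evalfam SS g (Xs l) = g {} (restrict (Xs l) {}) + (\<Sum>S\<in>SS - {{}}. g S (restrict (Xs l) S))"
    unfolding evalfam_def by (rule sum.remove[OF finite_SS SS(2)])
  ultimately show ?thesis by (simp add: Suc efun_def intercept_def restrict_def)
qed

context
  fixes a :: real and Xs :: "nat \<Rightarrow> nat \<Rightarrow> real"
  assumes a: "0 < a" and X: "\<And>l. Xs l \<in> cube D"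
begin

abbreviation "rr \<equiv> ridge_rep m SS a Xs"
abbreviation "ee \<equiv> efun SS Xs"

definition form :: "nat \<Rightarrow> family \<Rightarrow> family \<Rightarrow> real" where
  "form i f g = a * famJ m SS f g + ee 0 f * ee 0 g + (\<Sum>l<i. ee (Suc l) f * ee (Suc l) g)"

lemma form_nonneg: "0 \<le> form i f f"
  unfolding form_def using a famJ_nonneg[of f] by (intro add_nonneg_nonneg sum_nonneg zero_le_square) simp

lemma form_lincomb:
  assumes "f \<in> Hfam m SS" "g \<in> Hfam m SS" "h \<in> Hfam m SS"
  shows "form i (\<lambda>S x. c * f S x + d * g S x) h = c * form i f h + d * form i g h"
  unfolding form_def famJ_lincomb[OF assms] efun_lincomb
  by (simp add: algebra_simps sum.distrib sum_distrib_left)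

lemma form_commute: "form i f g = form i g f"
  by (simp add: form_def famJ_commute mult.commute)

lemma rr_Suc: "rr (Suc i) k = (\<lambda>S x. 1 * rr i k S x + (- (ee k (rr i (Suc i)) / (1 + ee (Suc i) (rr i (Suc i))))) * rr i (Suc i) S x)"
  by (simp add: fun_eq_iff)

lemma rr_Hfam: "rr i k \<in> Hfam m SS"
proof (induction i arbitrary: k)
  case 0 then show ?case by (simp add: rep0_Hfam[OF X])
next
  case (Suc i) show ?case unfolding rr_Suc by (rule Hfam_lincomb[OF Suc Suc])
qed

lemma rr_represents: "g \<in> Hfam m SS \<Longrightarrow> form i (rr i k) g = ee k g"
proof (induction i arbitrary: k g)
  case 0
  have "a * famJ m SS (rep0 m a Xs k) g + intercept (rep0 m a Xs k) * intercept g = ee k g"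
    by (rule rep0_represents[OF X a 0])
  then show ?case by (simp add: form_def efun_def)
next
  case (Suc i)
  let ?e = "rr i (Suc i)"
  let ?K = "ee (Suc i) ?e"
  let ?c = "ee k ?e / (1 + ?K)"
  have eH: "?e \<in> Hfam m SS" and kH: "rr i k \<in> Hfam m SS" by (rule rr_Hfam)+
  have K: "0 \<le> ?K" using Suc.IH[OF eH, of "Suc i"] form_nonneg[of i ?e] by simp
  have sym: "ee (Suc i) (rr i k) = ee k ?e"
    using Suc.IH[OF kH, of "Suc i"] Suc.IH[OF eH, of k] form_commute[of i ?e "rr i k"] by simp
  \<comment> \<open>Nonnegativity of \<open>?K\<close> keeps the denominator at least 1. The
    identity says that the corrected representer takes the value \<open>?c\<close> at the new design
    point, which is what cancels the correction in the enlarged form.\<close>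
  have c: "?c * (1 + ?K) = ee k ?e" using K by simp
  have "form (Suc i) (rr (Suc i) k) g = form i (rr (Suc i) k) g + ee (Suc i) (rr (Suc i) k) * ee (Suc i) g"
    by (simp add: form_def del: ridge_rep.simps)
  also have "form i (rr (Suc i) k) g = ee k g - ?c * ee (Suc i) g"
    unfolding rr_Suc form_lincomb[OF kH eH Suc.prems] Suc.IH[OF Suc.prems] by simp
  also have "ee (Suc i) (rr (Suc i) k) = ee k ?e - ?c * ?K"
    unfolding rr_Suc efun_lincomb sym by simp
  also have "ee k ?e - ?c * ?K = ?c" using c unfolding distrib_left mult_1_right by linarith
  finally show ?case by simp
qed

text \<open>Denominator of the final downdate. With \<open>?K\<close> the value of the form at the
  intercept representer, \<open>?K * ?K \<le> ?K\<close> holds, so \<open>?K \<le> 1\<close>.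
  Equality would make the penalty and all design values vanish; the representer would then be
  constant, equal to 1 by its intercept but to 0 at the first design point.\<close>

lemma intercept_rep_less_one:
  assumes "0 < n" shows "ee 0 (rr n 0) < 1"
proof -
  let ?r = "rr n 0"
  let ?K = "ee 0 ?r"
  have H: "?r \<in> Hfam m SS" by (rule rr_Hfam)
  have f: "?K = a * famJ m SS ?r ?r + ?K * ?K + (\<Sum>l<n. ee (Suc l) ?r * ee (Suc l) ?r)"
    using rr_represents[OF H, of n 0] by (simp add: form_def)
  have J0: "0 \<le> a * famJ m SS ?r ?r" using a famJ_nonneg[of ?r] by simp
  have E0: "0 \<le> (\<Sum>l<n. ee (Suc l) ?r * ee (Suc l) ?r)" by (intro sum_nonneg) auto
  have le: "?K * ?K \<le> ?K" using f J0 E0 by linarith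
  have K1: "?K \<le> 1"
  proof (rule ccontr)
    assume "\<not> ?K \<le> 1"
    then have "?K * 1 < ?K * ?K" by (intro mult_strict_left_mono) auto
    then show False using le by simp
  qed
  have "?K \<noteq> 1"
  proof
    assume K: "?K = 1"
    then have J: "a * famJ m SS ?r ?r \<le> 0" and E: "(\<Sum>l<n. ee (Suc l) ?r * ee (Suc l) ?r) \<le> 0" using f J0 E0 by auto
    have Jz: "famJ m SS ?r ?r \<le> 0" using J a by (simp add: mult_le_0_iff)
    have "ee (Suc 0) ?r * ee (Suc 0) ?r \<le> (\<Sum>l<n. ee (Suc l) ?r * ee (Suc l) ?r)"
      by (rule member_le_sum[of 0 "{..<n}" "\<lambda>l. ee (Suc l) ?r * ee (Suc l) ?r"]) (use assms in auto)
    then have "ee (Suc 0) ?r * ee (Suc 0) ?r \<le> 0" using E by linarith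
    then have e0: "ee (Suc 0) ?r = 0" by (simp add: power2_eq_square[symmetric])
    have "evalfam SS ?r (Xs 0) = ?r {} (restrict (Xs 0) {}) + (\<Sum>S\<in>SS - {{}}. ?r S (restrict (Xs 0) S))"
      unfolding evalfam_def by (rule sum.remove[OF finite_SS SS(2)])
    also have "(\<Sum>S\<in>SS - {{}}. ?r S (restrict (Xs 0) S)) = 0"
    proof (rule sum.neutral, rule ballI)
      fix S assume S: "S \<in> SS - {{}}"
      show "?r S (restrict (Xs 0) S) = 0"
        by (rule famJ_zero_vanishes(2)[OF H Jz S restrict_cube[OF m X]]) (use S SS in auto)
    qed
    finally have "evalfam SS ?r (Xs 0) = ?K" by (simp add: efun_def intercept_def restrict_def)
    then show False using K e0 by (simp add: efun_def)
  qed
  then show ?thesis using K1 by simp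
qed

lemma final_rep_Hfam: "final_rep m SS a Xs n k \<in> Hfam m SS"
proof -
  have "final_rep m SS a Xs n k = (\<lambda>S x. 1 * rr n k S x + ee k (rr n 0) / (1 - ee 0 (rr n 0)) * rr n 0 S x)"
    by (simp add: final_rep_def)
  then show ?thesis by (simp only: Hfam_lincomb[OF rr_Hfam rr_Hfam])
qed

lemma final_rep_represents:
  assumes n: "0 < n" and g: "g \<in> Hfam m SS"
  shows "a * famJ m SS (final_rep m SS a Xs n k) g + (\<Sum>l<n. ee (Suc l) (final_rep m SS a Xs n k) * ee (Suc l) g) = ee k g"
proof -
  let ?r = "rr n 0" and ?f = "final_rep m SS a Xs n k"
  let ?K = "ee 0 ?r"
  let ?c = "ee k ?r / (1 - ?K)"
  have fd: "?f = (\<lambda>S x. 1 * rr n k S x + ?c * ?r S x)" by (simp add: final_rep_def)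
  have c: "?c * (1 - ?K) = ee k ?r" using intercept_rep_less_one[OF n] by simp
  have sym: "ee 0 (rr n k) = ee k ?r"
    using rr_represents[OF rr_Hfam[of n k], of n 0] rr_represents[OF rr_Hfam[of n 0], of n k] form_commute[of n ?r "rr n k"] by simp
  have "form n ?f g = ee k g + ?c * ee 0 g"
    unfolding fd form_lincomb[OF rr_Hfam rr_Hfam g] rr_represents[OF g] by simp
  moreover have "ee 0 ?f = ?c"
    unfolding fd efun_lincomb sym using c unfolding right_diff_distrib mult_1_right mult_1 by linarith
  ultimately show ?thesis by (simp add: form_def)
qed

end

section \<open>Agreement of the chosen minimizer with the explicit fit\<close>

context
  fixes lam :: real and n :: nat and Xs :: "nat \<Rightarrow> nat \<Rightarrow> real" and Ys :: "nat \<Rightarrow> real"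
  assumes lam: "0 < lam" and n: "0 < n" and X: "\<And>l. Xs l \<in> cube D"
begin

lemma lamn: "0 < lam * real n" using lam n by simp

abbreviation "fit \<equiv> ridge_fit m SS lam Xs Ys n"

lemma fit_Hfam: "fit \<in> Hfam m SS"
  unfolding ridge_fit_def by (rule Hfam_sum) (rule final_rep_Hfam[OF lamn X])

lemma fit_normal_equation:
  assumes g: "g \<in> Hfam m SS"
  shows "lam * real n * famJ m SS fit g + (\<Sum>l<n. evalfam SS fit (Xs l) * evalfam SS g (Xs l)) = (\<Sum>i<n. Ys i * evalfam SS g (Xs i))"
proof -
  let ?F = "\<lambda>i. final_rep m SS (lam * real n) Xs n (Suc i)"
  have H: "?F i \<in> Hfam m SS" for i by (rule final_rep_Hfam[OF lamn X])
  have J: "famJ m SS fit g = (\<Sum>i<n. Ys i * famJ m SS (?F i) g)"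
    unfolding ridge_fit_def by (rule famJ_sum[OF H g])
  have e: "efun SS Xs (Suc l) fit = (\<Sum>i<n. Ys i * efun SS Xs (Suc l) (?F i))" for l
    unfolding ridge_fit_def by (rule efun_sum)
  have "lam * real n * famJ m SS fit g + (\<Sum>l<n. efun SS Xs (Suc l) fit * efun SS Xs (Suc l) g)
     = (\<Sum>i<n. Ys i * (lam * real n * famJ m SS (?F i) g + (\<Sum>l<n. efun SS Xs (Suc l) (?F i) * efun SS Xs (Suc l) g)))"
  proof -
    have "(\<Sum>l<n. (\<Sum>i<n. Ys i * efun SS Xs (Suc l) (?F i)) * efun SS Xs (Suc l) g) = (\<Sum>i<n. Ys i * (\<Sum>l<n. efun SS Xs (Suc l) (?F i) * efun SS Xs (Suc l) g))"
      unfolding sum_distrib_right sum_distrib_left by (subst sum.swap) (simp only: mult.assoc)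
    moreover have "lam * real n * (\<Sum>i<n. Ys i * famJ m SS (?F i) g) = (\<Sum>i<n. Ys i * (lam * real n * famJ m SS (?F i) g))"
      unfolding sum_distrib_left by (simp only: mult.left_commute)
    ultimately show ?thesis unfolding J e by (simp only: distrib_left sum.distrib)
  qed
  also have "\<dots> = (\<Sum>i<n. Ys i * efun SS Xs (Suc i) g)" by (simp add: final_rep_represents[OF lamn X n g])
  finally show ?thesis by (simp add: efun_def)
qed

text \<open>The objective is quadratic and the normal equation removes its cross term, so the excess
  over the fit is the energy of the difference.\<close>

lemma pls_obj_expand:
  assumes h: "h \<in> Hfam m SS"
  defines "g \<equiv> \<lambda>S x. 1 * h S x + (-1) * fit S x"
  shows "pls_obj m SS lam Xs Ys n h = pls_obj m SS lam Xs Ys n fit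
     + (lam * real n * famJ m SS g g + (\<Sum>l<n. (evalfam SS g (Xs l))\<^sup>2)) / (2 * real n)"
proof -
  have g: "g \<in> Hfam m SS" unfolding g_def by (rule Hfam_lincomb[OF h fit_Hfam])
  have hd: "(\<lambda>S x. 1 * fit S x + 1 * g S x) = h" by (simp add: g_def fun_eq_iff)
  have add: "famJ m SS h k = famJ m SS fit k + famJ m SS g k" if "k \<in> Hfam m SS" for k
    using famJ_lincomb[OF fit_Hfam g that, of 1 1] unfolding hd by simp
  have Jh: "famJ m SS h h = famJ m SS fit fit + 2 * famJ m SS fit g + famJ m SS g g"
    using add[OF h] add[OF fit_Hfam] add[OF g] famJ_commute[of fit h] famJ_commute[of g h] famJ_commute[of g fit] by simp
  have eh: "evalfam SS h x = evalfam SS fit x + evalfam SS g x" for x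
    using evalfam_lincomb[of SS 1 fit 1 g x] unfolding hd by simp
  have "(\<Sum>i<n. (Ys i - evalfam SS h (Xs i))\<^sup>2) = (\<Sum>i<n. (Ys i - evalfam SS fit (Xs i))\<^sup>2)
     - 2 * ((\<Sum>i<n. Ys i * evalfam SS g (Xs i)) - (\<Sum>i<n. evalfam SS fit (Xs i) * evalfam SS g (Xs i))) + (\<Sum>i<n. (evalfam SS g (Xs i))\<^sup>2)"
    unfolding eh by (simp add: power2_eq_square algebra_simps sum.distrib sum_subtractf sum_distrib_left)
  also have "(\<Sum>i<n. Ys i * evalfam SS g (Xs i)) - (\<Sum>i<n. evalfam SS fit (Xs i) * evalfam SS g (Xs i)) = lam * real n * famJ m SS fit g"
    using fit_normal_equation[OF g] by simp
  finally have e: "(\<Sum>i<n. (Ys i - evalfam SS h (Xs i))\<^sup>2) = (\<Sum>i<n. (Ys i - evalfam SS fit (Xs i))\<^sup>2)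
     - 2 * (lam * real n * famJ m SS fit g) + (\<Sum>i<n. (evalfam SS g (Xs i))\<^sup>2)" .
  have "real n \<noteq> 0" using n by simp
  then show ?thesis
    unfolding pls_obj_def Jtot_famJ Jh e by (simp add: add_divide_distrib diff_divide_distrib algebra_simps)
qed

lemma fit_minimizes: "h \<in> Hfam m SS \<Longrightarrow> pls_obj m SS lam Xs Ys n fit \<le> pls_obj m SS lam Xs Ys n h"
  using pls_obj_expand[of h] famJ_nonneg lam n
  by (auto intro!: divide_nonneg_nonneg add_nonneg_nonneg mult_nonneg_nonneg sum_nonneg)

abbreviation "est \<equiv> estimator m SS lam Xs Ys n"

lemma est_minimizes: "est \<in> Hfam m SS" "h \<in> Hfam m SS \<Longrightarrow> pls_obj m SS lam Xs Ys n est \<le> pls_obj m SS lam Xs Ys n h"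
proof -
  have "\<exists>f. f \<in> Hfam m SS \<and> (\<forall>g\<in>Hfam m SS. pls_obj m SS lam Xs Ys n f \<le> pls_obj m SS lam Xs Ys n g)"
    using fit_Hfam fit_minimizes by blast
  from someI_ex[OF this] show "est \<in> Hfam m SS" "h \<in> Hfam m SS \<Longrightarrow> pls_obj m SS lam Xs Ys n est \<le> pls_obj m SS lam Xs Ys n h"
    unfolding estimator_def by blast+
qed

text \<open>For a minimizer the excess over the fit is not positive, hence both of its nonnegative
  parts vanish. This is how the arbitrary choice made by \<open>estimator\<close> inherits the
  formula, the normal equation and measurability.\<close>

lemma est_diff:
  defines "g \<equiv> \<lambda>S x. 1 * est S x + (-1) * fit S x"
  shows "g \<in> Hfam m SS" "famJ m SS g g \<le> 0" "\<And>l. l < n \<Longrightarrow> evalfam SS g (Xs l) = 0"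
proof -
  show g: "g \<in> Hfam m SS" unfolding g_def by (rule Hfam_lincomb[OF est_minimizes(1) fit_Hfam])
  have "(lam * real n * famJ m SS g g + (\<Sum>l<n. (evalfam SS g (Xs l))\<^sup>2)) / (2 * real n) \<le> 0"
    using pls_obj_expand[OF est_minimizes(1)] est_minimizes(2)[OF fit_Hfam] by (simp add: g_def)
  then have z: "lam * real n * famJ m SS g g + (\<Sum>l<n. (evalfam SS g (Xs l))\<^sup>2) \<le> 0" using n by (simp add: divide_le_0_iff)
  have 1: "0 \<le> lam * real n * famJ m SS g g" using lam famJ_nonneg by simp
  have 2: "0 \<le> (\<Sum>l<n. (evalfam SS g (Xs l))\<^sup>2)" by (intro sum_nonneg) auto
  have "lam * real n * famJ m SS g g \<le> 0" using z 1 2 by linarith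
  then show "famJ m SS g g \<le> 0" using mult_pos_pos[OF lamn, of "famJ m SS g g"] by linarith
  fix l assume l: "l < n"
  have "(evalfam SS g (Xs l))\<^sup>2 \<le> (\<Sum>l<n. (evalfam SS g (Xs l))\<^sup>2)"
    by (rule member_le_sum[of l "{..<n}" "\<lambda>l. (evalfam SS g (Xs l))\<^sup>2"]) (use l in auto)
  then have "(evalfam SS g (Xs l))\<^sup>2 \<le> 0" using z 1 by linarith
  then show "evalfam SS g (Xs l) = 0" by simp
qed

lemma est_eq_fit: "S \<in> SS - {{}} \<Longrightarrow> x \<in> cube S \<Longrightarrow> est S x = fit S x"
  using famJ_zero_vanishes(2)[OF est_diff(1,2)] by fastforce

text \<open>The other components coincide, so equality of the two fits at one design point forces
  equality of the intercepts.\<close>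

lemma est_intercept_eq_fit: "intercept est = intercept fit"
proof -
  let ?g = "\<lambda>S x. 1 * est S x + (-1) * fit S x"
  have "evalfam SS ?g (Xs 0) = ?g {} (restrict (Xs 0) {}) + (\<Sum>S\<in>SS - {{}}. ?g S (restrict (Xs 0) S))"
    unfolding evalfam_def by (rule sum.remove[OF finite_SS SS(2)])
  also have "(\<Sum>S\<in>SS - {{}}. ?g S (restrict (Xs 0) S)) = 0"
  proof (rule sum.neutral, rule ballI)
    fix S assume S: "S \<in> SS - {{}}"
    show "?g S (restrict (Xs 0) S) = 0"
      by (rule famJ_zero_vanishes(2)[OF est_diff(1,2) S restrict_cube[OF m X]]) (use S SS in auto)
  qed
  finally show ?thesis using est_diff(3)[of 0] n by (simp add: intercept_def restrict_def)
qed

lemma est_normal_equation: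
  assumes k: "k \<in> Hfam m SS"
  shows "(\<Sum>i<n. (Ys i - evalfam SS est (Xs i)) * evalfam SS k (Xs i)) = real n * lam * famJ m SS est k"
proof -
  let ?g = "\<lambda>S x. 1 * est S x + (-1) * fit S x"
  have g: "?g \<in> Hfam m SS" by (rule est_diff(1))
  have "JS m S (?g S) (k S) = 0" if S: "S \<in> SS - {{}}" for S
  proof -
    have gS: "?g S \<in> HS m S" "k S \<in> HS m S" "finite S" using g k S finite_comp by (auto simp: Hfam_def)
    \<comment> \<open>The origin of the cube, as the point that \<open>famJ_zero_vanishes\<close>
      asks for.\<close>
    have ne: "(\<lambda>j. if j \<in> S then 0 else undefined) \<in> cube S" by (auto simp: cube_def PiE_iff extensional_def)
    have "(JS m S (?g S) (k S))\<^sup>2 \<le> JS m S (?g S) (?g S) * JS m S (k S) (k S)"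
      by (rule JS_Cauchy_Schwarz[OF m gS(3,1,2)])
    also have "\<dots> = 0" using famJ_zero_vanishes(1)[OF est_diff(1,2) S ne] by simp
    finally show ?thesis by simp
  qed
  then have "famJ m SS ?g k = 0" by (simp add: famJ_def)
  then have J: "famJ m SS est k = famJ m SS fit k"
    using famJ_lincomb[OF est_minimizes(1) fit_Hfam k, of 1 "-1"] by simp
  have "evalfam SS est (Xs l) = evalfam SS fit (Xs l)" if "l < n" for l
    using est_diff(3)[OF that] unfolding evalfam_lincomb by simp
  then have "(\<Sum>l<n. evalfam SS est (Xs l) * evalfam SS k (Xs l)) = (\<Sum>l<n. evalfam SS fit (Xs l) * evalfam SS k (Xs l))"
    by (intro sum.cong) auto
  then show ?thesis unfolding J left_diff_distrib sum_subtractf using fit_normal_equation[OF k] by (simp only: mult.commute[of "real n" lam])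
qed

end

text \<open>An update divides by values of earlier representers at the random design points.
  Measurability of those values and of the representers at fixed points therefore has to be carried
  through one induction, for all representers at once.\<close>

lemma ridge_rep_measurable:
  assumes X: "\<And>l. X l \<in> measurable M (PiM D (\<lambda>_. U01))"
  shows "(\<lambda>\<omega>. efun SS (\<lambda>l. X l \<omega>) j (ridge_rep m SS a (\<lambda>l. X l \<omega>) i k)) \<in> borel_measurable M"
    and "S \<in> SS \<Longrightarrow> x \<in> cube S \<Longrightarrow> (\<lambda>\<omega>. ridge_rep m SS a (\<lambda>l. X l \<omega>) i k S x) \<in> borel_measurable M"
proof -
  let ?P = "\<lambda>i k. (\<forall>j. (\<lambda>\<omega>. efun SS (\<lambda>l. X l \<omega>) j (ridge_rep m SS a (\<lambda>l. X l \<omega>) i k)) \<in> borel_measurable M) \<and>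
     (\<forall>S x. S \<in> SS \<longrightarrow> x \<in> cube S \<longrightarrow> (\<lambda>\<omega>. ridge_rep m SS a (\<lambda>l. X l \<omega>) i k S x) \<in> borel_measurable M)"
  have XS: "(\<lambda>\<omega>. restrict (X l \<omega>) S) \<in> measurable M (PiM S (\<lambda>_. U01))" if "S \<in> SS" for S l
    by (rule measurable_compose[OF X restrict_measurable[OF m]]) (use SS that in auto)
  have "?P i k" for i k
  proof (induction i arbitrary: k)
    case 0
    have comp: "(\<lambda>\<omega>. rep0 m a (\<lambda>l. X l \<omega>) k S x) \<in> borel_measurable M" if S: "S \<in> SS" and x: "x \<in> cube S" for S x
    proof (cases k)
      case (Suc l)
      have "(\<lambda>\<omega>. x) \<in> measurable M (PiM S (\<lambda>_. U01))" using x by (simp add: space_PiM_U01)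
      from rkern_measurable[OF m finite_comp[OF S] XS[OF S, of l] this]
      show ?thesis by (simp add: Suc)
    qed simp
    have comp2: "(\<lambda>\<omega>. rep0 m a (\<lambda>l. X l \<omega>) k S (restrict (X l \<omega>) S)) \<in> borel_measurable M" if S: "S \<in> SS" for S l
    proof (cases k)
      case (Suc l')
      from rkern_measurable[OF m finite_comp[OF S] XS[OF S, of l'] XS[OF S, of l]]
      show ?thesis by (simp add: Suc)
    qed simp
    have "(\<lambda>\<omega>. efun SS (\<lambda>l. X l \<omega>) j (rep0 m a (\<lambda>l. X l \<omega>) k)) \<in> borel_measurable M" for j
    proof (cases j)
      case 0
      have "(\<lambda>_. undefined) \<in> cube {}" by (simp add: cube_def)
      from comp[OF SS(2) this] show ?thesis by (simp add: 0 efun_def intercept_def)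
    next
      case (Suc l)
      show ?thesis unfolding Suc efun_def evalfam_def by (simp, intro borel_measurable_sum comp2)
    qed
    then show ?case using comp by simp
  next
    case (Suc i)
    have e: "(\<lambda>\<omega>. efun SS (\<lambda>l. X l \<omega>) j (ridge_rep m SS a (\<lambda>l. X l \<omega>) i k)) \<in> borel_measurable M" for j k using Suc by blast
    have s: "(\<lambda>\<omega>. ridge_rep m SS a (\<lambda>l. X l \<omega>) i k S x) \<in> borel_measurable M" if "S \<in> SS" "x \<in> cube S" for k S x using Suc that by blast
    have rr: "ridge_rep m SS a Xs (Suc i) k = (\<lambda>S x. 1 * ridge_rep m SS a Xs i k S x + (- (efun SS Xs k (ridge_rep m SS a Xs i (Suc i)) /
      (1 + efun SS Xs (Suc i) (ridge_rep m SS a Xs i (Suc i))))) * ridge_rep m SS a Xs i (Suc i) S x)" for Xs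
      by (simp add: fun_eq_iff)
    show ?case unfolding rr efun_lincomb
      by (intro conjI allI impI borel_measurable_add borel_measurable_times borel_measurable_uminus borel_measurable_divide borel_measurable_const e s)
  qed
  then show "(\<lambda>\<omega>. efun SS (\<lambda>l. X l \<omega>) j (ridge_rep m SS a (\<lambda>l. X l \<omega>) i k)) \<in> borel_measurable M"
    "S \<in> SS \<Longrightarrow> x \<in> cube S \<Longrightarrow> (\<lambda>\<omega>. ridge_rep m SS a (\<lambda>l. X l \<omega>) i k S x) \<in> borel_measurable M" by blast+
qed

lemma ridge_fit_measurable:
  assumes X: "\<And>l. X l \<in> measurable M (PiM D (\<lambda>_. U01))" and Y: "\<And>l. Y l \<in> borel_measurable M"
    and S: "S \<in> SS" "x \<in> cube S"
  shows "(\<lambda>\<omega>. ridge_fit m SS lam (\<lambda>l. X l \<omega>) (\<lambda>l. Y l \<omega>) n S x) \<in> borel_measurable M"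
  unfolding ridge_fit_def final_rep_def
  by (intro borel_measurable_sum borel_measurable_add borel_measurable_times borel_measurable_divide borel_measurable_diff
      borel_measurable_const Y ridge_rep_measurable[OF X] S)

end

section \<open>Perturbation of a diagonal system\<close>

text \<open>The unknown $u$ solves $u_i = w_i (b_i - \sum_k D_{ik} u_k)$; a small weighted Hilbert--Schmidt norm
  of $D$ bounds the weighted norm of $u$ by twice that of $b$, and then the off-diagonal contribution.\<close>

lemma diagonal_system_perturbation:
  fixes u w b l :: "nat \<Rightarrow> real" and D :: "nat \<Rightarrow> nat \<Rightarrow> real"
  assumes w: "\<And>k. 0 < w k" and u: "summable (\<lambda>k. (u k)\<^sup>2 / w k)"
    and D: "\<And>N. (\<Sum>i<N. \<Sum>k<N. w i * w k * (D i k)\<^sup>2) \<le> Q" and Q: "Q \<le> 1/4"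
    and sys: "\<And>i. (\<lambda>k. D i k * u k) sums (b i - u i / w i)"
    and b: "\<And>N. (\<Sum>i<N. w i * (b i)\<^sup>2) \<le> B" and l: "\<And>N. (\<Sum>i<N. w i * (l i)\<^sup>2) \<le> L"
  shows "(\<Sum>i<N. l i * (u i - w i * b i))\<^sup>2 \<le> 4 * L * Q * B"
proof -
  define U where "U = (\<Sum>k. (u k)\<^sup>2 / w k)"
  have w': "0 \<le> w k" for k using w[of k] by simp
  have U0: "0 \<le> U" unfolding U_def using w' by (intro suminf_nonneg[OF u]) auto
  have Q0: "0 \<le> Q" using D[of 0] by simp
  have B0: "0 \<le> B" using b[of 0] by simp
  have L0: "0 \<le> L" using l[of 0] by simp
  define r where "r i = b i - u i / w i" for i
  have rK: "(\<Sum>i<N. w i * (\<Sum>k<K. D i k * u k)\<^sup>2) \<le> Q * U" for N K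
  proof -
    \<comment> \<open>Cauchy--Schwarz with \<open>sqrt (w k)\<close> on one factor and its inverse
      on the other pairs the weighted Hilbert--Schmidt norm of \<open>D\<close> with the weighted
      norm \<open>U\<close> of the unknown.\<close>
    have "w i * (\<Sum>k<K. D i k * u k)\<^sup>2 \<le> (\<Sum>k<K. w i * w k * (D i k)\<^sup>2) * U" for i
    proof -
      have "(\<Sum>k<K. D i k * u k)\<^sup>2 = (\<Sum>k<K. (sqrt (w k) * D i k) * (u k / sqrt (w k)))\<^sup>2"
        using w[THEN less_imp_neq] w' by (intro arg_cong[where f="\<lambda>x. x\<^sup>2"] sum.cong) (auto simp: field_simps)
      also have "\<dots> \<le> (\<Sum>k<K. (sqrt (w k) * D i k)\<^sup>2) * (\<Sum>k<K. (u k / sqrt (w k))\<^sup>2)" by (rule Cauchy_Schwarz_ineq_sum)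
      also have "\<dots> = (\<Sum>k<K. w k * (D i k)\<^sup>2) * (\<Sum>k<K. (u k)\<^sup>2 / w k)"
        using w' by (simp add: power_mult_distrib power_divide)
      also have "\<dots> \<le> (\<Sum>k<K. w k * (D i k)\<^sup>2) * U"
        unfolding U_def using w' by (intro mult_left_mono sum_le_suminf[OF u] sum_nonneg) auto
      finally have "w i * (\<Sum>k<K. D i k * u k)\<^sup>2 \<le> w i * ((\<Sum>k<K. w k * (D i k)\<^sup>2) * U)" using w' by (rule mult_left_mono)
      then show ?thesis by (simp add: sum_distrib_left sum_distrib_right mult_ac)
    qed
    then have "(\<Sum>i<N. w i * (\<Sum>k<K. D i k * u k)\<^sup>2) \<le> (\<Sum>i<N. (\<Sum>k<K. w i * w k * (D i k)\<^sup>2) * U)" by (rule sum_mono)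
    also have "\<dots> = (\<Sum>i<N. \<Sum>k<K. w i * w k * (D i k)\<^sup>2) * U" by (simp add: sum_distrib_right)
    also have "\<dots> \<le> (\<Sum>i<max N K. \<Sum>k<max N K. w i * w k * (D i k)\<^sup>2) * U"
    proof (rule mult_right_mono[OF _ U0])
      have "(\<Sum>i<N. \<Sum>k<K. w i * w k * (D i k)\<^sup>2) \<le> (\<Sum>i<N. \<Sum>k<max N K. w i * w k * (D i k)\<^sup>2)"
        using w' by (intro sum_mono sum_mono2) auto
      also have "\<dots> \<le> (\<Sum>i<max N K. \<Sum>k<max N K. w i * w k * (D i k)\<^sup>2)"
        using w' by (intro sum_mono2 sum_nonneg) auto
      finally show "(\<Sum>i<N. \<Sum>k<K. w i * w k * (D i k)\<^sup>2) \<le> (\<Sum>i<max N K. \<Sum>k<max N K. w i * w k * (D i k)\<^sup>2)" .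
    qed
    also have "\<dots> \<le> Q * U" using D U0 by (rule mult_right_mono)
    finally show ?thesis .
  qed
  have r: "(\<Sum>i<N. w i * (r i)\<^sup>2) \<le> Q * U" for N
  proof (rule LIMSEQ_le_const2)
    show "(\<lambda>K. \<Sum>i<N. w i * (\<Sum>k<K. D i k * u k)\<^sup>2) \<longlonglongrightarrow> (\<Sum>i<N. w i * (r i)\<^sup>2)"
      using sys by (intro tendsto_intros) (simp add: sums_def r_def)
    show "\<exists>K0. \<forall>K\<ge>K0. (\<Sum>i<N. w i * (\<Sum>k<K. D i k * u k)\<^sup>2) \<le> Q * U" using rK by blast
  qed
  have "U \<le> 2 * B + 2 * (Q * U)"
    unfolding U_def
  proof (rule suminf_le_const[OF u])
    fix N
    have "(\<Sum>i<N. (u i)\<^sup>2 / w i) \<le> (\<Sum>i<N. 2 * (w i * (b i)\<^sup>2) + 2 * (w i * (r i)\<^sup>2))"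
    proof (rule sum_mono)
      fix i
      have "(u i)\<^sup>2 / w i = w i * (b i - r i)\<^sup>2" using w[of i] by (simp add: r_def field_simps power2_eq_square)
      moreover have "(b i - r i)\<^sup>2 \<le> 2 * (b i)\<^sup>2 + 2 * (r i)\<^sup>2"
        using zero_le_power2[of "b i + r i"] by (simp add: power2_eq_square algebra_simps)
      then have "w i * (b i - r i)\<^sup>2 \<le> w i * (2 * (b i)\<^sup>2 + 2 * (r i)\<^sup>2)" using w' by (rule mult_left_mono)
      ultimately show "(u i)\<^sup>2 / w i \<le> 2 * (w i * (b i)\<^sup>2) + 2 * (w i * (r i)\<^sup>2)" by (simp add: algebra_simps)
    qed
    also have "\<dots> = 2 * (\<Sum>i<N. w i * (b i)\<^sup>2) + 2 * (\<Sum>i<N. w i * (r i)\<^sup>2)" by (simp add: sum.distrib sum_distrib_left)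
    also have "\<dots> \<le> 2 * B + 2 * (Q * U)" using b[of N] r[of N] by simp
    finally show "(\<Sum>i<N. (u i)\<^sup>2 / w i) \<le> 2 * B + 2 * (Q * (\<Sum>k. (u k)\<^sup>2 / w k))" by (simp add: U_def)
  qed
  \<comment> \<open>The smallness of \<open>Q\<close> is used here: the term
    \<open>2 * (Q * U)\<close> is at most half of the finite number \<open>U\<close> and is absorbed
    on the left, giving \<open>U \<le> 4 * B\<close>.\<close>
  moreover have "Q * U \<le> 1/4 * U" using Q U0 by (rule mult_right_mono)
  ultimately have U4: "U \<le> 4 * B" by simp
  have "(\<Sum>i<N. l i * (u i - w i * b i))\<^sup>2 = (\<Sum>i<N. (sqrt (w i) * l i) * (sqrt (w i) * (- r i)))\<^sup>2"
  proof (intro arg_cong[where f="\<lambda>x. x\<^sup>2"] sum.cong refl)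
    fix i
    have "(sqrt (w i) * l i) * (sqrt (w i) * (- r i)) = (sqrt (w i) * sqrt (w i)) * (l i * (- r i))" by (simp add: mult_ac)
    also have "\<dots> = l i * (w i * (- r i))" using w'[of i] by (simp add: mult_ac)
    also have "w i * (- r i) = u i - w i * b i" using w[of i] by (simp add: r_def field_simps)
    finally show "l i * (u i - w i * b i) = (sqrt (w i) * l i) * (sqrt (w i) * (- r i))" by simp
  qed
  also have "\<dots> \<le> (\<Sum>i<N. (sqrt (w i) * l i)\<^sup>2) * (\<Sum>i<N. (sqrt (w i) * (- r i))\<^sup>2)" by (rule Cauchy_Schwarz_ineq_sum)
  also have "\<dots> = (\<Sum>i<N. w i * (l i)\<^sup>2) * (\<Sum>i<N. w i * (r i)\<^sup>2)" using w' by (simp add: power_mult_distrib)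
  also have "\<dots> \<le> L * (Q * U)"
    by (intro mult_mono l r sum_nonneg mult_nonneg_nonneg w' L0) auto
  also have "\<dots> \<le> L * (Q * (4 * B))" using L0 Q0 U4 by (intro mult_left_mono) auto
  finally show ?thesis by (simp add: mult_ac)
qed

section \<open>Independent samples\<close>

locale iid_sample = prob_space M for M :: "'w measure" +
  fixes N :: "'b measure" and T :: "nat \<Rightarrow> 'w \<Rightarrow> 'b" and \<nu> :: "'b measure"
  assumes indep_T: "indep_vars (\<lambda>_. N) T UNIV" and distr_T: "\<And>j. distr M N (T j) = \<nu>"
begin

lemma T_measurable: "T j \<in> measurable M N"
  using indep_T by (auto simp: indep_vars_def2)

lemma sets_nu: "sets \<nu> = sets N" using distr_T[of 0] by (metis sets_distr)

lemma prob_space_nu: "prob_space \<nu>"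
  using prob_space_distr[OF T_measurable[of 0]] distr_T[of 0] by simp

lemma integral_T:
  assumes "F \<in> borel_measurable N" shows "expectation (\<lambda>\<omega>. F (T j \<omega>)) = (LINT x|\<nu>. (F x :: real))"
  using integral_distr[OF T_measurable assms, of j] distr_T[of j] by simp

lemma integrable_T:
  assumes "F \<in> borel_measurable N" shows "integrable M (\<lambda>\<omega>. F (T j \<omega>)) \<longleftrightarrow> integrable \<nu> (F :: _ \<Rightarrow> real)"
  using integrable_distr_eq[OF T_measurable assms, of j] distr_T[of j] by simp

lemma indep_F:
  assumes "F \<in> borel_measurable N" shows "indep_vars (\<lambda>_. borel) (\<lambda>j \<omega>. F (T j \<omega>)) UNIV"
  by (rule indep_vars_compose2[OF indep_T]) (use assms in auto)

text \<open>Independence and zero mean remove all products with distinct indices; \<open>n\<close>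
  diagonal terms remain against the square of \<open>n\<close> in the denominator.\<close>

lemma second_moment_sample_mean:
  assumes F: "F \<in> borel_measurable N" and i2: "integrable \<nu> (\<lambda>x. (F x)\<^sup>2)" and mean: "(LINT x|\<nu>. F x) = (0::real)" and n: "0 < n"
  shows "integrable M (\<lambda>\<omega>. ((\<Sum>j<n. F (T j \<omega>)) / real n)\<^sup>2)"
    "expectation (\<lambda>\<omega>. ((\<Sum>j<n. F (T j \<omega>)) / real n)\<^sup>2) = (LINT x|\<nu>. (F x)\<^sup>2) / real n"
proof -
  have F2: "(\<lambda>x. (F x)\<^sup>2) \<in> borel_measurable N" using F by measurable
  have FT: "(\<lambda>\<omega>. F (T j \<omega>)) \<in> borel_measurable M" for j using T_measurable F by measurable
  have I2: "integrable M (\<lambda>\<omega>. (F (T j \<omega>))\<^sup>2)" for j using integrable_T[OF F2] i2 by simp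
  have I1: "integrable M (\<lambda>\<omega>. F (T j \<omega>))" for j by (rule integrable_of_square[OF FT I2])
  have IP: "integrable M (\<lambda>\<omega>. F (T i \<omega>) * F (T j \<omega>))" for i j by (rule integrable_mult_of_squares[OF FT FT I2 I2])
  have EP: "expectation (\<lambda>\<omega>. F (T i \<omega>) * F (T j \<omega>)) = (if i = j then LINT x|\<nu>. (F x)\<^sup>2 else 0)" for i j
  proof (cases "i = j")
    case True then show ?thesis using integral_T[OF F2, of j] by (simp add: power2_eq_square)
  next
    case False
    have "indep_vars (\<lambda>_. borel) (\<lambda>j \<omega>. F (T j \<omega>)) {i, j}" by (rule indep_vars_subset[OF indep_F[OF F]]) auto
    then have "expectation (\<lambda>\<omega>. \<Prod>k\<in>{i,j}. F (T k \<omega>)) = (\<Prod>k\<in>{i,j}. expectation (\<lambda>\<omega>. F (T k \<omega>)))"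
      by (intro indep_vars_lebesgue_integral) (use I1 in auto)
    then show ?thesis using False integral_T[OF F] mean by simp
  qed
  have sq: "((\<Sum>j<n. F (T j \<omega>)) / real n)\<^sup>2 = (\<Sum>i<n. \<Sum>j<n. F (T i \<omega>) * F (T j \<omega>)) / (real n)\<^sup>2" for \<omega>
    by (simp add: power_divide) (simp add: power2_eq_square sum_product)
  show "integrable M (\<lambda>\<omega>. ((\<Sum>j<n. F (T j \<omega>)) / real n)\<^sup>2)" unfolding sq using IP by simp
  have "expectation (\<lambda>\<omega>. ((\<Sum>j<n. F (T j \<omega>)) / real n)\<^sup>2) = (\<Sum>i<n. \<Sum>j<n. expectation (\<lambda>\<omega>. F (T i \<omega>) * F (T j \<omega>))) / (real n)\<^sup>2"
  proof -
    have "expectation (\<lambda>\<omega>. (\<Sum>i<n. \<Sum>j<n. F (T i \<omega>) * F (T j \<omega>))) = (\<Sum>i<n. \<Sum>j<n. expectation (\<lambda>\<omega>. F (T i \<omega>) * F (T j \<omega>)))"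
      using IP by (subst Bochner_Integration.integral_sum) (auto simp: Bochner_Integration.integral_sum)
    then show ?thesis unfolding sq by simp
  qed
  also have "(\<Sum>i<n. \<Sum>j<n. expectation (\<lambda>\<omega>. F (T i \<omega>) * F (T j \<omega>))) = (\<Sum>i<n. \<Sum>j<n. if i = j then LINT x|\<nu>. (F x)\<^sup>2 else 0)"
    by (simp add: EP)
  also have "\<dots> = real n * (LINT x|\<nu>. (F x)\<^sup>2)" by simp
  finally show "expectation (\<lambda>\<omega>. ((\<Sum>j<n. F (T j \<omega>)) / real n)\<^sup>2) = (LINT x|\<nu>. (F x)\<^sup>2) / real n"
    using n by (simp add: power2_eq_square)
qed

text \<open>Arithmetic-geometric mean: the cubic term in the error of a characteristic function is
  traded for second and fourth moments, with a free parameter \<open>e\<close> to balance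
  them.\<close>

lemma min_cubic_le:
  fixes e u y :: real
  assumes e: "0 < e"
  shows "min (6 * y\<^sup>2) (\<bar>u\<bar> * \<bar>y\<bar> ^ 3) \<le> e * y\<^sup>2 + u\<^sup>2 * y ^ 4 / e"
proof -
  let ?p = "sqrt e * \<bar>y\<bar>" and ?r = "\<bar>u\<bar> * y\<^sup>2 / sqrt e"
  have se: "sqrt e \<noteq> 0" using e by simp
  have "0 \<le> (?p - ?r)\<^sup>2" by simp
  then have 1: "2 * (?p * ?r) \<le> ?p\<^sup>2 + ?r\<^sup>2" unfolding power2_diff by linarith
  have "?p * ?r = \<bar>u\<bar> * (\<bar>y\<bar> * y\<^sup>2)" using se by simp
  also have "\<bar>y\<bar> * y\<^sup>2 = \<bar>y\<bar> ^ 3" by (simp add: power3_eq_cube power2_eq_square mult.assoc[symmetric] abs_mult[symmetric])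
  finally have 2: "?p * ?r = \<bar>u\<bar> * \<bar>y\<bar> ^ 3" .
  have 3: "?p\<^sup>2 = e * y\<^sup>2" using e by (simp add: power_mult_distrib)
  have 4: "?r\<^sup>2 = u\<^sup>2 * y ^ 4 / e" using e by (simp add: power_mult_distrib power_divide power_mult[symmetric])
  have 5: "0 \<le> \<bar>u\<bar> * \<bar>y\<bar> ^ 3" by simp
  have 6: "min (6 * y\<^sup>2) (\<bar>u\<bar> * \<bar>y\<bar> ^ 3) \<le> \<bar>u\<bar> * \<bar>y\<bar> ^ 3" by simp
  show ?thesis using 1 5 6 unfolding 2 3 4 by linarith
qed

text \<open>The summand may change with the row. The characteristic function of a row is a k-th
  power, and powers of numbers in the unit disc differ by at most k times the distance of the bases;
  the comparison is with (1 - t^2/(2k))^k. The Lyapunov condition on fourth moments makes the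
  distance of the bases o(1/k).\<close>

theorem row_central_limit_theorem:
  fixes W :: "nat \<Rightarrow> 'b \<Rightarrow> real" and k :: "nat \<Rightarrow> nat" and \<kappa> :: "nat \<Rightarrow> real"
  assumes W: "\<And>n. W n \<in> borel_measurable N" and i4: "\<And>n. integrable \<nu> (\<lambda>x. (W n x) ^ 4)"
    and mean: "\<And>n. (LINT x|\<nu>. W n x) = 0" and var: "\<And>n. (LINT x|\<nu>. (W n x)\<^sup>2) = 1"
    and kap: "\<And>n. (LINT x|\<nu>. (W n x) ^ 4) \<le> \<kappa> n"
    and k: "filterlim k at_top sequentially" "\<And>n. 0 < k n" and lim: "(\<lambda>n. \<kappa> n / real (k n)) \<longlonglongrightarrow> 0"
  shows "weak_conv_m (\<lambda>n. distr M borel (\<lambda>\<omega>. (\<Sum>j<k n. W n (T j \<omega>)) / sqrt (real (k n)))) std_normal_distribution"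
proof (rule levy_continuity)
  interpret nu: prob_space \<nu> by (rule prob_space_nu)
  have Wn: "W n \<in> borel_measurable \<nu>" for n using W[of n] by (simp add: measurable_cong_sets[OF sets_nu refl])
  have i2: "integrable \<nu> (\<lambda>x. (W n x)\<^sup>2)" for n
    by (rule nu.integrable_of_square) (use Wn i4[of n] in \<open>auto simp: power_mult[symmetric]\<close>)
  have WT: "(\<lambda>\<omega>. W n (T j \<omega>)) \<in> borel_measurable M" for n j using T_measurable W by measurable
  show "real_distribution (distr M borel (\<lambda>\<omega>. (\<Sum>j<k n. W n (T j \<omega>)) / sqrt (real (k n))))" for n
    by (rule real_distribution_distr) (use WT in measurable)
  show "real_distribution std_normal_distribution" by (rule real_dist_normal_dist)
  have i1: "integrable \<nu> (W n)" for n by (rule nu.integrable_of_square[OF Wn i2])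
  fix t :: real
  define \<phi> where "\<phi> n = char (distr M borel (\<lambda>\<omega>. (\<Sum>j<k n. W n (T j \<omega>)) / sqrt (real (k n)))) t" for n
  \<comment> \<open>Balances the two terms of \<open>min_cubic_le\<close> at argument
    \<open>t / sqrt (k n)\<close>: both become a multiple of this quantity. The reciprocal keeps it
    positive when the moment bound is zero.\<close>
  define e where "e n = sqrt (\<kappa> n / real (k n)) + 1 / real (k n)" for n
  have kap0: "0 \<le> \<kappa> n" for n
  proof -
    have "0 \<le> (LINT x|\<nu>. (W n x) ^ 4)" by (rule integral_nonneg_AE) simp
    then show ?thesis by (rule order_trans[OF _ kap])
  qed
  have e0: "0 < e n" for n using k(2)[of n] kap0[of n] by (simp add: e_def add_nonneg_pos)
  have ek: "\<kappa> n / real (k n) / e n \<le> e n" for n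
  proof -
    let ?q = "\<kappa> n / real (k n)"
    have q0: "0 \<le> ?q" using kap0 by simp
    have "sqrt ?q \<le> e n" by (simp add: e_def)
    then have "sqrt ?q * sqrt ?q \<le> e n * e n" by (intro mult_mono) (use e0[of n] q0 in auto)
    then have "?q \<le> e n * e n" unfolding real_sqrt_mult_self abs_of_nonneg[OF q0] .
    then show ?thesis using e0[of n] by (simp only: pos_divide_le_eq)
  qed
  \<comment> \<open>The restriction on \<open>k n\<close> puts 1 - t^2/(2k) into [-1,1], as required
    for comparing powers.\<close>
  have main: "norm (\<phi> n - complex_of_real ((1 + (- (t\<^sup>2) / 2) / real (k n)) ^ k n)) \<le> t\<^sup>2 / 6 * ((1 + t\<^sup>2) * e n)"
    if n: "t\<^sup>2 / 4 \<le> real (k n)" for n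
  proof -
    let ?k = "k n" and ?s = "sqrt (real (k n))"
    have k0: "0 < real ?k" using k(2) by simp
    define \<psi> where "\<psi> = char (distr \<nu> borel (W n)) (t / ?s)"
    have WTn: "random_variable borel (\<lambda>\<omega>. W n (T j \<omega>))" for j by (rule WT)
    have dW: "distr M borel (\<lambda>\<omega>. W n (T j \<omega>) / ?s) = distr \<nu> borel (\<lambda>x. W n x / ?s)" for j
    proof -
      have m: "(\<lambda>x. W n x / ?s) \<in> borel_measurable N" using W[of n] by measurable
      have "distr M borel ((\<lambda>x. W n x / ?s) \<circ> T j) = distr (distr M N (T j)) borel (\<lambda>x. W n x / ?s)"
        by (rule distr_distr[symmetric, OF m T_measurable])
      then show ?thesis using distr_T[of j] by (simp add: o_def)
    qed
    have "\<phi> n = char (distr M borel (\<lambda>\<omega>. \<Sum>j<?k. W n (T j \<omega>) / ?s)) t" by (simp add: \<phi>_def sum_divide_distrib)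
    also have "\<dots> = (\<Prod>j<?k. char (distr M borel (\<lambda>\<omega>. W n (T j \<omega>) / ?s)) t)"
      by (rule char_distr_sum, rule indep_vars_compose2[where X="\<lambda>j \<omega>. W n (T j \<omega>)"],
          rule indep_vars_subset[OF indep_F[OF W]]) auto
    also have "\<dots> = \<psi> ^ ?k"
      unfolding dW \<psi>_def char_def using Wn[of n] by (simp add: integral_distr)
    finally have ph: "\<phi> n = \<psi> ^ ?k" .
    interpret d: real_distribution "distr \<nu> borel (W n)" by (rule nu.real_distribution_distr[OF Wn])
    let ?u = "t / ?s"
    have "norm (\<psi> - (1 - ?u\<^sup>2 * 1 / 2)) \<le> ?u\<^sup>2 / 6 * nu.expectation (\<lambda>x. min (6 * (W n x)\<^sup>2) (\<bar>?u\<bar> * \<bar>W n x\<bar> ^ 3))"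
      unfolding \<psi>_def
      by (rule nu.char_approx3'[OF Wn i1 i2 mean _ refl]) (simp add: mean var)
    also have "\<dots> \<le> ?u\<^sup>2 / 6 * ((1 + t\<^sup>2) * e n)"
    proof (rule mult_left_mono)
      have pw: "min (6 * y\<^sup>2) (\<bar>?u\<bar> * \<bar>y\<bar> ^ 3) \<le> e n * y\<^sup>2 + ?u\<^sup>2 * y ^ 4 / e n" for y
        by (rule min_cubic_le[OF e0])
      have "nu.expectation (\<lambda>x. min (6 * (W n x)\<^sup>2) (\<bar>?u\<bar> * \<bar>W n x\<bar> ^ 3)) \<le> nu.expectation (\<lambda>x. e n * (W n x)\<^sup>2 + ?u\<^sup>2 * (W n x) ^ 4 / e n)"
      proof (rule integral_mono)
        show i: "integrable \<nu> (\<lambda>x. e n * (W n x)\<^sup>2 + ?u\<^sup>2 * (W n x) ^ 4 / e n)" using i2 i4 by simp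
        show "integrable \<nu> (\<lambda>x. min (6 * (W n x)\<^sup>2) (\<bar>?u\<bar> * \<bar>W n x\<bar> ^ 3))"
        proof (rule Bochner_Integration.integrable_bound[OF i])
          show "(\<lambda>x. min (6 * (W n x)\<^sup>2) (\<bar>?u\<bar> * \<bar>W n x\<bar> ^ 3)) \<in> borel_measurable \<nu>" using Wn[of n] by measurable
          show "AE x in \<nu>. norm (min (6 * (W n x)\<^sup>2) (\<bar>?u\<bar> * \<bar>W n x\<bar> ^ 3)) \<le> norm (e n * (W n x)\<^sup>2 + ?u\<^sup>2 * (W n x) ^ 4 / e n)"
          proof (rule AE_I2)
            fix x
            have "0 \<le> min (6 * (W n x)\<^sup>2) (\<bar>?u\<bar> * \<bar>W n x\<bar> ^ 3)" by simp
            then show "norm (min (6 * (W n x)\<^sup>2) (\<bar>?u\<bar> * \<bar>W n x\<bar> ^ 3)) \<le> norm (e n * (W n x)\<^sup>2 + ?u\<^sup>2 * (W n x) ^ 4 / e n)"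
              using pw[of "W n x"] unfolding real_norm_def by linarith
          qed
        qed
      qed (rule pw)
      also have "\<dots> = e n + ?u\<^sup>2 * (LINT x|\<nu>. (W n x) ^ 4) / e n" using i2 i4 var by simp
      also have "\<dots> \<le> e n + ?u\<^sup>2 * \<kappa> n / e n" using kap[of n] e0[of n] by (intro add_left_mono divide_right_mono mult_left_mono) auto
      also have "?u\<^sup>2 * \<kappa> n / e n = t\<^sup>2 * (\<kappa> n / real ?k / e n)" using k0 by (simp add: power_divide)
      also have "e n + \<dots> \<le> e n + t\<^sup>2 * e n" using ek[of n] by (intro add_left_mono mult_left_mono) auto
      finally show "nu.expectation (\<lambda>x. min (6 * (W n x)\<^sup>2) (\<bar>?u\<bar> * \<bar>W n x\<bar> ^ 3)) \<le> (1 + t\<^sup>2) * e n" by (simp add: algebra_simps)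
    qed simp
    also have "?u\<^sup>2 = t\<^sup>2 / real ?k" using k0 by (simp add: power_divide)
    finally have **: "norm (\<psi> - (1 - t\<^sup>2 / real ?k * 1 / 2)) \<le> t\<^sup>2 / real ?k / 6 * ((1 + t\<^sup>2) * e n)" by simp
    have eq: "1 - t\<^sup>2 / real ?k * 1 / 2 = 1 + (- (t\<^sup>2) / 2) / real ?k" by simp
    have **: "norm (\<psi> - complex_of_real (1 + (- (t\<^sup>2) / 2) / real ?k)) \<le> t\<^sup>2 / real ?k / 6 * ((1 + t\<^sup>2) * e n)"
      using ** unfolding eq[symmetric] by simp
    have z1: "norm \<psi> \<le> 1" unfolding \<psi>_def by (rule d.cmod_char_le_1)
    have z2: "norm (complex_of_real (1 + (- (t\<^sup>2) / 2) / real ?k)) \<le> 1"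
    proof -
      have "t\<^sup>2 / 2 / real ?k \<le> 2" using n k0 by (simp add: divide_le_eq)
      moreover have "0 \<le> t\<^sup>2 / 2 / real ?k" by simp
      ultimately show ?thesis unfolding norm_of_real by (simp add: abs_le_iff)
    qed
    have "norm (\<phi> n - complex_of_real (1 + (- (t\<^sup>2) / 2) / real ?k) ^ ?k) \<le> real ?k * norm (\<psi> - complex_of_real (1 + (- (t\<^sup>2) / 2) / real ?k))"
      unfolding ph by (rule norm_power_diff[OF z1 z2])
    also have "\<dots> \<le> real ?k * (t\<^sup>2 / real ?k / 6 * ((1 + t\<^sup>2) * e n))" using ** by (rule mult_left_mono) simp
    also have "\<dots> = t\<^sup>2 / 6 * ((1 + t\<^sup>2) * e n)" using k0 by simp
    finally show ?thesis by simp
  qed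
  have kr: "filterlim (\<lambda>n. real (k n)) at_top sequentially" by (rule filterlim_compose[OF filterlim_real_sequentially k(1)])
  have "(\<lambda>n. 1 / real (k n)) \<longlonglongrightarrow> 0"
    by (rule tendsto_divide_0[OF tendsto_const filterlim_at_top_imp_at_infinity[OF kr]])
  then have "e \<longlonglongrightarrow> sqrt 0 + 0" unfolding e_def[abs_def] by (intro tendsto_intros lim)
  then have "(\<lambda>n. t\<^sup>2 / 6 * ((1 + t\<^sup>2) * e n)) \<longlonglongrightarrow> t\<^sup>2 / 6 * ((1 + t\<^sup>2) * (sqrt 0 + 0))" by (intro tendsto_intros)
  then have l0: "(\<lambda>n. t\<^sup>2 / 6 * ((1 + t\<^sup>2) * e n)) \<longlonglongrightarrow> 0" by simp
  have ev: "\<forall>\<^sub>F n in sequentially. norm (\<phi> n - complex_of_real ((1 + (- (t\<^sup>2) / 2) / real (k n)) ^ k n)) \<le> t\<^sup>2 / 6 * ((1 + t\<^sup>2) * e n)"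
    using kr main unfolding filterlim_at_top by (auto elim!: eventually_mono allE[of _ "t\<^sup>2 / 4"])
  have "(\<lambda>n. complex_of_real ((1 + (- (t\<^sup>2) / 2) / real n) ^ n)) \<longlonglongrightarrow> complex_of_real (exp (- (t\<^sup>2) / 2))"
    by (rule isCont_tendsto_compose[OF _ tendsto_exp_limit_sequentially]) auto
  from filterlim_compose[OF this k(1)]
  have "(\<lambda>n. complex_of_real ((1 + (- (t\<^sup>2) / 2) / real (k n)) ^ k n)) \<longlonglongrightarrow> complex_of_real (exp (- (t\<^sup>2) / 2))" .
  then have "\<phi> \<longlonglongrightarrow> complex_of_real (exp (- (t\<^sup>2) / 2))"
    by (rule Lim_transform) (rule Lim_null_comparison[OF ev l0])
  then show "(\<lambda>n. char (distr M borel (\<lambda>\<omega>. (\<Sum>j<k n. W n (T j \<omega>)) / sqrt (real (k n)))) t) \<longlonglongrightarrow> char std_normal_distribution t"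
    by (simp add: \<phi>_def[abs_def] char_std_normal_distribution)
qed

end

text \<open>Slutsky's argument on characteristic functions: where the variables are close, the
  integrands differ by at most a multiple of \<open>\<bar>t\<bar>\<close>; on the rare remaining
  event they differ by at most 2.\<close>

lemma (in prob_space) weak_conv_m_perturbation:
  fixes A B :: "nat \<Rightarrow> 'a \<Rightarrow> real"
  assumes A: "\<And>n. A n \<in> borel_measurable M" and B: "\<And>n. B n \<in> borel_measurable M"
    and conv: "weak_conv_m (\<lambda>n. distr M borel (A n)) \<mu>" and mu: "real_distribution \<mu>"
    and diff: "\<And>\<delta> \<epsilon>. 0 < \<delta> \<Longrightarrow> 0 < \<epsilon> \<Longrightarrow> \<forall>\<^sub>F n in sequentially. prob {\<omega> \<in> space M. \<delta> < \<bar>B n \<omega> - A n \<omega>\<bar>} \<le> \<epsilon>"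
  shows "weak_conv_m (\<lambda>n. distr M borel (B n)) \<mu>"
proof (rule levy_continuity)
  show rB: "real_distribution (distr M borel (B n))" for n by (rule real_distribution_distr[OF B])
  have rA: "real_distribution (distr M borel (A n))" for n by (rule real_distribution_distr[OF A])
  fix t :: real
  have cA: "char (distr M borel (A n)) t = expectation (\<lambda>\<omega>. iexp (t * A n \<omega>))"
    "char (distr M borel (B n)) t = expectation (\<lambda>\<omega>. iexp (t * B n \<omega>))" for n
    using A B by (simp_all add: char_def integral_distr)
  have lip: "cmod (iexp x - iexp y) \<le> \<bar>x - y\<bar>" for x y :: real
  proof -
    have e: "iexp x = iexp y * iexp (x - y)" unfolding exp_add[symmetric] by (simp add: algebra_simps)
    have "iexp x - iexp y = iexp y * (iexp (x - y) - 1)" unfolding e by (simp only: right_diff_distrib mult_1_right)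
    then have "cmod (iexp x - iexp y) = cmod (iexp (x - y) - 1)" by (simp add: norm_mult)
    also have "\<dots> \<le> \<bar>x - y\<bar>" using iexp_approx1[of "x - y" 0] by simp
    finally show ?thesis .
  qed
  have "(\<lambda>n. char (distr M borel (B n)) t - char (distr M borel (A n)) t) \<longlonglongrightarrow> 0"
  proof (rule tendstoI)
    fix \<epsilon> :: real assume e: "0 < \<epsilon>"
    define \<delta> where "\<delta> = \<epsilon> / (3 * (\<bar>t\<bar> + 1))"
    have d: "0 < \<delta>" using e by (simp add: \<delta>_def add_nonneg_pos)
    have td: "\<bar>t\<bar> * \<delta> \<le> \<epsilon> / 3"
    proof -
      have "\<bar>t\<bar> * \<delta> \<le> (\<bar>t\<bar> + 1) * \<delta>" using d by (intro mult_right_mono) auto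
      also have "\<dots> = \<epsilon> / 3" unfolding \<delta>_def by (simp add: divide_simps)
      finally show ?thesis .
    qed
    \<comment> \<open>One third of \<epsilon> from the close part and twice one seventh from the
      exceptional event stay strictly below \<epsilon>.\<close>
    have "\<forall>\<^sub>F n in sequentially. prob {\<omega> \<in> space M. \<delta> < \<bar>B n \<omega> - A n \<omega>\<bar>} \<le> \<epsilon> / 7" by (rule diff[OF d]) (use e in simp)
    then show "\<forall>\<^sub>F n in sequentially. dist (char (distr M borel (B n)) t - char (distr M borel (A n)) t) 0 < \<epsilon>"
    proof eventually_elim
      case (elim n)
      let ?E = "{\<omega> \<in> space M. \<delta> < \<bar>B n \<omega> - A n \<omega>\<bar>}"
      have E: "?E \<in> events" using A[of n] B[of n] by measurable
      have iF: "integrable M (\<lambda>\<omega>. iexp (t * F \<omega>))" if "F \<in> borel_measurable M" for F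
        by (rule integrable_iexp) (use that in auto)
      note iA = iF[OF A[of n]] iF[OF B[of n]]
      have "norm (char (distr M borel (B n)) t - char (distr M borel (A n)) t) = norm (expectation (\<lambda>\<omega>. iexp (t * B n \<omega>) - iexp (t * A n \<omega>)))"
        unfolding cA using iA by simp
      also have "\<dots> \<le> expectation (\<lambda>\<omega>. norm (iexp (t * B n \<omega>) - iexp (t * A n \<omega>)))" by (rule integral_norm_bound)
      also have "\<dots> \<le> expectation (\<lambda>\<omega>. \<epsilon> / 3 + 2 * indicator ?E \<omega>)"
      proof (rule integral_mono)
        show "integrable M (\<lambda>\<omega>. norm (iexp (t * B n \<omega>) - iexp (t * A n \<omega>)))" using iA by simp
        show "integrable M (\<lambda>\<omega>. \<epsilon> / 3 + 2 * indicator ?E \<omega>)" using E by (auto intro!: integrable_real_mult_indicator)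
        fix \<omega> assume w: "\<omega> \<in> space M"
        show "norm (iexp (t * B n \<omega>) - iexp (t * A n \<omega>)) \<le> \<epsilon> / 3 + 2 * indicator ?E \<omega>"
        proof (cases "\<omega> \<in> ?E")
          case True
          have "norm (iexp (t * B n \<omega>) - iexp (t * A n \<omega>)) \<le> norm (iexp (t * B n \<omega>)) + norm (iexp (t * A n \<omega>))" by (rule norm_triangle_ineq4)
          then show ?thesis using True e by simp
        next
          case False
          have "norm (iexp (t * B n \<omega>) - iexp (t * A n \<omega>)) \<le> \<bar>t * B n \<omega> - t * A n \<omega>\<bar>" by (rule lip)
          also have "\<dots> = \<bar>t\<bar> * \<bar>B n \<omega> - A n \<omega>\<bar>" by (simp add: right_diff_distrib[symmetric] abs_mult)
          also have "\<dots> \<le> \<bar>t\<bar> * \<delta>" using False w by (intro mult_left_mono) auto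
          finally show ?thesis using td False by simp
        qed
      qed
      also have "\<dots> = \<epsilon> / 3 + 2 * prob ?E"
      proof -
        have "expectation (\<lambda>\<omega>. c + 2 * indicator E' \<omega>) = c + 2 * prob E'" if "E' \<in> events" for c :: real and E'
        proof -
          have "expectation (\<lambda>\<omega>. c + 2 * indicator E' \<omega>) = expectation (\<lambda>\<omega>. c) + expectation (\<lambda>\<omega>. 2 * indicator E' \<omega>)"
            by (rule Bochner_Integration.integral_add) (use that in \<open>auto simp: emeasure_eq_measure\<close>)
          also have "expectation (\<lambda>\<omega>. c) = c" by (simp add: prob_space)
          also have "expectation (\<lambda>\<omega>. 2 * indicator E' \<omega>) = 2 * expectation (indicator E' :: 'a \<Rightarrow> real)" by (rule integral_mult_right_zero)
          also have "expectation (indicator E' :: 'a \<Rightarrow> real) = prob E'" using that by simp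
          finally show ?thesis .
        qed
        then show ?thesis using E by blast
      qed
      also have "\<dots> < \<epsilon>" using elim e by simp
      finally show ?case by simp
    qed
  qed
  moreover have "(\<lambda>n. char (distr M borel (A n)) t) \<longlonglongrightarrow> char \<mu> t"
    by (rule levy_continuity1[OF rA mu conv])
  ultimately have "(\<lambda>n. (char (distr M borel (B n)) t - char (distr M borel (A n)) t) + char (distr M borel (A n)) t) \<longlonglongrightarrow> 0 + char \<mu> t"
    by (rule tendsto_add)
  then show "(\<lambda>n. char (distr M borel (B n)) t) \<longlonglongrightarrow> char \<mu> t" by simp
qed (rule mu)

text \<open>Discards finitely many indices, at which the sample may be empty or \<open>lam\<close>
  too large for the logarithm to be positive.\<close>

lemma weak_conv_m_offset: "weak_conv_m (\<lambda>n. \<mu> (n + k)) \<nu> \<Longrightarrow> weak_conv_m \<mu> \<nu>"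
  unfolding weak_conv_m_def weak_conv_def by (auto intro: LIMSEQ_offset[of _ k])

section \<open>Asymptotic normality of regularized linear functionals\<close>

lemma product_measure_integral_mult:
  fixes F :: "'a \<Rightarrow> real" and h :: "'b \<Rightarrow> real"
  assumes "prob_space P1" "prob_space P2" and F: "integrable P1 F" and h: "integrable P2 h"
  shows "integrable (P1 \<Otimes>\<^sub>M P2) (\<lambda>z. F (fst z) * h (snd z))"
    "(LINT z|(P1 \<Otimes>\<^sub>M P2). F (fst z) * h (snd z)) = (LINT x|P1. F x) * (LINT y|P2. h y)"
proof -
  interpret P1: prob_space P1 by fact
  interpret P2: prob_space P2 by fact
  interpret pair_sigma_finite P1 P2 ..
  have [measurable]: "F \<in> borel_measurable P1" "h \<in> borel_measurable P2" using F h by auto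
  show i: "integrable (P1 \<Otimes>\<^sub>M P2) (\<lambda>z. F (fst z) * h (snd z))"
  proof (rule Fubini_integrable)
    show "integrable P1 (\<lambda>x. LINT y|P2. norm (F (fst (x, y)) * h (snd (x, y))))"
      using F by (simp add: abs_mult)
    show "AE x in P1. integrable P2 (\<lambda>y. F (fst (x, y)) * h (snd (x, y)))" using h by simp
  qed measurable
  show "(LINT z|(P1 \<Otimes>\<^sub>M P2). F (fst z) * h (snd z)) = (LINT x|P1. F x) * (LINT y|P2. h y)"
    using integral_fst'[OF i] by simp
qed

text \<open>Stated with values in the extended nonnegative reals, because the weighted series it is
  applied to are not known to converge at every sample point; the complement of the event supplies
  both convergence and the bound.\<close>

lemma (in prob_space) Markov_ennreal:
  assumes u: "u \<in> borel_measurable M" and q: "(\<integral>\<^sup>+\<omega>. u \<omega> \<partial>M) \<le> ennreal q" and pos: "0 < q" "0 < K"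
  shows "prob {\<omega> \<in> space M. \<not> u \<omega> \<le> ennreal (K * q)} \<le> 1 / K"
proof -
  let ?c = "ennreal (1 / (K * q))"
  have sub: "{\<omega> \<in> space M. \<not> u \<omega> \<le> ennreal (K * q)} \<subseteq> {\<omega> \<in> space M. 1 \<le> ?c * u \<omega>}"
  proof
    fix \<omega> assume w: "\<omega> \<in> {\<omega> \<in> space M. \<not> u \<omega> \<le> ennreal (K * q)}"
    have "1 = ?c * ennreal (K * q)" using pos by (simp add: ennreal_mult[symmetric])
    also have "\<dots> \<le> ?c * u \<omega>" using w by (intro mult_left_mono) auto
    finally show "\<omega> \<in> {\<omega> \<in> space M. 1 \<le> ?c * u \<omega>}" using w by simp
  qed
  have "emeasure M {\<omega> \<in> space M. \<not> u \<omega> \<le> ennreal (K * q)} \<le> emeasure M {\<omega> \<in> space M. 1 \<le> ?c * u \<omega>}"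
    by (rule emeasure_mono[OF sub]) (use u in measurable)
  also have "\<dots> \<le> ?c * (\<integral>\<^sup>+ \<omega>. u \<omega> * indicator (space M) \<omega> \<partial>M)"
    by (rule nn_integral_Markov_inequality) (use u in auto)
  also have "(\<integral>\<^sup>+ \<omega>. u \<omega> * indicator (space M) \<omega> \<partial>M) = (\<integral>\<^sup>+ \<omega>. u \<omega> \<partial>M)"
    by (rule nn_integral_cong) simp
  also have "?c * (\<integral>\<^sup>+ \<omega>. u \<omega> \<partial>M) \<le> ?c * ennreal q" by (rule mult_left_mono[OF q]) simp
  also have "\<dots> = ennreal (1 / K)" using pos by (simp add: ennreal_mult[symmetric])
  finally show ?thesis using pos by (simp add: emeasure_eq_measure ennreal_le_iff)
qed

lemma suminf_ennreal_le:
  assumes "\<And>N. (\<Sum>i<N. f i) \<le> B" "\<And>i. 0 \<le> f i" "0 \<le> B" shows "(\<Sum>i. ennreal (f i)) \<le> ennreal B"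
proof (rule suminf_le_const)
  fix n
  have "(\<Sum>i<n. ennreal (f i)) = ennreal (\<Sum>i<n. f i)" using assms(2) by (simp add: sum_ennreal)
  also have "\<dots> \<le> ennreal B" using assms(1,3) by (simp add: ennreal_leI)
  finally show "(\<Sum>i<n. ennreal (f i)) \<le> ennreal B" .
qed auto

lemma partial_sum_le_of_suminf_ennreal:
  assumes "(\<Sum>i. ennreal (f i)) \<le> ennreal B" "\<And>i. 0 \<le> f i" "0 \<le> B" shows "(\<Sum>i<N. f i) \<le> B"
proof -
  have "ennreal (\<Sum>i<N. f i) = (\<Sum>i<N. ennreal (f i))" using assms(2) by (simp add: sum_ennreal)
  also have "\<dots> \<le> (\<Sum>i. ennreal (f i))" by (rule sum_le_suminf) auto
  also have "\<dots> \<le> ennreal B" by fact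
  finally show ?thesis using assms(3) by simp
qed

section \<open>Moments of the score and of the empirical Gram matrix\<close>

locale regression_sample = iid_sample M "PX \<Otimes>\<^sub>M (borel :: real measure)" T "PX \<Otimes>\<^sub>M PE"
  for M :: "'w measure" and PX :: "'x measure" and PE :: "real measure" and T :: "nat \<Rightarrow> 'w \<Rightarrow> 'x \<times> real" +
  fixes \<phi> :: "nat \<Rightarrow> 'x \<Rightarrow> real" and C \<sigma> :: real
  assumes PX: "prob_space PX" and PE: "prob_space PE" and sets_PE: "sets PE = sets borel"
    and phi_meas: "\<And>i. \<phi> i \<in> borel_measurable PX" and phi_bound: "\<And>i x. x \<in> space PX \<Longrightarrow> \<bar>\<phi> i x\<bar> \<le> C"
    and phi_orth: "\<And>i j. (LINT x|PX. \<phi> i x * \<phi> j x) = (if i = j then 1 else 0)"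
    and PE4: "integrable PE (\<lambda>e. e ^ 4)" and PE1: "(LINT e|PE. e) = 0" and PE2: "(LINT e|PE. e\<^sup>2) = \<sigma>\<^sup>2"
    and sigma: "0 < \<sigma>"
begin

sublocale PX: prob_space PX by (rule PX)
sublocale PE: prob_space PE by (rule PE)

lemma C_nonneg: "0 \<le> C"
  using phi_bound[of _ 0] PX.not_empty by (metis abs_ge_zero all_not_in_conv order_trans)

lemma PE_integrable2: "integrable PE (\<lambda>e. e\<^sup>2)"
proof (rule PE.integrable_of_square)
  show "(\<lambda>e::real. e\<^sup>2) \<in> borel_measurable PE" by (simp add: measurable_cong_sets[OF sets_PE refl])
  show "integrable PE (\<lambda>e. (e\<^sup>2)\<^sup>2)" using PE4 by (simp add: power_mult[symmetric])
qed

lemma PE_integrable1: "integrable PE (\<lambda>e. e)"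
  by (rule PE.integrable_of_square[OF _ PE_integrable2]) (simp add: measurable_cong_sets[OF sets_PE refl])

lemma PX_integrable_bounded:
  assumes "F \<in> borel_measurable PX" "\<And>x. x \<in> space PX \<Longrightarrow> \<bar>F x\<bar> \<le> (B::real)" shows "integrable PX F"
  by (rule PX.integrable_const_bound[of _ B]) (use assms in auto)

lemma phi_phi_bound: "x \<in> space PX \<Longrightarrow> \<bar>\<phi> i x * \<phi> j x\<bar> \<le> C\<^sup>2"
  unfolding abs_mult power2_eq_square by (intro mult_mono phi_bound C_nonneg) auto

lemma phi_phi_integrable: "integrable PX (\<lambda>x. \<phi> i x * \<phi> j x)"
  by (rule PX_integrable_bounded[of _ "C\<^sup>2"]) (use phi_meas phi_phi_bound in auto)

definition Zs :: "nat \<Rightarrow> nat \<Rightarrow> 'w \<Rightarrow> real" where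
  "Zs k i \<omega> = (\<Sum>j<k. snd (T j \<omega>) * \<phi> i (fst (T j \<omega>))) / real k"

definition Ds :: "nat \<Rightarrow> nat \<Rightarrow> nat \<Rightarrow> 'w \<Rightarrow> real" where
  "Ds k i l \<omega> = (\<Sum>j<k. \<phi> i (fst (T j \<omega>)) * \<phi> l (fst (T j \<omega>)) - (if i = l then 1 else 0)) / real k"

lemma Zs_moment:
  assumes k: "0 < k" shows "Zs k i \<in> borel_measurable M" "(\<integral>\<^sup>+\<omega>. ennreal ((Zs k i \<omega>)\<^sup>2) \<partial>M) = ennreal (\<sigma>\<^sup>2 / real k)"
proof -
  let ?F = "\<lambda>z. snd z * \<phi> i (fst z)"
  have F: "?F \<in> borel_measurable (PX \<Otimes>\<^sub>M borel)" using phi_meas[of i] by measurable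
  have FT: "(\<lambda>\<omega>. ?F (T j \<omega>)) \<in> borel_measurable M" for j using T_measurable[of j] F by (rule measurable_compose)
  show m: "Zs k i \<in> borel_measurable M" unfolding Zs_def[abs_def] using FT by simp
  have i2: "integrable (PX \<Otimes>\<^sub>M PE) (\<lambda>z. (\<phi> i (fst z) * \<phi> i (fst z)) * (snd z)\<^sup>2)"
    "(LINT z|(PX \<Otimes>\<^sub>M PE). (\<phi> i (fst z) * \<phi> i (fst z)) * (snd z)\<^sup>2) = \<sigma>\<^sup>2"
    using product_measure_integral_mult[OF PX PE phi_phi_integrable[of i i] PE_integrable2] phi_orth[of i i] PE2 by simp_all
  have sq: "(?F z)\<^sup>2 = (\<phi> i (fst z) * \<phi> i (fst z)) * (snd z)\<^sup>2" for z by (simp add: power2_eq_square mult_ac)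
  have i1: "integrable PX (\<phi> i)" by (rule PX_integrable_bounded[OF phi_meas phi_bound])
  have mean: "(LINT z|(PX \<Otimes>\<^sub>M PE). ?F z) = 0"
    using product_measure_integral_mult(2)[OF PX PE i1 PE_integrable1] PE1 by (simp add: mult.commute)
  have "integrable M (\<lambda>\<omega>. (Zs k i \<omega>)\<^sup>2)" "expectation (\<lambda>\<omega>. (Zs k i \<omega>)\<^sup>2) = \<sigma>\<^sup>2 / real k"
    unfolding Zs_def using second_moment_sample_mean[OF F _ mean k] i2 unfolding sq by simp_all
  then show "(\<integral>\<^sup>+\<omega>. ennreal ((Zs k i \<omega>)\<^sup>2) \<partial>M) = ennreal (\<sigma>\<^sup>2 / real k)" by (simp add: nn_integral_eq_integral)
qed

lemma Ds_moment:
  assumes k: "0 < k" shows "Ds k i l \<in> borel_measurable M" "(\<integral>\<^sup>+\<omega>. ennreal ((Ds k i l \<omega>)\<^sup>2) \<partial>M) \<le> ennreal (C ^ 4 / real k)"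
proof -
  let ?d = "if i = l then 1 else 0 :: real"
  let ?G = "\<lambda>x. \<phi> i x * \<phi> l x - ?d"
  let ?F = "\<lambda>z. ?G (fst z)"
  have G: "?G \<in> borel_measurable PX" using phi_meas[of i] phi_meas[of l] by measurable
  have F: "?F \<in> borel_measurable (PX \<Otimes>\<^sub>M borel)" by (rule measurable_compose[OF measurable_fst G])
  have FT: "(\<lambda>\<omega>. ?F (T j \<omega>)) \<in> borel_measurable M" for j using T_measurable[of j] F by (rule measurable_compose)
  show m: "Ds k i l \<in> borel_measurable M" unfolding Ds_def[abs_def] using FT by simp
  have G1: "integrable PX ?G" using phi_phi_integrable by simp
  have PP2: "integrable PX (\<lambda>x. (\<phi> i x * \<phi> l x)\<^sup>2)"
  proof (rule PX_integrable_bounded)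
    show "(\<lambda>x. (\<phi> i x * \<phi> l x)\<^sup>2) \<in> borel_measurable PX" using phi_meas[of i] phi_meas[of l] by measurable
    show "\<bar>(\<phi> i x * \<phi> l x)\<^sup>2\<bar> \<le> (C\<^sup>2)\<^sup>2" if "x \<in> space PX" for x
      using power_mono[OF phi_phi_bound[OF that, of i l], of 2] by simp
  qed
  have Gsq: "(?G x)\<^sup>2 = (\<phi> i x * \<phi> l x)\<^sup>2 - 2 * ?d * (\<phi> i x * \<phi> l x) + ?d\<^sup>2" for x by (simp add: power2_diff)
  have G2: "integrable PX (\<lambda>x. (?G x)\<^sup>2)" unfolding Gsq using PP2 phi_phi_integrable[of i l] by simp
  have "(LINT x|PX. (?G x)\<^sup>2) = (LINT x|PX. (\<phi> i x * \<phi> l x)\<^sup>2) - ?d\<^sup>2"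
    unfolding Gsq using PP2 phi_phi_integrable[of i l] phi_orth[of i l] by (simp add: PX.prob_space)
  also have "\<dots> \<le> (LINT x|PX. (\<phi> i x * \<phi> l x)\<^sup>2)" by simp
  also have "\<dots> \<le> (LINT x|PX. C ^ 4)"
  proof (rule integral_mono[OF PP2])
    fix x assume "x \<in> space PX"
    then show "(\<phi> i x * \<phi> l x)\<^sup>2 \<le> C ^ 4" using power_mono[OF phi_phi_bound[of x i l], of 2] by (simp add: power_mult[symmetric])
  qed simp
  finally have GC: "(LINT x|PX. (?G x)\<^sup>2) \<le> C ^ 4" by (simp add: PX.prob_space)
  have o: "integrable PE (\<lambda>_. 1::real)" "(LINT e|PE. 1::real) = 1" by (simp_all add: PE.prob_space)
  have i2: "integrable (PX \<Otimes>\<^sub>M PE) (\<lambda>z. (?F z)\<^sup>2)" "(LINT z|(PX \<Otimes>\<^sub>M PE). (?F z)\<^sup>2) = (LINT x|PX. (?G x)\<^sup>2)"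
    using product_measure_integral_mult[OF PX PE G2 o(1)] o(2) by simp_all
  have "(LINT x|PX. ?G x) = 0" using phi_phi_integrable[of i l] phi_orth[of i l] by (simp add: PX.prob_space)
  then have mean: "(LINT z|(PX \<Otimes>\<^sub>M PE). ?F z) = 0"
    using product_measure_integral_mult(2)[OF PX PE G1 o(1)] by simp
  have I: "integrable M (\<lambda>\<omega>. (Ds k i l \<omega>)\<^sup>2)" and E: "expectation (\<lambda>\<omega>. (Ds k i l \<omega>)\<^sup>2) = (LINT x|PX. (?G x)\<^sup>2) / real k"
    unfolding Ds_def using second_moment_sample_mean[OF F i2(1) mean k] i2(2) by simp_all
  have "(LINT x|PX. (?G x)\<^sup>2) / real k \<le> C ^ 4 / real k" using GC by (rule divide_right_mono) simp
  then show "(\<integral>\<^sup>+\<omega>. ennreal ((Ds k i l \<omega>)\<^sup>2) \<partial>M) \<le> ennreal (C ^ 4 / real k)" using I E by (simp add: nn_integral_eq_integral ennreal_leI)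
qed

text \<open>Uniform boundedness of the basis gives every entry the same second moment bound
  \<open>C ^ 4 / k\<close>, so the weighted double sum is bounded by the product of two sums of
  weights.\<close>

lemma weighted_Ds_moment:
  assumes k: "0 < k" and w: "\<And>i. 0 < (w i::real)" "\<And>N. (\<Sum>i<N. w i) \<le> W"
  shows "(\<lambda>\<omega>. \<Sum>i. \<Sum>l. ennreal (w i * w l * (Ds k i l \<omega>)\<^sup>2)) \<in> borel_measurable M"
    "(\<integral>\<^sup>+\<omega>. (\<Sum>i. \<Sum>l. ennreal (w i * w l * (Ds k i l \<omega>)\<^sup>2)) \<partial>M) \<le> ennreal (C ^ 4 * W\<^sup>2 / real k)"
proof -
  have [measurable]: "Ds k i l \<in> borel_measurable M" for i l by (rule Ds_moment[OF k])
  have W0: "0 \<le> W" using w(2)[of 0] by simp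
  show "(\<lambda>\<omega>. \<Sum>i. \<Sum>l. ennreal (w i * w l * (Ds k i l \<omega>)\<^sup>2)) \<in> borel_measurable M" by measurable
  let ?c = "C ^ 4 / real k"
  have c0: "0 \<le> ?c" using C_nonneg by simp
  have t: "(\<integral>\<^sup>+\<omega>. ennreal (w i * w l * (Ds k i l \<omega>)\<^sup>2) \<partial>M) \<le> ennreal (w i * w l * ?c)" for i l
  proof -
    have ww: "0 \<le> w i * w l" using w(1) less_imp_le by (intro mult_nonneg_nonneg) blast+
    have "(\<integral>\<^sup>+\<omega>. ennreal (w i * w l * (Ds k i l \<omega>)\<^sup>2) \<partial>M) = ennreal (w i * w l) * (\<integral>\<^sup>+\<omega>. ennreal ((Ds k i l \<omega>)\<^sup>2) \<partial>M)"
      using ww by (simp add: ennreal_mult nn_integral_cmult)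
    also have "\<dots> \<le> ennreal (w i * w l) * ennreal ?c" by (rule mult_left_mono[OF Ds_moment(2)[OF k]]) simp
    also have "\<dots> = ennreal (w i * w l * ?c)" by (rule ennreal_mult[symmetric, OF ww c0])
    finally show ?thesis .
  qed
  have "(\<integral>\<^sup>+\<omega>. (\<Sum>i. \<Sum>l. ennreal (w i * w l * (Ds k i l \<omega>)\<^sup>2)) \<partial>M) = (\<Sum>i. \<Sum>l. \<integral>\<^sup>+\<omega>. ennreal (w i * w l * (Ds k i l \<omega>)\<^sup>2) \<partial>M)"
    by (simp add: nn_integral_suminf)
  also have "\<dots> \<le> (\<Sum>i. ennreal (w i * W * ?c))"
  proof (rule suminf_le)
    fix i
    have "(\<Sum>l. \<integral>\<^sup>+\<omega>. ennreal (w i * w l * (Ds k i l \<omega>)\<^sup>2) \<partial>M) \<le> (\<Sum>l. ennreal (w i * w l * ?c))"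
      by (rule suminf_le[OF t]) auto
    also have "\<dots> \<le> ennreal (w i * W * ?c)"
    proof (rule suminf_ennreal_le)
      have "(\<Sum>l<N. w i * w l * ?c) = w i * (\<Sum>l<N. w l) * ?c" for N by (simp only: sum_distrib_left sum_distrib_right)
      also have "w i * (\<Sum>l<N. w l) * ?c \<le> w i * W * ?c" for N
        using w(1)[of i] w(2)[of N] c0 by (intro mult_right_mono mult_left_mono) auto
      finally show "(\<Sum>l<N. w i * w l * ?c) \<le> w i * W * ?c" for N .
      show "0 \<le> w i * w l * ?c" for l using w(1)[of i] w(1)[of l] c0 by (intro mult_nonneg_nonneg) auto
      show "0 \<le> w i * W * ?c" using w(1)[of i] W0 c0 by (intro mult_nonneg_nonneg) auto
    qed
    finally show "(\<Sum>l. \<integral>\<^sup>+\<omega>. ennreal (w i * w l * (Ds k i l \<omega>)\<^sup>2) \<partial>M) \<le> ennreal (w i * W * ?c)" .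
  qed auto
  also have "\<dots> \<le> ennreal (W * W * ?c)"
  proof (rule suminf_ennreal_le)
    have "(\<Sum>i<N. w i * W * ?c) = (\<Sum>i<N. w i) * W * ?c" for N by (simp only: sum_distrib_right)
    also have "(\<Sum>i<N. w i) * W * ?c \<le> W * W * ?c" for N
      using w(2)[of N] W0 c0 by (intro mult_right_mono) auto
    finally show "(\<Sum>i<N. w i * W * ?c) \<le> W * W * ?c" for N .
    show "0 \<le> w i * W * ?c" for i using w(1)[of i] W0 c0 by (intro mult_nonneg_nonneg) auto
    show "0 \<le> W * W * ?c" using W0 c0 by (intro mult_nonneg_nonneg) auto
  qed
  finally show "(\<integral>\<^sup>+\<omega>. (\<Sum>i. \<Sum>l. ennreal (w i * w l * (Ds k i l \<omega>)\<^sup>2)) \<partial>M) \<le> ennreal (C ^ 4 * W\<^sup>2 / real k)"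
    by (simp add: power2_eq_square mult_ac)
qed

lemma weighted_Zs_moment:
  assumes k: "0 < k" and w: "\<And>i. 0 < (w i::real)" "\<And>N. (\<Sum>i<N. w i) \<le> W" and c: "\<And>N. (\<Sum>i<N. w i * (c i)\<^sup>2) \<le> c2"
  shows "(\<lambda>\<omega>. \<Sum>i. ennreal (w i * (Zs k i \<omega> - c i)\<^sup>2)) \<in> borel_measurable M"
    "(\<integral>\<^sup>+\<omega>. (\<Sum>i. ennreal (w i * (Zs k i \<omega> - c i)\<^sup>2)) \<partial>M) \<le> ennreal (2 * (\<sigma>\<^sup>2 * W / real k) + 2 * c2)"
proof -
  have [measurable]: "Zs k i \<in> borel_measurable M" for i by (rule Zs_moment[OF k])
  show "(\<lambda>\<omega>. \<Sum>i. ennreal (w i * (Zs k i \<omega> - c i)\<^sup>2)) \<in> borel_measurable M" by measurable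
  have W0: "0 \<le> W" using w(2)[of 0] by simp
  have c20: "0 \<le> c2" using c[of 0] by simp
  have w0: "0 \<le> w i" for i using w(1)[of i] by simp
  have t: "(\<integral>\<^sup>+\<omega>. ennreal (w i * (Zs k i \<omega> - c i)\<^sup>2) \<partial>M) \<le> ennreal (2 * w i * (\<sigma>\<^sup>2 / real k) + 2 * (w i * (c i)\<^sup>2))" for i
  proof -
    have "(\<integral>\<^sup>+\<omega>. ennreal (w i * (Zs k i \<omega> - c i)\<^sup>2) \<partial>M) \<le> (\<integral>\<^sup>+\<omega>. ennreal (2 * w i) * ennreal ((Zs k i \<omega>)\<^sup>2) + ennreal (2 * (w i * (c i)\<^sup>2)) \<partial>M)"
    proof (rule nn_integral_mono)
      fix \<omega>
      have "(Zs k i \<omega> - c i)\<^sup>2 \<le> 2 * (Zs k i \<omega>)\<^sup>2 + 2 * (c i)\<^sup>2"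
        using zero_le_power2[of "Zs k i \<omega> + c i"] by (simp add: power2_eq_square algebra_simps)
      then have "w i * (Zs k i \<omega> - c i)\<^sup>2 \<le> w i * (2 * (Zs k i \<omega>)\<^sup>2 + 2 * (c i)\<^sup>2)" using w0 by (rule mult_left_mono)
      also have "\<dots> = (2 * w i) * (Zs k i \<omega>)\<^sup>2 + 2 * (w i * (c i)\<^sup>2)" by (simp add: algebra_simps)
      finally have "ennreal (w i * (Zs k i \<omega> - c i)\<^sup>2) \<le> ennreal ((2 * w i) * (Zs k i \<omega>)\<^sup>2 + 2 * (w i * (c i)\<^sup>2))" by (rule ennreal_leI)
      also have "\<dots> = ennreal (2 * w i) * ennreal ((Zs k i \<omega>)\<^sup>2) + ennreal (2 * (w i * (c i)\<^sup>2))"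
        using w0[of i] by (subst ennreal_plus) (simp_all add: ennreal_mult)
      finally show "ennreal (w i * (Zs k i \<omega> - c i)\<^sup>2) \<le> ennreal (2 * w i) * ennreal ((Zs k i \<omega>)\<^sup>2) + ennreal (2 * (w i * (c i)\<^sup>2))" .
    qed
    also have "\<dots> = ennreal (2 * w i) * ennreal (\<sigma>\<^sup>2 / real k) + ennreal (2 * (w i * (c i)\<^sup>2))"
      by (simp add: nn_integral_add nn_integral_cmult Zs_moment(2)[OF k] emeasure_space_1)
    also have "\<dots> = ennreal (2 * w i * (\<sigma>\<^sup>2 / real k) + 2 * (w i * (c i)\<^sup>2))"
      using w0[of i] by (subst ennreal_plus) (simp_all add: ennreal_mult[symmetric])
    finally show ?thesis .
  qed
  have "(\<integral>\<^sup>+\<omega>. (\<Sum>i. ennreal (w i * (Zs k i \<omega> - c i)\<^sup>2)) \<partial>M) = (\<Sum>i. \<integral>\<^sup>+\<omega>. ennreal (w i * (Zs k i \<omega> - c i)\<^sup>2) \<partial>M)"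
    by (simp add: nn_integral_suminf)
  also have "\<dots> \<le> (\<Sum>i. ennreal (2 * w i * (\<sigma>\<^sup>2 / real k) + 2 * (w i * (c i)\<^sup>2)))" by (rule suminf_le[OF t]) auto
  also have "\<dots> \<le> ennreal (2 * (\<sigma>\<^sup>2 * W / real k) + 2 * c2)"
  proof (rule suminf_ennreal_le)
    fix N
    have "(\<Sum>i<N. 2 * w i * (\<sigma>\<^sup>2 / real k) + 2 * (w i * (c i)\<^sup>2)) = 2 * (\<sigma>\<^sup>2 / real k) * (\<Sum>i<N. w i) + 2 * (\<Sum>i<N. w i * (c i)\<^sup>2)"
    proof -
      have "(\<Sum>i<N. 2 * w i * K + 2 * (w i * (c i)\<^sup>2)) = 2 * K * (\<Sum>i<N. w i) + 2 * (\<Sum>i<N. w i * (c i)\<^sup>2)" for K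
        by (simp add: sum.distrib sum_distrib_left mult_ac)
      then show ?thesis .
    qed
    also have "\<dots> \<le> 2 * (\<sigma>\<^sup>2 / real k) * W + 2 * c2"
      using w(2)[of N] c[of N] by (intro add_mono mult_left_mono) auto
    finally show "(\<Sum>i<N. 2 * w i * (\<sigma>\<^sup>2 / real k) + 2 * (w i * (c i)\<^sup>2)) \<le> 2 * (\<sigma>\<^sup>2 * W / real k) + 2 * c2" by simp
  next
    show "0 \<le> 2 * w i * (\<sigma>\<^sup>2 / real k) + 2 * (w i * (c i)\<^sup>2)" for i using w0[of i] by simp
    show "0 \<le> 2 * (\<sigma>\<^sup>2 * W / real k) + 2 * c2" using W0 c20 by simp
  qed
  finally show "(\<integral>\<^sup>+\<omega>. (\<Sum>i. ennreal (w i * (Zs k i \<omega> - c i)\<^sup>2)) \<partial>M) \<le> ennreal (2 * (\<sigma>\<^sup>2 * W / real k) + 2 * c2)" .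
qed

text \<open>With coefficients \<open>l i * w i\<close> the function \<open>g\<close> turns the
  leading term of a functional into the sample mean of noise times \<open>g\<close>. Absolute
  summability makes \<open>g\<close> bounded, which controls its fourth moment by its
  second.\<close>

lemma orthonormal_series:
  assumes a: "\<And>N. (\<Sum>i<N. \<bar>a i\<bar>) \<le> (A::real)"
  defines "g \<equiv> \<lambda>x. \<Sum>i. a i * \<phi> i x"
  shows "x \<in> space PX \<Longrightarrow> (\<lambda>i. a i * \<phi> i x) sums g x" "x \<in> space PX \<Longrightarrow> \<bar>g x\<bar> \<le> C * A" "g \<in> borel_measurable PX"
    "(LINT x|PX. (g x)\<^sup>2) = (\<Sum>i. (a i)\<^sup>2)" "summable (\<lambda>i. (a i)\<^sup>2)"
proof -
  have sa: "summable (\<lambda>i. \<bar>a i\<bar>)" by (rule bounded_imp_summable[of _ A]) (use a in \<open>auto simp: lessThan_Suc_atMost[symmetric] simp del: sum.lessThan_Suc\<close>)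
  have A0: "0 \<le> A" using a[of 0] by simp
  have part: "\<bar>\<Sum>i<N. a i * \<phi> i x\<bar> \<le> C * A" if x: "x \<in> space PX" for N x
  proof -
    have "\<bar>\<Sum>i<N. a i * \<phi> i x\<bar> \<le> (\<Sum>i<N. \<bar>a i\<bar> * C)"
      by (rule order_trans[OF sum_abs sum_mono]) (simp add: abs_mult mult_left_mono phi_bound[OF x])
    also have "\<dots> = C * (\<Sum>i<N. \<bar>a i\<bar>)" by (simp add: sum_distrib_left mult.commute)
    also have "\<dots> \<le> C * A" using a C_nonneg by (rule mult_left_mono)
    finally show ?thesis .
  qed
  have sm: "summable (\<lambda>i. a i * \<phi> i x)" if x: "x \<in> space PX" for x
  proof (rule summable_comparison_test')
    show "summable (\<lambda>i. C * \<bar>a i\<bar>)" using sa by (rule summable_mult)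
    show "norm (a n * \<phi> n x) \<le> C * \<bar>a n\<bar>" for n using phi_bound[OF x, of n]
      by (simp add: abs_mult mult.commute[of C] mult_left_mono)
  qed
  show s: "(\<lambda>i. a i * \<phi> i x) sums g x" if "x \<in> space PX" for x unfolding g_def by (rule summable_sums[OF sm[OF that]])
  have lim: "(\<lambda>N. \<Sum>i<N. a i * \<phi> i x) \<longlonglongrightarrow> g x" if "x \<in> space PX" for x using s[OF that] by (simp add: sums_def)
  show gb: "\<bar>g x\<bar> \<le> C * A" if "x \<in> space PX" for x
    by (rule LIMSEQ_le_const2[OF tendsto_rabs[OF lim[OF that]]]) (use part[OF that] in blast)
  have pm: "(\<lambda>x. \<Sum>i<N. a i * \<phi> i x) \<in> borel_measurable PX" for N
    by (intro borel_measurable_sum borel_measurable_times borel_measurable_const phi_meas)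
  show gm: "g \<in> borel_measurable PX" by (rule borel_measurable_LIMSEQ_real[OF lim pm])
  have pint: "(LINT x|PX. (\<Sum>i<N. a i * \<phi> i x)\<^sup>2) = (\<Sum>i<N. (a i)\<^sup>2)" for N
  proof -
    have "(\<Sum>i<N. a i * \<phi> i x)\<^sup>2 = (\<Sum>i<N. \<Sum>j<N. (a i * a j) * (\<phi> i x * \<phi> j x))" for x
      by (simp add: power2_eq_square sum_product mult_ac)
    then have "(LINT x|PX. (\<Sum>i<N. a i * \<phi> i x)\<^sup>2) = (LINT x|PX. (\<Sum>i<N. \<Sum>j<N. (a i * a j) * (\<phi> i x * \<phi> j x)))" by simp
    also have "\<dots> = (\<Sum>i<N. \<Sum>j<N. (a i * a j) * (LINT x|PX. \<phi> i x * \<phi> j x))"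
      using phi_phi_integrable by (subst Bochner_Integration.integral_sum) (auto simp: Bochner_Integration.integral_sum)
    also have "\<dots> = (\<Sum>i<N. \<Sum>j<N. if j = i then a i * a j else 0)"
      unfolding phi_orth by (intro sum.cong refl) auto
    also have "\<dots> = (\<Sum>i<N. (a i)\<^sup>2)"
      by (rule sum.cong[OF refl]) (subst sum.delta, auto simp: power2_eq_square)
    finally show ?thesis .
  qed
  have L: "(\<lambda>N. LINT x|PX. (\<Sum>i<N. a i * \<phi> i x)\<^sup>2) \<longlonglongrightarrow> (LINT x|PX. (g x)\<^sup>2)"
  proof (rule integral_dominated_convergence[where w="\<lambda>_. (C * A)\<^sup>2"])
    show "AE x in PX. (\<lambda>N. (\<Sum>i<N. a i * \<phi> i x)\<^sup>2) \<longlonglongrightarrow> (g x)\<^sup>2" by (rule AE_I2) (intro tendsto_power lim)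
    show "AE x in PX. norm ((\<Sum>i<N. a i * \<phi> i x)\<^sup>2) \<le> (C * A)\<^sup>2" for N
    proof (rule AE_I2)
      fix x assume "x \<in> space PX"
      then show "norm ((\<Sum>i<N. a i * \<phi> i x)\<^sup>2) \<le> (C * A)\<^sup>2" using power_mono[OF part[of x N], of 2] by simp
    qed
  qed (use gm pm in auto)
  then have "(\<lambda>i. (a i)\<^sup>2) sums (LINT x|PX. (g x)\<^sup>2)" unfolding pint sums_def .
  then show "(LINT x|PX. (g x)\<^sup>2) = (\<Sum>i. (a i)\<^sup>2)" "summable (\<lambda>i. (a i)\<^sup>2)" by (simp_all add: sums_iff)
qed

end

context regression_sample
begin

text \<open>The deterministic half of the argument: \<open>q\<close> and \<open>b\<close> bound the weighted empirical Gram error and the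
  weighted score at one sample point.\<close>

lemma functional_deviation_le:
  fixes w l c u :: "nat \<Rightarrow> real"
  assumes k: "0 < k" and w: "\<And>i. 0 < w i"
    and L: "\<And>N. (\<Sum>i<N. w i * (l i)\<^sup>2) \<le> L" and bb: "\<And>N. (\<Sum>i<N. l i * w i * c i)\<^sup>2 \<le> bb"
    and u: "summable (\<lambda>i. (u i)\<^sup>2 / w i)" and h: "\<And>j. j < k \<Longrightarrow> (\<lambda>i. u i * \<phi> i (fst (T j \<omega>))) sums h j"
    and eq: "\<And>i. (\<Sum>j<k. (snd (T j \<omega>) - h j) * \<phi> i (fst (T j \<omega>))) / real k = u i / w i - u i + c i"
    and Y: "(\<lambda>i. l i * u i) sums Y" and Zl: "(\<lambda>i. l i * w i * Zs k i \<omega>) sums Z"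
    and Q: "(\<Sum>i. \<Sum>j. ennreal (w i * w j * (Ds k i j \<omega>)\<^sup>2)) \<le> ennreal q" "0 \<le> q" "q \<le> 1/4"
    and B: "(\<Sum>i. ennreal (w i * (Zs k i \<omega> - c i)\<^sup>2)) \<le> ennreal b" "0 \<le> b"
  shows "(Y - Z)\<^sup>2 \<le> 2 * (4 * L * q * b + bb)"
proof -
  have w0: "0 \<le> w i" for i using w[of i] by simp
  have D: "(\<Sum>i<N. \<Sum>j<N. w i * w j * (Ds k i j \<omega>)\<^sup>2) \<le> q" for N
  proof (rule partial_sum_le_of_suminf_ennreal[OF _ _ Q(2)])
    show "0 \<le> (\<Sum>j<N. w i * w j * (Ds k i j \<omega>)\<^sup>2)" for i using w0 by (intro sum_nonneg mult_nonneg_nonneg) auto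
    have "(\<Sum>i. ennreal (\<Sum>j<N. w i * w j * (Ds k i j \<omega>)\<^sup>2)) \<le> (\<Sum>i. \<Sum>j. ennreal (w i * w j * (Ds k i j \<omega>)\<^sup>2))"
    proof (rule suminf_le)
      fix i
      have "ennreal (\<Sum>j<N. w i * w j * (Ds k i j \<omega>)\<^sup>2) = (\<Sum>j<N. ennreal (w i * w j * (Ds k i j \<omega>)\<^sup>2))"
        using w0 by (intro sum_ennreal[symmetric]) auto
      also have "\<dots> \<le> (\<Sum>j. ennreal (w i * w j * (Ds k i j \<omega>)\<^sup>2))" by (rule sum_le_suminf) auto
      finally show "ennreal (\<Sum>j<N. w i * w j * (Ds k i j \<omega>)\<^sup>2) \<le> (\<Sum>j. ennreal (w i * w j * (Ds k i j \<omega>)\<^sup>2))" .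
    qed auto
    then show "(\<Sum>i. ennreal (\<Sum>j<N. w i * w j * (Ds k i j \<omega>)\<^sup>2)) \<le> ennreal q" using Q(1) by (rule order_trans)
  qed
  have Bp: "(\<Sum>i<N. w i * (Zs k i \<omega> - c i)\<^sup>2) \<le> b" for N
    by (rule partial_sum_le_of_suminf_ennreal[OF B(1) _ B(2)]) (use w0 in auto)
  \<comment> \<open>The coordinate equations in terms of the Gram error: the expansion of
    \<open>h\<close> is inserted and its infinite sum exchanged with the finite sum over the
    sample.\<close>
  have sys: "(\<lambda>j. Ds k i j \<omega> * u j) sums ((Zs k i \<omega> - c i) - u i / w i)" for i
  proof -
    have s1: "(\<lambda>m. \<Sum>j<k. \<phi> i (fst (T j \<omega>)) * (u m * \<phi> m (fst (T j \<omega>)))) sums (\<Sum>j<k. \<phi> i (fst (T j \<omega>)) * h j)"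
      by (rule sums_sum, rule sums_mult, rule h) simp
    have s2: "(\<lambda>m. if m = i then u m else 0) sums u i" by (rule sums_single)
    have "(\<lambda>m. (\<Sum>j<k. \<phi> i (fst (T j \<omega>)) * (u m * \<phi> m (fst (T j \<omega>)))) / real k - (if m = i then u m else 0)) sums
        ((\<Sum>j<k. \<phi> i (fst (T j \<omega>)) * h j) / real k - u i)"
      by (rule sums_diff[OF sums_divide[OF s1] s2])
    moreover have "(\<Sum>j<k. \<phi> i (fst (T j \<omega>)) * (u m * \<phi> m (fst (T j \<omega>)))) / real k - (if m = i then u m else 0) = Ds k i m \<omega> * u m" for m
    proof -
      have "(\<Sum>j<k. \<phi> i (fst (T j \<omega>)) * \<phi> m (fst (T j \<omega>)) - (if i = m then 1 else 0))
          = (\<Sum>j<k. \<phi> i (fst (T j \<omega>)) * \<phi> m (fst (T j \<omega>))) - real k * (if i = m then 1 else 0)"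
        by (simp add: sum_subtractf)
      then have D1: "Ds k i m \<omega> = (\<Sum>j<k. \<phi> i (fst (T j \<omega>)) * \<phi> m (fst (T j \<omega>))) / real k - (if i = m then 1 else 0)"
        using k by (simp add: Ds_def diff_divide_distrib)
      have S1: "(\<Sum>j<k. \<phi> i (fst (T j \<omega>)) * (u m * \<phi> m (fst (T j \<omega>)))) = u m * (\<Sum>j<k. \<phi> i (fst (T j \<omega>)) * \<phi> m (fst (T j \<omega>)))"
        by (simp add: sum_distrib_left mult_ac)
      show ?thesis unfolding D1 S1 left_diff_distrib by (auto simp: mult.commute)
    qed
    moreover have "(\<Sum>j<k. \<phi> i (fst (T j \<omega>)) * h j) / real k - u i = (Zs k i \<omega> - c i) - u i / w i"
    proof -
      have "(\<Sum>j<k. (snd (T j \<omega>) - h j) * \<phi> i (fst (T j \<omega>))) = (\<Sum>j<k. snd (T j \<omega>) * \<phi> i (fst (T j \<omega>))) - (\<Sum>j<k. \<phi> i (fst (T j \<omega>)) * h j)"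
        unfolding sum_subtractf[symmetric] by (rule sum.cong) (simp_all add: algebra_simps)
      then show ?thesis using eq[of i] by (simp add: Zs_def diff_divide_distrib)
    qed
    ultimately show ?thesis by simp
  qed
  have P: "(\<Sum>i<N. l i * (u i - w i * (Zs k i \<omega> - c i)))\<^sup>2 \<le> 4 * L * q * b" for N
    by (rule diagonal_system_perturbation[OF w u D Q(3) sys Bp L])
  have step: "(\<Sum>i<N. l i * u i - l i * w i * Zs k i \<omega>)\<^sup>2 \<le> 2 * (4 * L * q * b + bb)" for N
  proof -
    let ?a = "\<Sum>i<N. l i * (u i - w i * (Zs k i \<omega> - c i))" and ?b = "\<Sum>i<N. l i * w i * c i"
    have "(\<Sum>i<N. l i * u i - l i * w i * Zs k i \<omega>) = ?a - ?b"
      by (simp add: sum_subtractf[symmetric] algebra_simps)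
    moreover have "(?a - ?b)\<^sup>2 \<le> 2 * (?a\<^sup>2 + ?b\<^sup>2)"
      using zero_le_power2[of "?a + ?b"] by (simp add: power2_eq_square algebra_simps)
    ultimately show ?thesis using P[of N] bb[of N] by simp
  qed
  have "(\<lambda>N. (\<Sum>i<N. l i * u i - l i * w i * Zs k i \<omega>)\<^sup>2) \<longlonglongrightarrow> (Y - Z)\<^sup>2"
    using sums_diff[OF Y Zl] unfolding sums_def by (rule tendsto_power)
  then show ?thesis by (rule LIMSEQ_le_const2) (use step in blast)
qed

text \<open>\<open>W\<close> bounds the effective dimension, \<open>L\<close> the weighted size of
  the functional, \<open>c2\<close> the weighted bias, \<open>bb\<close> the squared bias of the
  functional; \<open>s2\<close> is the variance of the leading term times the sample size. The Gram
  error contributes W^2/k and the score W/k + c2; multiplied by \<open>L\<close> and by k/s2 this is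
  \<open>rate2\<close>. \<open>rate1\<close> serves twice, for the smallness of the Gram error and
  for the Lyapunov ratio.\<close>

theorem ridge_functional_clt:
  fixes k :: "nat \<Rightarrow> nat" and w c :: "nat \<Rightarrow> nat \<Rightarrow> real" and l :: "nat \<Rightarrow> real"
    and u :: "nat \<Rightarrow> 'w \<Rightarrow> nat \<Rightarrow> real" and h :: "nat \<Rightarrow> 'w \<Rightarrow> nat \<Rightarrow> real" and Y :: "nat \<Rightarrow> 'w \<Rightarrow> real"
    and W L c2 bb s2 :: "nat \<Rightarrow> real"
  assumes k: "\<And>n. 0 < k n" "filterlim k at_top sequentially"
    and w: "\<And>n i. 0 < w n i" and W: "\<And>n N. (\<Sum>i<N. w n i) \<le> W n" "\<And>n. 0 < W n"
    and w1: "\<And>n i. w n i \<le> 1"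
    and L: "\<And>n N. (\<Sum>i<N. w n i * (l i)\<^sup>2) \<le> L n"
    and lC: "\<And>i. \<bar>l i\<bar> \<le> Cl"
    and c2: "\<And>n N. (\<Sum>i<N. w n i * (c n i)\<^sup>2) \<le> c2 n"
    and bb: "\<And>n N. (\<Sum>i<N. l i * w n i * c n i)\<^sup>2 \<le> bb n"
    and s2: "\<And>n. s2 n = \<sigma>\<^sup>2 * (\<Sum>i. (l i * w n i)\<^sup>2)" "\<And>n. s0 \<le> s2 n" "0 < s0"
    and u: "\<And>n \<omega>. \<omega> \<in> space M \<Longrightarrow> summable (\<lambda>i. (u n \<omega> i)\<^sup>2 / w n i)"
    and h: "\<And>n \<omega> j. \<omega> \<in> space M \<Longrightarrow> j < k n \<Longrightarrow> (\<lambda>i. u n \<omega> i * \<phi> i (fst (T j \<omega>))) sums h n \<omega> j"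
    and eq: "\<And>n \<omega> i. \<omega> \<in> space M \<Longrightarrow>
        (\<Sum>j<k n. (snd (T j \<omega>) - h n \<omega> j) * \<phi> i (fst (T j \<omega>))) / real (k n) = u n \<omega> i / w n i - u n \<omega> i + c n i"
    and Y: "\<And>n \<omega>. \<omega> \<in> space M \<Longrightarrow> (\<lambda>i. l i * u n \<omega> i) sums Y n \<omega>" "\<And>n. Y n \<in> borel_measurable M"
    and rate1: "(\<lambda>n. (W n)\<^sup>2 / real (k n)) \<longlonglongrightarrow> 0"
    and rate2: "(\<lambda>n. L n / s2 n * (W n)\<^sup>2 * (W n / real (k n) + c2 n)) \<longlonglongrightarrow> 0"
    and rate3: "(\<lambda>n. real (k n) * bb n / s2 n) \<longlonglongrightarrow> 0"
  shows "weak_conv_m (\<lambda>n. distr M borel (\<lambda>\<omega>. sqrt (real (k n)) * Y n \<omega> / sqrt (s2 n))) std_normal_distribution"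
proof -
  have s2pos: "0 < s2 n" for n using s2(2)[of n] s2(3) by simp
  have w0: "0 \<le> w n i" for n i using w[of n i] by simp
  have Cl0: "0 \<le> Cl" using lC[of 0] by (meson abs_ge_zero order_trans)
  define a where "a n i = l i * w n i" for n i
  have aA: "(\<Sum>i<N. \<bar>a n i\<bar>) \<le> Cl * W n" for n N
  proof -
    have "(\<Sum>i<N. \<bar>a n i\<bar>) \<le> (\<Sum>i<N. Cl * w n i)"
      unfolding a_def abs_mult using w0 lC Cl0 by (intro sum_mono mult_mono) auto
    also have "\<dots> \<le> Cl * W n" unfolding sum_distrib_left[symmetric] using W(1) Cl0 by (rule mult_left_mono)
    finally show ?thesis .
  qed
  define g where "g n x = (\<Sum>i. a n i * \<phi> i x)" for n x
  note gs = orthonormal_series[of "a _", OF aA, folded g_def]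
  define A where "A n = C * (Cl * W n)" for n
  have A0: "0 \<le> A n" for n using C_nonneg Cl0 W(2)[of n] by (simp add: A_def)
  have gb: "x \<in> space PX \<Longrightarrow> \<bar>g n x\<bar> \<le> A n" for n x using gs(2) by (simp add: A_def)
  have g2: "\<sigma>\<^sup>2 * (LINT x|PX. (g n x)\<^sup>2) = s2 n" for n unfolding gs(4) s2(1) by (simp add: a_def)
  define Wf where "Wf n z = snd z * g n (fst z) / sqrt (s2 n)" for n and z :: "'x \<times> real"
  have Wm: "Wf n \<in> borel_measurable (PX \<Otimes>\<^sub>M borel)" for n
    unfolding Wf_def using gs(3)[of n] by measurable
  have gi: "integrable PX (\<lambda>x. (g n x) ^ p)" for n p
  proof (rule PX_integrable_bounded)
    show "\<bar>(g n x) ^ p\<bar> \<le> A n ^ p" if "x \<in> space PX" for x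
      unfolding power_abs by (rule power_mono[OF gb[OF that]]) simp
  qed (use gs(3)[of n] in measurable)
  define \<kappa>4 where "\<kappa>4 = (LINT e|PE. e ^ 4)"
  have k40: "0 \<le> \<kappa>4" unfolding \<kappa>4_def by (rule integral_nonneg_AE) simp
  \<comment> \<open>Lyapunov ratio: the sup bound \<open>A n\<close> gives a fourth moment of
    \<open>g\<close> of at most its square times the second moment; normalization leaves the square
    of \<open>A n\<close> over \<open>s2 n\<close>, and \<open>s2 n\<close> is at least
    \<open>s0\<close>.\<close>
  define kap where "kap n = \<kappa>4 * (A n)\<^sup>2 / (\<sigma>\<^sup>2 * s0)" for n
  have clt: "weak_conv_m (\<lambda>n. distr M borel (\<lambda>\<omega>. (\<Sum>j<k n. Wf n (T j \<omega>)) / sqrt (real (k n)))) std_normal_distribution"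
  proof (rule row_central_limit_theorem[OF Wm _ _ _ _ k(2,1)])
    fix n
    have p4: "(Wf n z) ^ 4 = (g n (fst z)) ^ 4 * (snd z) ^ 4 / (s2 n)\<^sup>2" for z
    proof -
      have "(sqrt (s2 n)) ^ 4 = ((sqrt (s2 n))\<^sup>2)\<^sup>2" by (simp add: power_mult[symmetric])
      also have "\<dots> = (s2 n)\<^sup>2" using s2pos[of n] by simp
      finally show ?thesis by (simp add: Wf_def power_divide power_mult_distrib mult.commute)
    qed
    have i4: "integrable (PX \<Otimes>\<^sub>M PE) (\<lambda>z. (g n (fst z)) ^ 4 * (snd z) ^ 4)"
      "(LINT z|(PX \<Otimes>\<^sub>M PE). (g n (fst z)) ^ 4 * (snd z) ^ 4) = (LINT x|PX. (g n x) ^ 4) * \<kappa>4"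
      using product_measure_integral_mult[OF PX PE gi[of n 4] PE4] by (simp_all add: \<kappa>4_def)
    show "integrable (PX \<Otimes>\<^sub>M PE) (\<lambda>z. (Wf n z) ^ 4)" unfolding p4 using i4(1) by simp
    have "(LINT z|(PX \<Otimes>\<^sub>M PE). Wf n z) = (LINT z|(PX \<Otimes>\<^sub>M PE). g n (fst z) * snd z) / sqrt (s2 n)"
      by (simp add: Wf_def mult.commute)
    also have "(LINT z|(PX \<Otimes>\<^sub>M PE). g n (fst z) * snd z) = 0"
      using product_measure_integral_mult(2)[OF PX PE gi[of n 1, simplified] PE_integrable1] PE1 by simp
    finally show "(LINT z|(PX \<Otimes>\<^sub>M PE). Wf n z) = 0" by simp
    have p2: "(Wf n z)\<^sup>2 = (g n (fst z))\<^sup>2 * (snd z)\<^sup>2 / s2 n" for z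
      using s2pos[of n] by (simp add: Wf_def power_divide power_mult_distrib mult.commute)
    have "(LINT z|(PX \<Otimes>\<^sub>M PE). (Wf n z)\<^sup>2) = (LINT z|(PX \<Otimes>\<^sub>M PE). (g n (fst z))\<^sup>2 * (snd z)\<^sup>2) / s2 n"
      unfolding p2 by simp
    also have "(LINT z|(PX \<Otimes>\<^sub>M PE). (g n (fst z))\<^sup>2 * (snd z)\<^sup>2) = s2 n"
      using product_measure_integral_mult(2)[OF PX PE gi[of n 2] PE_integrable2] PE2 g2[of n] by (simp add: mult.commute)
    finally show "(LINT z|(PX \<Otimes>\<^sub>M PE). (Wf n z)\<^sup>2) = 1" using s2pos[of n] by simp
    have "(LINT x|PX. (g n x) ^ 4) \<le> (LINT x|PX. (A n)\<^sup>2 * (g n x)\<^sup>2)"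
    proof (rule integral_mono[OF gi])
      show "integrable PX (\<lambda>x. (A n)\<^sup>2 * (g n x)\<^sup>2)" using gi[of n 2] by simp
      fix x assume "x \<in> space PX"
      then have "\<bar>g n x\<bar>\<^sup>2 \<le> (A n)\<^sup>2" by (intro power_mono gb) auto
      then have "(g n x)\<^sup>2 * (g n x)\<^sup>2 \<le> (A n)\<^sup>2 * (g n x)\<^sup>2" by (intro mult_right_mono) auto
      then show "(g n x) ^ 4 \<le> (A n)\<^sup>2 * (g n x)\<^sup>2" by (simp add: power_add[symmetric])
    qed
    also have "\<dots> = (A n)\<^sup>2 * (s2 n / \<sigma>\<^sup>2)" using g2[of n, symmetric] sigma by simp
    finally have g4: "(LINT x|PX. (g n x) ^ 4) \<le> (A n)\<^sup>2 * (s2 n / \<sigma>\<^sup>2)" .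
    have "(LINT z|(PX \<Otimes>\<^sub>M PE). (Wf n z) ^ 4) = (LINT x|PX. (g n x) ^ 4) * \<kappa>4 / (s2 n)\<^sup>2" unfolding p4 using i4(2) by simp
    also have "\<dots> \<le> (A n)\<^sup>2 * (s2 n / \<sigma>\<^sup>2) * \<kappa>4 / (s2 n)\<^sup>2" using g4 k40 by (intro divide_right_mono mult_right_mono) auto
    also have "\<dots> = \<kappa>4 * (A n)\<^sup>2 / (\<sigma>\<^sup>2 * s2 n)" using s2pos[of n] by (simp add: field_simps power2_eq_square)
    also have "\<dots> \<le> kap n" unfolding kap_def
      using s2(2)[of n] s2(3) sigma k40 by (intro divide_left_mono mult_left_mono mult_nonneg_nonneg mult_pos_pos) auto
    finally show "(LINT z|(PX \<Otimes>\<^sub>M PE). (Wf n z) ^ 4) \<le> kap n" .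
  next
    have "kap n / real (k n) = (\<kappa>4 * (C * Cl)\<^sup>2 / (\<sigma>\<^sup>2 * s0)) * ((W n)\<^sup>2 / real (k n))" for n
      by (simp add: kap_def A_def power_mult_distrib)
    moreover have "(\<lambda>n. (\<kappa>4 * (C * Cl)\<^sup>2 / (\<sigma>\<^sup>2 * s0)) * ((W n)\<^sup>2 / real (k n))) \<longlonglongrightarrow> (\<kappa>4 * (C * Cl)\<^sup>2 / (\<sigma>\<^sup>2 * s0)) * 0"
      by (intro tendsto_intros rate1)
    ultimately show "(\<lambda>n. kap n / real (k n)) \<longlonglongrightarrow> 0" by simp
  qed
  \<comment> \<open>The \<open>+ 1\<close> makes the level strictly positive, as
    \<open>Markov_ennreal\<close> requires.\<close>
  define Qn where "Qn n = (C ^ 4 + 1) * (W n)\<^sup>2 / real (k n)" for n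
  define Bn where "Bn n = 2 * (\<sigma>\<^sup>2 * W n / real (k n)) + 2 * c2 n" for n
  have Qn0: "0 < Qn n" for n
  proof -
    have "0 < C ^ 4 + 1" using C_nonneg by (simp add: add_nonneg_pos)
    then show ?thesis using W(2)[of n] k(1)[of n] by (simp add: Qn_def)
  qed
  have c20: "0 \<le> c2 n" for n
  proof -
    have "(\<Sum>i<0. w n i * (c n i)\<^sup>2) \<le> c2 n" by (rule c2)
    then show ?thesis by simp
  qed
  have Bn0: "0 < Bn n" for n using sigma W(2)[of n] k(1)[of n] c20[of n] by (simp add: Bn_def add_pos_nonneg)
  have L0: "0 \<le> L n" for n
  proof -
    have "(\<Sum>i<0. w n i * (l i)\<^sup>2) \<le> L n" by (rule L)
    then show ?thesis by simp
  qed
  have Zrep: "(\<lambda>i. l i * w n i * Zs (k n) i \<omega>) sums ((\<Sum>j<k n. snd (T j \<omega>) * g n (fst (T j \<omega>))) / real (k n))"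
    if w': "\<omega> \<in> space M" for n \<omega>
  proof -
    have x: "fst (T j \<omega>) \<in> space PX" for j using measurable_space[OF T_measurable w', of j] by (auto simp: space_pair_measure)
    have "(\<lambda>i. \<Sum>j<k n. snd (T j \<omega>) * (a n i * \<phi> i (fst (T j \<omega>)))) sums (\<Sum>j<k n. snd (T j \<omega>) * g n (fst (T j \<omega>)))"
      by (intro sums_sum sums_mult gs(1) x)
    then have "(\<lambda>i. (\<Sum>j<k n. snd (T j \<omega>) * (a n i * \<phi> i (fst (T j \<omega>)))) / real (k n)) sums ((\<Sum>j<k n. snd (T j \<omega>) * g n (fst (T j \<omega>))) / real (k n))"
      by (rule sums_divide)
    moreover have "(\<Sum>j<k n. snd (T j \<omega>) * (a n i * \<phi> i (fst (T j \<omega>)))) / real (k n) = l i * w n i * Zs (k n) i \<omega>" for i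
      by (simp add: Zs_def a_def sum_distrib_left mult_ac)
    ultimately show ?thesis by simp
  qed
  define An where "An n \<omega> = (\<Sum>j<k n. Wf n (T j \<omega>)) / sqrt (real (k n))" for n \<omega>
  define Bf where "Bf n \<omega> = sqrt (real (k n)) * Y n \<omega> / sqrt (s2 n)" for n \<omega>
  have WfT: "(\<lambda>\<omega>. Wf n (T j \<omega>)) \<in> borel_measurable M" for n j by (rule measurable_compose[OF T_measurable Wm])
  have Am: "An n \<in> borel_measurable M" for n unfolding An_def[abs_def] using WfT by measurable
  have Bm: "Bf n \<in> borel_measurable M" for n unfolding Bf_def[abs_def] using Y(2)[of n] by measurable
  have dev: "(Bf n \<omega> - An n \<omega>)\<^sup>2 = real (k n) / s2 n * (Y n \<omega> - (\<Sum>j<k n. snd (T j \<omega>) * g n (fst (T j \<omega>))) / real (k n))\<^sup>2" for n \<omega>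
  proof -
    have kk: "sqrt (real (k n)) * sqrt (real (k n)) = real (k n)" by simp
    have kp: "0 < sqrt (real (k n))" using k(1)[of n] by simp
    have "An n \<omega> = (\<Sum>j<k n. snd (T j \<omega>) * g n (fst (T j \<omega>))) / sqrt (s2 n) / sqrt (real (k n))"
      by (simp add: An_def Wf_def sum_divide_distrib)
    also have "\<dots> = sqrt (real (k n)) / sqrt (s2 n) * ((\<Sum>j<k n. snd (T j \<omega>) * g n (fst (T j \<omega>))) / real (k n))"
    proof -
      have "x / s / r = r / s * (x / (r * r))" if "0 < r" for x s r :: real using that by simp
      from this[OF kp] show ?thesis unfolding kk by blast
    qed
    finally have "Bf n \<omega> - An n \<omega> = sqrt (real (k n)) / sqrt (s2 n) * (Y n \<omega> - (\<Sum>j<k n. snd (T j \<omega>) * g n (fst (T j \<omega>))) / real (k n))"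
      by (simp add: Bf_def right_diff_distrib)
    then show ?thesis using s2pos[of n] by (simp add: power_mult_distrib power_divide)
  qed
  \<comment> \<open>The squared deviation allowed by \<open>functional_deviation_le\<close> when the
    Gram error is at most \<open>K * Qn n\<close> and the score at most \<open>K * Bn n\<close>,
    after scaling by \<open>k n / s2 n\<close>.\<close>
  define R where "R K n = 8 * K\<^sup>2 * (real (k n) * L n / s2 n * (Qn n * Bn n)) + 2 * (real (k n) * bb n / s2 n)" for K n
  have Rlim: "R K \<longlonglongrightarrow> 0" for K
  proof -
    let ?Cq = "(C ^ 4 + 1) * (2 * \<sigma>\<^sup>2 + 2)"
    have le: "real (k n) * L n / s2 n * (Qn n * Bn n) \<le> ?Cq * (L n / s2 n * (W n)\<^sup>2 * (W n / real (k n) + c2 n))" for n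
    proof -
      have kp: "real (k n) \<noteq> 0" using k(1)[of n] by simp
      have e: "real (k n) * L n / s2 n * (Qn n * Bn n) = (C ^ 4 + 1) * (L n / s2 n * (W n)\<^sup>2) * Bn n"
        using kp by (simp add: Qn_def)
      have "Bn n \<le> (2 * \<sigma>\<^sup>2 + 2) * (W n / real (k n) + c2 n)"
      proof -
        define x where "x = W n / real (k n)"
        have "0 \<le> x" using W(2)[of n] by (simp add: x_def)
        moreover have "0 \<le> \<sigma>\<^sup>2 * c2 n" using c20 by simp
        moreover have "Bn n = 2 * (\<sigma>\<^sup>2 * x) + 2 * c2 n" by (simp add: Bn_def x_def)
        ultimately show ?thesis unfolding x_def[symmetric] by (simp add: algebra_simps)
      qed
      moreover have "0 \<le> (C ^ 4 + 1) * (L n / s2 n * (W n)\<^sup>2)" using C_nonneg L0[of n] s2pos[of n] by simp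
      ultimately have "(C ^ 4 + 1) * (L n / s2 n * (W n)\<^sup>2) * Bn n \<le> (C ^ 4 + 1) * (L n / s2 n * (W n)\<^sup>2) * ((2 * \<sigma>\<^sup>2 + 2) * (W n / real (k n) + c2 n))"
        by (rule mult_left_mono)
      then show ?thesis unfolding e by (simp only: mult_ac)
    qed
    have "(\<lambda>n. real (k n) * L n / s2 n * (Qn n * Bn n)) \<longlonglongrightarrow> 0"
    proof (rule tendsto_sandwich)
      show "\<forall>\<^sub>F n in sequentially. 0 \<le> real (k n) * L n / s2 n * (Qn n * Bn n)"
      proof (rule always_eventually, rule allI)
        fix n show "0 \<le> real (k n) * L n / s2 n * (Qn n * Bn n)"
          using L0[of n] s2pos[of n] Qn0[of n] Bn0[of n] by simp
      qed
      show "\<forall>\<^sub>F n in sequentially. real (k n) * L n / s2 n * (Qn n * Bn n) \<le> ?Cq * (L n / s2 n * (W n)\<^sup>2 * (W n / real (k n) + c2 n))"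
        using le by simp
      have "(\<lambda>n. ?Cq * (L n / s2 n * (W n)\<^sup>2 * (W n / real (k n) + c2 n))) \<longlonglongrightarrow> ?Cq * 0" by (intro tendsto_intros rate2)
      then show "(\<lambda>n. ?Cq * (L n / s2 n * (W n)\<^sup>2 * (W n / real (k n) + c2 n))) \<longlonglongrightarrow> 0" by simp
    qed simp
    then have "R K \<longlonglongrightarrow> 8 * K\<^sup>2 * 0 + 2 * 0" unfolding R_def[abs_def] by (intro tendsto_intros rate3)
    then show ?thesis by simp
  qed
  have Qlim: "Qn \<longlonglongrightarrow> 0"
  proof -
    have "Qn = (\<lambda>n. (C ^ 4 + 1) * ((W n)\<^sup>2 / real (k n)))" by (simp add: fun_eq_iff Qn_def)
    then show ?thesis using tendsto_mult_right_zero[OF rate1] by simp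
  qed
  have "weak_conv_m (\<lambda>n. distr M borel (Bf n)) std_normal_distribution"
  proof (rule weak_conv_m_perturbation[OF Am Bm _ real_dist_normal_dist])
    show "weak_conv_m (\<lambda>n. distr M borel (An n)) std_normal_distribution" using clt by (simp add: An_def[abs_def])
    fix \<delta> \<epsilon> :: real assume d: "0 < \<delta>" and e: "0 < \<epsilon>"
    \<comment> \<open>Each of the two Markov bounds fails with probability at most
      \<open>1 / K\<close>, together \<epsilon>.\<close>
    define K where "K = 2 / \<epsilon>"
    have K: "0 < K" using e by (simp add: K_def)
    have ev1: "\<forall>\<^sub>F n in sequentially. R K n < \<delta>\<^sup>2" using Rlim d by (intro order_tendstoD(2)[of _ 0]) auto
    have ev2: "\<forall>\<^sub>F n in sequentially. Qn n < 1 / (4 * K)" using Qlim K by (intro order_tendstoD(2)[of _ 0]) auto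
    from ev1 ev2 show "\<forall>\<^sub>F n in sequentially. prob {\<omega> \<in> space M. \<delta> < \<bar>Bf n \<omega> - An n \<omega>\<bar>} \<le> \<epsilon>"
    proof eventually_elim
      case (elim n)
      let ?Qf = "\<lambda>\<omega>. \<Sum>i. \<Sum>j. ennreal (w n i * w n j * (Ds (k n) i j \<omega>)\<^sup>2)"
      let ?Zf = "\<lambda>\<omega>. \<Sum>i. ennreal (w n i * (Zs (k n) i \<omega> - c n i)\<^sup>2)"
      let ?E1 = "{\<omega> \<in> space M. \<not> ?Qf \<omega> \<le> ennreal (K * Qn n)}" and ?E2 = "{\<omega> \<in> space M. \<not> ?Zf \<omega> \<le> ennreal (K * Bn n)}"
      note mq = weighted_Ds_moment[of "k n" "w n" "W n", OF k(1) w W(1)]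
      note mz = weighted_Zs_moment[of "k n" "w n" "W n" "c n" "c2 n", OF k(1) w W(1) c2]
      have "C ^ 4 * (W n)\<^sup>2 / real (k n) \<le> Qn n" unfolding Qn_def by (intro divide_right_mono mult_right_mono) auto
      then have mq2: "(\<integral>\<^sup>+\<omega>. ?Qf \<omega> \<partial>M) \<le> ennreal (Qn n)" using mq(2) by (meson ennreal_leI order_trans)
      have P1: "prob ?E1 \<le> 1 / K" by (rule Markov_ennreal[OF mq(1) mq2 Qn0 K])
      have P2: "prob ?E2 \<le> 1 / K" by (rule Markov_ennreal[OF mz(1) mz(2)[folded Bn_def] Bn0 K])
      have E1: "?E1 \<in> events" using mq(1) by measurable
      have E2: "?E2 \<in> events" using mz(1) by measurable
      have sub: "{\<omega> \<in> space M. \<delta> < \<bar>Bf n \<omega> - An n \<omega>\<bar>} \<subseteq> ?E1 \<union> ?E2"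
      proof (rule subsetI, rule ccontr)
        fix \<omega> assume w1: "\<omega> \<in> {\<omega> \<in> space M. \<delta> < \<bar>Bf n \<omega> - An n \<omega>\<bar>}" and w2: "\<omega> \<notin> ?E1 \<union> ?E2"
        then have ws: "\<omega> \<in> space M" and Qe: "?Qf \<omega> \<le> ennreal (K * Qn n)" and Ze: "?Zf \<omega> \<le> ennreal (K * Bn n)" by auto
        have q4: "K * Qn n \<le> 1/4" using elim(2) K by (simp add: field_simps)
        have KQ: "0 \<le> K * Qn n" "0 \<le> K * Bn n" using K Qn0[of n] Bn0[of n] by simp_all
        have "(Y n \<omega> - (\<Sum>j<k n. snd (T j \<omega>) * g n (fst (T j \<omega>))) / real (k n))\<^sup>2 \<le> 2 * (4 * L n * (K * Qn n) * (K * Bn n) + bb n)"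
          by (rule functional_deviation_le[OF k(1) w L bb u[OF ws] h[OF ws] eq[OF ws] Y(1)[OF ws] Zrep[OF ws] Qe KQ(1) q4 Ze KQ(2)])
        then have "(Bf n \<omega> - An n \<omega>)\<^sup>2 \<le> real (k n) / s2 n * (2 * (4 * L n * (K * Qn n) * (K * Bn n) + bb n))"
          unfolding dev using s2pos[of n] by (intro mult_left_mono) auto
        also have "\<dots> = R K n" unfolding R_def by (simp only: distrib_left power2_eq_square times_divide_eq_right times_divide_eq_left mult_ac)
        also have "\<dots> < \<delta>\<^sup>2" by (rule elim(1))
        finally have "\<bar>Bf n \<omega> - An n \<omega>\<bar>\<^sup>2 < \<delta>\<^sup>2" by simp
        then have "\<bar>Bf n \<omega> - An n \<omega>\<bar> < \<delta>" by (rule power2_less_imp_less) (use d in simp)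
        then show False using w1 by auto
      qed
      have "prob {\<omega> \<in> space M. \<delta> < \<bar>Bf n \<omega> - An n \<omega>\<bar>} \<le> prob (?E1 \<union> ?E2)" by (rule finite_measure_mono[OF sub]) (use E1 E2 in blast)
      also have "\<dots> \<le> prob ?E1 + prob ?E2" by (rule measure_Un_le[OF E1 E2])
      also have "\<dots> \<le> 1 / K + 1 / K" using P1 P2 by simp
      also have "\<dots> = \<epsilon>" using e by (simp add: K_def)
      finally show ?case .
    qed
  qed
  then show ?thesis by (simp add: Bf_def[abs_def])
qed

end

section \<open>Consequences of the rate conditions\<close>

lemma linear_minus_log_at_top:
  fixes c k :: real assumes c: "0 < c" and k: "0 \<le> k"
  shows "filterlim (\<lambda>x. c * x - k * ln x) at_top at_top"
proof -
  have "((\<lambda>x. c - k * (ln x / x)) \<longlongrightarrow> c - k * 0) at_top"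
    by (intro tendsto_intros ln_x_over_x_tendsto_0)
  then have "((\<lambda>x. c - k * (ln x / x)) \<longlongrightarrow> c) at_top" by simp
  then have "filterlim (\<lambda>x. (c - k * (ln x / x)) * x) at_top at_top"
    by (rule filterlim_tendsto_pos_mult_at_top[OF _ c filterlim_ident])
  moreover have "\<forall>\<^sub>F x in at_top. (c - k * (ln x / x)) * x = c * x - k * ln x"
    using eventually_gt_at_top[of 0] by eventually_elim (simp add: field_simps)
  ultimately show ?thesis by (rule filterlim_cong[THEN iffD1, OF refl refl, rotated])
qed

lemma lam_tendsto_zero:
  assumes pos: "\<And>n. 0 < lam n" and rate1: "(\<lambda>n. sqrt (real n) * lam n) \<longlonglongrightarrow> 0"
  shows "lam \<longlonglongrightarrow> 0"
proof (rule Lim_null_comparison[OF _ rate1])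
  show "\<forall>\<^sub>F n in sequentially. norm (lam n) \<le> sqrt (real n) * lam n"
    using eventually_ge_at_top[of 1]
  proof eventually_elim
    case (elim n)
    then have "1 * lam n \<le> sqrt (real n) * lam n" using pos[of n] by (intro mult_right_mono) auto
    then show ?case using pos[of n] by simp
  qed
qed

lemma effective_dimension_rate:
  fixes lam :: "nat \<Rightarrow> real"
  assumes m: "2 \<le> m" and c: "1 \<le> c" and tau: "0 \<le> \<tau>" "\<tau> < 2 * real m - 2"
    and pos: "\<And>n. 0 < lam n" and rate1: "(\<lambda>n. sqrt (real n) * lam n) \<longlonglongrightarrow> 0" and J: "0 \<le> J"
    and rate3: "(\<lambda>n. sqrt (real n) * alpha_n (real m) \<tau> (real c) J (lam n) n) \<longlonglongrightarrow> 0"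
  shows "(\<lambda>n. lam n powr (-2 / real m) / real n) \<longlonglongrightarrow> 0"
proof -
  define p where "p = 4 * real m - 2 * \<tau> - 2"
  have p: "2 < p" "p \<le> 4 * real m - 2" using tau by (auto simp: p_def)
  have m0: "0 < real m" "2 \<le> real m" using m by auto
  have lam0: "lam \<longlonglongrightarrow> 0" by (rule lam_tendsto_zero[OF pos rate1])
  have "filterlim lam (at_right 0) sequentially"
    by (rule tendsto_imp_filterlim_at_right[OF lam0]) (use pos in simp)
  then have "filterlim (\<lambda>n. ln (lam n)) at_bot sequentially" by (rule filterlim_compose[OF ln_at_0])
  then have xlim: "filterlim (\<lambda>n. - ln (lam n)) at_top sequentially" by (simp add: filterlim_uminus_at_top)
  have c1: "0 < 1/2 - 1 / (4 * real m)" using m0 by (simp add: field_simps)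
  \<comment> \<open>This expression is the inner logarithm of \<open>beta_n\<close>. Its linear part
    in \<open>- ln (lam n)\<close> dominates, so it is eventually at least 1 and so is its square
    root.\<close>
  have g: "filterlim (\<lambda>n. (1/2 - 1 / (4 * real m)) * (- ln (lam n)) - ((real c - 1) / 2) * ln (- ln (lam n))) at_top sequentially"
    by (rule filterlim_compose[OF linear_minus_log_at_top xlim]) (use c1 c in auto)
  have e1: "\<forall>\<^sub>F n in sequentially. 1 \<le> - ln (lam n)" using xlim unfolding filterlim_at_top by blast
  have e2: "\<forall>\<^sub>F n in sequentially. 1 \<le> (1/2 - 1 / (4 * real m)) * (- ln (lam n)) - ((real c - 1) / 2) * ln (- ln (lam n))"
    using g by (simp add: filterlim_at_top)
  have main: "\<forall>\<^sub>F n in sequentially. norm (real n powr (-1/2) * lam n powr (-1 / real m)) \<le> sqrt (real n) * alpha_n (real m) \<tau> (real c) J (lam n) n"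
    using e1 e2 eventually_ge_at_top[of 3]
  proof eventually_elim
    case (elim n)
    let ?l = "lam n" and ?x = "- ln (lam n)"
    have l0: "0 < ?l" by (rule pos)
    have l1: "?l < 1"
    proof (rule ccontr)
      assume "\<not> ?l < 1" then have "0 \<le> ln ?l" by simp
      then show False using elim(1) by simp
    qed
    have n0: "0 < real n" using elim(3) by simp
    have lnn: "1 \<le> ln (real n)"
    proof -
      have "exp 1 \<le> (3::real)" using exp_le by simp
      also have "3 \<le> real n" using elim(3) by simp
      finally show ?thesis using n0 by (simp add: ln_ge_iff)
    qed
    have x1: "1 \<le> ?x powr a" if "0 \<le> a" for a using elim(1) that by (simp add: ge_one_powr_ge_zero)
    have L: "1 \<le> ln (?l powr (1 / (4 * real m) - 1/2) * ?x powr ((1 - real c) / 2))"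
    proof -
      have "ln (?l powr (1 / (4 * real m) - 1/2) * ?x powr ((1 - real c) / 2)) =
         (1 / (4 * real m) - 1/2) * ln ?l + ((1 - real c) / 2) * ln ?x"
        using l0 elim(1) by (simp add: ln_mult ln_powr)
      also have "\<dots> = (1/2 - 1 / (4 * real m)) * ?x - ((real c - 1) / 2) * ln ?x"
        by (simp add: algebra_simps diff_divide_distrib)
      finally show ?thesis using elim(2) by simp
    qed
    \<comment> \<open>Collected exponent of \<open>1 / lam n\<close> in \<open>beta_n\<close>. It
      decreases in \<open>p\<close>, and the largest value 4m - 2 of \<open>p\<close>, reached for
      \<tau> = 0, gives exactly 3/(4m).\<close>
    define b where "b = 1/(2 * real m) + 1/p - 1/(2 * real m * p)"
    have b: "3 / (4 * real m) \<le> b"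
    proof -
      have "1 / (4 * real m) = (1 - 1 / (2 * real m)) / (4 * real m - 2)"
        using m0 by (simp add: field_simps)
      also have "\<dots> \<le> (1 - 1 / (2 * real m)) / p"
        using p m0 by (intro divide_left_mono) (auto simp: field_simps)
      also have "\<dots> = 1/p - 1/(2 * real m * p)" by (simp add: diff_divide_distrib)
      finally show ?thesis unfolding b_def by (simp add: field_simps)
    qed
    have pe: "8 * (real m)\<^sup>2 - 4 * real m * \<tau> - 4 * real m = 2 * real m * p" by (simp add: p_def power2_eq_square algebra_simps)
    have lamb: "?l powr (-1/(2 * real m)) * ?l powr (-1/p) * ?l powr (1/(2 * real m * p)) = ?l powr (- b)"
    proof -
      have "-1/(2 * real m) + -1/p + 1/(2 * real m * p) = - b" by (simp add: b_def)
      then show ?thesis unfolding powr_add[symmetric] by (simp only:)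
    qed
    have beta: "real n powr (-1/2) * ?l powr (- 3 / (4 * real m)) \<le> beta_n (real m) \<tau> (real c) ?l n"
    proof -
      have "?l powr (- 3 / (4 * real m)) \<le> ?l powr (- b)"
        by (rule powr_mono') (use l0 l1 b in auto)
      then have "real n powr (-1/2) * ?l powr (- 3 / (4 * real m)) * 1 * 1 * 1 \<le>
        real n powr (-1/2) * ?l powr (- b) * ?x powr ((real c - 1) * (1 - 1/p))
         * sqrt (ln (?l powr (1 / (4 * real m) - 1/2) * ?x powr ((1 - real c) / 2))) * sqrt (ln (real n))"
        using L lnn c p by (intro mult_mono x1 mult_nonneg_nonneg) auto
      also have "\<dots> = beta_n (real m) \<tau> (real c) ?l n"
        unfolding beta_n_def pe p_def[symmetric] lamb[symmetric] by (simp only: mult.assoc)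
      finally show ?thesis by simp
    qed
    have b0: "0 \<le> beta_n (real m) \<tau> (real c) ?l n" by (rule order_trans[OF _ beta]) simp
    have "real n powr (-1/2) * ?l powr (-1 / (4 * real m)) * 1 \<le>
       real n powr (-1/2) * ?l powr (-1 / (4 * real m)) * ?x powr ((real c - 1) / 2) + sqrt ?l * sqrt J"
    proof -
      have "real n powr (-1/2) * ?l powr (-1 / (4 * real m)) * 1 \<le> real n powr (-1/2) * ?l powr (-1 / (4 * real m)) * ?x powr ((real c - 1) / 2)"
        using c by (intro mult_left_mono x1) auto
      moreover have "0 \<le> sqrt ?l * sqrt J" using l0 J by simp
      ultimately show ?thesis by linarith
    qed
    then have "(real n powr (-1/2) * ?l powr (- 3 / (4 * real m))) * (real n powr (-1/2) * ?l powr (-1 / (4 * real m)) * 1)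
        \<le> alpha_n (real m) \<tau> (real c) J ?l n"
      unfolding alpha_n_def using beta b0 by (intro mult_mono) auto
    then have "sqrt (real n) * ((real n powr (-1/2) * ?l powr (- 3 / (4 * real m))) * (real n powr (-1/2) * ?l powr (-1 / (4 * real m)) * 1))
        \<le> sqrt (real n) * alpha_n (real m) \<tau> (real c) J ?l n" by (rule mult_left_mono) simp
    moreover have "sqrt (real n) * ((real n powr (-1/2) * ?l powr (- 3 / (4 * real m))) * (real n powr (-1/2) * ?l powr (-1 / (4 * real m)) * 1))
       = real n powr (-1/2) * ?l powr (-1 / real m)"
    proof -
      have a: "sqrt (real n) * real n powr (-1/2) = 1" using n0 by (simp add: powr_half_sqrt[symmetric] powr_add[symmetric])
      have "?l powr (- 3 / (4 * real m)) * ?l powr (-1 / (4 * real m)) = ?l powr (-1 / real m)"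
        unfolding powr_add[symmetric] using m0 by (simp add: field_simps)
      moreover have "A * ((B * E) * (B * F * 1)) = (A * B) * (B * (E * F))" for A B E F :: real by (simp only: mult_1_right mult_ac)
      ultimately show ?thesis using a by (simp only: mult_1)
    qed
    ultimately have fin: "real n powr (-1/2) * ?l powr (-1 / real m) \<le> sqrt (real n) * alpha_n (real m) \<tau> (real c) J ?l n"
      by (simp only:)
    have "0 \<le> real n powr (-1/2) * ?l powr (-1 / real m)" by simp
    then show ?case using fin unfolding real_norm_def by (simp only: abs_of_nonneg)
  qed
  have R: "(\<lambda>n. real n powr (-1/2) * lam n powr (-1 / real m)) \<longlonglongrightarrow> 0" by (rule Lim_null_comparison[OF main rate3])
  have "(\<lambda>n. (real n powr (-1/2) * lam n powr (-1 / real m))\<^sup>2) \<longlonglongrightarrow> 0\<^sup>2" by (rule tendsto_power[OF R])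
  then have R2: "(\<lambda>n. (real n powr (-1/2) * lam n powr (-1 / real m))\<^sup>2) \<longlonglongrightarrow> 0" by simp
  show ?thesis
  proof (rule Lim_transform_eventually[OF R2])
    show "\<forall>\<^sub>F n in sequentially. (real n powr (-1/2) * lam n powr (-1 / real m))\<^sup>2 = lam n powr (-2 / real m) / real n"
      using eventually_ge_at_top[of 1]
    proof eventually_elim
      case (elim n)
      have A: "(real n powr (-1/2))\<^sup>2 = 1 / real n"
        using elim unfolding power2_eq_square powr_add[symmetric] by (simp add: powr_minus_divide)
      have B: "(lam n powr (-1 / real m))\<^sup>2 = lam n powr (-2 / real m)" unfolding power2_eq_square powr_add[symmetric] by simp
      show ?case unfolding power_mult_distrib A B by (simp only: times_divide_eq_left mult_1)
    qed
  qed
qed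

lemma powr_rate_over_n:
  assumes r: "(\<lambda>n. lam n powr (- q) / real (k n)) \<longlonglongrightarrow> 0" and l: "\<And>n. 0 < lam n \<and> lam n \<le> (1::real)" and p: "p \<le> q"
  shows "(\<lambda>n. lam n powr (- p) / real (k n)) \<longlonglongrightarrow> 0"
proof (rule Lim_null_comparison[OF _ r])
  have "norm (lam n powr (- p) / real (k n)) \<le> lam n powr (- q) / real (k n)" for n
    using l[of n] p by (auto intro!: divide_right_mono powr_mono')
  then show "\<forall>\<^sub>F n in sequentially. norm (lam n powr (- p) / real (k n)) \<le> lam n powr (- q) / real (k n)" by simp
qed

lemma powr_tendsto_zero:
  assumes "lam \<longlonglongrightarrow> 0" "\<And>n. 0 < lam n" "0 < (p::real)" shows "(\<lambda>n. lam n powr p) \<longlonglongrightarrow> 0"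
  using tendsto_zero_powrI[OF assms(1) tendsto_const, of p] assms(2,3) by (simp add: less_imp_le)

section \<open>The joint eigensystem of all components\<close>

locale spline_design = family_space m SS D
  for m :: nat and SS :: "nat set set" and D :: "nat set" +
  fixes \<mu> :: "nat set \<Rightarrow> nat \<Rightarrow> real" and \<psi> :: "nat set \<Rightarrow> nat \<Rightarrow> (nat \<Rightarrow> real) \<Rightarrow> real" and C\<psi> \<theta> :: real
  assumes Cpsi: "1 < C\<psi>" and eigs: "\<And>T. T \<in> SS - {{}} \<Longrightarrow> eigensystem m T (\<mu> T) (\<psi> T) C\<psi>"
    and nontrivial: "SS - {{}} \<noteq> {}" and theta: "0 < \<theta>" "\<theta> < 1" "1 < 2 * real m * \<theta>"
begin

lemma comp: assumes "T \<in> SS - {{}}" shows "finite T" "T \<subseteq> D" "T \<in> SS" "T \<noteq> {}"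
  using assms finite_comp SS by auto

text \<open>The index \<open>({}, 0)\<close> stands for the constant function 1; its penalty ratio \<open>rho\<close> is 0 since the
  intercept is not penalized.\<close>

definition eidx :: "(nat set \<times> nat) set" where "eidx = insert ({}, 0) ((SS - {{}}) \<times> UNIV)"

text \<open>A single sequence for the constant and all components, since the perturbation lemma and
  the functional limit theorem treat systems indexed by natural numbers.\<close>

definition enum :: "nat \<Rightarrow> nat set \<times> nat" where "enum = from_nat_into eidx"

lemma enum_bij: "bij_betw enum UNIV eidx"
  unfolding enum_def
proof (rule bij_betw_from_nat_into)
  have "countable (SS - {{}})" using finite_SS by (intro countable_finite) simp
  then show "countable eidx" unfolding eidx_def by (intro countable_insert countable_SIGMA countableI_type)
  show "infinite eidx" using nontrivial by (auto simp: eidx_def finite_cartesian_product_iff)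
qed

lemma enum_in: "enum i \<in> eidx" using enum_bij by (auto simp: bij_betw_def)

lemma enum_eq_iff: "enum i = enum j \<longleftrightarrow> i = j" using enum_bij by (auto simp: bij_betw_def inj_on_def)

definition efn :: "nat set \<times> nat \<Rightarrow> (nat \<Rightarrow> real) \<Rightarrow> real" where
  "efn p x = (if fst p = {} then 1 else \<psi> (fst p) (snd p) (restrict x (fst p)))"

definition rho :: "nat set \<times> nat \<Rightarrow> real" where
  "rho p = (if fst p = {} then 0 else 1 / \<mu> (fst p) (snd p))"

definition coef :: "family \<Rightarrow> nat set \<times> nat \<Rightarrow> real" where
  "coef f p = (if fst p = {} then intercept f else VS (fst p) (f (fst p)) (\<psi> (fst p) (snd p)))"

definition wgt :: "real \<Rightarrow> nat set \<times> nat \<Rightarrow> real" where "wgt lam p = 1 / (1 + lam * rho p)"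

lemma rho_nonneg: assumes "p \<in> eidx" shows "0 \<le> rho p"
proof (cases "fst p = {}")
  case False
  then have T: "fst p \<in> SS - {{}}" using assms by (auto simp: eidx_def)
  show ?thesis using eig_mu_pos[OF m comp(1)[OF T] eigs[OF T], of "snd p"] by (simp add: rho_def)
qed (simp add: rho_def)

lemma wgt_bounds: assumes "0 < lam" "p \<in> eidx" shows "0 < wgt lam p" "wgt lam p \<le> 1"
  using rho_nonneg[OF assms(2)] assms(1) by (auto simp: wgt_def add_pos_nonneg)

text \<open>The enumeration interleaves the components in no particular order, so unconditional
  summability within each component is assumed and a plain series results.\<close>

lemma enum_sums:
  assumes "\<And>T. T \<in> SS - {{}} \<Longrightarrow> ((\<lambda>v. F (T, v)) has_sum s T) UNIV"
  shows "(\<lambda>i. F (enum i)) sums (F ({}, 0) + (\<Sum>T\<in>SS - {{}}. s T) :: real)"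
proof -
  have "(F has_sum (\<Sum>T\<in>A. s T)) (A \<times> UNIV)" if "finite A" "A \<subseteq> SS - {{}}" for A
    using that
  proof (induction A)
    case (insert T A)
    have "inj (Pair T :: nat \<Rightarrow> _)" by (auto simp: inj_on_def)
    then have "(F has_sum s T) (range (Pair T))"
      using assms[of T] insert by (simp add: has_sum_reindex o_def)
    moreover have "range (Pair T) = {T} \<times> (UNIV :: nat set)" by auto
    ultimately have "(F has_sum s T) ({T} \<times> UNIV)" by (simp only:)
    then have "(F has_sum (s T + (\<Sum>T\<in>A. s T))) ({T} \<times> UNIV \<union> A \<times> UNIV)"
      by (rule has_sum_Un_disjoint) (use insert in auto)
    moreover have "{T} \<times> UNIV \<union> A \<times> UNIV = insert T A \<times> (UNIV :: nat set)" by auto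
    ultimately show ?case using insert by simp
  qed simp
  from this[of "SS - {{}}"] have h: "(F has_sum (\<Sum>T\<in>SS - {{}}. s T)) ((SS - {{}}) \<times> UNIV)" using finite_SS by simp
  have "(F has_sum F ({}, 0)) {({}, 0)}" using has_sum_finite[of "{({}, 0)}" F] by simp
  then have "(F has_sum (F ({}, 0) + (\<Sum>T\<in>SS - {{}}. s T))) ({({}, 0)} \<union> (SS - {{}}) \<times> UNIV)"
    by (rule has_sum_Un_disjoint[OF _ h]) auto
  then have "(F has_sum (F ({}, 0) + (\<Sum>T\<in>SS - {{}}. s T))) eidx" by (simp add: eidx_def)
  then have "((\<lambda>i. F (enum i)) has_sum (F ({}, 0) + (\<Sum>T\<in>SS - {{}}. s T))) UNIV"
    by (simp only: has_sum_reindex_bij_betw[OF enum_bij])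
  then show ?thesis by (rule has_sum_imp_sums)
qed

lemma efn_measurable: "p \<in> eidx \<Longrightarrow> efn p \<in> borel_measurable (PiM D (\<lambda>_. U01))"
proof -
  assume p: "p \<in> eidx"
  show ?thesis
  proof (cases "fst p = {}")
    case False
    then have T: "fst p \<in> SS - {{}}" using p by (auto simp: eidx_def)
    show ?thesis unfolding efn_def[abs_def] using False
      by (simp add: measurable_compose[OF restrict_measurable[OF m comp(2)[OF T]] HS_measurable[OF m comp(1)[OF T] eig_HS[OF m comp(1)[OF T] eigs[OF T]]]])
  qed (simp add: efn_def[abs_def])
qed

lemma efn_bound: assumes p: "p \<in> eidx" and x: "x \<in> cube D" shows "\<bar>efn p x\<bar> \<le> C\<psi>"
proof (cases "fst p = {}")
  case False
  then have T: "fst p \<in> SS - {{}}" using p by (auto simp: eidx_def)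
  show ?thesis using False eig_bound[OF m comp(1)[OF T] eigs[OF T] restrict_cube[OF m x comp(2)[OF T]], of "snd p"]
    by (simp add: efn_def)
qed (use Cpsi in \<open>simp add: efn_def\<close>)

lemma efn_orth:
  assumes p: "p \<in> eidx" and q: "q \<in> eidx"
  shows "(LINT x|PiM D (\<lambda>_. U01). efn p x * efn q x) = (if p = q then 1 else 0)"
proof -
  interpret P: prob_space "PiM D (\<lambda>_::nat. U01)" by (rule prob_space_PiM_U01)
  have zero: "(LINT x|PiM D (\<lambda>_. U01). \<psi> T v (restrict x T)) = 0" if T: "T \<in> SS - {{}}" for T v
  proof -
    obtain j where j: "j \<in> T" using comp(4)[OF T] by auto
    have "(LINT x|PiM D (\<lambda>_. U01). \<psi> T v (restrict x T) * 1) = 0"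
      by (rule HS_integral_against_independent[OF m D comp(2)[OF T] j eig_HS[OF m comp(1)[OF T] eigs[OF T]], where B=1]) auto
    then show ?thesis by simp
  qed
  obtain T v where pT: "p = (T, v)" by (cases p)
  obtain T' v' where qT: "q = (T', v')" by (cases q)
  consider "T = {}" "T' = {}" | "T = {}" "T' \<noteq> {}" | "T \<noteq> {}" "T' = {}" | "T \<noteq> {}" "T = T'" | "T \<noteq> {}" "T' \<noteq> {}" "T \<noteq> T'" by blast
  then show ?thesis
  proof cases
    case 1 then show ?thesis using p q pT qT by (auto simp: efn_def eidx_def P.prob_space)
  next
    case 2 then show ?thesis using p q pT qT zero by (auto simp: efn_def eidx_def)
  next
    case 3 then show ?thesis using p q pT qT zero by (auto simp: efn_def eidx_def)
  next
    case 4
    have T: "T \<in> SS - {{}}" using p pT 4 by (auto simp: eidx_def)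
    note e = m comp(1)[OF T] eigs[OF T]
    have "(LINT x|PiM D (\<lambda>_. U01). \<psi> T v (restrict x T) * \<psi> T v' (restrict x T)) = (LINT x|PiM T (\<lambda>_. U01). \<psi> T v x * \<psi> T v' x)"
      by (rule integral_restrict_PiM[OF m D comp(2)[OF T], of "\<lambda>x. \<psi> T v x * \<psi> T v' x"])
        (intro borel_measurable_times HS_measurable[OF m comp(1)[OF T]] eig_HS[OF e])
    also have "\<dots> = (if v = v' then 1 else 0)" using eig_V[OF e, of v v'] by (simp add: VS_def)
    finally show ?thesis using 4 by (simp add: pT qT efn_def)
  next
    case 5
    have T: "T \<in> SS - {{}}" "T' \<in> SS - {{}}" using p q pT qT 5 by (auto simp: eidx_def)
    have "(LINT x|PiM D (\<lambda>_. U01). \<psi> T v (restrict x T) * \<psi> T' v' (restrict x T')) = 0"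
      by (rule HS_cross_integral[OF m D comp(2)[OF T(1)] comp(2)[OF T(2)] 5(3)
          eig_HS[OF m comp(1)[OF T(1)] eigs[OF T(1)]] eig_HS[OF m comp(1)[OF T(2)] eigs[OF T(2)]]])
    then show ?thesis using 5 by (simp add: pT qT efn_def)
  qed
qed

text \<open>The constant function has weight 1, at most \<open>lam powr (-\<theta>)\<close> when
  \<open>lam \<le> 1\<close>; the finitely many components add their own constants. The second
  conclusion, the pointwise bound at parameter 1, is what makes component expansions converge
  absolutely.\<close>

lemma effective_dimension_total:
  obtains Wc where "0 < Wc" "\<And>lam N. 0 < lam \<Longrightarrow> lam \<le> 1 \<Longrightarrow> (\<Sum>i<N. wgt lam (enum i)) \<le> Wc * lam powr (-\<theta>)"
    "\<And>T x. T \<in> SS - {{}} \<Longrightarrow> x \<in> cube T \<Longrightarrow> summable (\<lambda>v. (\<psi> T v x)\<^sup>2 / (1 + 1 / \<mu> T v))"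
proof -
  have "\<forall>T\<in>SS - {{}}. \<exists>C. 0 < C \<and> (\<forall>f x lam. f \<in> HS m T \<longrightarrow> x \<in> cube T \<longrightarrow> 0 < lam \<longrightarrow>
    (f x)\<^sup>2 \<le> C * lam powr (-\<theta>) * (VS T f f + lam * JS m T f f))"
    using interpolation_inequality[OF m comp(1) theta] by metis
  from bchoice[OF this] obtain C where C: "\<And>T. T \<in> SS - {{}} \<Longrightarrow> 0 < C T"
    "\<And>T f x lam. T \<in> SS - {{}} \<Longrightarrow> f \<in> HS m T \<Longrightarrow> x \<in> cube T \<Longrightarrow> 0 < lam \<Longrightarrow>
      (f x)\<^sup>2 \<le> C T * lam powr (-\<theta>) * (VS T f f + lam * JS m T f f)" by metis
  show thesis
  proof (rule that[of "1 + (\<Sum>T\<in>SS - {{}}. C T)"])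
    show "0 < 1 + (\<Sum>T\<in>SS - {{}}. C T)" using C(1) by (intro add_pos_nonneg sum_nonneg) (auto intro: less_imp_le)
    fix lam :: real and N assume lam: "0 < lam" "lam \<le> 1"
    define s where "s T = (\<Sum>v. 1 / (1 + lam / \<mu> T v))" for T
    have w0: "0 \<le> 1 / (1 + lam / \<mu> T v)" if "T \<in> SS - {{}}" for T v
      using eig_mu_pos[OF m comp(1)[OF that] eigs[OF that], of v] lam by (simp add: add_nonneg_nonneg)
    have bd: "(\<Sum>v<N. 1 / (1 + lam / \<mu> T v)) \<le> C T * lam powr (-\<theta>)" if T: "T \<in> SS - {{}}" for T N
      by (rule effective_dimension[OF m comp(1)[OF T] eigs[OF T] C(2)[OF T] C(1)[OF T] lam(1)])
    have sm: "summable (\<lambda>v. 1 / (1 + lam / \<mu> T v))" if T: "T \<in> SS - {{}}" for T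
      by (rule bounded_imp_summable[of _ "C T * lam powr (-\<theta>)"])
        (use w0[OF T] bd[OF T] in \<open>auto simp: lessThan_Suc_atMost[symmetric] simp del: sum.lessThan_Suc\<close>)
    have hs: "((\<lambda>v. wgt lam (T, v)) has_sum s T) UNIV" if T: "T \<in> SS - {{}}" for T
    proof -
      have "(\<lambda>v. 1 / (1 + lam / \<mu> T v)) sums s T" unfolding s_def by (rule summable_sums[OF sm[OF T]])
      then have "((\<lambda>v. 1 / (1 + lam / \<mu> T v)) has_sum s T) UNIV" by (rule sums_nonneg_imp_has_sum) (rule w0[OF T])
      moreover have "wgt lam (T, v) = 1 / (1 + lam / \<mu> T v)" for v using T by (simp add: wgt_def rho_def)
      ultimately show ?thesis by simp
    qed
    have S: "(\<lambda>i. wgt lam (enum i)) sums (wgt lam ({}, 0) + (\<Sum>T\<in>SS - {{}}. s T))" by (rule enum_sums[OF hs])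
    have "(\<Sum>i<N. wgt lam (enum i)) \<le> wgt lam ({}, 0) + (\<Sum>T\<in>SS - {{}}. s T)"
      unfolding sums_unique[OF S]
      by (rule sum_le_suminf[OF sums_summable[OF S]]) (use wgt_bounds(1)[OF lam(1) enum_in] in \<open>auto intro: less_imp_le\<close>)
    also have "\<dots> \<le> 1 * lam powr (-\<theta>) + (\<Sum>T\<in>SS - {{}}. C T * lam powr (-\<theta>))"
    proof (rule add_mono[OF _ sum_mono])
      have "lam powr 0 \<le> lam powr (-\<theta>)" by (rule powr_mono') (use lam theta in auto)
      then show "wgt lam ({}, 0) \<le> 1 * lam powr (-\<theta>)" using lam by (simp add: wgt_def rho_def)
      fix T assume T: "T \<in> SS - {{}}"
      show "s T \<le> C T * lam powr (-\<theta>)" unfolding s_def by (rule suminf_le_const[OF sm[OF T] bd[OF T]])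
    qed
    finally show "(\<Sum>i<N. wgt lam (enum i)) \<le> (1 + (\<Sum>T\<in>SS - {{}}. C T)) * lam powr (-\<theta>)"
      by (simp add: distrib_right sum_distrib_right)
  next
    fix T x assume T: "T \<in> SS - {{}}" and x: "x \<in> cube T"
    note e = m comp(1)[OF T] eigs[OF T]
    have bd: "(\<Sum>v<N. (\<psi> T v x)\<^sup>2 / (1 + 1 / \<mu> T v)) \<le> C T * 1 powr (-\<theta>)" for N
      by (rule effective_dimension_pointwise[OF e C(2)[OF T] C(1)[OF T] x, where lam="1::real"]) simp_all
    show "summable (\<lambda>v. (\<psi> T v x)\<^sup>2 / (1 + 1 / \<mu> T v))"
    proof (rule bounded_imp_summable[of _ "C T * 1 powr (-\<theta>)"])
      show "0 \<le> (\<psi> T v x)\<^sup>2 / (1 + 1 / \<mu> T v)" for v using eig_mu_pos[OF e, of v] by (simp add: add_nonneg_nonneg)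
      show "(\<Sum>v\<le>N. (\<psi> T v x)\<^sup>2 / (1 + 1 / \<mu> T v)) \<le> C T * 1 powr (-\<theta>)" for N
        unfolding lessThan_Suc_atMost[symmetric] by (rule bd)
    qed
  qed
qed

section \<open>Coefficients and expansions of a family in the joint basis\<close>

lemma coef_energy_has_sum:
  assumes f: "f \<in> Hfam m SS" and T: "T \<in> SS - {{}}"
  shows "((\<lambda>v. rho (T, v) * (coef f (T, v))\<^sup>2) has_sum JS m T (f T) (f T)) UNIV"
proof -
  note e = m comp(1)[OF T] eigs[OF T]
  have fT: "f T \<in> HS m T" using f T by (auto simp: Hfam_def)
  have "((\<lambda>v. (VS T (f T) (\<psi> T v))\<^sup>2 / \<mu> T v) has_sum JS m T (f T) (f T)) UNIV"
    by (rule sums_nonneg_imp_has_sum[OF eig_JS_energy[OF e fT]]) (use eig_mu_pos[OF e] in \<open>auto intro!: divide_nonneg_pos\<close>)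
  moreover have "rho (T, v) * (coef f (T, v))\<^sup>2 = (VS T (f T) (\<psi> T v))\<^sup>2 / \<mu> T v" for v
    using T by (simp add: rho_def coef_def)
  ultimately show ?thesis by simp
qed

lemma coef_energy_sums: "f \<in> Hfam m SS \<Longrightarrow> (\<lambda>i. rho (enum i) * (coef f (enum i))\<^sup>2) sums famJ m SS f f"
  using enum_sums[OF coef_energy_has_sum, of f] by (simp add: rho_def famJ_def)

text \<open>The largest eigenvalue \<open>\<mu> T 0\<close> bounds each squared coefficient by a
  multiple of its share in the penalty.\<close>

lemma coef_square_summable:
  assumes f: "f \<in> Hfam m SS" and T: "T \<in> SS - {{}}"
  shows "summable (\<lambda>v. (coef f (T, v))\<^sup>2)"
proof (rule summable_comparison_test')
  note e = m comp(1)[OF T] eigs[OF T]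
  have "summable (\<lambda>v. rho (T, v) * (coef f (T, v))\<^sup>2)"
    using has_sum_imp_sums[OF coef_energy_has_sum[OF f T]] by (rule sums_summable)
  then show "summable (\<lambda>v. \<mu> T 0 * (rho (T, v) * (coef f (T, v))\<^sup>2))" by (rule summable_mult)
  show "norm ((coef f (T, v))\<^sup>2) \<le> \<mu> T 0 * (rho (T, v) * (coef f (T, v))\<^sup>2)" for v
  proof -
    have "1 \<le> \<mu> T 0 * rho (T, v)" using eig_mu_le[OF e, of v] eig_mu_pos[OF e, of v] T by (simp add: rho_def)
    then have "1 * (coef f (T, v))\<^sup>2 \<le> \<mu> T 0 * rho (T, v) * (coef f (T, v))\<^sup>2" by (rule mult_right_mono) simp
    then show ?thesis by (simp add: mult.assoc)
  qed
qed

lemma coef_weighted_summable: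
  assumes f: "f \<in> Hfam m SS" and lam: "0 < lam"
  shows "summable (\<lambda>i. (coef f (enum i))\<^sup>2 / wgt lam (enum i))"
proof -
  have "((\<lambda>v. (coef f (T, v))\<^sup>2 / wgt lam (T, v)) has_sum ((\<Sum>v. (coef f (T, v))\<^sup>2) + lam * JS m T (f T) (f T))) UNIV"
    if T: "T \<in> SS - {{}}" for T
  proof -
    have "((\<lambda>v. (coef f (T, v))\<^sup>2) has_sum (\<Sum>v. (coef f (T, v))\<^sup>2)) UNIV"
      by (rule sums_nonneg_imp_has_sum[OF summable_sums[OF coef_square_summable[OF f T]]]) simp
    then have "((\<lambda>v. (coef f (T, v))\<^sup>2 + lam * (rho (T, v) * (coef f (T, v))\<^sup>2)) has_sum ((\<Sum>v. (coef f (T, v))\<^sup>2) + lam * JS m T (f T) (f T))) UNIV"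
      by (intro has_sum_add has_sum_cmult_right coef_energy_has_sum[OF f T])
    moreover have "(coef f (T, v))\<^sup>2 + lam * (rho (T, v) * (coef f (T, v))\<^sup>2) = (coef f (T, v))\<^sup>2 / wgt lam (T, v)" for v
      by (simp add: wgt_def algebra_simps)
    ultimately show ?thesis by simp
  qed
  from enum_sums[OF this] show ?thesis by (rule sums_summable)
qed

text \<open>Absolute convergence is what survives the joint enumeration. The coefficients are square
  summable with weight \<open>1 + 1 / \<mu> T v\<close>, the eigenfunctions at \<open>x\<close> with
  its inverse, and the arithmetic-geometric inequality bounds the products.\<close>

lemma component_expansion:
  assumes f: "f \<in> Hfam m SS" and T: "T \<in> SS - {{}}" and x: "x \<in> cube T"
  shows "((\<lambda>v. coef f (T, v) * \<psi> T v x) has_sum f T x) UNIV"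
proof (rule norm_summable_imp_has_sum)
  note e = m comp(1)[OF T] eigs[OF T]
  have fT: "f T \<in> HS m T" using f T by (auto simp: Hfam_def)
  show "(\<lambda>v. coef f (T, v) * \<psi> T v x) sums f T x" using eig_pointwise[OF e fT x] T by (simp add: coef_def)
  have 1: "summable (\<lambda>v. (\<psi> T v x)\<^sup>2 / (1 + 1 / \<mu> T v))" using effective_dimension_total T x by metis
  have "summable (\<lambda>v. (coef f (T, v))\<^sup>2 + rho (T, v) * (coef f (T, v))\<^sup>2)"
    by (rule summable_add[OF coef_square_summable[OF f T] sums_summable[OF has_sum_imp_sums[OF coef_energy_has_sum[OF f T]]]])
  from summable_add[OF this 1]
  show "summable (\<lambda>v. norm (coef f (T, v) * \<psi> T v x))"
  proof (rule summable_comparison_test')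
    fix v
    let ?a = "coef f (T, v)" and ?b = "\<psi> T v x" and ?s = "1 + 1 / \<mu> T v"
    have s: "0 < ?s" using eig_mu_pos[OF e, of v] by (simp add: add_pos_pos)
    have "0 \<le> (sqrt ?s * \<bar>?a\<bar> - \<bar>?b\<bar> / sqrt ?s)\<^sup>2" by simp
    also have "\<dots> = ?s * ?a\<^sup>2 + ?b\<^sup>2 / ?s - 2 * (\<bar>?a\<bar> * \<bar>?b\<bar>)"
      using s by (simp add: power2_diff power_mult_distrib power_divide)
    finally have "2 * (\<bar>?a\<bar> * \<bar>?b\<bar>) \<le> ?s * ?a\<^sup>2 + ?b\<^sup>2 / ?s" by simp
    moreover have "0 \<le> \<bar>?a\<bar> * \<bar>?b\<bar>" by simp
    ultimately have "\<bar>?a\<bar> * \<bar>?b\<bar> \<le> ?s * ?a\<^sup>2 + ?b\<^sup>2 / ?s" by linarith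
    moreover have "?s * ?a\<^sup>2 = ?a\<^sup>2 + rho (T, v) * ?a\<^sup>2" using T by (simp add: rho_def distrib_right)
    ultimately show "norm (norm (?a * ?b)) \<le> ?a\<^sup>2 + rho (T, v) * ?a\<^sup>2 + ?b\<^sup>2 / ?s" by (simp add: abs_mult)
  qed
qed

lemma family_expansion:
  assumes f: "f \<in> Hfam m SS" and x: "x \<in> cube D"
  shows "(\<lambda>i. coef f (enum i) * efn (enum i) x) sums evalfam SS f x"
proof -
  have "((\<lambda>v. coef f (T, v) * efn (T, v) x) has_sum f T (restrict x T)) UNIV" if T: "T \<in> SS - {{}}" for T
    using component_expansion[OF f T restrict_cube[OF m x comp(2)[OF T]]] T by (simp add: efn_def)
  from enum_sums[OF this] have "(\<lambda>i. coef f (enum i) * efn (enum i) x) sums (coef f ({}, 0) * efn ({}, 0) x + (\<Sum>T\<in>SS - {{}}. f T (restrict x T)))" .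
  moreover have "evalfam SS f x = f {} (restrict x {}) + (\<Sum>T\<in>SS - {{}}. f T (restrict x T))"
    unfolding evalfam_def by (rule sum.remove[OF finite_SS SS(2)])
  ultimately show ?thesis by (simp add: coef_def efn_def intercept_def restrict_def)
qed

lemma component_target_sums:
  assumes f: "f \<in> Hfam m SS" and T: "T \<in> SS - {{}}" and x: "x \<in> cube T"
  shows "(\<lambda>i. (if fst (enum i) = T then \<psi> T (snd (enum i)) x else 0) * coef f (enum i)) sums f T x"
proof -
  let ?F = "\<lambda>p. (if fst p = T then \<psi> T (snd p) x else 0) * coef f p"
  have "((\<lambda>v. ?F (T', v)) has_sum (if T' = T then f T x else 0)) UNIV" if "T' \<in> SS - {{}}" for T'
    using component_expansion[OF f T x] by (cases "T' = T") (simp_all add: mult.commute)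
  from enum_sums[OF this] show ?thesis using T comp(4)[OF T] not_sym[OF comp(4)[OF T]] finite_SS by (simp add: sum.delta)
qed

lemma component_variance_sums:
  assumes T: "T \<in> SS - {{}}" and s: "summable (\<lambda>v. (\<psi> T v x)\<^sup>2 / (1 + lam / \<mu> T v)\<^sup>2)"
  shows "(\<lambda>i. ((if fst (enum i) = T then \<psi> T (snd (enum i)) x else 0) * wgt lam (enum i))\<^sup>2) sums (\<Sum>v. (\<psi> T v x)\<^sup>2 / (1 + lam / \<mu> T v)\<^sup>2)"
proof -
  let ?F = "\<lambda>p. ((if fst p = T then \<psi> T (snd p) x else 0) * wgt lam p)\<^sup>2"
  have "((\<lambda>v. ?F (T', v)) has_sum (if T' = T then (\<Sum>v. (\<psi> T v x)\<^sup>2 / (1 + lam / \<mu> T v)\<^sup>2) else 0)) UNIV" if "T' \<in> SS - {{}}" for T'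
  proof (cases "T' = T")
    case True
    have "((\<lambda>v. (\<psi> T v x)\<^sup>2 / (1 + lam / \<mu> T v)\<^sup>2) has_sum (\<Sum>v. (\<psi> T v x)\<^sup>2 / (1 + lam / \<mu> T v)\<^sup>2)) UNIV"
      by (rule sums_nonneg_imp_has_sum[OF summable_sums[OF s]]) simp
    moreover have "?F (T, v) = (\<psi> T v x)\<^sup>2 / (1 + lam / \<mu> T v)\<^sup>2" for v
      using T by (simp add: wgt_def rho_def power_mult_distrib power_divide)
    ultimately show ?thesis using True by simp
  qed simp
  from enum_sums[OF this] show ?thesis using T comp(4)[OF T] not_sym[OF comp(4)[OF T]] finite_SS by (simp add: sum.delta)
qed

lemma intercept_index: obtains i0 where "enum i0 = ({}, 0)" "\<And>i. fst (enum i) = {} \<longleftrightarrow> i = i0"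
proof -
  have "({}, 0) \<in> eidx" by (simp add: eidx_def)
  then have "({}, 0) \<in> range enum" using enum_bij by (simp add: bij_betw_def)
  then obtain i0 where i0: "enum i0 = ({}, 0)" by (metis rangeE)
  moreover have "fst (enum i) = {} \<longleftrightarrow> i = i0" for i
  proof
    assume "fst (enum i) = {}"
    then have "enum i = ({}, 0)" using enum_in[of i] by (auto simp: eidx_def)
    then show "i = i0" using i0 enum_eq_iff by metis
  qed (simp add: i0)
  ultimately show thesis using that by blast
qed

text \<open>The normal equation is tested with one basis function, regarded as a family supported on
  a single component. Writing \<open>lam * rho p\<close> as \<open>1 / wgt lam p - 1\<close> then
  separates the unknown from the bias caused by the truth.\<close>

lemma coordinate_normal_equation:
  assumes lam: "0 < lam" and n: "0 < n" and X: "\<And>l. Xs l \<in> cube D" and fs: "fs \<in> Hfam m SS" and p: "p \<in> eidx"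
    and Ys: "\<And>i. i < n \<Longrightarrow> Ys i = evalfam SS fs (Xs i) + es i"
  defines "g \<equiv> (\<lambda>S x. 1 * estimator m SS lam Xs Ys n S x + (-1) * fs S x)"
  shows "(\<Sum>j<n. (es j - evalfam SS g (Xs j)) * efn p (Xs j)) / real n = coef g p / wgt lam p - coef g p + lam * rho p * coef fs p"
proof -
  let ?e = "estimator m SS lam Xs Ys n"
  have eH: "?e \<in> Hfam m SS" by (rule est_minimizes(1)[OF lam n X])
  obtain T v where pT: "p = (T, v)" by (cases p)
  define k :: family where "k = (\<lambda>S x. if S = T then (if T = {} then 1 else \<psi> T v x) else 0)"
  have kH: "k \<in> Hfam m SS"
  proof -
    have "k S \<in> HS m S" if S: "S \<in> SS - {{}}" for S
    proof (cases "S = T")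
      case True
      then show ?thesis using eig_HS[OF m comp(1)[OF S] eigs[OF S], of v] S by (simp add: k_def)
    next
      case False
      then have "k S = (\<lambda>_. 0)" by (simp add: k_def fun_eq_iff)
      then show ?thesis using HS_zero[OF m] by simp
    qed
    then show ?thesis by (simp add: Hfam_def)
  qed
  have T: "T \<in> SS" "T \<noteq> {} \<Longrightarrow> T \<in> SS - {{}}" "T = {} \<Longrightarrow> v = 0" using p pT SS by (auto simp: eidx_def)
  have ek: "evalfam SS k x = efn p x" for x
  proof -
    have "evalfam SS k x = (\<Sum>S\<in>SS. if S = T then efn p x else 0)"
      unfolding evalfam_def by (rule sum.cong) (auto simp: k_def efn_def pT)
    then show ?thesis using T finite_SS by simp
  qed
  have Jk: "famJ m SS ?e k = rho p * coef ?e p"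
  proof (cases "T = {}")
    case True
    have "JS m S (?e S) (k S) = 0" if S: "S \<in> SS - {{}}" for S
    proof -
      have eS: "?e S \<in> HS m S" using eH S by (auto simp: Hfam_def)
      have "k S = (\<lambda>_. 0)" using S True by (auto simp: k_def fun_eq_iff)
      then have "JS m S (?e S) (k S) = JS m S (\<lambda>x. 0 * (?e S) x + 0 * (?e S) x) (?e S)" using JS_commute[OF m, of S "?e S"] by simp
      also have "\<dots> = 0" unfolding JS_lincomb[OF m comp(1)[OF S] eS eS eS] by simp
      finally show ?thesis .
    qed
    then show ?thesis using True by (simp add: famJ_def rho_def pT)
  next
    case False
    note TS = T(2)[OF False]
    have "JS m S (?e S) (k S) = (if S = T then rho p * coef ?e p else 0)" if S: "S \<in> SS - {{}}" for S
    proof -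
      have eS: "?e S \<in> HS m S" using eH S by (auto simp: Hfam_def)
      show ?thesis
      proof (cases "S = T")
        case True
        then have "k S = \<psi> T v" using False by (simp add: k_def fun_eq_iff)
        then show ?thesis using eig_JS_psi[OF m comp(1)[OF S] eigs[OF S] eS, of v] True False by (simp add: rho_def coef_def pT)
      next
        case F: False
        then have "k S = (\<lambda>_. 0)" by (simp add: k_def fun_eq_iff)
        then have "JS m S (?e S) (k S) = JS m S (\<lambda>x. 0 * (?e S) x + 0 * (?e S) x) (?e S)" using JS_commute[OF m, of S "?e S"] by simp
        also have "\<dots> = 0" unfolding JS_lincomb[OF m comp(1)[OF S] eS eS eS] by simp
        finally show ?thesis using F by simp
      qed
    qed
    then have "famJ m SS ?e k = (\<Sum>S\<in>SS - {{}}. if S = T then rho p * coef ?e p else 0)" unfolding famJ_def by (intro sum.cong) auto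
    then show ?thesis using TS finite_SS by simp
  qed
  have cg: "coef g p = coef ?e p - coef fs p"
  proof (cases "T = {}")
    case True then show ?thesis by (simp add: coef_def pT g_def intercept_def)
  next
    case False
    note TS = T(2)[OF False]
    have "VS T (\<lambda>x. 1 * ?e T x + (-1) * fs T x) (\<psi> T v) = 1 * VS T (?e T) (\<psi> T v) + (-1) * VS T (fs T) (\<psi> T v)"
      by (rule VS_lincomb[OF m comp(1)[OF TS] _ _ eig_HS[OF m comp(1)[OF TS] eigs[OF TS]]]) (use eH fs TS in \<open>auto simp: Hfam_def\<close>)
    then show ?thesis using False by (simp add: coef_def pT g_def)
  qed
  have "(\<Sum>j<n. (es j - evalfam SS g (Xs j)) * efn p (Xs j)) = (\<Sum>i<n. (Ys i - evalfam SS ?e (Xs i)) * evalfam SS k (Xs i))"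
    unfolding g_def evalfam_lincomb by (rule sum.cong) (use Ys in \<open>auto simp: ek\<close>)
  also have "\<dots> = real n * lam * famJ m SS ?e k" by (rule est_normal_equation[OF lam n X kH])
  finally have "(\<Sum>j<n. (es j - evalfam SS g (Xs j)) * efn p (Xs j)) / real n = lam * (rho p * coef ?e p)"
    using n by (simp add: Jk)
  also have "\<dots> = coef g p / wgt lam p - coef g p + lam * rho p * coef fs p"
    by (simp add: cg wgt_def algebra_simps)
  finally show ?thesis .
qed

end

section \<open>Asymptotic normality of linear functionals of the estimator\<close>

lemma (in family_space) evalfam_measurable:
  assumes f: "f \<in> Hfam m SS"
  shows "evalfam SS f \<in> borel_measurable (PiM D (\<lambda>_. U01))"
  unfolding evalfam_def[abs_def]
proof (rule borel_measurable_sum)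
  fix S assume S: "S \<in> SS"
  show "(\<lambda>x. f S (restrict x S)) \<in> borel_measurable (PiM D (\<lambda>_. U01))"
  proof (cases "S = {}")
    case False
    then have fS: "f S \<in> HS m S" using f S by (auto simp: Hfam_def)
    have "S \<subseteq> D" using S SS by auto
    from measurable_compose[OF restrict_measurable[OF m this] HS_measurable[OF m finite_comp[OF S] fS]]
    show ?thesis .
  qed (simp add: restrict_def)
qed

text \<open>Measurability is transferred from the explicit fit, with which the chosen minimizer
  agrees at every point of the cubes.\<close>

lemma (in family_space) estimator_measurable:
  assumes lam: "0 < lam" and n: "0 < n"
    and X: "\<And>l. X l \<in> measurable M (PiM D (\<lambda>_. U01))" and Y: "\<And>l. Y l \<in> borel_measurable M"
  shows "S \<in> SS - {{}} \<Longrightarrow> x \<in> cube S \<Longrightarrow> (\<lambda>\<omega>. estimator m SS lam (\<lambda>l. X l \<omega>) (\<lambda>l. Y l \<omega>) n S x) \<in> borel_measurable M"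
    and "(\<lambda>\<omega>. intercept (estimator m SS lam (\<lambda>l. X l \<omega>) (\<lambda>l. Y l \<omega>) n)) \<in> borel_measurable M"
proof -
  have XD: "X l \<omega> \<in> cube D" if "\<omega> \<in> space M" for \<omega> l
    using measurable_space[OF X that, of l] by (simp add: space_PiM_U01)
  show "(\<lambda>\<omega>. estimator m SS lam (\<lambda>l. X l \<omega>) (\<lambda>l. Y l \<omega>) n S x) \<in> borel_measurable M" if S: "S \<in> SS - {{}}" and x: "x \<in> cube S"
  proof -
    have "(\<lambda>\<omega>. ridge_fit m SS lam (\<lambda>l. X l \<omega>) (\<lambda>l. Y l \<omega>) n S x) \<in> borel_measurable M"
      by (rule ridge_fit_measurable[OF X Y _ x]) (use S in simp)
    then show ?thesis
      by (rule measurable_cong[THEN iffD2, rotated]) (rule est_eq_fit[OF lam n XD S x])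
  qed
  have u: "(\<lambda>_. undefined) \<in> cube {}" by (simp add: cube_def)
  have "(\<lambda>\<omega>. intercept (ridge_fit m SS lam (\<lambda>l. X l \<omega>) (\<lambda>l. Y l \<omega>) n)) \<in> borel_measurable M"
    unfolding intercept_def by (rule ridge_fit_measurable[OF X Y SS(2) u])
  then show "(\<lambda>\<omega>. intercept (estimator m SS lam (\<lambda>l. X l \<omega>) (\<lambda>l. Y l \<omega>) n)) \<in> borel_measurable M"
    by (rule measurable_cong[THEN iffD2, rotated]) (rule est_intercept_eq_fit[OF lam n XD])
qed

context spline_design
begin

lemma component_source_sums:
  assumes f: "f \<in> Hfam m SS" and T: "T \<in> SS - {{}}" and s: "summable (\<lambda>v. (VS T (f T) (\<psi> T v))\<^sup>2 / (\<mu> T v)\<^sup>2)"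
  shows "(\<lambda>i. (if fst (enum i) = T then rho (enum i) * coef f (enum i) else 0)\<^sup>2) sums (\<Sum>v. (VS T (f T) (\<psi> T v))\<^sup>2 / (\<mu> T v)\<^sup>2)"
proof -
  let ?F = "\<lambda>p. (if fst p = T then rho p * coef f p else 0)\<^sup>2"
  let ?s = "\<Sum>v. (VS T (f T) (\<psi> T v))\<^sup>2 / (\<mu> T v)\<^sup>2"
  have "((\<lambda>v. ?F (T', v)) has_sum (if T' = T then ?s else 0)) UNIV" if "T' \<in> SS - {{}}" for T'
  proof (cases "T' = T")
    case True
    have "((\<lambda>v. (VS T (f T) (\<psi> T v))\<^sup>2 / (\<mu> T v)\<^sup>2) has_sum ?s) UNIV"
      by (rule sums_nonneg_imp_has_sum[OF summable_sums[OF s]]) simp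
    moreover have "?F (T, v) = (VS T (f T) (\<psi> T v))\<^sup>2 / (\<mu> T v)\<^sup>2" for v
      using T by (simp add: rho_def coef_def power_mult_distrib power_divide)
    ultimately show ?thesis using True by simp
  qed simp
  from enum_sums[OF this] show ?thesis using T comp(4)[OF T] not_sym[OF comp(4)[OF T]] finite_SS by (simp add: sum.delta)
qed

text \<open>The choice of \<open>\<theta>\<close> leaves room on both sides: it is above the Sobolev threshold $1/(2m)$, while the
  remainder terms only need $n^{-1} \lambda^{-2/m} \to 0$.\<close>

lemma linear_functional_clt:
  fixes k :: "nat \<Rightarrow> nat" and lam L bb s2 :: "nat \<Rightarrow> real" and l :: "nat \<Rightarrow> real"
    and X :: "nat \<Rightarrow> 'w \<Rightarrow> nat \<Rightarrow> real" and e :: "nat \<Rightarrow> 'w \<Rightarrow> real" and \<Phi> :: "family \<Rightarrow> real"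
  assumes R: "regression_sample M (PiM D (\<lambda>_. U01)) PE (\<lambda>j \<omega>. (X j \<omega>, e j \<omega>)) (\<lambda>i. efn (enum i)) C\<psi> \<sigma>"
    and m2: "2 \<le> m" and th: "\<theta> = 9 / (16 * real m)"
    and fs: "fs \<in> Hfam m SS"
    and Wc: "0 < Wc" "\<And>lam N. 0 < lam \<Longrightarrow> lam \<le> 1 \<Longrightarrow> (\<Sum>i<N. wgt lam (enum i)) \<le> Wc * lam powr (-\<theta>)"
    and k: "\<And>n. 0 < k n" "filterlim k at_top sequentially"
    and lam: "\<And>n. 0 < lam n" "\<And>n. lam n \<le> 1" "lam \<longlonglongrightarrow> 0"
    and rate: "(\<lambda>n. lam n powr (-(2 / real m)) / real (k n)) \<longlonglongrightarrow> 0"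
    and L: "\<And>n N. (\<Sum>i<N. wgt (lam n) (enum i) * (l i)\<^sup>2) \<le> L n"
    and lC: "\<And>i. \<bar>l i\<bar> \<le> Cl"
    and bb: "\<And>n N. (\<Sum>i<N. l i * wgt (lam n) (enum i) * (lam n * rho (enum i) * coef fs (enum i)))\<^sup>2 \<le> bb n"
    and s2: "\<And>n. s2 n = \<sigma>\<^sup>2 * (\<Sum>i. (l i * wgt (lam n) (enum i))\<^sup>2)" "\<And>n. s0 \<le> s2 n" "0 < s0"
    and K: "0 \<le> K" "\<And>n. L n / s2 n \<le> K * lam n powr (-r)" "r \<le> 1 / (16 * real m)"
    and rate3: "(\<lambda>n. real (k n) * bb n / s2 n) \<longlonglongrightarrow> 0"
  defines "err \<equiv> (\<lambda>n \<omega> S x. 1 * estimator m SS (lam n) (\<lambda>j. X j \<omega>) (\<lambda>j. evalfam SS fs (X j \<omega>) + e j \<omega>) (k n) S x + (-1) * fs S x)"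
  assumes Y: "\<And>g. g \<in> Hfam m SS \<Longrightarrow> (\<lambda>i. l i * coef g (enum i)) sums \<Phi> g" "\<And>n. (\<lambda>\<omega>. \<Phi> (err n \<omega>)) \<in> borel_measurable M"
  shows "weak_conv_m (\<lambda>n. distr M borel (\<lambda>\<omega>. sqrt (real (k n)) * \<Phi> (err n \<omega>) / sqrt (s2 n))) std_normal_distribution"
proof -
  interpret R: regression_sample M "PiM D (\<lambda>_. U01)" PE "\<lambda>j \<omega>. (X j \<omega>, e j \<omega>)" "\<lambda>i. efn (enum i)" C\<psi> \<sigma> by (rule R)
  have X: "X j \<omega> \<in> cube D" if "\<omega> \<in> space M" for j \<omega>
    using measurable_space[OF R.T_measurable[of j] that] by (simp add: space_pair_measure space_PiM_U01)
  have errH: "err n \<omega> \<in> Hfam m SS" if "\<omega> \<in> space M" for n \<omega>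
    unfolding err_def by (rule Hfam_lincomb[OF est_minimizes(1)[OF lam(1) k(1) X[OF that]] fs])
  let ?J = "famJ m SS fs fs"
  have J: "(\<lambda>i. rho (enum i) * (coef fs (enum i))\<^sup>2) sums ?J" by (rule coef_energy_sums[OF fs])
  have r0: "0 \<le> rho (enum i)" for i by (rule rho_nonneg[OF enum_in])
  have J0: "0 \<le> ?J" by (rule famJ_nonneg)
  have L0: "0 \<le> L n" for n using L[of n 0] by simp
  have s2pos: "0 < s2 n" for n using s2(2)[of n] s2(3) by simp
  \<comment> \<open>One of the two factors \<open>lam n * rho\<close> is absorbed by the weight, as
    their product is at most 1; what remains is \<open>lam n\<close> times the penalty of the
    truth.\<close>
  have c2: "(\<Sum>i<N. wgt (lam n) (enum i) * (lam n * rho (enum i) * coef fs (enum i))\<^sup>2) \<le> lam n * ?J" for n N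
  proof -
    have "(\<Sum>i<N. wgt (lam n) (enum i) * (lam n * rho (enum i) * coef fs (enum i))\<^sup>2) \<le> (\<Sum>i<N. lam n * (rho (enum i) * (coef fs (enum i))\<^sup>2))"
    proof (rule sum_mono)
      fix i
      let ?r = "rho (enum i)"
      have "0 < 1 + lam n * ?r" using r0[of i] lam(1)[of n] by (simp add: add_pos_nonneg)
      then have "wgt (lam n) (enum i) * (lam n * ?r) \<le> 1" using r0[of i] lam(1)[of n] by (simp add: wgt_def divide_le_eq)
      then have "(wgt (lam n) (enum i) * (lam n * ?r)) * (lam n * (?r * (coef fs (enum i))\<^sup>2)) \<le> 1 * (lam n * (?r * (coef fs (enum i))\<^sup>2))"
        by (rule mult_right_mono) (use r0[of i] lam(1)[of n] in simp)
      then show "wgt (lam n) (enum i) * (lam n * ?r * coef fs (enum i))\<^sup>2 \<le> lam n * (?r * (coef fs (enum i))\<^sup>2)"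
        by (simp add: power2_eq_square mult_ac)
    qed
    also have "\<dots> = lam n * (\<Sum>i<N. rho (enum i) * (coef fs (enum i))\<^sup>2)" by (simp add: sum_distrib_left)
    also have "(\<Sum>i<N. rho (enum i) * (coef fs (enum i))\<^sup>2) \<le> ?J"
      unfolding sums_unique[OF J] by (rule sum_le_suminf[OF sums_summable[OF J]]) (use r0 in auto)
    finally show ?thesis using lam(1)[of n] by (simp add: mult_left_mono)
  qed
  have m0: "0 < real m" using m2 by simp
  have po: "(\<lambda>n. lam n powr (- p) / real (k n)) \<longlonglongrightarrow> 0" if "p \<le> 2 / real m" for p
    by (rule powr_rate_over_n[OF rate _ that]) (use lam in simp)
  have rate1: "(\<lambda>n. (Wc * lam n powr (-\<theta>))\<^sup>2 / real (k n)) \<longlonglongrightarrow> 0"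
  proof -
    have "(\<lambda>n. Wc\<^sup>2 * (lam n powr (-(2 * \<theta>)) / real (k n))) \<longlonglongrightarrow> Wc\<^sup>2 * 0"
      by (intro tendsto_mult tendsto_const po) (use m0 in \<open>simp add: th field_simps\<close>)
    moreover have "Wc\<^sup>2 * (lam n powr (-(2 * \<theta>)) / real (k n)) = (Wc * lam n powr (-\<theta>))\<^sup>2 / real (k n)" for n
      by (simp add: power_mult_distrib power2_eq_square powr_add[symmetric])
    ultimately show ?thesis by (simp only: mult_zero_right)
  qed
  have rate2: "(\<lambda>n. L n / s2 n * (Wc * lam n powr (-\<theta>))\<^sup>2 * (Wc * lam n powr (-\<theta>) / real (k n) + lam n * ?J)) \<longlonglongrightarrow> 0"
  proof (rule Lim_null_comparison)
    \<comment> \<open>Both exponents have room: r + 3\<theta> is at most 28/(16m), below the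
      available 2/m, and r + 2\<theta> is at most 19/(16m), below 1 because m is at least 2.\<close>
    let ?b = "\<lambda>n. K * Wc\<^sup>2 * (Wc * (lam n powr (-(r + 3 * \<theta>)) / real (k n)) + lam n powr (1 - r - 2 * \<theta>) * ?J)"
    have "(\<lambda>n. lam n powr (-(r + 3 * \<theta>)) / real (k n)) \<longlonglongrightarrow> 0"
    proof (rule po)
      have "r + 3 * \<theta> \<le> 1 / (16 * real m) + 27 / (16 * real m)" using K(3) by (simp add: th)
      also have "\<dots> \<le> 2 / real m" using m0 by (simp add: field_simps)
      finally show "r + 3 * \<theta> \<le> 2 / real m" .
    qed
    moreover have "(\<lambda>n. lam n powr (1 - r - 2 * \<theta>)) \<longlonglongrightarrow> 0"
    proof (rule powr_tendsto_zero[OF lam(3,1)])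
      have "r + 2 * \<theta> \<le> 1 / (16 * real m) + 18 / (16 * real m)" using K(3) by (simp add: th)
      also have "\<dots> < 1" using m2 by (simp add: field_simps)
      finally show "0 < 1 - r - 2 * \<theta>" by simp
    qed
    ultimately have "?b \<longlonglongrightarrow> K * Wc\<^sup>2 * (Wc * 0 + 0 * ?J)" by (intro tendsto_intros)
    then show "?b \<longlonglongrightarrow> 0" by simp
    have "norm (L n / s2 n * (Wc * lam n powr (-\<theta>))\<^sup>2 * (Wc * lam n powr (-\<theta>) / real (k n) + lam n * ?J)) \<le> ?b n" for n
    proof -
      let ?q = "(Wc * lam n powr (-\<theta>))\<^sup>2 * (Wc * lam n powr (-\<theta>) / real (k n) + lam n * ?J)"
      have q: "0 \<le> ?q" using Wc(1) J0 lam(1)[of n] by (intro mult_nonneg_nonneg add_nonneg_nonneg) auto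
      have l1: "lam n powr 1 = lam n" using lam(1)[of n] by simp
      have "norm (L n / s2 n * ?q) = L n / s2 n * ?q" using q L0[of n] s2pos[of n] by simp
      also have "\<dots> \<le> K * lam n powr (-r) * ?q" by (rule mult_right_mono[OF K(2) q])
      also have "\<dots> = K * Wc\<^sup>2 * (Wc * ((lam n powr (-r) * lam n powr (-\<theta>) * lam n powr (-\<theta>) * lam n powr (-\<theta>)) / real (k n))
          + (lam n powr 1 * lam n powr (-r) * lam n powr (-\<theta>) * lam n powr (-\<theta>)) * ?J)"
        unfolding l1 by (simp add: power2_eq_square distrib_left mult_ac)
      also have "lam n powr (-r) * lam n powr (-\<theta>) * lam n powr (-\<theta>) * lam n powr (-\<theta>) = lam n powr (-(r + 3 * \<theta>))"
        unfolding powr_add[symmetric] by (rule arg_cong[of _ _ "\<lambda>p. lam n powr p"]) simp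
      also have "lam n powr 1 * lam n powr (-r) * lam n powr (-\<theta>) * lam n powr (-\<theta>) = lam n powr (1 - r - 2 * \<theta>)"
        unfolding powr_add[symmetric] by (simp add: algebra_simps)
      finally show ?thesis by (simp only: mult.assoc)
    qed
    then show "\<forall>\<^sub>F n in sequentially. norm (L n / s2 n * (Wc * lam n powr (-\<theta>))\<^sup>2 * (Wc * lam n powr (-\<theta>) / real (k n) + lam n * ?J)) \<le> ?b n"
      by simp
  qed
  have eq: "(\<Sum>j<k n. (snd (X j \<omega>, e j \<omega>) - evalfam SS (err n \<omega>) (X j \<omega>)) * efn (enum i) (fst (X j \<omega>, e j \<omega>))) / real (k n)
      = coef (err n \<omega>) (enum i) / wgt (lam n) (enum i) - coef (err n \<omega>) (enum i) + lam n * rho (enum i) * coef fs (enum i)"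
    if "\<omega> \<in> space M" for n \<omega> i
    using coordinate_normal_equation[where lam="lam n" and n="k n" and Xs="\<lambda>j. X j \<omega>" and Ys="\<lambda>j. evalfam SS fs (X j \<omega>) + e j \<omega>"
        and es="\<lambda>j. e j \<omega>", OF lam(1) k(1) X[OF that] fs enum_in refl, of i] by (simp add: err_def)
  show ?thesis
  proof (rule R.ridge_functional_clt[where w="\<lambda>n i. wgt (lam n) (enum i)" and c="\<lambda>n i. lam n * rho (enum i) * coef fs (enum i)"
        and u="\<lambda>n \<omega> i. coef (err n \<omega>) (enum i)" and h="\<lambda>n \<omega> j. evalfam SS (err n \<omega>) (X j \<omega>)" and W="\<lambda>n. Wc * lam n powr (-\<theta>)"
        and l=l, OF k _ _ _ _ L lC c2 bb s2 _ _ eq _ Y(2) rate1 rate2 rate3])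
    show "0 < wgt (lam n) (enum i)" "wgt (lam n) (enum i) \<le> 1" for n i by (rule wgt_bounds[OF lam(1) enum_in])+
    show "(\<Sum>i<N. wgt (lam n) (enum i)) \<le> Wc * lam n powr (-\<theta>)" for n N by (rule Wc(2)[OF lam(1,2)])
    show "0 < Wc * lam n powr (-\<theta>)" for n using Wc(1) lam(1)[of n] by simp
    fix n \<omega> assume w: "\<omega> \<in> space M"
    show "summable (\<lambda>i. (coef (err n \<omega>) (enum i))\<^sup>2 / wgt (lam n) (enum i))" by (rule coef_weighted_summable[OF errH[OF w] lam(1)])
    show "(\<lambda>i. l i * coef (err n \<omega>) (enum i)) sums \<Phi> (err n \<omega>)" by (rule Y(1)[OF errH[OF w]])
    show "(\<lambda>i. coef (err n \<omega>) (enum i) * efn (enum i) (fst (X j \<omega>, e j \<omega>))) sums evalfam SS (err n \<omega>) (X j \<omega>)" for j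
      using family_expansion[OF errH[OF w] X[OF w]] by simp
  qed
qed

end

theorem theorem3:
  fixes d m :: nat
    and SS :: "nat set set" and Ssup :: "nat set"
    and \<mu> :: "nat set \<Rightarrow> nat \<Rightarrow> real"
    and \<psi> :: "nat set \<Rightarrow> nat \<Rightarrow> (nat \<Rightarrow> real) \<Rightarrow> real"
    and C\<psi> :: real
    and M :: "'w measure"
    and X :: "nat \<Rightarrow> 'w \<Rightarrow> nat \<Rightarrow> real"
    and \<epsilon> :: "nat \<Rightarrow> 'w \<Rightarrow> real"
    and \<sigma> :: real
    and fstar :: "nat set \<Rightarrow> (nat \<Rightarrow> real) \<Rightarrow> real"
    and CJ :: "nat set \<Rightarrow> real"
    and lam :: "nat \<Rightarrow> real"
    and \<tau> :: real
    and S :: "nat set" and Cstar :: real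
    and xS :: "nat \<Rightarrow> real"
  assumes d: "d \<ge> 1" and m: "m \<ge> 2"
    and SS: "SS \<subseteq> Pow {1..d}" "{} \<in> SS"
    and Ssup: "Ssup \<in> SS" "\<forall>T\<in>SS. card T \<le> card Ssup"
    and eig: "C\<psi> > 1" "\<forall>T\<in>SS - {{}}. eigensystem m T (\<mu> T) (\<psi> T) C\<psi>"
    and P: "prob_space M"
    and X_meas: "\<forall>i. X i \<in> measurable M (PiM {1..d} (\<lambda>_. U01))"
    and eps_meas: "\<forall>i. \<epsilon> i \<in> borel_measurable M"
    and indep: "prob_space.indep_vars M (\<lambda>_. PiM {1..d} (\<lambda>_. U01) \<Otimes>\<^sub>M borel)
                  (\<lambda>i \<omega>. (X i \<omega>, \<epsilon> i \<omega>)) UNIV"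
    and joint_distr: "\<forall>i. distr M (PiM {1..d} (\<lambda>_. U01) \<Otimes>\<^sub>M borel) (\<lambda>\<omega>. (X i \<omega>, \<epsilon> i \<omega>))
                        = PiM {1..d} (\<lambda>_. U01) \<Otimes>\<^sub>M distr M borel (\<epsilon> 0)"
    and eps_moments: "integrable M (\<lambda>\<omega>. (\<epsilon> 0 \<omega>) ^ 4)"
      "(LINT \<omega>|M. \<epsilon> 0 \<omega>) = 0" "(LINT \<omega>|M. (\<epsilon> 0 \<omega>)\<^sup>2) = \<sigma>\<^sup>2" "\<sigma> > 0"
    and fstar: "fstar \<in> Hfam m SS"
    and smooth: "\<forall>T\<in>SS - {{}}. JS m T (fstar T) (fstar T) \<le> CJ T"
    and lam_pos: "\<forall>n. lam n > 0"
    and rate1: "(\<lambda>n. sqrt (real n) * lam n) \<longlonglongrightarrow> 0"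
    and rate2: "(\<lambda>n. 1 / real n * lam n powr (-1 / real m)
                     * (- ln (lam n)) powr (2 * real (card Ssup) - 2)) \<longlonglongrightarrow> 0"
    and tau: "card Ssup = 1 \<longrightarrow> \<tau> = 0" "card Ssup > 1 \<longrightarrow> 0 < \<tau> \<and> \<tau> < 2 * real m - 2"
    and rate3: "(\<lambda>n. sqrt (real n) * alpha_n (real m) \<tau> (real (card Ssup)) (Jtot m SS fstar) (lam n) n)
                  \<longlonglongrightarrow> 0"
    and S: "S \<in> SS - {{}}"
    and Cstar: "Cstar > 0"
      "summable (\<lambda>v. (VS S (fstar S) (\<psi> S v))\<^sup>2 / (\<mu> S v)\<^sup>2)"
      "(\<Sum>v. (VS S (fstar S) (\<psi> S v))\<^sup>2 / (\<mu> S v)\<^sup>2) \<le> Cstar"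
    and xS: "xS \<in> cube S"
    and xS_summ: "\<forall>n. summable (\<lambda>v. (\<psi> S v xS)\<^sup>2 / (1 + lam n / \<mu> S v)\<^sup>2)"
    and xS_asymp: "(\<lambda>n. \<Sum>v. (\<psi> S v xS)\<^sup>2 / (1 + lam n / \<mu> S v)\<^sup>2)
                     \<in> \<Theta>(\<lambda>n. lam n powr (-1 / (2 * real m)) * (- ln (lam n)) powr (real (card S) - 1))"
  shows "weak_conv_m
           (\<lambda>n. distr M borel (\<lambda>\<omega>.
              let fhat = estimator m SS (lam n) (\<lambda>i. X i \<omega>)
                           (\<lambda>i. evalfam SS fstar (X i \<omega>) + \<epsilon> i \<omega>) n
              in sqrt (real n * lam n powr (1 / (2 * real m)) * (- ln (lam n)) powr (1 - real (card S)))
                   * (fhat S xS - fstar S xS)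
                 / sqrt (\<sigma>\<^sup>2 * lam n powr (1 / (2 * real m)) * (- ln (lam n)) powr (1 - real (card S))
                         * (\<Sum>v. (\<psi> S v xS)\<^sup>2 / (1 + lam n / \<mu> S v)\<^sup>2))))
           std_normal_distribution
       \<and> weak_conv_m
           (\<lambda>n. distr M borel (\<lambda>\<omega>.
              let fhat = estimator m SS (lam n) (\<lambda>i. X i \<omega>)
                           (\<lambda>i. evalfam SS fstar (X i \<omega>) + \<epsilon> i \<omega>) n
              in sqrt (real n) * (intercept fhat - intercept fstar) / \<sigma>))
           std_normal_distribution"
proof -
  \<comment> \<open>Exceeds the threshold 8/(16m) by 1/(16m); the excess reappears as the exponent
    \<open>r\<close> when the size of the functional is compared with its variance.\<close>
  define \<theta> where "\<theta> = 9 / (16 * real m)"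
  have m0: "0 < m" "0 < real m" using m by auto
  have eigs: "eigensystem m T (\<mu> T) (\<psi> T) C\<psi>" if "T \<in> SS - {{}}" for T using eig(2) that by blast
  interpret A: spline_design m SS "{1..d}" \<mu> \<psi> C\<psi> \<theta>
  proof unfold_locales
    show "SS - {{}} \<noteq> {}" using S by blast
    show "0 < \<theta>" "\<theta> < 1" "1 < 2 * real m * \<theta>" using m by (simp_all add: \<theta>_def field_simps)
  qed (use m0 SS eig(1) eigs in auto)
  interpret prob_space M by (rule P)
  let ?PX = "PiM {1..d} (\<lambda>_. U01)" and ?PE = "distr M borel (\<epsilon> 0)"
  have Xm: "X j \<in> measurable M ?PX" and em: "\<epsilon> j \<in> borel_measurable M" for j using X_meas eps_meas by auto
  have R: "regression_sample M ?PX ?PE (\<lambda>j \<omega>. (X j \<omega>, \<epsilon> j \<omega>)) (\<lambda>i. A.efn (A.enum i)) C\<psi> \<sigma>"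
  proof (intro regression_sample.intro iid_sample.intro iid_sample_axioms.intro regression_sample_axioms.intro)
    show "prob_space ?PX" by (rule prob_space_PiM_U01)
    show "prob_space ?PE" by (rule prob_space_distr[OF em])
    show "A.efn (A.enum i) \<in> borel_measurable ?PX" for i by (rule A.efn_measurable[OF A.enum_in])
    show "\<bar>A.efn (A.enum i) x\<bar> \<le> C\<psi>" if "x \<in> space ?PX" for i x
      by (rule A.efn_bound[OF A.enum_in]) (use that in \<open>simp add: space_PiM_U01\<close>)
    show "(LINT x|?PX. A.efn (A.enum i) x * A.efn (A.enum j) x) = (if i = j then 1 else 0)" for i j
      using A.efn_orth[OF A.enum_in A.enum_in, of i j] by (simp add: A.enum_eq_iff)
    show "integrable ?PE (\<lambda>e. e ^ 4)" using eps_moments(1) em by (simp add: integrable_distr_eq)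
    show "(LINT e|?PE. e) = 0" using eps_moments(2) em by (simp add: integral_distr)
    show "(LINT e|?PE. e\<^sup>2) = \<sigma>\<^sup>2" using eps_moments(3) em by (simp add: integral_distr)
  qed (use P indep joint_distr eps_moments in auto)
  have lp: "0 < lam n" for n using lam_pos by blast
  have lam0: "lam \<longlonglongrightarrow> 0" by (rule lam_tendsto_zero[OF lp rate1])
  have fS: "finite S" by (rule A.comp(1)[OF S])
  have cS: "1 \<le> card S" using fS S by (simp add: Suc_le_eq card_gt_0_iff)
  have csup: "1 \<le> card Ssup" using cS Ssup(2) S by fastforce
  have tau': "0 \<le> \<tau>" "\<tau> < 2 * real m - 2" using tau csup m by (cases "card Ssup = 1"; simp)+
  have J0: "0 \<le> Jtot m SS fstar" using A.famJ_nonneg by (simp add: Jtot_def famJ_def)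
  have rate: "(\<lambda>n. lam n powr (-2 / real m) / real n) \<longlonglongrightarrow> 0"
    by (rule effective_dimension_rate[OF m csup tau' lp rate1 J0 rate3])
  define \<Sigma> where "\<Sigma> n = (\<Sum>v. (\<psi> S v xS)\<^sup>2 / (1 + lam n / \<mu> S v)\<^sup>2)" for n
  have Sig0: "0 \<le> \<Sigma> n" for n unfolding \<Sigma>_def by (rule suminf_nonneg) (use xS_summ in auto)
  obtain c0 where c0: "0 < c0" and ev: "\<forall>\<^sub>F n in sequentially.
      c0 * norm (lam n powr (-1 / (2 * real m)) * (- ln (lam n)) powr (real (card S) - 1)) \<le> norm (\<Sigma> n)"
  proof -
    from landau_omega.bigE[OF bigthetaD2[OF xS_asymp]] obtain c where "0 < c" "\<forall>\<^sub>F n in sequentially.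
      c * norm (lam n powr (-1 / (2 * real m)) * (- ln (lam n)) powr (real (card S) - 1)) \<le> norm (\<Sigma> n)"
      unfolding \<Sigma>_def .
    then show thesis by (rule that)
  qed
  have "\<forall>\<^sub>F n in sequentially. lam n < exp (-1)" using lam0 by (rule order_tendstoD(2)) simp
  with ev have "\<forall>\<^sub>F n in sequentially. lam n < exp (-1) \<and> c0 * lam n powr (-1 / (2 * real m)) \<le> \<Sigma> n"
  proof eventually_elim
    case (elim n)
    have "ln (lam n) \<le> ln (exp (-1))" using elim(2) lp[of n] by (intro ln_mono) auto
    then have x: "1 \<le> - ln (lam n)" by simp
    have "c0 * lam n powr (-1 / (2 * real m)) * 1 \<le> c0 * lam n powr (-1 / (2 * real m)) * (- ln (lam n)) powr (real (card S) - 1)"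
      using c0 x cS by (intro mult_left_mono ge_one_powr_ge_zero) auto
    also have "\<dots> \<le> \<Sigma> n" using elim(1) Sig0[of n] c0 by (simp add: abs_mult mult.assoc)
    finally show ?case using elim(2) by simp
  qed
  then obtain n1 where n1: "\<And>n. n1 \<le> n \<Longrightarrow> lam n < exp (-1)" "\<And>n. n1 \<le> n \<Longrightarrow> c0 * lam n powr (-1 / (2 * real m)) \<le> \<Sigma> n"
    unfolding eventually_sequentially by blast
  \<comment> \<open>From this index on, \<open>lam\<close> is below \<open>exp (-1)\<close>, so
    \<open>- ln (lam n)\<close> exceeds 1, and the variance has its lower bound. The successor makes
    every remaining sample size positive.\<close>
  define n0 where "n0 = Suc n1"
  define lam' where "lam' n = lam (n + n0)" for n
  have k: "0 < n + n0" "filterlim (\<lambda>n. n + n0) at_top sequentially" for n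
    by (simp_all add: n0_def filterlim_add_const_nat_at_top del: add_Suc_right)
  have small: "lam' n < exp (-1)" for n using n1(1)[of "n + n0"] by (simp add: lam'_def n0_def)
  have l': "0 < lam' n" "lam' n \<le> 1" for n
    using lp small[of n] exp_le_one_iff[of "-1"] by (auto simp: lam'_def intro: less_imp_le order_trans)
  have l'0: "lam' \<longlonglongrightarrow> 0" unfolding lam'_def by (rule LIMSEQ_ignore_initial_segment[OF lam0])
  have rate': "(\<lambda>n. lam' n powr (-(2 / real m)) / real (n + n0)) \<longlonglongrightarrow> 0"
    using LIMSEQ_ignore_initial_segment[OF rate, of n0] by (simp add: lam'_def)
  have Slow: "c0 * lam' n powr (-1 / (2 * real m)) \<le> \<Sigma> (n + n0)" for n
    using n1(2)[of "n + n0"] by (simp add: lam'_def n0_def)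
  have S1: "c0 \<le> \<Sigma> (n + n0)" for n
  proof -
    have "lam' n powr 0 \<le> lam' n powr (-1 / (2 * real m))" by (rule powr_mono') (use l'[of n] in auto)
    then have "c0 * 1 \<le> c0 * lam' n powr (-1 / (2 * real m))" using c0 l'(1)[of n] by (intro mult_left_mono) auto
    then show ?thesis using Slow[of n] by simp
  qed
  obtain Wc where Wc: "0 < Wc" "\<And>lam N. 0 < lam \<Longrightarrow> lam \<le> 1 \<Longrightarrow> (\<Sum>i<N. A.wgt lam (A.enum i)) \<le> Wc * lam powr (-\<theta>)"
    using A.effective_dimension_total by metis
  note clt = A.linear_functional_clt[OF R m \<theta>_def fstar Wc(1) _ k l' l'0 rate']
  let ?Y = "\<lambda>\<omega> j. evalfam SS fstar (X j \<omega>) + \<epsilon> j \<omega>"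
  have Ym: "(\<lambda>\<omega>. ?Y \<omega> j) \<in> borel_measurable M" for j
    by (intro borel_measurable_add em measurable_compose[OF Xm A.evalfam_measurable[OF fstar]])
  note estm = A.estimator_measurable[OF l'(1) k(1), where X=X and M=M and Y="\<lambda>j \<omega>. ?Y \<omega> j", OF Xm Ym]
  have sig: "0 < \<sigma>\<^sup>2" using eps_moments(4) by simp
  have w0: "0 < A.wgt (lam' n) (A.enum i)" and w1: "A.wgt (lam' n) (A.enum i) \<le> 1" for n i
    using A.wgt_bounds[OF l'(1) A.enum_in] by auto
  \<comment> \<open>Coordinates, in the joint basis, of the functional that evaluates component
    \<open>S\<close> at \<open>xS\<close>.\<close>
  define l where "l i = (if fst (A.enum i) = S then \<psi> S (snd (A.enum i)) xS else 0)" for i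
  have lb: "\<bar>l i\<bar> \<le> C\<psi>" for i
    using eig_bound[OF m0(1) fS eigs[OF S] xS, of "snd (A.enum i)"] eig(1) by (simp add: l_def)
  have var: "(\<lambda>i. (l i * A.wgt (lam' n) (A.enum i))\<^sup>2) sums \<Sigma> (n + n0)" for n
    unfolding l_def \<Sigma>_def lam'_def by (rule A.component_variance_sums[OF S]) (use xS_summ in blast)
  have A: "weak_conv_m (\<lambda>n. distr M borel (\<lambda>\<omega>. sqrt (real (n + n0)) *
      (1 * estimator m SS (lam' n) (\<lambda>j. X j \<omega>) (?Y \<omega>) (n + n0) S xS + (-1) * fstar S xS) / sqrt (\<sigma>\<^sup>2 * \<Sigma> (n + n0)))) std_normal_distribution"
  proof (rule clt[where \<Phi>="\<lambda>g. g S xS" and l=l and L="\<lambda>n. C\<psi>\<^sup>2 * (Wc * lam' n powr (-\<theta>))" and bb="\<lambda>n. \<Sigma> (n + n0) * ((lam' n)\<^sup>2 * Cstar)"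
        and K="C\<psi>\<^sup>2 * Wc / (\<sigma>\<^sup>2 * c0)" and r="1 / (16 * real m)" and Cl=C\<psi> and ?s0.0="\<sigma>\<^sup>2 * c0" and ?s2.0="\<lambda>n. \<sigma>\<^sup>2 * \<Sigma> (n + n0)"])
    show "\<bar>l i\<bar> \<le> C\<psi>" for i by (rule lb)
    fix n N
    show "(\<Sum>i<N. A.wgt (lam' n) (A.enum i) * (l i)\<^sup>2) \<le> C\<psi>\<^sup>2 * (Wc * lam' n powr (-\<theta>))"
    proof -
      have "(l i)\<^sup>2 \<le> C\<psi>\<^sup>2" for i using lb[of i] eig(1) by (simp add: abs_le_square_iff[symmetric])
      then have "(\<Sum>i<N. A.wgt (lam' n) (A.enum i) * (l i)\<^sup>2) \<le> (\<Sum>i<N. A.wgt (lam' n) (A.enum i) * C\<psi>\<^sup>2)"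
        using w0 by (intro sum_mono mult_left_mono) (auto intro: less_imp_le)
      also have "\<dots> = C\<psi>\<^sup>2 * (\<Sum>i<N. A.wgt (lam' n) (A.enum i))" by (simp add: sum_distrib_left mult.commute)
      also have "\<dots> \<le> C\<psi>\<^sup>2 * (Wc * lam' n powr (-\<theta>))" by (rule mult_left_mono[OF Wc(2)[OF l']]) simp
      finally show ?thesis .
    qed
    show "(\<Sum>i<N. l i * A.wgt (lam' n) (A.enum i) * (lam' n * A.rho (A.enum i) * A.coef fstar (A.enum i)))\<^sup>2 \<le> \<Sigma> (n + n0) * ((lam' n)\<^sup>2 * Cstar)"
    proof -
      \<comment> \<open>Cauchy--Schwarz separates the coefficients \<open>?a\<close>, whose squares
        sum to the variance factor, from the source terms \<open>?b\<close>. The variance factor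
        cancels on normalization, and n lambda^2 times a constant remains, which
        \<open>rate1\<close> sends to zero.\<close>
      let ?a = "\<lambda>i. l i * A.wgt (lam' n) (A.enum i)" and ?b = "\<lambda>i. if fst (A.enum i) = S then A.rho (A.enum i) * A.coef fstar (A.enum i) else 0"
      note src = A.component_source_sums[OF fstar S Cstar(2)]
      have "(\<Sum>i<N. ?a i * (lam' n * A.rho (A.enum i) * A.coef fstar (A.enum i))) = (\<Sum>i<N. ?a i * (lam' n * ?b i))"
        by (rule sum.cong) (auto simp: l_def)
      then have "(\<Sum>i<N. ?a i * (lam' n * A.rho (A.enum i) * A.coef fstar (A.enum i)))\<^sup>2 \<le> (\<Sum>i<N. (?a i)\<^sup>2) * (\<Sum>i<N. (lam' n * ?b i)\<^sup>2)"
        using Cauchy_Schwarz_ineq_sum[of ?a "\<lambda>i. lam' n * ?b i" "{..<N}"] by (simp only:)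
      also have "\<dots> = (\<Sum>i<N. (?a i)\<^sup>2) * ((lam' n)\<^sup>2 * (\<Sum>i<N. (?b i)\<^sup>2))" by (simp only: power_mult_distrib sum_distrib_left)
      also have "\<dots> \<le> \<Sigma> (n + n0) * ((lam' n)\<^sup>2 * Cstar)"
      proof (intro mult_mono mult_nonneg_nonneg Sig0 sum_nonneg)
        show "(\<Sum>i<N. (?a i)\<^sup>2) \<le> \<Sigma> (n + n0)" unfolding sums_unique[OF var]
          by (rule sum_le_suminf[OF sums_summable[OF var]]) auto
        have "(\<Sum>i<N. (?b i)\<^sup>2) \<le> (\<Sum>i. (?b i)\<^sup>2)" by (rule sum_le_suminf[OF sums_summable[OF src]]) auto
        then show "(\<Sum>i<N. (?b i)\<^sup>2) \<le> Cstar" using Cstar(3) unfolding sums_unique[OF src, symmetric] by linarith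
      qed auto
      finally show ?thesis .
    qed
    show "\<sigma>\<^sup>2 * \<Sigma> (n + n0) = \<sigma>\<^sup>2 * (\<Sum>i. (l i * A.wgt (lam' n) (A.enum i))\<^sup>2)" using sums_unique[OF var] by simp
    show "\<sigma>\<^sup>2 * c0 \<le> \<sigma>\<^sup>2 * \<Sigma> (n + n0)" using S1 by (rule mult_left_mono) simp
    show "C\<psi>\<^sup>2 * (Wc * lam' n powr (-\<theta>)) / (\<sigma>\<^sup>2 * \<Sigma> (n + n0)) \<le> C\<psi>\<^sup>2 * Wc / (\<sigma>\<^sup>2 * c0) * lam' n powr (-(1 / (16 * real m)))"
    proof -
      \<comment> \<open>The numerator is bounded with the enlarged exponent \<theta>, the
        denominator with 1/(2m) from the assumption on \<open>xS\<close>; their quotient costs only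
        the difference 1/(16m).\<close>
      have "C\<psi>\<^sup>2 * (Wc * lam' n powr (-\<theta>)) / (\<sigma>\<^sup>2 * \<Sigma> (n + n0)) \<le> C\<psi>\<^sup>2 * (Wc * lam' n powr (-\<theta>)) / (\<sigma>\<^sup>2 * (c0 * lam' n powr (-1 / (2 * real m))))"
        using Slow[of n] S1[of n] c0 sig Wc(1) l'(1)[of n]
        by (intro divide_left_mono mult_left_mono mult_pos_pos mult_nonneg_nonneg) (auto intro: less_le_trans)
      also have "\<dots> = C\<psi>\<^sup>2 * Wc / (\<sigma>\<^sup>2 * c0) * (lam' n powr (-\<theta>) / lam' n powr (-1 / (2 * real m)))" by simp
      also have "lam' n powr (-\<theta>) / lam' n powr (-1 / (2 * real m)) = lam' n powr (-(1 / (16 * real m)))"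
        unfolding powr_diff[symmetric] by (rule arg_cong[of _ _ "\<lambda>p. lam' n powr p"]) (use m0 in \<open>simp add: \<theta>_def field_simps\<close>)
      finally show ?thesis .
    qed
  next
    have eq: "real (n + n0) * (\<Sigma> (n + n0) * ((lam' n)\<^sup>2 * Cstar)) / (\<sigma>\<^sup>2 * \<Sigma> (n + n0)) = (sqrt (real (n + n0)) * lam (n + n0))\<^sup>2 * (Cstar / \<sigma>\<^sup>2)" for n
      using S1[of n] c0 by (simp add: power_mult_distrib lam'_def)
    have "(\<lambda>n. (sqrt (real (n + n0)) * lam (n + n0))\<^sup>2 * (Cstar / \<sigma>\<^sup>2)) \<longlonglongrightarrow> 0\<^sup>2 * (Cstar / \<sigma>\<^sup>2)"
      by (intro tendsto_mult tendsto_power tendsto_const LIMSEQ_ignore_initial_segment[OF rate1])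
    then show "(\<lambda>n. real (n + n0) * (\<Sigma> (n + n0) * ((lam' n)\<^sup>2 * Cstar)) / (\<sigma>\<^sup>2 * \<Sigma> (n + n0))) \<longlonglongrightarrow> 0"
      unfolding eq by simp
    show "(\<Sum>i<N. A.wgt q (A.enum i)) \<le> Wc * q powr (-\<theta>)" if "0 < q" "q \<le> 1" for q N by (rule Wc(2)[OF that])
    show "(\<lambda>i. l i * A.coef g (A.enum i)) sums g S xS" if "g \<in> Hfam m SS" for g
      unfolding l_def by (rule A.component_target_sums[OF that S xS])
    show "(\<lambda>\<omega>. 1 * estimator m SS (lam' n) (\<lambda>j. X j \<omega>) (?Y \<omega>) (n + n0) S xS + (-1) * fstar S xS) \<in> borel_measurable M" for n
      by (intro borel_measurable_add borel_measurable_times borel_measurable_const estm(1)[OF S xS])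
  qed (use c0 sig Wc(1) in auto)
  \<comment> \<open>The intercept is a single coordinate with penalty ratio 0 and weight 1, so its
    functional has no bias and its normalizing variance is the noise variance itself.\<close>
  obtain i0 where i0: "A.enum i0 = ({}, 0)" "\<And>i. fst (A.enum i) = {} \<longleftrightarrow> i = i0" using A.intercept_index by metis
  have pick: "(\<lambda>i. (if i = i0 then 1 else 0) * f i) sums f i0" for f :: "nat \<Rightarrow> real"
    using sums_If_finite_set[of "{i0}" f] by (simp add: if_distrib[of "\<lambda>c. c * _"] cong: if_cong)
  have wi0: "A.wgt (lam' n) (A.enum i0) = 1" "A.rho (A.enum i0) = 0" for n by (simp_all add: i0 A.wgt_def A.rho_def)
  have B: "weak_conv_m (\<lambda>n. distr M borel (\<lambda>\<omega>. sqrt (real (n + n0)) *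
      intercept (\<lambda>S x. 1 * estimator m SS (lam' n) (\<lambda>j. X j \<omega>) (?Y \<omega>) (n + n0) S x + (-1) * fstar S x) / sqrt (\<sigma>\<^sup>2))) std_normal_distribution"
  proof (rule clt[where \<Phi>=intercept and l="\<lambda>i. if i = i0 then 1 else 0" and L="\<lambda>_. 1" and bb="\<lambda>_. 0"
        and K="1 / \<sigma>\<^sup>2" and r=0 and Cl=1 and ?s0.0="\<sigma>\<^sup>2" and ?s2.0="\<lambda>_. \<sigma>\<^sup>2"])
    fix n N
    have "(\<Sum>i<N. A.wgt (lam' n) (A.enum i) * (if i = i0 then 1 else 0)\<^sup>2) = (\<Sum>i<N. if i = i0 then 1 else 0)"
      by (rule sum.cong) (auto simp: wi0)
    also have "\<dots> \<le> 1" by simp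
    finally show "(\<Sum>i<N. A.wgt (lam' n) (A.enum i) * (if i = i0 then 1 else 0)\<^sup>2) \<le> 1" .
    have "(\<Sum>i<N. (if i = i0 then 1 else 0) * A.wgt (lam' n) (A.enum i) * (lam' n * A.rho (A.enum i) * A.coef fstar (A.enum i))) = 0"
      by (rule sum.neutral) (auto simp: wi0)
    then show "(\<Sum>i<N. (if i = i0 then 1 else 0) * A.wgt (lam' n) (A.enum i) * (lam' n * A.rho (A.enum i) * A.coef fstar (A.enum i)))\<^sup>2 \<le> 0" by simp
    have "(\<lambda>i. ((if i = i0 then 1 else 0) * A.wgt (lam' n) (A.enum i))\<^sup>2) = (\<lambda>i. (if i = i0 then 1 else 0) * 1)"
      by (auto simp: fun_eq_iff wi0)
    then show "\<sigma>\<^sup>2 = \<sigma>\<^sup>2 * (\<Sum>i. ((if i = i0 then 1 else 0) * A.wgt (lam' n) (A.enum i))\<^sup>2)"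
      using sums_unique[OF pick[of "\<lambda>_. 1"]] by simp
    show "1 / \<sigma>\<^sup>2 \<le> 1 / \<sigma>\<^sup>2 * lam' n powr (- 0)" using l'(1)[of n] by simp
  next
    show "(\<Sum>i<N. A.wgt q (A.enum i)) \<le> Wc * q powr (-\<theta>)" if "0 < q" "q \<le> 1" for q N by (rule Wc(2)[OF that])
    show "(\<lambda>i. (if i = i0 then 1 else 0) * A.coef g (A.enum i)) sums intercept g" for g
      using pick[of "\<lambda>i. A.coef g (A.enum i)"] by (simp add: i0 A.coef_def)
    show "(\<lambda>\<omega>. intercept (\<lambda>S x. 1 * estimator m SS (lam' n) (\<lambda>j. X j \<omega>) (?Y \<omega>) (n + n0) S x + (-1) * fstar S x)) \<in> borel_measurable M" for n
      using borel_measurable_diff[OF estm(2)[of n] borel_measurable_const[of "intercept fstar"]] by (simp add: intercept_def)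
  qed (use sig in auto)
  \<comment> \<open>The rate factors occur under both square roots and cancel once they are
    positive, which holds past \<open>n0\<close>.\<close>
  have scale: "sqrt (x * a * b) * y / sqrt (s * a * b * q) = sqrt x * y / sqrt (s * q)" if "0 < a" "0 < b" for x a b y s q :: real
    using that by (simp add: real_sqrt_mult)
  show ?thesis
  proof (rule conjI; rule weak_conv_m_offset[where k=n0])
    have pos: "0 < lam (n + n0) powr (1 / (2 * real m))" "0 < (- ln (lam (n + n0))) powr (1 - real (card S))" for n
    proof -
      have "ln (lam' n) < ln (exp (-1))" using small[of n] l'(1)[of n] by (subst ln_less_cancel_iff) auto
      then show "0 < (- ln (lam (n + n0))) powr (1 - real (card S))" by (simp add: lam'_def)
      show "0 < lam (n + n0) powr (1 / (2 * real m))" using lp[of "n + n0"] by simp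
    qed
    show "weak_conv_m (\<lambda>n. distr M borel (\<lambda>\<omega>.
        let fhat = estimator m SS (lam (n + n0)) (\<lambda>i. X i \<omega>) (\<lambda>i. evalfam SS fstar (X i \<omega>) + \<epsilon> i \<omega>) (n + n0)
        in sqrt (real (n + n0) * lam (n + n0) powr (1 / (2 * real m)) * (- ln (lam (n + n0))) powr (1 - real (card S)))
             * (fhat S xS - fstar S xS)
           / sqrt (\<sigma>\<^sup>2 * lam (n + n0) powr (1 / (2 * real m)) * (- ln (lam (n + n0))) powr (1 - real (card S))
                   * (\<Sum>v. (\<psi> S v xS)\<^sup>2 / (1 + lam (n + n0) / \<mu> S v)\<^sup>2)))) std_normal_distribution"
      unfolding Let_def scale[OF pos] using A by (simp add: lam'_def \<Sigma>_def)
    show "weak_conv_m (\<lambda>n. distr M borel (\<lambda>\<omega>.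
        let fhat = estimator m SS (lam (n + n0)) (\<lambda>i. X i \<omega>) (\<lambda>i. evalfam SS fstar (X i \<omega>) + \<epsilon> i \<omega>) (n + n0)
        in sqrt (real (n + n0)) * (intercept fhat - intercept fstar) / \<sigma>)) std_normal_distribution"
      using B eps_moments(4) by (simp add: Let_def lam'_def intercept_def)
  qed
qed

end
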